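(* Let $c=0$, $\alpha>0$, $\beta,h,\mu\in\mathbb{R}$, $s=0$ and $\Omega=\beta/\alpha$, and consider solutions of $$\partial_t\boldsymbol m=\boldsymbol m\times\big[\alpha\partial_t\boldsymbol m-\partial_x^2\boldsymbol m+(\mu m_3-h)\boldsymbol{\hat e}_3+\beta\,\boldsymbol m\times\boldsymbol{\hat e}_3\big]$$ of the form $\boldsymbol m=(e^{i\varphi}\sin\theta,\cos\theta)$ with $\theta=\theta(\xi)$, $\xi=x$, and $\varphi=\phi_0+\Omega t$ constant in $\xi$ (i.e. $q=0$). Equivalently, $\theta$ satisfies $\theta''=\sin\theta\,(h-\Omega-\mu\cos\theta)$ with $\theta\in\mathbb{R}/2\pi\mathbb{Z}$. These solutions oscillate in time pointwise about the $\boldsymbol{\hat e}_3$-axis with frequency $\Omega=\beta/\alpha$. Assume (without loss of generality, by the symmetry $(h-\beta/\alpha,\theta)\to(\beta/\alpha-h,\theta+\pi)$) that $h>\Omega$ in items 1 and 2. 1. Subcritical anisotropy $h-\Omega>|\mu|>0$. There exist no nontrivial wavetrains with $q=0$, and the coherent structure solutions with $q=0$ are a pair of homoclinic profiles to $\boldsymbol{\hat e}_3$, and three one-parameter families of periodic profiles, one bounded and two semi-unbounded. The homoclinic profiles each cross once through $-\boldsymbol{\hat e}_3$ in opposite $\theta$-directions. The limit points of the bounded curve of periodic profiles are $-\boldsymbol{\hat e}_3$ and the union of the homoclinic profiles. Each of the homoclinics is the limit point of one of the semi-unbounded families, each of which has unbounded $\theta$-derivatives. The profiles from the bounded family each cross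 $-\boldsymbol{\hat e}_3$ once during a half-period; the profiles of the unbounded families cross both $\pm\boldsymbol{\hat e}_3$ during one half-period. 2. Suppose super- or subsubcritical anisotropy $|\mu|>h-\Omega$. There exists a wavetrain with $k=0$, which is stable in the supercritical case ($\mu>0$) and unstable in the subsubcritical case ($\mu<0$). In the ODE for $\theta$ this appears in the form of two equilibria, being the symmetric pair of intersection points of the wavetrain orbit and a meridian on the sphere, phase shifted by $\pi$ in $\varphi$-direction. (a) In the supercritical case ($\mu>h-\Omega$) the coherent structure solutions with $q=0$ are two pairs of heteroclinic connections between the wavetrain and its phase shift, and four curves of periodic profiles; two bounded and two semi-unbounded. (b) In the subsubcritical case ($\mu<-(h-\Omega)$) the coherent structure solutions with $q=0$ are two pairs of homoclinic connections to $\pm\boldsymbol{\hat e}_3$, respectively, and five curves of periodic profiles, three bounded and two semi-unbounded. 3. The degenerate case $h=\Omega$, $\mu<0$ is the only possibility for profiles of stationary coherent structures to connect between $\pm\boldsymbol{\hat e}_3$, which then come in a pair (as in the phase plane of $\theta''=-\mu\sin\theta\cos\theta$). The remaining coherent structures with $q=0$ are analogous to the supercritical case 2(a), with $\pm\boldsymbol{\hat e}_3$ and the pair consisting of the wavetrain and its phase shift interchanged.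
   Context: Here $\boldsymbol m(x,t)\in\mathbb{S}^2$, $x\in\mathbb{R}$, and the $(m_1,m_2)$-plane is identified with $\mathbb{C}$; $\boldsymbol{\hat e}_3$ and $-\boldsymbol{\hat e}_3$ correspond to $\theta=0$ and $\theta=\pi$. Coherent structures are solutions with $\varphi=\phi(\xi)+\Omega t$, $\theta=\theta(\xi)$, $\xi=x-st$; $q=\phi'$; stationary means $s=0$. Wavetrains are solutions with $\varphi=kx-\omega t$ and constant $\theta$ ($\sin\theta\ne0$). For $k=0$ these correspond to equilibria of the $\theta$-ODE with $\cos\theta=(h-\Omega)/\mu$. Supercritical: $\pm\boldsymbol{\hat e}_3$ both unstable ($\mu>|h-\beta/\alpha|$); subcritical: different stability; subsubcritical: both stable ($-\mu>|h-\beta/\alpha|$). Stability of wavetrains is spectral stability in $L^2(\mathbb{R})$ for the linearized equation. "Profiles" are the orbits $\theta(\xi)$ of the ODE on the cylinder $(\theta,\theta')\in(\mathbb{R}/2\pi\mathbb{Z})\times\mathbb{R}$; a curve (one-parameter family) of periodic profiles is bounded if it is a bounded set in this cylinder and semi-unbounded if it is unbounded towards one end of the family. Periodicity is understood on the cylinder. *)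

theory Defs
  imports "HOL-Analysis.Analysis"
begin

definition e3 :: "real^3" where
  "e3 = axis 3 1"

definition sph :: "real \<Rightarrow> real \<Rightarrow> real^3" where
  "sph \<phi> \<theta> = vector [cos \<phi> * sin \<theta>, sin \<phi> * sin \<theta>, cos \<theta>]"

definition rot3 :: "real \<Rightarrow> real^3 \<Rightarrow> real^3" where
  "rot3 \<psi> v = vector [cos \<psi> * v$1 - sin \<psi> * v$2, sin \<psi> * v$1 + cos \<psi> * v$2, v$3]"

text \<open>Left-hand side minus right-hand side of the equation, as a function of the values of
  \<open>m\<close>, \<open>\<partial>\<^sub>t m\<close> and \<open>\<partial>\<^sub>x\<^sup>2 m\<close> at a point.\<close>

definition LLGS_residual ::
    "real \<Rightarrow> real \<Rightarrow> real \<Rightarrow> real \<Rightarrow> (real^3) \<times> (real^3) \<times> (real^3) \<Rightarrow> real^3" where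
  "LLGS_residual \<alpha> \<beta> h \<mu> = (\<lambda>(m, mt, mxx).
     mt - cross3 m (\<alpha> *\<^sub>R mt - mxx + (\<mu> * m$3 - h) *\<^sub>R e3 + \<beta> *\<^sub>R cross3 m e3))"

definition solves_LLGS ::
    "real \<Rightarrow> real \<Rightarrow> real \<Rightarrow> real \<Rightarrow> (real \<Rightarrow> real \<Rightarrow> real^3) \<Rightarrow> bool" where
  "solves_LLGS \<alpha> \<beta> h \<mu> m \<longleftrightarrow>
     (\<forall>x t. norm (m x t) = 1) \<and>
     (\<exists>mt mx mxx. \<forall>x t.
        ((\<lambda>\<tau>. m x \<tau>) has_vector_derivative mt x t) (at t) \<and>
        ((\<lambda>y. m y t) has_vector_derivative mx x t) (at x) \<and>
        ((\<lambda>y. mx y t) has_vector_derivative mxx x t) (at x) \<and>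
        LLGS_residual \<alpha> \<beta> h \<mu> (m x t, mt x t, mxx x t) = 0)"

definition twice_differentiable :: "(real \<Rightarrow> real) \<Rightarrow> bool" where
  "twice_differentiable f \<longleftrightarrow>
     (\<exists>f' f''. \<forall>x. (f has_real_derivative f' x) (at x) \<and> (f' has_real_derivative f'' x) (at x))"

text \<open>The solution attached to the profiles \<open>\<phi>\<close>, \<open>\<theta>\<close>, which are functions of \<open>\<xi> = x - s t\<close>.\<close>

definition coherent_field ::
    "real \<Rightarrow> real \<Rightarrow> (real \<Rightarrow> real) \<Rightarrow> (real \<Rightarrow> real) \<Rightarrow> real \<Rightarrow> real \<Rightarrow> real^3" where
  "coherent_field s \<Omega> \<phi> \<theta> x t = sph (\<phi> (x - s * t) + \<Omega> * t) (\<theta> (x - s * t))"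

definition coherent_structure ::
    "real \<Rightarrow> real \<Rightarrow> real \<Rightarrow> real \<Rightarrow> real \<Rightarrow> real \<Rightarrow> (real \<Rightarrow> real) \<Rightarrow> (real \<Rightarrow> real) \<Rightarrow> bool" where
  "coherent_structure \<alpha> \<beta> h \<mu> s \<Omega> \<phi> \<theta> \<longleftrightarrow>
     twice_differentiable \<phi> \<and> twice_differentiable \<theta> \<and>
     solves_LLGS \<alpha> \<beta> h \<mu> (coherent_field s \<Omega> \<phi> \<theta>)"

definition connects_poles :: "(real \<Rightarrow> real) \<Rightarrow> bool" where
  "connects_poles \<theta> \<longleftrightarrow>
     (((\<lambda>\<xi>. cis (\<theta> \<xi>)) \<longlongrightarrow> 1) at_bot \<and> ((\<lambda>\<xi>. cis (\<theta> \<xi>)) \<longlongrightarrow> -1) at_top) \<or>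
     (((\<lambda>\<xi>. cis (\<theta> \<xi>)) \<longlongrightarrow> -1) at_bot \<and> ((\<lambda>\<xi>. cis (\<theta> \<xi>)) \<longlongrightarrow> 1) at_top)"

definition wavetrain ::
    "real \<Rightarrow> real \<Rightarrow> real \<Rightarrow> real \<Rightarrow> real \<Rightarrow> real \<Rightarrow> real \<Rightarrow> bool" where
  "wavetrain \<alpha> \<beta> h \<mu> k \<omega> \<theta>\<^sub>0 \<longleftrightarrow>
     sin \<theta>\<^sub>0 \<noteq> 0 \<and> solves_LLGS \<alpha> \<beta> h \<mu> (\<lambda>x t. sph (k * x - \<omega> * t) \<theta>\<^sub>0)"

text \<open>The orbit of the wavetrain under rotation about the \<open>e3\<close>-axis. It is the set of values of
  the wavetrain as soon as \<open>k\<close> or \<open>\<omega>\<close> is nonzero, and it is still a circle if both vanish.\<close>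

definition wavetrain_orbit :: "real \<Rightarrow> (real^3) set" where
  "wavetrain_orbit \<theta>\<^sub>0 = range (\<lambda>\<phi>. sph \<phi> \<theta>\<^sub>0)"

text \<open>The full great circle through the poles.\<close>

definition meridian :: "real \<Rightarrow> (real^3) set" where
  "meridian \<phi>\<^sub>0 = range (sph \<phi>\<^sub>0)"

text \<open>In the frame rotating about \<open>e3\<close> with the angular velocity \<open>-\<omega>\<close> of the wavetrain, the
  wavetrain is the steady state \<open>n x = sph (k * x) \<theta>\<^sub>0\<close> and \<open>\<partial>\<^sub>t\<close> becomes
  \<open>\<partial>\<^sub>t - \<omega> e3 \<times> _\<close>. Since the equation is equivariant under these rotations, the linearized
  equation for a perturbation \<open>w\<close> does not depend on time. It is the vanishing of the following
  derivative of the residual, where \<open>wt\<close>, \<open>wxx\<close> are the values of \<open>\<partial>\<^sub>t w\<close>, \<open>\<partial>\<^sub>x\<^sup>2 w\<close> at \<open>x\<close>.\<close>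

definition wavetrain_linearization ::
    "real \<Rightarrow> real \<Rightarrow> real \<Rightarrow> real \<Rightarrow> real \<Rightarrow> real \<Rightarrow> real \<Rightarrow>
     real \<Rightarrow> real^3 \<Rightarrow> real^3 \<Rightarrow> real^3 \<Rightarrow> real^3" where
  "wavetrain_linearization \<alpha> \<beta> h \<mu> k \<omega> \<theta>\<^sub>0 x w wt wxx =
     (let n = (\<lambda>y. sph (k * y) \<theta>\<^sub>0);
          nxx = vector_derivative (\<lambda>y. vector_derivative n (at y)) (at x)
      in frechet_derivative (LLGS_residual \<alpha> \<beta> h \<mu>)
           (at (n x, - \<omega> *\<^sub>R cross3 e3 (n x), nxx))
           (w, wt - \<omega> *\<^sub>R cross3 e3 w, wxx))"

definition ReV :: "complex^3 \<Rightarrow> real^3" where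
  "ReV w = (\<chi> i. Re (w $ i))"

definition ImV :: "complex^3 \<Rightarrow> real^3" where
  "ImV w = (\<chi> i. Im (w $ i))"

definition L2 :: "(real \<Rightarrow> complex^3) \<Rightarrow> bool" where
  "L2 u \<longleftrightarrow> u \<in> borel_measurable borel \<and> integrable lborel (\<lambda>x. (norm (u x))\<^sup>2)"

definition L2_norm_fun :: "(real \<Rightarrow> complex^3) \<Rightarrow> real" where
  "L2_norm_fun u = sqrt (LINT x|lborel. (norm (u x))\<^sup>2)"

text \<open>\<open>w\<close> is the continuous representative of an element of the Sobolev space \<open>H\<^sup>2\<close> on the
  line and \<open>wxx\<close> is its second weak derivative.\<close>

definition H2 :: "(real \<Rightarrow> complex^3) \<Rightarrow> (real \<Rightarrow> complex^3) \<Rightarrow> bool" where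
  "H2 w wxx \<longleftrightarrow> L2 w \<and> L2 wxx \<and>
     (\<exists>wx. L2 wx \<and>
        (\<forall>a b. a \<le> b \<longrightarrow> (wx has_integral (w b - w a)) {a..b}) \<and>
        (\<forall>a b. a \<le> b \<longrightarrow> (wxx has_integral (wx b - wx a)) {a..b}))"

text \<open>Perturbations are tangent to the sphere along the wavetrain.\<close>

definition tangent_field :: "real \<Rightarrow> real \<Rightarrow> (real \<Rightarrow> complex^3) \<Rightarrow> bool" where
  "tangent_field k \<theta>\<^sub>0 w \<longleftrightarrow>
     (\<forall>x. ReV (w x) \<bullet> sph (k * x) \<theta>\<^sub>0 = 0 \<and> ImV (w x) \<bullet> sph (k * x) \<theta>\<^sub>0 = 0)"

text \<open>The resolvent equation \<open>(z - L) w = f\<close>, where \<open>\<partial>\<^sub>t w = L w\<close> is the linearized equation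
  solved for \<open>\<partial>\<^sub>t w\<close>: equivalently, the linearized equation holds with \<open>\<partial>\<^sub>t w\<close> replaced by
  \<open>z w - f\<close>. As the linearized equation has real coefficients, the real and imaginary parts
  are treated separately.\<close>

definition resolvent_equation ::
    "real \<Rightarrow> real \<Rightarrow> real \<Rightarrow> real \<Rightarrow> real \<Rightarrow> real \<Rightarrow> real \<Rightarrow> complex \<Rightarrow>
     (real \<Rightarrow> complex^3) \<Rightarrow> (real \<Rightarrow> complex^3) \<Rightarrow> bool" where
  "resolvent_equation \<alpha> \<beta> h \<mu> k \<omega> \<theta>\<^sub>0 z f w \<longleftrightarrow>
     tangent_field k \<theta>\<^sub>0 w \<and>
     (\<exists>wxx. H2 w wxx \<and>
       (AE x in lborel.
          wavetrain_linearization \<alpha> \<beta> h \<mu> k \<omega> \<theta>\<^sub>0 x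
            (ReV (w x)) (ReV (z *s w x - f x)) (ReV (wxx x)) = 0 \<and>
          wavetrain_linearization \<alpha> \<beta> h \<mu> k \<omega> \<theta>\<^sub>0 x
            (ImV (w x)) (ImV (z *s w x - f x)) (ImV (wxx x)) = 0))"

definition wavetrain_resolvent_set ::
    "real \<Rightarrow> real \<Rightarrow> real \<Rightarrow> real \<Rightarrow> real \<Rightarrow> real \<Rightarrow> real \<Rightarrow> complex set" where
  "wavetrain_resolvent_set \<alpha> \<beta> h \<mu> k \<omega> \<theta>\<^sub>0 = {z. \<exists>C. \<forall>f. L2 f \<and> tangent_field k \<theta>\<^sub>0 f \<longrightarrow>
     (\<exists>!w. resolvent_equation \<alpha> \<beta> h \<mu> k \<omega> \<theta>\<^sub>0 z f w) \<and>
     (\<forall>w. resolvent_equation \<alpha> \<beta> h \<mu> k \<omega> \<theta>\<^sub>0 z f w \<longrightarrow> L2_norm_fun w \<le> C * L2_norm_fun f)}"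

definition wavetrain_spectrum ::
    "real \<Rightarrow> real \<Rightarrow> real \<Rightarrow> real \<Rightarrow> real \<Rightarrow> real \<Rightarrow> real \<Rightarrow> complex set" where
  "wavetrain_spectrum \<alpha> \<beta> h \<mu> k \<omega> \<theta>\<^sub>0 = - wavetrain_resolvent_set \<alpha> \<beta> h \<mu> k \<omega> \<theta>\<^sub>0"

definition spectrally_stable ::
    "real \<Rightarrow> real \<Rightarrow> real \<Rightarrow> real \<Rightarrow> real \<Rightarrow> real \<Rightarrow> real \<Rightarrow> bool" where
  "spectrally_stable \<alpha> \<beta> h \<mu> k \<omega> \<theta>\<^sub>0 \<longleftrightarrow>
     (\<forall>z\<in>wavetrain_spectrum \<alpha> \<beta> h \<mu> k \<omega> \<theta>\<^sub>0. Re z \<le> 0)"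

text \<open>The cylinder is realized as \<open>{z. cmod z = 1} \<times> UNIV\<close>, and \<open>(\<theta>, \<theta>')\<close> as \<open>(cis \<theta>, \<theta>')\<close>.\<close>

type_synonym cyl = "complex \<times> real"

definition north :: cyl where
  "north = (1, 0)"

definition south :: cyl where
  "south = (-1, 0)"

definition profile_solution ::
    "real \<Rightarrow> real \<Rightarrow> real \<Rightarrow> (real \<Rightarrow> real) \<Rightarrow> (real \<Rightarrow> real) \<Rightarrow> bool" where
  "profile_solution h \<Omega> \<mu> \<theta> \<theta>' \<longleftrightarrow>
     (\<forall>\<xi>. (\<theta> has_real_derivative \<theta>' \<xi>) (at \<xi>) \<and>
          (\<theta>' has_real_derivative sin (\<theta> \<xi>) * (h - \<Omega> - \<mu> * cos (\<theta> \<xi>))) (at \<xi>))"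

definition trajectory :: "real \<Rightarrow> real \<Rightarrow> real \<Rightarrow> (real \<Rightarrow> cyl) \<Rightarrow> bool" where
  "trajectory h \<Omega> \<mu> \<gamma> \<longleftrightarrow>
     (\<exists>\<theta> \<theta>'. profile_solution h \<Omega> \<mu> \<theta> \<theta>' \<and> \<gamma> = (\<lambda>\<xi>. (cis (\<theta> \<xi>), \<theta>' \<xi>)))"

definition profiles :: "real \<Rightarrow> real \<Rightarrow> real \<Rightarrow> cyl set set" where
  "profiles h \<Omega> \<mu> = {range \<gamma> | \<gamma>. trajectory h \<Omega> \<mu> \<gamma>}"

definition equilibria :: "real \<Rightarrow> real \<Rightarrow> real \<Rightarrow> cyl set" where
  "equilibria h \<Omega> \<mu> = {P. trajectory h \<Omega> \<mu> (\<lambda>_. P)}"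

text \<open>Nonconstant profiles from \<open>P\<close> to \<open>Q\<close>; these are homoclinic if \<open>P = Q\<close>.\<close>

definition connections :: "real \<Rightarrow> real \<Rightarrow> real \<Rightarrow> cyl \<Rightarrow> cyl \<Rightarrow> cyl set set" where
  "connections h \<Omega> \<mu> P Q =
     {range \<gamma> | \<gamma>. trajectory h \<Omega> \<mu> \<gamma> \<and> \<not> \<gamma> constant_on UNIV \<and>
                   (\<gamma> \<longlongrightarrow> P) at_bot \<and> (\<gamma> \<longlongrightarrow> Q) at_top}"

definition is_period :: "(real \<Rightarrow> cyl) \<Rightarrow> real \<Rightarrow> bool" where
  "is_period \<gamma> T \<longleftrightarrow> T > 0 \<and> (\<forall>\<xi>. \<gamma> (\<xi> + T) = \<gamma> \<xi>)"

definition minimal_period :: "(real \<Rightarrow> cyl) \<Rightarrow> real \<Rightarrow> bool" where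
  "minimal_period \<gamma> T \<longleftrightarrow> is_period \<gamma> T \<and> (\<forall>S. is_period \<gamma> S \<longrightarrow> T \<le> S)"

definition periodic_profiles :: "real \<Rightarrow> real \<Rightarrow> real \<Rightarrow> cyl set set" where
  "periodic_profiles h \<Omega> \<mu> =
     {range \<gamma> | \<gamma>. trajectory h \<Omega> \<mu> \<gamma> \<and> \<not> \<gamma> constant_on UNIV \<and> (\<exists>T. is_period \<gamma> T)}"

definition crosses :: "(real \<Rightarrow> cyl) \<Rightarrow> cyl \<Rightarrow> real \<Rightarrow> bool" where
  "crosses \<gamma> P \<xi> \<longleftrightarrow> fst (\<gamma> \<xi>) = fst P \<and> snd (\<gamma> \<xi>) \<noteq> 0"

text \<open>Families are parametrized by the open unit interval; \<open>c\<close> selects initial points of the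
  profiles, continuously in the parameter.\<close>

definition periodic_curve :: "real \<Rightarrow> real \<Rightarrow> real \<Rightarrow> (real \<Rightarrow> cyl set) \<Rightarrow> bool" where
  "periodic_curve h \<Omega> \<mu> F \<longleftrightarrow>
     (\<forall>r\<in>{0<..<1}. F r \<in> periodic_profiles h \<Omega> \<mu>) \<and> inj_on F {0<..<1} \<and>
     (\<exists>c. continuous_on {0<..<1} c \<and> (\<forall>r\<in>{0<..<1}. c r \<in> F r))"

definition bounded_curve :: "(real \<Rightarrow> cyl set) \<Rightarrow> bool" where
  "bounded_curve F \<longleftrightarrow> bounded (\<Union>r\<in>{0<..<1}. F r)"

text \<open>The family is parametrized such that its unbounded end is at 1.\<close>

definition semi_unbounded_curve :: "(real \<Rightarrow> cyl set) \<Rightarrow> bool" where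
  "semi_unbounded_curve F \<longleftrightarrow>
     (\<forall>r\<^sub>0\<in>{0<..<1}. bounded (\<Union>r\<in>{0<..r\<^sub>0}. F r) \<and> \<not> bounded (\<Union>r\<in>{r\<^sub>0..<1}. F r))"

text \<open>Convergence of sets in Hausdorff distance.\<close>

definition set_limit :: "(real \<Rightarrow> cyl set) \<Rightarrow> cyl set \<Rightarrow> real filter \<Rightarrow> bool" where
  "set_limit F S flt \<longleftrightarrow>
     (\<forall>\<epsilon>>0. \<forall>\<^sub>F r in flt. F r \<subseteq> (\<Union>x\<in>S. ball x \<epsilon>) \<and> S \<subseteq> (\<Union>x\<in>F r. ball x \<epsilon>))"

text \<open>Every profile is an equilibrium in \<open>E\<close>, a connecting profile in \<open>C\<close> or a member of exactly one
  of the listed curves of periodic profiles, of which those in \<open>Bs\<close> are bounded and those in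
  \<open>Us\<close> are semi-unbounded. As the parameter interval is open and the curves are disjoint,
  no curve can be cut into several or two curves joined to one.\<close>

definition phase_portrait ::
    "real \<Rightarrow> real \<Rightarrow> real \<Rightarrow> cyl set \<Rightarrow> cyl set set \<Rightarrow>
     (real \<Rightarrow> cyl set) list \<Rightarrow> (real \<Rightarrow> cyl set) list \<Rightarrow> bool" where
  "phase_portrait h \<Omega> \<mu> E C Bs Us \<longleftrightarrow>
     equilibria h \<Omega> \<mu> = E \<and>
     profiles h \<Omega> \<mu> = (\<lambda>P. {P}) ` E \<union> C \<union> (\<Union>F\<in>set (Bs @ Us). F ` {0<..<1}) \<and>
     periodic_profiles h \<Omega> \<mu> = (\<Union>F\<in>set (Bs @ Us). F ` {0<..<1}) \<and>
     (\<forall>F\<in>set (Bs @ Us). periodic_curve h \<Omega> \<mu> F) \<and>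
     (\<forall>F\<in>set Bs. bounded_curve F) \<and> (\<forall>F\<in>set Us. semi_unbounded_curve F) \<and>
     sorted_wrt (\<lambda>F G. F ` {0<..<1} \<inter> G ` {0<..<1} = {}) (Bs @ Us)"

text \<open>Two pairs of heteroclinic connections between \<open>P\<close> and \<open>Q\<close>, that is, two in each direction, and
  four curves of periodic profiles. The equilibria that are not connected are \<open>R\<close> and \<open>S\<close>.\<close>

definition heteroclinic_portrait ::
    "real \<Rightarrow> real \<Rightarrow> real \<Rightarrow> cyl \<Rightarrow> cyl \<Rightarrow> cyl \<Rightarrow> cyl \<Rightarrow> bool" where
  "heteroclinic_portrait h \<Omega> \<mu> P Q R S \<longleftrightarrow>
     distinct [P, Q, R, S] \<and>
     card (connections h \<Omega> \<mu> P Q) = 2 \<and> card (connections h \<Omega> \<mu> Q P) = 2 \<and>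
     connections h \<Omega> \<mu> P Q \<inter> connections h \<Omega> \<mu> Q P = {} \<and>
     (\<exists>B\<^sub>1 B\<^sub>2 U\<^sub>1 U\<^sub>2. phase_portrait h \<Omega> \<mu> {P, Q, R, S}
        (connections h \<Omega> \<mu> P Q \<union> connections h \<Omega> \<mu> Q P) [B\<^sub>1, B\<^sub>2] [U\<^sub>1, U\<^sub>2])"

end

theory Submission
  imports Defs
begin

text \<open>
  The profile equation is conservative, with a potential that is even and \<open>2 \<pi>\<close>-periodic in the
  angle. Conservation of energy decides whether a motion turns back, converges to an equilibrium at the
  height of its energy or passes over it; a motion that turns twice is a libration and one
  that never turns while gaining a full angle is a rotation. Every orbit that is not an equilibrium passes the bottom of
  a potential well with nonzero speed, so speeds at the bottoms parametrize all orbits, and the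
  critical speeds separate the families.

  The linearization about the wavetrain is, in polar and azimuthal components, a constant coefficient
  system on the line. For \<open>Re z > 0\<close> and \<open>\<mu> > 0\<close> its symbol has no zero on the imaginary axis; then it is made
  triangular by a left eigenvector and inverted by two scalar resolvents \<open>(\<sigma>\<^sup>2 - \<partial>\<^sub>x\<^sup>2)\<^sup>-\<^sup>1\<close>, which are
  products of convolutions with one-sided exponentials. For \<open>\<mu> < 0\<close>, slowly varying multiples of the unstable
  eigenvector at wave number zero contradict the resolvent bound.

  For a stationary coherent structure that connects the poles, the flux \<open>sin\<^sup>2 \<theta> q\<close> has derivative
  \<open>(\<alpha> \<Omega> - \<beta>) sin\<^sup>2 \<theta>\<close> and also controls the growth of the energy; both are compatible with the limits at the poles
  only if the flux vanishes, so \<open>\<Omega> = \<beta> / \<alpha>\<close>. Equal energies at the two poles then give \<open>h = \<Omega>\<close>.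
\<close>

section \<open>Global flows of Lipschitz vector fields\<close>

text \<open>Profiles are sets in the cylinder, so counting families means deciding when two initial
  states give the same set. Energy separates orbits of different height; at equal height they are
  kept apart by confinement to a well, or by a velocity that never changes sign. A libration passes
  its bottom in both directions and is one orbit, whereas rotations, and connections that never
  turn, come as two. Exhaustion is easier: connections are never periodic, so a cover of all
  nonequilibria by the listed orbits already fixes the set of periodic profiles and all connections.
  The vector field is globally Lipschitz, so solutions exist on the whole line without any
  continuation argument. \<open>H2\<close> is phrased through increments and integrals, which suits
  explicit kernels better than Fourier transforms. The resolvent set demands a bound uniform in the
  source, so approximate eigenfunctions suffice for instability. A stationary coherent structure may
  touch a pole, where its phase carries no information; hence a frame that does not degenerate there
  and a flux that stays meaningful.\<close>

definition primitive :: "(real \<Rightarrow> 'a::banach) \<Rightarrow> real \<Rightarrow> 'a" where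
  "primitive g t = integral {0..t} g - integral {t..0} g"

lemma primitive_0 [simp]: "primitive g 0 = 0"
  by (simp add: primitive_def)

text \<open>The reversed interval is empty or a point; this is how one formula covers both signs of
  \<open>t\<close>.\<close>

lemma primitive_nonneg: "0 \<le> t \<Longrightarrow> primitive g t = integral {0..t} g"
  by (cases "t = 0") (auto simp: primitive_def)

lemma primitive_nonpos: "t \<le> 0 \<Longrightarrow> primitive g t = - integral {t..0} g"
  by (cases "t = 0") (auto simp: primitive_def)

text \<open>Near \<open>t\<close> the function differs by a constant from an integral with the fixed
  lower end \<open>- n\<close>, to which the fundamental theorem applies. The choice of
  \<open>n\<close> makes both 0 and \<open>t\<close> interior, so the derivative within the interval
  is two-sided.\<close>

lemma has_vector_derivative_primitive:
  fixes g :: "real \<Rightarrow> 'a::banach"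
  assumes "continuous_on UNIV g"
  shows "(primitive g has_vector_derivative g t) (at t)"
proof -
  define n where "n = \<bar>t\<bar> + 1"
  have c: "continuous_on {-n..n} g"
    using assms continuous_on_subset by blast
  have eq: "primitive g s = integral {-n..s} g - integral {-n..0} g" if s: "s \<in> {-n..n}" for s
  proof (cases "0 \<le> s")
    case True
    have "integral {-n..0} g + integral {0..s} g = integral {-n..s} g"
      by (rule Henstock_Kurzweil_Integration.integral_combine)
        (use True s n_def assms in \<open>auto intro!: integrable_continuous_real intro: continuous_on_subset\<close>)
    then show ?thesis using True by (simp add: primitive_nonneg algebra_simps)
  next
    case False
    have "integral {-n..s} g + integral {s..0} g = integral {-n..0} g"
      by (rule Henstock_Kurzweil_Integration.integral_combine)
        (use False s n_def assms in \<open>auto intro!: integrable_continuous_real intro: continuous_on_subset\<close>)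
    then show ?thesis using False by (simp add: primitive_nonpos algebra_simps)
  qed
  have "((\<lambda>s. integral {-n..s} g - integral {-n..0} g) has_vector_derivative g t - 0) (at t within {-n..n})"
    by (intro has_vector_derivative_diff integral_has_vector_derivative c has_vector_derivative_const)
      (auto simp: n_def)
  then have "((\<lambda>s. integral {-n..s} g - integral {-n..0} g) has_vector_derivative g t) (at t within {-n..n})"
    by simp
  then have "(primitive g has_vector_derivative g t) (at t within {-n..n})"
    by (rule has_vector_derivative_transform[rotated -1]) (auto simp: eq, auto simp: n_def)
  moreover have "at t within {-n..n} = at t"
    by (rule at_within_interior) (auto simp: n_def)
  ultimately show ?thesis by simp
qed

text \<open>Integrating the weight gains the factor \<open>1 / c\<close>. With a rate
  \<open>c\<close> twice the Lipschitz constant, this gain is what makes the Picard map a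
  contraction.\<close>

lemma norm_primitive_le:
  fixes g :: "real \<Rightarrow> 'a::banach"
  assumes g: "continuous_on UNIV g" and c: "c > 0"
    and bnd: "\<And>s. norm (g s) \<le> M * exp (c * \<bar>s\<bar>)"
  shows "norm (primitive g t) \<le> M / c * exp (c * \<bar>t\<bar>)"
proof -
  have "norm (g 0) \<le> M" using bnd[of 0] by simp
  then have M: "M \<ge> 0" using norm_ge_zero order_trans by blast
  show ?thesis
  proof (cases "0 \<le> t")
    case True
    have "((\<lambda>s. M * exp (c * s)) has_integral (M / c * exp (c * t) - M / c * exp (c * 0))) {0..t}"
      by (rule fundamental_theorem_of_calculus)
        (use True c in \<open>auto intro!: derivative_eq_intros simp flip: has_real_derivative_iff_has_vector_derivative\<close>)
    then have i: "(\<lambda>s. M * exp (c * s)) integrable_on {0..t}"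
      "integral {0..t} (\<lambda>s. M * exp (c * s)) = M / c * exp (c * t) - M / c"
      by (auto simp: integrable_on_def dest: integral_unique simp del: integral_mult_right)
    have "norm (integral {0..t} g) \<le> integral {0..t} (\<lambda>s. M * exp (c * s))"
      by (rule integral_norm_bound_integral)
        (use bnd i g in \<open>auto intro!: integrable_continuous_real intro: continuous_on_subset order_trans\<close>,
          metis abs_of_nonneg bnd)
    also have "\<dots> \<le> M / c * exp (c * t)" using i M c by simp
    finally show ?thesis using True by (simp add: primitive_nonneg)
  next
    case False
    have "((\<lambda>s. M * exp (- c * s)) has_integral (- M / c * exp (- c * 0) - (- M / c) * exp (- c * t))) {t..0}"
      by (rule fundamental_theorem_of_calculus)
        (use False c in \<open>auto intro!: derivative_eq_intros simp flip: has_real_derivative_iff_has_vector_derivative\<close>)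
    then have i: "(\<lambda>s. M * exp (- c * s)) integrable_on {t..0}"
      "integral {t..0} (\<lambda>s. M * exp (- c * s)) = M / c * exp (- c * t) - M / c"
      by (auto simp: integrable_on_def dest: integral_unique simp del: integral_mult_right)
    have "norm (integral {t..0} g) \<le> integral {t..0} (\<lambda>s. M * exp (- c * s))"
    proof (rule integral_norm_bound_integral)
      show "norm (g s) \<le> M * exp (- c * s)" if "s \<in> {t..0}" for s
        using bnd[of s] that by simp
    qed (use i g in \<open>auto intro!: integrable_continuous_real intro: continuous_on_subset\<close>)
    also have "\<dots> \<le> M / c * exp (- c * t)" using i M c by simp
    finally show ?thesis using False by (simp add: primitive_nonpos)
  qed
qed

text \<open>Picard iteration contracts on all of the line at once for the norm weighted by \<open>exp (- 2 K \<bar>t\<bar>)\<close>.\<close>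

lemma lipschitz_ode_exists:
  fixes F :: "'a::banach \<Rightarrow> 'a"
  assumes K: "K > 0" and lip: "\<And>x y. norm (F x - F y) \<le> K * norm (x - y)"
  shows "\<exists>X. X 0 = x0 \<and> (\<forall>t. (X has_vector_derivative F (X t)) (at t))"
proof -
  have "K-lipschitz_on UNIV F"
    using K lip by (intro lipschitz_onI) (auto simp: dist_norm)
  then have contF: "continuous_on UNIV F" by (rule lipschitz_on_continuous_on)
  define w where "w t = exp (2 * K * \<bar>t\<bar>)" for t :: real
  have wpos: "w t > 0" for t by (simp add: w_def)
  have w1: "w t \<ge> 1" for t using K by (simp add: w_def)
  have contw: "continuous_on UNIV w" unfolding w_def by (intro continuous_intros)
  \<comment> \<open>The unknown is the solution divided by the weight \<open>w\<close>, a bounded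
    function even if the solution grows exponentially. \<open>G\<close> is the right-hand side along
    it and \<open>S\<close> the Picard map in these terms.\<close>
  define G where "G y t = F (w t *\<^sub>R apply_bcontfun y t)" for y :: "real \<Rightarrow>\<^sub>C 'a" and t
  have contG: "continuous_on UNIV (G y)" for y
    unfolding G_def by (intro continuous_on_compose2[OF contF] continuous_intros contw) auto
  define S where "S y t = (1 / w t) *\<^sub>R (x0 + primitive (G y) t)" for y t
  have contP: "continuous_on UNIV (primitive (G y))" for y
    using has_vector_derivative_primitive[OF contG]
    by (meson continuous_at_imp_continuous_on has_vector_derivative_continuous)
  have contS: "continuous_on UNIV (S y)" for y
    unfolding S_def using wpos
    by (intro continuous_intros contw contP) (metis less_irrefl)
  have bS: "S y \<in> bcontfun" for y
  proof (rule bcontfun_normI[OF contS])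
    fix t
    have "norm (G y s) \<le> (norm (F 0) + K * norm y) * exp (2 * K * \<bar>s\<bar>)" for s
    proof -
      have "norm (G y s) \<le> norm (F 0) + norm (G y s - F 0)"
        by (metis add.commute diff_add_cancel norm_triangle_ineq)
      also have "norm (G y s - F 0) \<le> K * norm (w s *\<^sub>R apply_bcontfun y s)"
        using lip[of "w s *\<^sub>R apply_bcontfun y s" 0] by (simp add: G_def)
      also have "\<dots> \<le> K * (w s * norm y)"
        using K wpos[of s] by (auto intro!: mult_left_mono norm_bounded)
      also have "norm (F 0) + K * (w s * norm y) \<le> norm (F 0) * w s + K * (w s * norm y)"
        using mult_left_mono[OF w1[of s] norm_ge_zero[of "F 0"]] by simp
      finally show ?thesis by (simp add: w_def algebra_simps)
    qed
    from norm_primitive_le[OF contG _ this, of t] K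
    have "norm (primitive (G y) t) \<le> (norm (F 0) + K * norm y) / (2 * K) * w t"
      by (simp add: w_def)
    then have "norm (x0 + primitive (G y) t) \<le> norm x0 * w t + (norm (F 0) + K * norm y) / (2 * K) * w t"
      using norm_triangle_ineq[of x0 "primitive (G y) t"] mult_left_mono[OF w1[of t] norm_ge_zero[of x0]]
      by linarith
    then show "norm (S y t) \<le> norm x0 + (norm (F 0) + K * norm y) / (2 * K)"
      using wpos[of t] unfolding S_def norm_scaleR by (simp add: divide_le_eq distrib_right)
  qed
  define T where "T y = Bcontfun (S y)" for y
  have T: "apply_bcontfun (T y) = S y" for y
    unfolding T_def by (rule Bcontfun_inverse[OF bS])
  \<comment> \<open>The Lipschitz constant \<open>K\<close> against the growth rate
    \<open>2 * K\<close> of the weight leaves the factor 1/2.\<close>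
  have contr: "dist (T y) (T z) \<le> 1/2 * dist y z" for y z
  proof (rule dist_bound)
    fix t
    have "norm (G y s - G z s) \<le> K * norm (y - z) * exp (2 * K * \<bar>s\<bar>)" for s
    proof -
      have "norm (G y s - G z s) \<le> K * norm (w s *\<^sub>R apply_bcontfun (y - z) s)"
        using lip[of "w s *\<^sub>R apply_bcontfun y s" "w s *\<^sub>R apply_bcontfun z s"]
        by (simp add: G_def algebra_simps)
      also have "\<dots> \<le> K * (w s * norm (y - z))"
        using K wpos[of s] by (auto intro!: mult_left_mono norm_bounded simp del: minus_bcontfun.rep_eq)
      finally show ?thesis by (simp add: w_def algebra_simps)
    qed
    from norm_primitive_le[OF _ _ this, of t] K contG
    have "norm (primitive (\<lambda>s. G y s - G z s) t) \<le> norm (y - z) / 2 * w t"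
      by (simp add: w_def continuous_on_diff)
    moreover have "primitive (\<lambda>s. G y s - G z s) t = primitive (G y) t - primitive (G z) t"
    proof -
      have "G u integrable_on {a..b}" for u a b
        using contG continuous_on_subset by (blast intro: integrable_continuous_real)
      then show ?thesis by (simp add: primitive_def Henstock_Kurzweil_Integration.integral_diff)
    qed
    moreover have "S y t - S z t = (1 / w t) *\<^sub>R (primitive (G y) t - primitive (G z) t)"
      by (simp add: S_def algebra_simps)
    ultimately show "dist (apply_bcontfun (T y) t) (apply_bcontfun (T z) t) \<le> 1/2 * dist y z"
      using wpos[of t] by (simp add: T dist_norm divide_le_eq)
  qed
  then obtain y where y: "T y = y"
    using banach_fix_type[of "1/2" T] by auto
  define X where "X t = w t *\<^sub>R apply_bcontfun y t" for t
  have "X t = x0 + primitive (G y) t" for t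
  proof -
    have "apply_bcontfun y t = (1 / w t) *\<^sub>R (x0 + primitive (G y) t)"
      using fun_cong[OF T[of y], of t] by (simp add: y S_def)
    then show ?thesis using wpos[of t] by (simp add: X_def)
  qed
  then have X: "X = (\<lambda>t. x0 + primitive (G y) t)" by blast
  have "(X has_vector_derivative F (X t)) (at t)" for t
  proof -
    have "((\<lambda>t. x0 + primitive (G y) t) has_vector_derivative 0 + G y t) (at t)"
      by (intro has_vector_derivative_add has_vector_derivative_const has_vector_derivative_primitive contG)
    then show ?thesis by (simp add: X[symmetric] G_def X_def)
  qed
  moreover have "X 0 = x0" by (simp add: X)
  ultimately show ?thesis by blast
qed

text \<open>Gronwall: the squared distance \<open>d\<close> changes at a rate of at most
  \<open>2 K d\<close>, so it decreases after multiplication with \<open>exp (- 2 K t)\<close> and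
  increases after multiplication with \<open>exp (2 K t)\<close>. As it vanishes at
  \<open>t0\<close>, it vanishes on both sides.\<close>

lemma lipschitz_ode_unique:
  fixes F :: "'a::real_inner \<Rightarrow> 'a"
  assumes lip: "\<And>x y. norm (F x - F y) \<le> K * norm (x - y)"
    and X: "\<And>t. (X has_vector_derivative F (X t)) (at t)"
    and Y: "\<And>t. (Y has_vector_derivative F (Y t)) (at t)"
    and eq: "X t0 = Y t0"
  shows "X t = Y t"
proof -
  define D where "D t = X t - Y t" for t
  define d where "d t = D t \<bullet> D t" for t
  define d' where "d' t = D t \<bullet> (F (X t) - F (Y t)) + (F (X t) - F (Y t)) \<bullet> D t" for t
  have D: "(D has_vector_derivative F (X t) - F (Y t)) (at t)" for t
    unfolding D_def by (intro has_vector_derivative_diff X Y)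
  have dd: "(d has_real_derivative d' t) (at t)" for t
    unfolding d_def d'_def
    using bounded_bilinear.has_vector_derivative[OF bounded_bilinear_inner D D]
    by (simp add: has_real_derivative_iff_has_vector_derivative)
  have d': "\<bar>d' t\<bar> \<le> 2 * K * d t" for t
  proof -
    have "\<bar>d' t\<bar> = 2 * \<bar>D t \<bullet> (F (X t) - F (Y t))\<bar>"
      by (simp add: d'_def inner_commute)
    also have "\<dots> \<le> 2 * (norm (D t) * norm (F (X t) - F (Y t)))"
      using Cauchy_Schwarz_ineq2 by simp
    also have "\<dots> \<le> 2 * (norm (D t) * (K * norm (D t)))"
      unfolding D_def by (intro mult_left_mono lip) auto
    finally show ?thesis by (simp add: d_def dot_square_norm power2_eq_square algebra_simps)
  qed
  have nonneg: "d t \<ge> 0" for t by (simp add: d_def)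
  have z: "d t0 = 0" using eq by (simp add: d_def D_def)
  have "d t \<le> 0"
  proof (cases "t0 \<le> t")
    case True
    have "d t * exp (- 2 * K * t) \<le> d t0 * exp (- 2 * K * t0)"
    proof (rule DERIV_nonpos_imp_nonincreasing[OF True])
      fix s
      have "((\<lambda>s. d s * exp (- 2 * K * s)) has_real_derivative (d' s - 2 * K * d s) * exp (- 2 * K * s)) (at s)"
        by (rule derivative_eq_intros dd refl | simp add: algebra_simps)+
      moreover have "(d' s - 2 * K * d s) * exp (- 2 * K * s) \<le> 0"
        using d'[of s] by (intro mult_nonpos_nonneg) auto
      ultimately show "\<exists>y. ((\<lambda>s. d s * exp (- 2 * K * s)) has_real_derivative y) (at s) \<and> y \<le> 0" by blast
    qed
    then show ?thesis using z by (simp add: mult_le_0_iff)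
  next
    case False
    have "d t * exp (2 * K * t) \<le> d t0 * exp (2 * K * t0)"
    proof (rule DERIV_nonneg_imp_nondecreasing[where a=t and b=t0])
      from False show "t \<le> t0" by simp
    next
      fix s
      have "((\<lambda>s. d s * exp (2 * K * s)) has_real_derivative (d' s + 2 * K * d s) * exp (2 * K * s)) (at s)"
        by (rule derivative_eq_intros dd refl | simp add: algebra_simps)+
      moreover have "(d' s + 2 * K * d s) * exp (2 * K * s) \<ge> 0"
        using d'[of s] by (intro mult_nonneg_nonneg) auto
      ultimately show "\<exists>y. ((\<lambda>s. d s * exp (2 * K * s)) has_real_derivative y) (at s) \<and> 0 \<le> y" by blast
    qed
    then show ?thesis using z by (simp add: mult_le_0_iff)
  qed
  then have "d t = 0" using nonneg[of t] by linarith
  then have "D t = 0" by (simp add: d_def)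
  then show ?thesis by (simp add: D_def)
qed

section \<open>The pendulum-type equation for the profiles\<close>

lemma abs_sin_diff_le: "\<bar>sin x - sin y\<bar> \<le> \<bar>x - y\<bar>" for x y :: real
proof -
  have "\<bar>sin x - sin y\<bar> = 2 * \<bar>sin ((x - y) / 2)\<bar> * \<bar>cos ((x + y) / 2)\<bar>"
    by (simp add: sin_diff_sin abs_mult)
  also have "\<dots> \<le> 2 * \<bar>(x - y) / 2\<bar> * 1"
    by (intro mult_mono abs_sin_x_le_abs_x) auto
  finally show ?thesis by simp
qed

text \<open>The mean value theorem on the interval from \<open>n\<close> to \<open>n + 1\<close>
  yields points beyond \<open>n\<close> where \<open>g'\<close> equals an increment of
  \<open>g\<close>, and these increments tend to 0. Applied to position and then to velocity, it
  shows that limits of motions are equilibria.\<close>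

lemma derivative_tendsto_0:
  fixes g g' :: "real \<Rightarrow> real"
  assumes der: "\<And>t. (g has_real_derivative g' t) (at t)"
    and g: "(g \<longlongrightarrow> L) at_top" and g': "(g' \<longlongrightarrow> c) at_top"
  shows "c = 0"
proof -
  have "\<exists>z>real n. g (real n + 1) - g (real n) = g' z" for n
    using MVT2[of "real n" "real n + 1" g g'] der by auto
  then obtain z where z: "\<And>n. z n > real n" "\<And>n. g (real n + 1) - g (real n) = g' (z n)"
    by metis
  have n: "filterlim (\<lambda>n. real n) at_top sequentially" "filterlim (\<lambda>n. real n + 1) at_top sequentially"
    using filterlim_real_sequentially
    by (auto intro!: filterlim_tendsto_add_at_top[OF tendsto_const] simp: add.commute[of _ 1])
  have "filterlim z at_top sequentially"
    by (rule filterlim_at_top_mono[OF n(1)]) (use z(1) in \<open>auto simp: less_imp_le\<close>)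
  then have "(\<lambda>n. g' (z n)) \<longlonglongrightarrow> c" by (rule filterlim_compose[OF g'])
  moreover have "(\<lambda>n. g (real n + 1) - g (real n)) \<longlonglongrightarrow> L - L"
    by (intro tendsto_diff filterlim_compose[OF g] n)
  ultimately show ?thesis using LIMSEQ_unique z(2) by fastforce
qed

locale profile_ode =
  fixes h \<Omega> \<mu> :: real
begin

definition force :: "real \<Rightarrow> real" where
  "force x = sin x * (h - \<Omega> - \<mu> * cos x)"

text \<open>Normalized such that \<open>force\<close> is minus its derivative: the profile equation
  is Newton's equation of a particle in this potential.\<close>

definition pot :: "real \<Rightarrow> real" where
  "pot x = (h - \<Omega>) * cos x - \<mu> / 2 * (cos x)\<^sup>2"

definition energy :: "real \<Rightarrow> real \<Rightarrow> real" where
  "energy x v = v\<^sup>2 / 2 + pot x"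

abbreviation sol :: "(real \<Rightarrow> real) \<Rightarrow> (real \<Rightarrow> real) \<Rightarrow> bool" where
  "sol \<equiv> profile_solution h \<Omega> \<mu>"

lemma sol_iff:
  "sol \<theta> p \<longleftrightarrow> (\<forall>t. (\<theta> has_real_derivative p t) (at t) \<and> (p has_real_derivative force (\<theta> t)) (at t))"
  by (simp add: profile_solution_def force_def)

lemma cis_eq_sin_cos: "cis x = cis y \<longleftrightarrow> cos x = cos y \<and> sin x = sin y"
  by (simp add: complex_eq_iff)

lemma force_cis: "cis x = cis y \<Longrightarrow> force x = force y"
  and pot_cis: "cis x = cis y \<Longrightarrow> pot x = pot y"
  by (simp_all add: force_def pot_def cis_eq_sin_cos)

lemma energy_cis: "cis x = cis y \<Longrightarrow> energy x v = energy y v"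
  using pot_cis[of x y] by (simp add: energy_def)

lemma force_minus [simp]: "force (- x) = - force x"
  and pot_minus [simp]: "pot (- x) = pot x"
  by (simp_all add: force_def pot_def)

lemma energy_minus [simp]: "energy (- x) v = energy x v" "energy x (- v) = energy x v"
  by (simp_all add: energy_def)

lemma DERIV_pot: "(pot has_real_derivative - force x) (at x)"
  unfolding pot_def[abs_def] force_def
  by (auto intro!: derivative_eq_intros simp: power2_eq_square algebra_simps)

lemma continuous_pot: "continuous_on A pot"
  unfolding pot_def[abs_def] by (intro continuous_intros)

lemma continuous_force: "continuous_on A force"
  unfolding force_def[abs_def] by (intro continuous_intros)

lemma tendsto_pot: "(f \<longlongrightarrow> l) F \<Longrightarrow> ((\<lambda>t. pot (f t)) \<longlongrightarrow> pot l) F"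
  using continuous_pot[of UNIV] isCont_tendsto_compose[of l pot f F]
  by (simp add: continuous_on_eq_continuous_at)

lemma tendsto_force: "(f \<longlongrightarrow> l) F \<Longrightarrow> ((\<lambda>t. force (f t)) \<longlongrightarrow> force l) F"
  using continuous_force[of UNIV] isCont_tendsto_compose[of l force f F]
  by (simp add: continuous_on_eq_continuous_at)

lemma force_lipschitz: "\<bar>force x - force y\<bar> \<le> (\<bar>h - \<Omega>\<bar> + \<bar>\<mu>\<bar>) * \<bar>x - y\<bar>"
proof -
  \<comment> \<open>With the double angle the product of \<open>sin\<close> and \<open>cos\<close>
    disappears, and the Lipschitz bound for \<open>sin\<close> is enough.\<close>
  have f: "force z = (h - \<Omega>) * sin z - \<mu> / 2 * sin (2 * z)" for z
    using sin_double[of z] by (simp add: force_def algebra_simps)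
  have "\<bar>force x - force y\<bar> = \<bar>(h - \<Omega>) * (sin x - sin y) - \<mu> / 2 * (sin (2 * x) - sin (2 * y))\<bar>"
    by (simp add: f algebra_simps)
  also have "\<dots> \<le> \<bar>(h - \<Omega>) * (sin x - sin y)\<bar> + \<bar>\<mu> / 2 * (sin (2 * x) - sin (2 * y))\<bar>"
    by (rule abs_triangle_ineq4)
  also have "\<dots> \<le> \<bar>h - \<Omega>\<bar> * \<bar>x - y\<bar> + \<bar>\<mu> / 2\<bar> * \<bar>2 * x - 2 * y\<bar>"
    unfolding abs_mult by (intro add_mono mult_left_mono abs_sin_diff_le) auto
  also have "\<dots> = (\<bar>h - \<Omega>\<bar> + \<bar>\<mu>\<bar>) * \<bar>x - y\<bar>"
  proof -
    have "\<bar>2 * x - 2 * y\<bar> = 2 * \<bar>x - y\<bar>" using abs_mult[of 2 "x - y"] by simp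
    then show ?thesis by (simp add: algebra_simps)
  qed
  finally show ?thesis .
qed

definition field :: "real \<times> real \<Rightarrow> real \<times> real" where
  "field X = (snd X, force (fst X))"

text \<open>The summand 1 comes from the position component; it also makes the constant positive
  when both parameters vanish, as the existence result demands.\<close>

lemma field_lipschitz: "norm (field X - field Y) \<le> (\<bar>h - \<Omega>\<bar> + \<bar>\<mu>\<bar> + 1) * norm (X - Y)"
proof -
  have "norm (field X - field Y) \<le> norm (snd X - snd Y) + norm (force (fst X) - force (fst Y))"
    unfolding field_def by (simp add: norm_Pair sqrt_sum_squares_le_sum_abs)
  also have "\<dots> \<le> norm (snd X - snd Y) + (\<bar>h - \<Omega>\<bar> + \<bar>\<mu>\<bar>) * norm (fst X - fst Y)"
    using force_lipschitz by simp
  also have "\<dots> \<le> norm (X - Y) + (\<bar>h - \<Omega>\<bar> + \<bar>\<mu>\<bar>) * norm (X - Y)"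
    using norm_fst_le[of "fst (X - Y)" "snd (X - Y)"] norm_snd_le[of "snd (X - Y)" "fst (X - Y)"]
    unfolding prod.collapse by (intro add_mono mult_left_mono) auto
  finally show ?thesis by (simp add: algebra_simps)
qed

lemma sol_iff_field: "sol \<theta> p \<longleftrightarrow> (\<forall>t. ((\<lambda>t. (\<theta> t, p t)) has_vector_derivative field (\<theta> t, p t)) (at t))"
proof -
  have "((\<lambda>t. (\<theta> t, p t)) has_vector_derivative (a, b)) (at t) \<longleftrightarrow>
      (\<theta> has_real_derivative a) (at t) \<and> (p has_real_derivative b) (at t)" for a b t
  proof
    assume *: "((\<lambda>t. (\<theta> t, p t)) has_vector_derivative (a, b)) (at t)"
    from bounded_linear.has_vector_derivative[OF bounded_linear_fst *]
      bounded_linear.has_vector_derivative[OF bounded_linear_snd *]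
    show "(\<theta> has_real_derivative a) (at t) \<and> (p has_real_derivative b) (at t)"
      by (simp add: has_real_derivative_iff_has_vector_derivative)
  qed (auto simp: has_real_derivative_iff_has_vector_derivative intro: has_vector_derivative_Pair)
  then show ?thesis by (simp add: sol_iff field_def)
qed

lemma sol_exists: "\<exists>X. sol (\<lambda>t. fst (X t)) (\<lambda>t. snd (X t)) \<and> X 0 = (x, v)"
proof -
  have "\<bar>h - \<Omega>\<bar> + \<bar>\<mu>\<bar> + 1 > 0" by (smt (verit) abs_ge_zero)
  from lipschitz_ode_exists[OF this field_lipschitz, of "(x, v)"]
  obtain X where "X 0 = (x, v)" "\<forall>t. (X has_vector_derivative field (X t)) (at t)" by blast
  then show ?thesis by (intro exI[of _ X]) (simp add: sol_iff_field)
qed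

lemma sol_unique:
  assumes "sol \<theta> p" "sol \<theta>' p'" "\<theta> s = \<theta>' s" "p s = p' s"
  shows "\<theta> t = \<theta>' t" "p t = p' t"
proof -
  have "(\<lambda>t. (\<theta> t, p t)) t = (\<lambda>t. (\<theta>' t, p' t)) t"
    by (rule lipschitz_ode_unique[OF field_lipschitz, where ?t0.0 = s]) (use assms sol_iff_field in auto)
  then show "\<theta> t = \<theta>' t" "p t = p' t" by auto
qed

lemma sol_shift:
  assumes "sol \<theta> p"
  shows "sol (\<lambda>t. \<theta> (t + s)) (\<lambda>t. p (t + s))"
proof -
  have "((\<lambda>t. \<theta> (t + s)) has_real_derivative p (t + s)) (at t)"
    "((\<lambda>t. p (t + s)) has_real_derivative force (\<theta> (t + s))) (at t)" for t
    using assms DERIV_shift[of \<theta> "p (t + s)" t s] DERIV_shift[of p "force (\<theta> (t + s))" t s]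
    unfolding sol_iff by simp_all
  then show ?thesis unfolding sol_iff by blast
qed

lemma sol_reverse:
  assumes "sol \<theta> p"
  shows "sol (\<lambda>t. \<theta> (s - t)) (\<lambda>t. - p (s - t))"
proof -
  have d: "((\<lambda>t. s - t) has_real_derivative - 1) (at t)" for t
    by (auto intro!: derivative_eq_intros)
  have "((\<lambda>t. \<theta> (s - t)) has_real_derivative p (s - t) * - 1) (at t)"
    "((\<lambda>t. p (s - t)) has_real_derivative force (\<theta> (s - t)) * - 1) (at t)" for t
    using assms DERIV_chain2[OF _ d] unfolding sol_iff by blast+
  then show ?thesis unfolding sol_iff by (auto intro!: derivative_eq_intros)
qed

lemma sol_reflect:
  assumes "sol \<theta> p"
  shows "sol (\<lambda>t. - \<theta> t) (\<lambda>t. - p t)"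
  using assms unfolding sol_iff by (auto intro!: derivative_eq_intros)

text \<open>Lifts of one curve on the cylinder differ by such an angle \<open>c\<close>; all of them
  are solutions because \<open>force\<close> depends on \<open>cis\<close> only.\<close>

lemma sol_translate:
  assumes "sol \<theta> p" "cis c = 1"
  shows "sol (\<lambda>t. \<theta> t + c) p"
proof -
  have "force (x + c) = force x" for x
    by (rule force_cis) (use assms in \<open>simp flip: cis_mult\<close>)
  then show ?thesis using assms unfolding sol_iff by (auto intro!: derivative_eq_intros)
qed

lemma sol_const: "force x = 0 \<Longrightarrow> sol (\<lambda>_. x) (\<lambda>_. 0)"
  by (simp add: sol_iff)

lemma sol_equilibrium:
  assumes "sol \<theta> p" "p s = 0" "force (\<theta> s) = 0"
  shows "\<theta> t = \<theta> s" "p t = 0"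
  using sol_unique[OF assms(1) sol_const[OF assms(3)], of s t] assms by auto

lemma sol_cont:
  assumes "sol \<theta> p"
  shows "continuous_on A \<theta>" "continuous_on A p"
  using assms unfolding sol_iff by (auto intro!: continuous_at_imp_continuous_on dest: DERIV_isCont)

lemma sol_energy:
  assumes "sol \<theta> p"
  shows "energy (\<theta> t) (p t) = energy (\<theta> s) (p s)"
proof -
  have d: "(\<theta> has_real_derivative p t) (at t)" "(p has_real_derivative force (\<theta> t)) (at t)" for t
    using assms unfolding sol_iff by auto
  have "((\<lambda>t. energy (\<theta> t) (p t)) has_real_derivative 0) (at t)" for t
    unfolding energy_def
    by (auto intro!: derivative_eq_intros d DERIV_chain2[OF DERIV_pot])
  then show ?thesis using DERIV_isconst_all[of "\<lambda>t. energy (\<theta> t) (p t)" t s] by simp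
qed

text \<open>Reversing time about an instant of rest gives a solution with the same state at that
  instant, so uniqueness identifies the two.\<close>

lemma sol_turn_symmetric:
  assumes "sol \<theta> p" "p s = 0"
  shows "\<theta> (2 * s - t) = \<theta> t" "p (2 * s - t) = - p t"
proof -
  have "\<theta> (2 * s - t) = \<theta> t" "- p (2 * s - t) = p t"
    using sol_unique[OF sol_reverse[OF assms(1), of "2 * s"] assms(1), of s t] assms(2) by auto
  then show "\<theta> (2 * s - t) = \<theta> t" "p (2 * s - t) = - p t" by auto
qed

text \<open>Two reflections of time compose to a translation by twice the distance of their
  centres.\<close>

lemma sol_two_turns_periodic:
  assumes "sol \<theta> p" "p s = 0" "p s' = 0"
  shows "\<theta> (t + 2 * (s' - s)) = \<theta> t" "p (t + 2 * (s' - s)) = p t"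
proof -
  have eq: "t + 2 * (s' - s) = 2 * s' - (2 * s - t)" by simp
  show "\<theta> (t + 2 * (s' - s)) = \<theta> t" "p (t + 2 * (s' - s)) = p t"
    unfolding eq
    using sol_turn_symmetric[OF assms(1,2), of t] sol_turn_symmetric[OF assms(1,3), of "2 * s - t"]
    by simp_all
qed

subsection \<open>Monotone motion\<close>

text \<open>Exit is detected by one continuous function, the minimum of the speed and the remaining
  distance; the infimum of the closed set of times where it is not positive is the exit
  time.\<close>

lemma sol_first_exit:
  assumes "sol \<theta> p" "p 0 > 0" "\<theta> 0 < y"
  obtains (never) "\<And>t. t \<ge> 0 \<Longrightarrow> p t > 0 \<and> \<theta> t < y"
  | (exit) t where "t > 0" "p t = 0 \<or> \<theta> t = y" "p t \<ge> 0" "\<theta> 0 \<le> \<theta> t" "\<theta> t \<le> y"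
      "\<And>s. 0 \<le> s \<Longrightarrow> s < t \<Longrightarrow> p s > 0 \<and> \<theta> s < y"
proof -
  define A where "A = {t. 0 \<le> t \<and> min (p t) (y - \<theta> t) \<le> 0}"
  have contm: "continuous_on B (\<lambda>t. min (p t) (y - \<theta> t))" for B
    by (intro continuous_intros sol_cont[OF assms(1)])
  show thesis
  proof (cases "A = {}")
    case True
    then show thesis using never by (force simp: A_def min_def split: if_splits)
  next
    case False
    have "closed A"
    proof -
      have "A = {0..} \<inter> (\<lambda>t. min (p t) (y - \<theta> t)) -` {..0}" by (auto simp: A_def)
      then show ?thesis using continuous_closed_preimage[OF contm, of "{0..}" "{..0}"] by simp
    qed
    have bdd: "bdd_below A" by (auto simp: A_def intro: bdd_belowI[where m = 0])
    define t where "t = Inf A"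
    have tA: "t \<in> A" unfolding t_def by (rule closed_contains_Inf[OF False bdd \<open>closed A\<close>])
    have before: "p s > 0 \<and> \<theta> s < y" if "0 \<le> s" "s < t" for s
    proof -
      have "s \<notin> A" using cInf_lower[OF _ bdd, of s] that by (auto simp: t_def)
      then show ?thesis using that by (auto simp: A_def min_def split: if_splits)
    qed
    have t0: "t > 0"
      using tA assms(2,3) by (cases "t = 0") (auto simp: A_def min_def split: if_splits)
    \<comment> \<open>At the exit instant both quantities are limits of positive ones from the left,
      which excludes a negative speed and a jump beyond \<open>y\<close>.\<close>
    have nn: "p t \<ge> 0 \<and> y - \<theta> t \<ge> 0"
    proof -

      have ev2: "eventually (\<lambda>s. 0 < p s \<and> \<theta> s < y) (at_left t)"
        using eventually_at_left_real[OF t0] by (rule eventually_mono) (use before in auto)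
      have lim: "(p \<longlongrightarrow> p t) (at_left t)" "(\<theta> \<longlongrightarrow> \<theta> t) (at_left t)"
        using sol_cont[OF assms(1), of UNIV] by (auto simp: continuous_on_def intro: tendsto_within_subset)
      have "p t \<ge> 0"
        by (rule tendsto_lowerbound[OF lim(1)]) (use ev2 in \<open>auto elim!: eventually_mono\<close>)
      moreover have "\<theta> t \<le> y"
        by (rule tendsto_upperbound[OF lim(2)]) (use ev2 in \<open>auto elim!: eventually_mono\<close>)
      ultimately show ?thesis by simp
    qed
    have mono: "\<theta> 0 \<le> \<theta> t"
    proof (rule DERIV_nonneg_imp_nondecreasing[where a = 0 and b = t])
      show "0 \<le> t" using t0 by simp
    next
      fix s assume "0 \<le> s" "s \<le> t"
      then have "p s \<ge> 0" using before[of s] nn by (cases "s = t") auto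
      then show "\<exists>d. (\<theta> has_real_derivative d) (at s) \<and> 0 \<le> d"
        using assms(1) unfolding sol_iff by blast
    qed
    show thesis
      by (rule exit[OF t0]) (use tA nn mono before in \<open>auto simp: A_def min_def split: if_splits\<close>)
  qed
qed

text \<open>The bounded increasing position converges, and energy conservation then makes the speed
  converge. \<open>derivative_tendsto_0\<close>, applied to the position and then to the speed,
  shows that the limit is an equilibrium at the height of the energy.\<close>

lemma sol_bounded_monotone_limit:
  assumes "sol \<theta> p" and pos: "\<And>t. t \<ge> 0 \<Longrightarrow> p t > 0 \<and> \<theta> t < y"
  obtains L where "\<theta> 0 < L" "L \<le> y" "(\<theta> \<longlongrightarrow> L) at_top" "(p \<longlongrightarrow> 0) at_top"
    "pot L = energy (\<theta> 0) (p 0)" "force L = 0"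
proof -
  have der: "(\<theta> has_real_derivative p t) (at t)" "(p has_real_derivative force (\<theta> t)) (at t)" for t
    using assms(1) unfolding sol_iff by auto
  have mono: "\<theta> s < \<theta> t" if "0 \<le> s" "s < t" for s t
    by (rule DERIV_pos_imp_increasing[OF that(2)]) (use that der pos in force)
  define L where "L = Sup (\<theta> ` {0..})"
  have bdd: "bdd_above (\<theta> ` {0..})" using pos by (auto intro!: bdd_aboveI[of _ y] less_imp_le)
  have le: "\<theta> t \<le> L" if "t \<ge> 0" for t
    unfolding L_def using that by (intro cSup_upper bdd) auto
  have Ly: "L \<le> y" unfolding L_def using pos by (intro cSup_least) (auto intro: less_imp_le)
  have lim: "(\<theta> \<longlongrightarrow> L) at_top"
  proof (rule order_tendstoI)
    fix a assume "a < L"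
    then obtain t where t: "t \<ge> 0" "a < \<theta> t"
      unfolding L_def using less_cSup_iff[OF _ bdd, of a] by auto
    show "eventually (\<lambda>s. a < \<theta> s) at_top"
      using eventually_gt_at_top[of t] by eventually_elim (use t mono in force)
  next
    fix a assume "L < a"
    show "eventually (\<lambda>s. \<theta> s < a) at_top"
      using eventually_ge_at_top[of 0] by eventually_elim (use le \<open>L < a\<close> in force)
  qed
  define E where "E = energy (\<theta> 0) (p 0)"
  have p: "p t = sqrt (2 * (E - pot (\<theta> t)))" if "t \<ge> 0" for t
  proof -
    have "2 * (E - pot (\<theta> t)) = (p t)\<^sup>2"
      using sol_energy[OF assms(1), of t 0] by (simp add: E_def energy_def)
    then show ?thesis using pos[OF that] by simp
  qed
  have "((\<lambda>t. sqrt (2 * (E - pot (\<theta> t)))) \<longlongrightarrow> sqrt (2 * (E - pot L))) at_top"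
    by (intro tendsto_intros tendsto_pot lim)
  then have plim: "(p \<longlongrightarrow> sqrt (2 * (E - pot L))) at_top"
    by (rule Lim_transform_eventually) (use p in \<open>auto intro!: eventually_mono[OF eventually_ge_at_top[of 0]]\<close>)
  have "sqrt (2 * (E - pot L)) = 0" by (rule derivative_tendsto_0[OF der(1) lim plim])
  then have "pot L = E" and p0: "(p \<longlongrightarrow> 0) at_top" using plim by auto
  moreover have "force L = 0"
    by (rule derivative_tendsto_0[OF der(2) p0 tendsto_force[OF lim]])
  moreover have "\<theta> 0 < L" using mono[of 0 1] le[of 1] by simp
  ultimately show thesis using that lim Ly E_def by blast
qed

text \<open>Stopping, as well as converging without arrival, would happen at a point where the
  potential equals the energy; there is none up to \<open>y\<close>.\<close>

lemma sol_reach: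
  assumes "sol \<theta> p" "p 0 > 0" "\<theta> 0 \<le> y" and lt: "\<And>x. \<theta> 0 \<le> x \<Longrightarrow> x \<le> y \<Longrightarrow> pot x < energy (\<theta> 0) (p 0)"
  shows "\<exists>t\<ge>0. \<theta> t = y \<and> p t > 0"
proof (cases "\<theta> 0 = y")
  case True
  then show ?thesis using assms by auto
next
  case False
  then have "\<theta> 0 < y" using assms by simp
  from assms(1,2) this show ?thesis
  proof (cases rule: sol_first_exit)
    case never
    obtain L where "\<theta> 0 < L" "L \<le> y" "pot L = energy (\<theta> 0) (p 0)"
      using sol_bounded_monotone_limit[OF assms(1) never] by blast
    then show ?thesis using lt[of L] by auto
  next
    case (exit t)
    have "p t \<noteq> 0"
      using lt[of "\<theta> t"] exit sol_energy[OF assms(1), of t 0] by (auto simp: energy_def)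
    then show ?thesis using exit by (intro exI[of _ t]) auto
  qed
qed

text \<open>As \<open>y\<close> is no equilibrium, the motion cannot merely converge to it. It
  arrives, and then the energy leaves no speed.\<close>

lemma sol_turn:
  assumes "sol \<theta> p" "p 0 > 0" "\<theta> 0 < y" and lt: "\<And>x. \<theta> 0 \<le> x \<Longrightarrow> x < y \<Longrightarrow> pot x < energy (\<theta> 0) (p 0)"
    and "pot y = energy (\<theta> 0) (p 0)" "force y \<noteq> 0"
  shows "\<exists>t>0. \<theta> t = y \<and> p t = 0 \<and> (\<forall>s. 0 \<le> s \<and> s < t \<longrightarrow> p s > 0)"
  using assms(1-3)
proof (cases rule: sol_first_exit)
  case never
  obtain L where "\<theta> 0 < L" "L \<le> y" "pot L = energy (\<theta> 0) (p 0)" "force L = 0"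
    using sol_bounded_monotone_limit[OF assms(1) never] by blast
  then show ?thesis using lt[of L] assms by (cases "L = y") auto
next
  case (exit t)
  have "\<theta> t = y \<and> p t = 0"
    using lt[of "\<theta> t"] exit(2-5) sol_energy[OF assms(1), of t 0] assms(5)
    by (cases "\<theta> t = y") (auto simp: energy_def)
  then show ?thesis using exit by (intro exI[of _ t]) auto
qed

text \<open>Arrival in finite time would mean rest at an equilibrium, hence a constant solution by
  uniqueness; only convergence remains.\<close>

lemma sol_limit:
  assumes "sol \<theta> p" "p 0 > 0" "\<theta> 0 < y" and lt: "\<And>x. \<theta> 0 \<le> x \<Longrightarrow> x < y \<Longrightarrow> pot x < energy (\<theta> 0) (p 0)"
    and "pot y = energy (\<theta> 0) (p 0)" "force y = 0"
  shows "(\<theta> \<longlongrightarrow> y) at_top" "(p \<longlongrightarrow> 0) at_top" "t \<ge> 0 \<Longrightarrow> p t > 0 \<and> \<theta> t < y"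
proof -
  have "(\<forall>t\<ge>0. p t > 0 \<and> \<theta> t < y) \<and> (\<theta> \<longlongrightarrow> y) at_top \<and> (p \<longlongrightarrow> 0) at_top"
    using assms(1-3)
  proof (cases rule: sol_first_exit)
    case never
    obtain L where "\<theta> 0 < L" "L \<le> y" "(\<theta> \<longlongrightarrow> L) at_top" "(p \<longlongrightarrow> 0) at_top" "pot L = energy (\<theta> 0) (p 0)"
      using sol_bounded_monotone_limit[OF assms(1) never] by blast
    then show ?thesis using lt[of L] never by (cases "L = y") auto
  next
    case (exit t)
    have "\<theta> t = y \<and> p t = 0"
      using lt[of "\<theta> t"] exit(2-5) sol_energy[OF assms(1), of t 0] assms(5)
      by (cases "\<theta> t = y") (auto simp: energy_def)
    then show ?thesis using sol_equilibrium[OF assms(1), of t 0] assms by auto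
  qed
  then show "(\<theta> \<longlongrightarrow> y) at_top" "(p \<longlongrightarrow> 0) at_top" "t \<ge> 0 \<Longrightarrow> p t > 0 \<and> \<theta> t < y" by auto
qed

lemma pot_less_of_force_pos:
  assumes "a < c" "\<And>z. a < z \<Longrightarrow> z < c \<Longrightarrow> force z > 0"
  shows "pot c < pot a"
  by (rule DERIV_neg_imp_decreasing_open[OF assms(1)])
    (use assms(2) DERIV_pot continuous_pot in \<open>force intro: exI[of _ "- force _"]\<close>)+

lemma pot_less_of_force_neg:
  assumes "a < c" "\<And>z. a < z \<Longrightarrow> z < c \<Longrightarrow> force z < 0"
  shows "pot a < pot c"
  by (rule DERIV_pos_imp_increasing_open[OF assms(1)])
    (use assms(2) DERIV_pot continuous_pot in \<open>force intro: exI[of _ "- force _"]\<close>)+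

subsection \<open>Orbits on the cylinder\<close>

text \<open>Solutions are kept as lifts to real angles, where monotonicity and intermediate values
  make sense; \<open>curve\<close> and \<open>orb\<close> pass to the cylinder.\<close>

definition flow :: "real \<Rightarrow> real \<Rightarrow> real \<Rightarrow> real \<times> real" where
  "flow x v = (SOME X. sol (\<lambda>t. fst (X t)) (\<lambda>t. snd (X t)) \<and> X 0 = (x, v))"

definition pos :: "real \<Rightarrow> real \<Rightarrow> real \<Rightarrow> real" where
  "pos x v t = fst (flow x v t)"

definition vel :: "real \<Rightarrow> real \<Rightarrow> real \<Rightarrow> real" where
  "vel x v t = snd (flow x v t)"

definition curve :: "real \<Rightarrow> real \<Rightarrow> real \<Rightarrow> cyl" where
  "curve x v t = (cis (pos x v t), vel x v t)"

definition orb :: "real \<Rightarrow> real \<Rightarrow> cyl set" where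
  "orb x v = range (curve x v)"

lemma sol_flow: "sol (pos x v) (vel x v)"
  and pos_0 [simp]: "pos x v 0 = x"
  and vel_0 [simp]: "vel x v 0 = v"
proof -
  have "sol (\<lambda>t. fst (flow x v t)) (\<lambda>t. snd (flow x v t)) \<and> flow x v 0 = (x, v)"
    unfolding flow_def by (rule someI_ex[OF sol_exists])
  then show "sol (pos x v) (vel x v)" "pos x v 0 = x" "vel x v 0 = v"
    by (simp_all add: pos_def[abs_def] vel_def[abs_def])
qed

lemma DERIV_pos: "(pos x v has_real_derivative vel x v t) (at t)"
  and DERIV_vel: "(vel x v has_real_derivative force (pos x v t)) (at t)"
  using sol_flow unfolding sol_iff by blast+

lemma sol_eq_flow:
  assumes "sol \<theta> p" "\<theta> s = x" "p s = v"
  shows "\<theta> (t + s) = pos x v t" "p (t + s) = vel x v t"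
  using sol_unique[OF sol_shift[OF assms(1), of s] sol_flow[of x v], of 0 t] assms by auto

lemma flow_energy: "energy (pos x v t) (vel x v t) = energy x v"
  using sol_energy[OF sol_flow, of x v t 0] by simp

lemma trajectory_curve: "trajectory h \<Omega> \<mu> (curve x v)"
  unfolding trajectory_def curve_def[abs_def] using sol_flow by blast

lemma trajectory_eq_curve:
  assumes "trajectory h \<Omega> \<mu> \<gamma>" "\<gamma> s = (cis x, v)"
  shows "\<gamma> (t + s) = curve x v t"
proof -
  obtain \<theta> p where s: "sol \<theta> p" and \<gamma>: "\<gamma> = (\<lambda>t. (cis (\<theta> t), p t))"
    using assms(1) unfolding trajectory_def by blast
  have c: "cis (\<theta> s) = cis x" "p s = v" using assms(2) \<gamma> by auto
  \<comment> \<open>\<open>\<theta> s\<close> and \<open>x\<close> may be different lifts of one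
    angle; translating by their difference makes the initial states agree.\<close>
  have c1: "cis (x - \<theta> s) = 1" by (simp add: c flip: cis_divide)
  have "sol (\<lambda>t. \<theta> t + (x - \<theta> s)) p" by (rule sol_translate[OF s c1])
  from sol_eq_flow[OF this, of s x v t] c(2)
  have "\<theta> (t + s) + (x - \<theta> s) = pos x v t" "p (t + s) = vel x v t" by auto
  moreover from this have "cis (\<theta> (t + s)) = cis (pos x v t)"
    using c1 by (metis cis_mult mult.right_neutral)
  ultimately show ?thesis by (simp add: \<gamma> curve_def)
qed

lemma curve_shift: "curve x v s = (cis y, w) \<Longrightarrow> curve x v (t + s) = curve y w t"
  by (rule trajectory_eq_curve[OF trajectory_curve])

lemma trajectory_start:
  assumes "trajectory h \<Omega> \<mu> \<gamma>"
  obtains x v where "\<gamma> s = (cis x, v)" "\<And>t. \<gamma> (t + s) = curve x v t"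
proof -
  obtain \<theta> p where \<gamma>: "\<gamma> = (\<lambda>t. (cis (\<theta> t), p t))"
    using assms(1) unfolding trajectory_def by blast
  show thesis using that[of "\<theta> s" "p s"] trajectory_eq_curve[OF assms] \<gamma> by auto
qed

lemma range_shift: "range (\<lambda>t. f (t + s)) = range f" for f :: "real \<Rightarrow> 'a"
proof (intro equalityI subsetI)
  fix z assume "z \<in> range f"
  then obtain t where "z = f (t - s + s)" by auto
  then show "z \<in> range (\<lambda>t. f (t + s))" by blast
qed auto

lemma orb_mem: "(cis x, v) \<in> orb x v"
  unfolding orb_def curve_def[abs_def] by (rule image_eqI[where x = 0]) auto

lemma curve_mem: "curve x v t \<in> orb x v"
  by (simp add: orb_def)

lemma orb_eqI:
  assumes "(cis y, w) \<in> orb x v"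
  shows "orb x v = orb y w"
proof -
  obtain s where "curve x v s = (cis y, w)" using assms by (auto simp: orb_def)
  then have "curve x v (t + s) = curve y w t" for t by (rule curve_shift)
  then have "curve y w = (\<lambda>t. curve x v (t + s))" by auto
  then show ?thesis using range_shift[of "curve x v" s] by (simp add: orb_def)
qed

lemma orb_flow: "orb x v = orb (pos x v t) (vel x v t)"
  by (rule orb_eqI) (use curve_mem[of x v t] in \<open>simp add: curve_def\<close>)

lemma orb_cis: "cis x = cis y \<Longrightarrow> orb x v = orb y v"
  using orb_eqI orb_mem by metis

lemma orb_energy: "(cis y, w) \<in> orb x v \<Longrightarrow> energy y w = energy x v"
proof -
  assume "(cis y, w) \<in> orb x v"
  then obtain t where t: "cis y = cis (pos x v t)" "w = vel x v t" by (auto simp: orb_def curve_def)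
  show "energy y w = energy x v" unfolding energy_cis[OF t(1)] t(2) by (rule flow_energy)
qed

lemma orb_eq_energy: "orb x v = orb y w \<Longrightarrow> energy x v = energy y w"
  using orb_mem orb_energy by metis

lemma profiles_eq: "profiles h \<Omega> \<mu> = {orb x v | x v. True}"
proof (intro equalityI subsetI)
  fix S assume "S \<in> profiles h \<Omega> \<mu>"
  then obtain \<gamma> where \<gamma>: "trajectory h \<Omega> \<mu> \<gamma>" "S = range \<gamma>" by (auto simp: profiles_def)
  obtain x v where "\<And>t. \<gamma> (t + 0) = curve x v t" using trajectory_start[OF \<gamma>(1), of 0] by blast
  then have "\<gamma> = curve x v" by auto
  then show "S \<in> {orb x v | x v. True}" using \<gamma> by (auto simp: orb_def)
qed (auto simp: profiles_def orb_def intro: trajectory_curve)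

text \<open>Every parametrization of an orbit is a time shift of the standard one, so claims about
  all trajectories with a given range reduce to \<open>curve x v\<close>.\<close>

lemma trajectory_orb:
  assumes "trajectory h \<Omega> \<mu> \<gamma>" "range \<gamma> = orb x v"
  obtains s where "\<gamma> = (\<lambda>t. curve x v (t + s))"
proof -
  obtain y w where y: "\<gamma> 0 = (cis y, w)" "\<And>t. \<gamma> (t + 0) = curve y w t"
    using trajectory_start[OF assms(1), of 0] by blast
  have "(cis y, w) \<in> orb x v" using assms(2) y(1) by (metis rangeI)
  then obtain s where "curve x v s = (cis y, w)" by (auto simp: orb_def)
  then have "\<gamma> t = curve x v (t + s)" for t using curve_shift[of x v s y w t] y(2)[of t] by simp
  then show thesis using that by blast
qed

lemma flow_reflect: "pos (- x) (- v) t = - pos x v t" "vel (- x) (- v) t = - vel x v t"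
  using sol_eq_flow[OF sol_reflect[OF sol_flow[of x v]], of 0 "- x" "- v" t] by auto

lemma flow_reverse: "pos x (- v) t = pos x v (- t)" "vel x (- v) t = - vel x v (- t)"
  using sol_eq_flow[OF sol_reverse[OF sol_flow[of x v], of 0], of 0 x "- v" t] by auto

text \<open>Point reflection and time reversal combined: the velocity keeps its sign, so claims
  about where a motion to the right is going become claims about where it came from.\<close>

lemma flow_mirror: "pos (- x) v t = - pos x v (- t)" "vel (- x) v t = vel x v (- t)"
  using flow_reflect[of x "- v" t] flow_reverse[of x v t] by auto

lemma curve_reverse: "curve x (- v) t = (\<lambda>(z, p). (z, - p)) (curve x v (- t))"
  by (simp add: curve_def flow_reverse)

lemma curve_reflect: "curve (- x) (- v) t = (\<lambda>(z, p). (cnj z, - p)) (curve x v t)"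
  by (simp add: curve_def flow_reflect cis_cnj)

lemma orb_reverse: "orb x (- v) = (\<lambda>(z, p). (z, - p)) ` orb x v"
proof -
  have "range (\<lambda>t. curve x v (- t)) = range (curve x v)"
  proof (intro equalityI subsetI)
    fix z assume "z \<in> range (curve x v)"
    then obtain t where "z = curve x v (- (- t))" by auto
    then show "z \<in> range (\<lambda>t. curve x v (- t))" by blast
  qed auto
  then have "(\<lambda>(z, p). (z, - p)) ` range (curve x v) = (\<lambda>(z, p). (z, - p)) ` range (\<lambda>t. curve x v (- t))"
    by simp
  then show ?thesis unfolding orb_def curve_reverse[abs_def] image_image by simp
qed

lemma orb_reflect: "orb (- x) (- v) = (\<lambda>(z, p). (cnj z, - p)) ` orb x v"
  unfolding orb_def curve_reflect[abs_def] by (simp add: image_image)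

lemma orb_eq_reverse: "orb x v = orb y w \<Longrightarrow> orb x (- v) = orb y (- w)"
  by (simp add: orb_reverse)

lemma orb_eq_reflect: "orb x v = orb y w \<Longrightarrow> orb (- x) (- v) = orb (- y) (- w)"
  by (simp add: orb_reflect)

lemma curve_constant_iff: "curve x v constant_on UNIV \<longleftrightarrow> v = 0 \<and> force x = 0"
proof
  assume "curve x v constant_on UNIV"
  then obtain c where c: "\<And>t. curve x v t = c" by (auto simp: constant_on_def)
  then have cc: "curve x v t = (cis x, v)" for t using c[of 0] by (metis curve_def pos_0 vel_0)
  then have vt: "vel x v = (\<lambda>_. v)" and cis: "cis (pos x v t) = cis x" for t by (auto simp: curve_def)
  have "((\<lambda>t. pos x v t - v * t) has_real_derivative 0) (at t)" for t
    using DERIV_pos[of x v t] vt by (auto intro!: derivative_eq_intros)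
  then have p: "pos x v t = x + v * t" for t
    using DERIV_isconst_all[of "\<lambda>t. pos x v t - v * t" t 0] by simp
  have "force x = 0"
    using DERIV_vel[of x v 0] vt DERIV_unique[of "\<lambda>_. v" 0 0] by auto
  moreover have "v = 0"
  proof (rule ccontr)
    assume "v \<noteq> 0"
    \<comment> \<open>After the time \<open>pi / v\<close> the angle has advanced by half a turn,
      which \<open>cis\<close> detects.\<close>
    then have "cis (x + pi) = cis x" using cis[of "pi / v"] p[of "pi / v"] by simp
    then show False by (simp add: cis_mult[symmetric])
  qed
  ultimately show "v = 0 \<and> force x = 0" by simp
next
  assume *: "v = 0 \<and> force x = 0"
  then have "curve x v t = (cis x, 0)" for t
    using sol_equilibrium[OF sol_flow, of x v 0 t] by (simp add: curve_def)
  then show "curve x v constant_on UNIV" unfolding constant_on_def by blast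
qed

lemma equilibria_eq: "equilibria h \<Omega> \<mu> = (\<lambda>x. (cis x, 0)) ` {x. force x = 0}"
proof (intro equalityI subsetI)
  fix P assume "P \<in> equilibria h \<Omega> \<mu>"
  then have t: "trajectory h \<Omega> \<mu> (\<lambda>_. P)" by (simp add: equilibria_def)
  obtain x v where x: "P = (cis x, v)" "\<And>t. P = curve x v t" using trajectory_start[OF t] by metis
  then have "curve x v constant_on UNIV" unfolding constant_on_def by metis
  then show "P \<in> (\<lambda>x. (cis x, 0)) ` {x. force x = 0}" using x(1) by (auto simp: curve_constant_iff)
next
  fix P :: cyl assume "P \<in> (\<lambda>x. (cis x, 0)) ` {x. force x = 0}"
  then obtain x where x: "P = (cis x, 0)" "force x = 0" by blast
  then show "P \<in> equilibria h \<Omega> \<mu>"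
    using sol_const[OF x(2)] by (auto simp: equilibria_def trajectory_def)
qed

lemma orb_equilibrium: "force x = 0 \<Longrightarrow> orb x 0 = {(cis x, 0)}"
  using sol_equilibrium[OF sol_flow, of x 0 0] by (auto simp: orb_def curve_def)

lemma orb_pass_right:
  assumes "v > 0" "x \<le> y" "\<And>z. x \<le> z \<Longrightarrow> z \<le> y \<Longrightarrow> pot z < energy x v"
  shows "orb x v = orb y (sqrt (2 * (energy x v - pot y)))"
proof -
  obtain t where t: "pos x v t = y" "vel x v t > 0"
    using sol_reach[OF sol_flow, of x v y] assms by auto
  have "2 * (energy x v - pot y) = (vel x v t)\<^sup>2"
    using flow_energy[of x v t] t(1) by (simp add: energy_def)
  then show ?thesis using orb_flow[of x v t] t by simp
qed

text \<open>Where the potential is below the energy the motion cannot turn, so the whole segment is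
  traversed by one orbit. The case \<open>y < x\<close> asks for the past of the motion and is the
  mirror image of the other.\<close>

lemma orb_pass:
  assumes "v > 0" "\<And>z. z \<in> closed_segment x y \<Longrightarrow> pot z < energy x v"
  shows "orb x v = orb y (sqrt (2 * (energy x v - pot y)))"
proof (cases "x \<le> y")
  case True
  then show ?thesis by (intro orb_pass_right) (use assms in \<open>auto simp: closed_segment_eq_real_ivl\<close>)
next
  case False
  have "orb (- x) v = orb (- y) (sqrt (2 * (energy (- x) v - pot (- y))))"
  proof (rule orb_pass_right)
    fix z assume "- x \<le> z" "z \<le> - y"
    then show "pot z < energy (- x) v"
      using assms(2)[of "- z"] False by (auto simp: closed_segment_eq_real_ivl)
  qed (use False assms in auto)
  from orb_eq_reverse[OF orb_eq_reflect[OF this]] show ?thesis by simp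
qed

lemma orb_pass_neg:
  assumes "v < 0" "\<And>z. z \<in> closed_segment x y \<Longrightarrow> pot z < energy x v"
  shows "orb x v = orb y (- sqrt (2 * (energy x v - pot y)))"
  using orb_eq_reverse[OF orb_pass[of "- v" x y]] assms by simp

lemma well_pot:
  assumes lbu: "l \<le> b" "b \<le> u"
    and f: "\<And>z. l < z \<Longrightarrow> z < b \<Longrightarrow> force z > 0" "\<And>z. b < z \<Longrightarrow> z < u \<Longrightarrow> force z < 0"
    and x: "l \<le> x" "x \<le> u" and z: "z \<in> closed_segment x b" "z \<noteq> x"
  shows "pot z < pot x"
proof (cases "x \<le> b")
  case True
  then show ?thesis
    by (intro pot_less_of_force_pos) (use x z f in \<open>auto simp: closed_segment_eq_real_ivl\<close>)
next
  case False
  then show ?thesis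
    by (intro pot_less_of_force_neg) (use x z f in \<open>auto simp: closed_segment_eq_real_ivl\<close>)
qed

text \<open>The potential falls towards the bottom, so a state with nonzero speed is joined to it;
  orbits extend over all times, hence the direction of the velocity does not matter. A state at rest
  is replaced by a slightly later one, which moves because the force does not vanish.\<close>

lemma orb_well:
  assumes lbu: "l < b" "b < u"
    and f: "\<And>z. l < z \<Longrightarrow> z < b \<Longrightarrow> force z > 0" "\<And>z. b < z \<Longrightarrow> z < u \<Longrightarrow> force z < 0"
    and x: "l \<le> x" "x \<le> u" and nz: "v \<noteq> 0 \<or> (l < x \<and> x < u \<and> x \<noteq> b)"
  shows "\<exists>q. q \<noteq> 0 \<and> orb x v = orb b q"
proof -
  have main: "\<exists>q. q \<noteq> 0 \<and> orb y w = orb b q" if y: "l \<le> y" "y \<le> u" and w: "w \<noteq> 0" for y w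
  proof -
    have seg: "pot z < energy y w" if "z \<in> closed_segment y b" for z
    proof -
      have "pot z \<le> pot y"
        using well_pot[of l b u y z] lbu f y that by (cases "z = y") (auto intro: less_imp_le)
      then show ?thesis using w by (auto simp: energy_def add_strict_increasing)
    qed
    define q where "q = sqrt (2 * (energy y w - pot b))"
    have "pot b < energy y w" by (rule seg) auto
    then have q: "q > 0" by (simp add: q_def)
    show ?thesis
    proof (cases "w > 0")
      case True
      have "orb y w = orb b q" unfolding q_def by (rule orb_pass[OF True seg])
      then show ?thesis using q by (intro exI[of _ q]) auto
    next
      case False
      then have "w < 0" using w by simp
      then have "orb y w = orb b (- q)" unfolding q_def by (rule orb_pass_neg[OF _ seg])
      then show ?thesis using q by (metis neg_equal_0_iff_equal less_irrefl)
    qed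
  qed
  show ?thesis
  proof (cases "v = 0")
    case False
    then show ?thesis using main x by blast
  next
    case True
    then have x': "l < x" "x < u" "x \<noteq> b" using nz by auto
    then have fx: "force x \<noteq> 0" using f[of x] by (cases "x < b") auto
    have "eventually (\<lambda>t. vel x v t \<noteq> vel x v 0) (at_right 0)"
    proof (cases "force x > 0")
      case True
      then obtain d where "d > 0" "\<forall>s>0. s < d \<longrightarrow> vel x v 0 < vel x v (0 + s)"
        using DERIV_pos_inc_right[OF DERIV_vel[of x v 0]] by auto
      then show ?thesis unfolding eventually_at_right_field by (intro exI[of _ d]) force
    next
      case False
      then obtain d where "d > 0" "\<forall>s>0. s < d \<longrightarrow> vel x v 0 > vel x v (0 + s)"
        using DERIV_neg_dec_right[OF DERIV_vel[of x v 0]] fx by auto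
      then show ?thesis unfolding eventually_at_right_field by (intro exI[of _ d]) force
    qed
    moreover have "(pos x v \<longlongrightarrow> x) (at_right 0)"
      using DERIV_isCont[OF DERIV_pos[of x v 0]] by (auto simp: isCont_def intro: tendsto_within_subset)
    then have "eventually (\<lambda>t. l < pos x v t \<and> pos x v t < u) (at_right 0)"
      using x' by (auto intro: eventually_conj order_tendstoD)
    ultimately have "eventually (\<lambda>t. vel x v t \<noteq> vel x v 0 \<and> l < pos x v t \<and> pos x v t < u) (at_right 0)"
      by eventually_elim auto
    then obtain t where "vel x v t \<noteq> vel x v 0" "l < pos x v t" "pos x v t < u"
      using eventually_happens'[OF trivial_limit_at_right_real] by blast
    then show ?thesis using main[of "pos x v t" "vel x v t"] orb_flow[of x v t] True by auto
  qed
qed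

text \<open>The turning point is the first place \<open>y\<close> to the right of \<open>b\<close>
  where the potential attains the energy. It lies before \<open>u\<close>, and \<open>ne\<close>
  rules out that it is an equilibrium.\<close>

lemma turn_right:
  assumes "v > 0" "b < u" "pot u > energy b v"
    and ne: "\<And>y. b < y \<Longrightarrow> y < u \<Longrightarrow> pot y = energy b v \<Longrightarrow> force y \<noteq> 0"
  shows "\<exists>t>0. vel b v t = 0 \<and> (\<forall>s. 0 \<le> s \<and> s < t \<longrightarrow> vel b v s > 0)"
proof -
  define A where "A = {b..u} \<inter> pot -` {energy b v..}"
  have cl: "closed A"
    unfolding A_def by (intro continuous_closed_preimage continuous_pot) auto
  have A0: "u \<in> A" using assms by (auto simp: A_def)
  have bdd: "bdd_below A" by (auto simp: A_def)
  define y where "y = Inf A"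
  have yA: "y \<in> A" unfolding y_def using A0 by (intro closed_contains_Inf bdd cl) auto
  have before: "pot z < energy b v" if "b \<le> z" "z < y" for z
  proof -
    have "z \<notin> A" using cInf_lower[OF _ bdd, of z] that by (auto simp: y_def)
    moreover have "z \<le> u" using that yA by (auto simp: A_def)
    ultimately show ?thesis using that by (auto simp: A_def)
  qed
  have potb: "pot b < energy b v" using assms(1) by (simp add: energy_def)
  have b_y: "b < y" using yA potb by (cases "y = b") (auto simp: A_def)
  have "pot y = energy b v"
  proof (rule antisym)
    have lim: "(pot \<longlongrightarrow> pot y) (at_left y)"
      using continuous_pot[of UNIV] by (auto simp: continuous_on_def intro: tendsto_within_subset)
    have "eventually (\<lambda>z. pot z < energy b v) (at_left y)"
      using eventually_at_left_real[OF b_y] by (rule eventually_mono) (use before in auto)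
    then show "pot y \<le> energy b v"
      by (intro tendsto_upperbound[OF lim]) (auto elim!: eventually_mono)
  qed (use yA in \<open>auto simp: A_def\<close>)
  moreover have "y < u" using yA assms(3) calculation by (cases "y = u") (auto simp: A_def)
  ultimately show ?thesis
    using sol_turn[OF sol_flow, of b v y] ne[of y] b_y before assms(1) by auto
qed

lemma turn_left:
  assumes "v > 0" "l < b" "pot l > energy b v"
    and ne: "\<And>y. l < y \<Longrightarrow> y < b \<Longrightarrow> pot y = energy b v \<Longrightarrow> force y \<noteq> 0"
  shows "\<exists>t<0. vel b v t = 0 \<and> (\<forall>s. t < s \<and> s \<le> 0 \<longrightarrow> vel b v s > 0)"
proof -
  obtain t where t: "t > 0" "vel (- b) v t = 0" "\<And>s. 0 \<le> s \<and> s < t \<Longrightarrow> vel (- b) v s > 0"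
    using turn_right[of v "- b" "- l"] assms ne[of "- _"] by (force simp: minus_less_iff)
  then show ?thesis
    by (intro exI[of _ "- t"]) (auto simp: flow_mirror(2), metis add.inverse_inverse flow_mirror(2) minus_less_iff neg_0_le_iff_le)
qed

text \<open>The symmetry about the turning instant maps the initial state to the one with reversed
  velocity, later or earlier on the same orbit.\<close>

lemma orb_turn: "vel x v t = 0 \<Longrightarrow> orb x (- v) = orb x v"
  using sol_turn_symmetric[OF sol_flow, of x v t 0] orb_flow[of x v "2 * t"] by simp

lemma two_turns_period:
  assumes "vel x v s = 0" "vel x v s' = 0" "s < s'"
  shows "is_period (curve x v) (2 * (s' - s))"
  using sol_two_turns_periodic[OF sol_flow assms(1,2)] assms(3) by (simp add: is_period_def curve_def)

lemma periodic_orb: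
  assumes "is_period (curve x v) T" "v \<noteq> 0"
  shows "orb x v \<in> periodic_profiles h \<Omega> \<mu>"
  using assms trajectory_curve curve_constant_iff[of x v]
  by (auto simp: periodic_profiles_def orb_def)

lemma libration:
  assumes v: "v > 0" and lbu: "l < b" "b < u" "pot l > energy b v" "pot u > energy b v"
    and ne: "\<And>y. l < y \<Longrightarrow> y < u \<Longrightarrow> pot y = energy b v \<Longrightarrow> force y \<noteq> 0"
  shows "orb b v \<in> periodic_profiles h \<Omega> \<mu>" "orb b (- v) = orb b v"
proof -
  obtain t where t: "t > 0" "vel b v t = 0" using turn_right[of v b u] assms by auto
  obtain s where s: "s < 0" "vel b v s = 0" using turn_left[of v l b] assms by auto
  show "orb b v \<in> periodic_profiles h \<Omega> \<mu>"
    using periodic_orb[OF two_turns_period[OF s(2) t(2)]] s t v by auto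
  show "orb b (- v) = orb b v" by (rule orb_turn[OF t(2)])
qed

text \<open>Either the energy is too low for \<open>y\<close>, or \<open>y\<close> is an equilibrium
  at the height of the energy and uniqueness forbids reaching it in finite time.\<close>

lemma flow_avoids:
  assumes "energy x v < pot y \<or> (energy x v = pot y \<and> force y = 0 \<and> (v \<noteq> 0 \<or> force x \<noteq> 0))"
  shows "pos x v t \<noteq> y"
proof
  assume y: "pos x v t = y"
  have e: "(vel x v t)\<^sup>2 / 2 + pot y = energy x v"
    using flow_energy[of x v t] y by (simp add: energy_def)
  show False
  proof (cases "energy x v < pot y")
    case True
    then show False using e zero_le_power2[of "vel x v t"] by linarith
  next
    case False
    then have *: "energy x v = pot y" "force y = 0" "v \<noteq> 0 \<or> force x \<noteq> 0" using assms by auto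
    then have "vel x v t = 0" using e by simp
    then have "pos x v 0 = y" "vel x v 0 = 0"
      using sol_equilibrium[OF sol_flow, of x v t 0] y * by auto
    then show False using * by simp
  qed
qed

lemma flow_confined:
  assumes "l < x" "x < u" "\<And>t. pos x v t \<noteq> l" "\<And>t. pos x v t \<noteq> u"
  shows "l < pos x v t" "pos x v t < u"
proof -
  have conn: "connected (range (pos x v))"
    by (intro connected_continuous_image sol_cont[OF sol_flow]) auto
  have n: "l \<notin> range (pos x v)" "u \<notin> range (pos x v)" using assms(3,4) by auto
  have x: "x \<in> range (pos x v)" by (rule image_eqI[where x = 0]) auto
  have p: "pos x v t \<in> range (pos x v)" by auto
  show "l < pos x v t"
    using connectedD_interval[OF conn p x, of l] n assms(1) by force
  show "pos x v t < u"
    using connectedD_interval[OF conn x p, of u] n assms(2) by force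
qed

lemma vel_pos:
  assumes "v > 0" "\<And>t. vel x v t \<noteq> 0"
  shows "vel x v t > 0"
proof (rule ccontr)
  assume "\<not> vel x v t > 0"
  have conn: "connected (range (vel x v))"
    by (intro connected_continuous_image sol_cont[OF sol_flow]) auto
  have "v \<in> range (vel x v)" by (rule image_eqI[where x = 0]) auto
  then have "0 \<in> range (vel x v)"
    using connectedD_interval[OF conn, of "vel x v t" v 0] \<open>\<not> vel x v t > 0\<close> assms(1) by auto
  then show False using assms(2) by auto
qed

text \<open>A full turn restores the potential, hence the square of the speed, and the speed stays
  positive; so the state on the cylinder returns.\<close>

lemma rotation:
  assumes "v > 0" "\<And>z. pot z < energy x v"
  shows "vel x v t > 0"
    and "\<exists>T>0. pos x v T = x + 2 * pi \<and> is_period (curve x v) T"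
proof -
  show "vel x v t > 0" for t
  proof (rule vel_pos[OF assms(1)])
    show "vel x v s \<noteq> 0" for s
      using flow_energy[of x v s] assms(2)[of "pos x v s"] by (auto simp: energy_def)
  qed
  obtain T where T: "T \<ge> 0" "pos x v T = x + 2 * pi" "vel x v T > 0"
    using sol_reach[OF sol_flow, of x v "x + 2 * pi"] assms by auto
  have "pot (x + 2 * pi) = pot x" by (rule pot_cis) (simp flip: cis_mult)
  then have "(vel x v T)\<^sup>2 = v\<^sup>2" using flow_energy[of x v T] T(2) by (simp add: energy_def)
  then have "vel x v T = v" using T(3) assms(1) by (simp add: power2_eq_iff_nonneg)
  then have "curve x v T = (cis x, v)" using T(2) by (simp add: curve_def flip: cis_mult)
  then have "curve x v (t + T) = curve x v t" for t by (rule curve_shift)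
  moreover have "T > 0" using T by (cases "T = 0") auto
  ultimately show "\<exists>T>0. pos x v T = x + 2 * pi \<and> is_period (curve x v) T"
    using T by (auto simp: is_period_def)
qed

lemma limit_right:
  assumes "v > 0" "b < y" "\<And>x. b \<le> x \<Longrightarrow> x < y \<Longrightarrow> pot x < energy b v" "pot y = energy b v" "force y = 0"
  shows "(curve b v \<longlongrightarrow> (cis y, 0)) at_top"
proof -
  have "(pos b v \<longlongrightarrow> y) at_top" "(vel b v \<longlongrightarrow> 0) at_top"
    using sol_limit[OF sol_flow, of b v y] assms by auto
  then show ?thesis
    unfolding curve_def[abs_def] cis_conv_exp by (intro tendsto_intros)
qed

lemma limit_left:
  assumes "v > 0" "y < b" "\<And>x. y < x \<Longrightarrow> x \<le> b \<Longrightarrow> pot x < energy b v" "pot y = energy b v" "force y = 0"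
  shows "(curve b v \<longlongrightarrow> (cis y, 0)) at_bot"
proof -
  have l: "(pos (- b) v \<longlongrightarrow> - y) at_top" "(vel (- b) v \<longlongrightarrow> 0) at_top"
  proof -
    have "pot x < energy (- b) v" if "- b \<le> x" "x < - y" for x
      using assms(3)[of "- x"] that by simp
    then show "(pos (- b) v \<longlongrightarrow> - y) at_top" "(vel (- b) v \<longlongrightarrow> 0) at_top"
      using sol_limit[OF sol_flow, of "- b" v "- y"] assms by auto
  qed
  have "((\<lambda>t. (cis (- pos (- b) v t), vel (- b) v t)) \<longlongrightarrow> (cis (- (- y)), 0)) at_top"
    unfolding cis_conv_exp by (intro tendsto_intros l)
  then show ?thesis
    unfolding filterlim_at_bot_mirror by (simp add: curve_def flow_mirror)
qed

text \<open>Meant for homoclinic orbits that turn: the symmetry about the turning instant carries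
  the limit in the future over to the past.\<close>

lemma limit_turn:
  assumes "vel x v s = 0" "(curve x v \<longlongrightarrow> (z, 0)) at_top"
  shows "(curve x v \<longlongrightarrow> (z, 0)) at_bot"
proof -
  have eq: "curve x v (- t) = (fst (curve x v (t + 2 * s)), - snd (curve x v (t + 2 * s)))" for t
    using sol_turn_symmetric[OF sol_flow assms(1), of "- t"] by (simp add: curve_def algebra_simps)
  have "filterlim (\<lambda>t. t + 2 * s) at_top at_top"
    using filterlim_tendsto_add_at_top[OF tendsto_const filterlim_ident, of "2 * s"] by (simp add: add.commute)
  from filterlim_compose[OF assms(2) this]
  have l: "((\<lambda>t. curve x v (t + 2 * s)) \<longlongrightarrow> (z, 0)) at_top" by simp
  have "((\<lambda>t. curve x v (- t)) \<longlongrightarrow> (fst (z, 0::real), - snd (z, 0::real))) at_top"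
    unfolding eq by (intro tendsto_Pair tendsto_minus tendsto_fst tendsto_snd l)
  then show ?thesis by (simp add: filterlim_at_bot_mirror)
qed

lemma limits_reverse:
  assumes "(curve x v \<longlongrightarrow> (z, 0)) at_top"
  shows "(curve x (- v) \<longlongrightarrow> (z, 0)) at_bot"
proof -
  have "curve x (- v) (- t) = (fst (curve x v t), - snd (curve x v t))" for t
    by (simp add: curve_reverse case_prod_beta)
  moreover have "((\<lambda>t. (fst (curve x v t), - snd (curve x v t))) \<longlongrightarrow> (fst (z, 0::real), - snd (z, 0::real))) at_top"
    by (intro tendsto_Pair tendsto_minus tendsto_fst tendsto_snd assms)
  ultimately show ?thesis by (simp add: filterlim_at_bot_mirror)
qed

lemma limits_reverse':
  assumes "(curve x v \<longlongrightarrow> (z, 0)) at_bot"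
  shows "(curve x (- v) \<longlongrightarrow> (z, 0)) at_top"
proof -
  have "curve x (- v) = (\<lambda>t. (fst (curve x v (- t)), - snd (curve x v (- t))))"
    by (rule ext) (simp add: curve_reverse case_prod_beta)
  moreover have "((\<lambda>t. (fst (curve x v (- t)), - snd (curve x v (- t)))) \<longlongrightarrow> (fst (z, 0::real), - snd (z, 0::real))) at_top"
    by (intro tendsto_Pair tendsto_minus tendsto_fst tendsto_snd assms[unfolded filterlim_at_bot_mirror])
  ultimately show ?thesis by simp
qed

definition joins :: "real \<Rightarrow> real \<Rightarrow> cyl \<Rightarrow> cyl \<Rightarrow> bool" where
  "joins x v P Q \<longleftrightarrow> (curve x v \<longlongrightarrow> P) at_bot \<and> (curve x v \<longlongrightarrow> Q) at_top"

lemma joins_unique: "joins x v P Q \<Longrightarrow> joins x v P' Q' \<Longrightarrow> P = P' \<and> Q = Q'"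
  unfolding joins_def by (meson tendsto_unique trivial_limit_at_bot_linorder trivial_limit_at_top_linorder)

lemma orb_connection_iff:
  "orb x v \<in> connections h \<Omega> \<mu> P Q \<longleftrightarrow> (v \<noteq> 0 \<or> force x \<noteq> 0) \<and> joins x v P Q"
proof
  assume "orb x v \<in> connections h \<Omega> \<mu> P Q"
  then obtain \<gamma> where \<gamma>: "trajectory h \<Omega> \<mu> \<gamma>" "range \<gamma> = orb x v" "\<not> \<gamma> constant_on UNIV"
    "(\<gamma> \<longlongrightarrow> P) at_bot" "(\<gamma> \<longlongrightarrow> Q) at_top" by (auto simp: connections_def)
  obtain s where s: "\<gamma> = (\<lambda>t. curve x v (t + s))" using trajectory_orb[OF \<gamma>(1,2)] by blast
  have c: "curve x v = (\<lambda>t. \<gamma> (t + - s))" by (simp add: s)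
  have "filterlim (\<lambda>t. t + - s) at_top at_top" "filterlim (\<lambda>t. t + - s) at_bot at_bot"
    using filterlim_tendsto_add_at_top_iff[of "\<lambda>_. - s" "- s" at_top "\<lambda>x. x"]
      filterlim_tendsto_add_at_bot_iff[of "\<lambda>_. - s" "- s" at_bot "\<lambda>x. x"]
    by (simp_all add: add.commute filterlim_ident)
  then have "joins x v P Q"
    unfolding joins_def c using filterlim_compose[OF \<gamma>(4)] filterlim_compose[OF \<gamma>(5)] by auto
  moreover have "\<not> curve x v constant_on UNIV" using \<gamma>(3) by (auto simp: s constant_on_def)
  ultimately show "(v \<noteq> 0 \<or> force x \<noteq> 0) \<and> joins x v P Q" by (auto simp: curve_constant_iff)
next
  assume *: "(v \<noteq> 0 \<or> force x \<noteq> 0) \<and> joins x v P Q"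
  then show "orb x v \<in> connections h \<Omega> \<mu> P Q"
    unfolding connections_def orb_def
    using trajectory_curve[of x v] curve_constant_iff[of x v] by (auto simp: joins_def)
qed

lemma connection_is_orb:
  assumes "S \<in> connections h \<Omega> \<mu> P Q"
  obtains x v where "S = orb x v" "v \<noteq> 0 \<or> force x \<noteq> 0"
proof -
  have "S \<in> profiles h \<Omega> \<mu>" using assms by (auto simp: connections_def profiles_def)
  then obtain x v where "S = orb x v" by (auto simp: profiles_eq)
  then show thesis using that assms orb_connection_iff by blast
qed

text \<open>Sampled at multiples of the period, the state is a constant sequence that tends to
  \<open>Q\<close>; so every state would equal \<open>Q\<close>.\<close>

lemma joins_not_periodic:
  assumes "joins x v P Q" "v \<noteq> 0 \<or> force x \<noteq> 0"
  shows "orb x v \<notin> periodic_profiles h \<Omega> \<mu>"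
proof
  assume "orb x v \<in> periodic_profiles h \<Omega> \<mu>"
  then obtain \<gamma> T where \<gamma>: "trajectory h \<Omega> \<mu> \<gamma>" "range \<gamma> = orb x v" "is_period \<gamma> T"
    by (auto simp: periodic_profiles_def)
  obtain s where s: "\<gamma> = (\<lambda>t. curve x v (t + s))" using trajectory_orb[OF \<gamma>(1,2)] by blast
  have T: "T > 0" and per: "curve x v (t + T) = curve x v t" for t
  proof -
    show "T > 0" using \<gamma>(3) by (simp add: is_period_def)
    have "\<gamma> (t - s + T) = \<gamma> (t - s)" using \<gamma>(3) by (simp add: is_period_def)
    then show "curve x v (t + T) = curve x v t" by (simp add: s algebra_simps)
  qed
  have per_n: "curve x v (t + real n * T) = curve x v t" for t n
  proof (induction n)
    case (Suc n)
    have "curve x v (t + real (Suc n) * T) = curve x v ((t + real n * T) + T)"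
      by (simp add: algebra_simps)
    then show ?case using Suc per by simp
  qed simp
  have "curve x v t = Q" for t
  proof -
    have "filterlim (\<lambda>n. t + real n * T) at_top sequentially"
      using T by (intro filterlim_tendsto_add_at_top[OF tendsto_const]
          filterlim_at_top_mult_tendsto_pos[OF tendsto_const _ filterlim_real_sequentially])
    then have "(\<lambda>n. curve x v (t + real n * T)) \<longlonglongrightarrow> Q"
      using assms(1) filterlim_compose[of "curve x v" "nhds Q" at_top] unfolding joins_def by blast
    then show ?thesis by (simp add: per_n LIMSEQ_const_iff)
  qed
  then have "curve x v constant_on UNIV" by (auto simp: constant_on_def)
  then show False using assms(2) by (simp add: curve_constant_iff)
qed

lemma connection_not_periodic: "S \<in> connections h \<Omega> \<mu> P Q \<Longrightarrow> S \<notin> periodic_profiles h \<Omega> \<mu>"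
  by (metis connection_is_orb joins_not_periodic orb_connection_iff)

end

subsection \<open>One-parameter families of orbits\<close>

text \<open>An increasing bijection of the open unit interval onto the half-line above
  \<open>a\<close>; its unbounded end is at 1, where \<open>semi_unbounded_curve\<close> expects
  it.\<close>

definition ray :: "real \<Rightarrow> real \<Rightarrow> real" where
  "ray a r = a + r / (1 - r)"

lemma ray_mono: "0 < r \<Longrightarrow> r < s \<Longrightarrow> s < 1 \<Longrightarrow> ray a r < ray a s"
  by (simp add: ray_def frac_less)

lemma ray_gt: "0 < r \<Longrightarrow> r < 1 \<Longrightarrow> a < ray a r"
  by (simp add: ray_def)

lemma inj_on_ray: "inj_on (ray a) {0<..<1}"
  by (intro linorder_inj_onI') (metis greaterThanLessThan_iff less_irrefl ray_mono)

lemma continuous_on_ray: "continuous_on {0<..<1} (ray a)"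
  unfolding ray_def by (intro continuous_intros) auto

lemma ray_image: "ray a ` {0<..<1} = {a<..}"
proof (intro equalityI subsetI)
  fix y assume "y \<in> {a<..}"
  then have y: "y - a > 0" by simp
  define r where "r = (y - a) / (1 + (y - a))"
  have "r \<in> {0<..<1}" "y = ray a r" using y by (auto simp: r_def ray_def field_simps)
  then show "y \<in> ray a ` {0<..<1}" by blast
qed (auto simp: ray_gt)

lemma scale_image: "0 < K \<Longrightarrow> (\<lambda>r. K * r) ` {0<..<1} = {0<..<K}" for K :: real
proof (intro equalityI subsetI)
  fix y assume "0 < K" "y \<in> {0<..<K}"
  then have "y / K \<in> {0<..<1}" "y = K * (y / K)" by auto
  then show "y \<in> (\<lambda>r. K * r) ` {0<..<1}" by blast
qed auto

lemma cis_eq_close: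
  assumes "cis x = cis y" "\<bar>x - y\<bar> < 2 * pi"
  shows "x = y"
proof -
  have "cos (x - y) = 1"
    using assms(1) by (metis cis_divide cis_neq_zero divide_self_if one_complex.simps(1) cis.simps(1))
  then obtain n :: int where n: "x - y = of_int n * (2 * pi)"
    using cos_one_2pi_int by (metis mult.commute mult.left_commute)
  then have "\<bar>real_of_int n\<bar> * (2 * pi) < 1 * (2 * pi)" using assms(2) by (simp add: abs_mult)
  then have "\<bar>real_of_int n\<bar> < 1" using mult_less_cancel_right_pos[of "2 * pi"] pi_gt_zero by simp
  then have "n = 0" by linarith
  then show ?thesis using n by simp
qed

lemma cis_representative: "\<exists>y. a \<le> y \<and> y < a + 2 * pi \<and> cis y = cis x"
proof -
  define n where "n = \<lfloor>(x - a) / (2 * pi)\<rfloor>"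
  have n: "of_int n * (2 * pi) \<le> x - a" "x - a < (of_int n + 1) * (2 * pi)"
    using pi_gt_zero floor_divide_lower[of "2 * pi" "x - a"] floor_divide_upper[of "2 * pi" "x - a"]
    unfolding n_def by auto
  have "cis (x - 2 * pi * of_int n) = cis x"
    by (simp add: complex_eq_iff cos_diff sin_diff)
  then show ?thesis using n by (intro exI[of _ "x - 2 * pi * of_int n"]) (auto simp: algebra_simps)
qed

context profile_ode
begin

lemma pot_bound: "\<bar>pot x\<bar> \<le> \<bar>h - \<Omega>\<bar> + \<bar>\<mu>\<bar>"
proof -
  have c: "\<bar>cos x\<bar> \<le> 1" "(cos x)\<^sup>2 \<le> 1" by (auto simp: abs_square_le_1)
  have "\<bar>pot x\<bar> \<le> \<bar>h - \<Omega>\<bar> * \<bar>cos x\<bar> + \<bar>\<mu>\<bar> / 2 * (cos x)\<^sup>2"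
    unfolding pot_def by (rule order_trans[OF abs_triangle_ineq4]) (simp add: abs_mult)
  also have "\<dots> \<le> \<bar>h - \<Omega>\<bar> * 1 + \<bar>\<mu>\<bar> / 2 * 1"
    using c by (intro add_mono mult_left_mono) auto
  finally show ?thesis by simp
qed

text \<open>Energy conservation: the potential varies by at most twice its bound, and the
  denominator of the kinetic term doubles this to the factor 4.\<close>

lemma orb_speed_bound:
  assumes "(z, p) \<in> orb x v" "\<bar>v\<bar> \<le> M"
  shows "cmod z = 1" "p\<^sup>2 \<le> M\<^sup>2 + 4 * (\<bar>h - \<Omega>\<bar> + \<bar>\<mu>\<bar>)"
proof -
  obtain t where t: "z = cis (pos x v t)" "p = vel x v t" using assms(1) by (auto simp: orb_def curve_def)
  show "cmod z = 1" by (simp add: t)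
  have "p\<^sup>2 / 2 + pot (pos x v t) = v\<^sup>2 / 2 + pot x"
    using flow_energy[of x v t] by (simp add: energy_def t)
  moreover have "v\<^sup>2 \<le> M\<^sup>2" using assms(2) by (meson abs_ge_self abs_le_square_iff order_trans)
  ultimately show "p\<^sup>2 \<le> M\<^sup>2 + 4 * (\<bar>h - \<Omega>\<bar> + \<bar>\<mu>\<bar>)"
    using abs_le_D1[OF pot_bound[of x]] abs_le_D2[OF pot_bound[of "pos x v t"]]
    by (simp add: field_simps)
qed

lemma bounded_orbs:
  assumes "\<And>r. r \<in> A \<Longrightarrow> \<bar>g r\<bar> \<le> M"
  shows "bounded (\<Union>r\<in>A. orb b (g r))"
proof -
  define C where "C = M\<^sup>2 + 4 * (\<bar>h - \<Omega>\<bar> + \<bar>\<mu>\<bar>)"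
  have "norm X \<le> 1 + sqrt C" if X: "X \<in> (\<Union>r\<in>A. orb b (g r))" for X
  proof -
    obtain r where r: "r \<in> A" "X \<in> orb b (g r)" using X by blast
    then have r2: "(fst X, snd X) \<in> orb b (g r)" by simp
    note * = orb_speed_bound[OF r2 assms[OF r(1)]]
    have "\<bar>snd X\<bar> \<le> sqrt C" using *(2) by (intro real_le_rsqrt) (simp add: C_def)
    moreover have "norm X \<le> norm (fst X) + norm (snd X)" by (metis norm_Pair_le prod.collapse)
    ultimately show ?thesis using *(1) by simp
  qed
  then show ?thesis by (meson boundedI)
qed

text \<open>Equal orbits have equal energy, so at a common position the speeds agree up to
  sign.\<close>

lemma orb_inj: "orb b q = orb b q' \<Longrightarrow> 0 \<le> q * q' \<Longrightarrow> q = q'"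
proof -
  assume *: "orb b q = orb b q'" "0 \<le> q * q'"
  have "q\<^sup>2 = q'\<^sup>2" using orb_eq_energy[OF *(1)] by (simp add: energy_def)
  then have "q = q' \<or> q = - q'" by (rule power2_eq_iff[THEN iffD1])
  then show "q = q'" using *(2) by (auto simp: mult_le_0_iff power2_eq_square[symmetric])
qed

lemma periodic_curve_orb:
  assumes per: "\<And>r. 0 < r \<Longrightarrow> r < 1 \<Longrightarrow> orb b (g r) \<in> periodic_profiles h \<Omega> \<mu>"
    and cont: "continuous_on {0<..<1} g" and inj: "inj_on g {0<..<1}"
    and sgn: "\<And>r s. 0 < r \<Longrightarrow> r < 1 \<Longrightarrow> 0 < s \<Longrightarrow> s < 1 \<Longrightarrow> 0 \<le> g r * g s"
  shows "periodic_curve h \<Omega> \<mu> (\<lambda>r. orb b (g r))"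
proof -
  have "inj_on (\<lambda>r. orb b (g r)) {0<..<1}"
  proof (rule inj_onI)
    fix r s assume rs: "r \<in> {0<..<1}" "s \<in> {0<..<1}" "orb b (g r) = orb b (g s)"
    then have "g r = g s" using orb_inj[OF rs(3)] sgn by auto
    then show "r = s" using inj rs by (auto dest: inj_onD)
  qed
  moreover have "\<exists>c. continuous_on {0<..<1} c \<and> (\<forall>r\<in>{0<..<1}. c r \<in> orb b (g r))"
    by (rule exI[of _ "\<lambda>r. (cis b, g r)"]) (auto intro!: continuous_intros cont orb_mem)
  ultimately show ?thesis using per by (simp add: periodic_curve_def)
qed

text \<open>Families start at the angle \<open>b\<close> with speeds below or above a critical value
  \<open>K\<close>. A libration contains both \<open>q\<close> and \<open>- q\<close>, a rotation
  only one of them, so one bounded family stands against two unbounded ones.\<close>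

definition librations :: "real \<Rightarrow> real \<Rightarrow> real \<Rightarrow> cyl set" where
  "librations b K r = orb b (K * r)"

definition rotations_up :: "real \<Rightarrow> real \<Rightarrow> real \<Rightarrow> cyl set" where
  "rotations_up b K r = orb b (ray K r)"

definition rotations_down :: "real \<Rightarrow> real \<Rightarrow> real \<Rightarrow> cyl set" where
  "rotations_down b K r = orb b (- ray K r)"

lemma librations_image:
  assumes "K > 0"
  shows "librations b K ` {0<..<1} = orb b ` {0<..<K}"
  using arg_cong[OF scale_image[OF assms], of "image (orb b)"] by (simp add: librations_def image_image)

lemma rotations_up_image: "rotations_up b K ` {0<..<1} = orb b ` {K<..}"
proof -
  have "rotations_up b K ` {0<..<1} = orb b ` ray K ` {0<..<1}" by (simp add: rotations_up_def image_image)
  then show ?thesis by (simp only: ray_image)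
qed

lemma rotations_down_image: "rotations_down b K ` {0<..<1} = (\<lambda>q. orb b (- q)) ` {K<..}"
proof -
  have "rotations_down b K ` {0<..<1} = (\<lambda>q. orb b (- q)) ` ray K ` {0<..<1}" by (simp add: rotations_down_def image_image)
  then show ?thesis by (simp only: ray_image)
qed

lemma librations_curve:
  assumes "K > 0" "\<And>q. 0 < q \<Longrightarrow> q < K \<Longrightarrow> orb b q \<in> periodic_profiles h \<Omega> \<mu>"
  shows "periodic_curve h \<Omega> \<mu> (librations b K)" "bounded_curve (librations b K)"
proof -
  show "periodic_curve h \<Omega> \<mu> (librations b K)" unfolding librations_def[abs_def]
    by (rule periodic_curve_orb) (use assms in \<open>auto intro!: continuous_intros inj_onI\<close>)
  show "bounded_curve (librations b K)" unfolding bounded_curve_def librations_def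
    by (rule bounded_orbs[of _ _ K]) (use assms in \<open>auto simp: abs_mult\<close>)
qed

lemma not_bounded_speeds:
  fixes S :: "cyl set"
  assumes "\<And>N. \<exists>X\<in>S. \<bar>snd X\<bar> > N"
  shows "\<not> bounded (snd ` S)" "\<not> bounded S"
proof -
  show *: "\<not> bounded (snd ` S)"
    using assms by (auto simp: bounded_iff not_le[symmetric])
  show "\<not> bounded S" using * bounded_snd by blast
qed

lemma semi_unbounded_orbs:
  assumes K: "K \<ge> 0" and g: "\<And>r. 0 < r \<Longrightarrow> r < 1 \<Longrightarrow> \<bar>g r\<bar> = ray K r"
  shows "semi_unbounded_curve (\<lambda>r. orb b (g r))" "\<not> bounded (snd ` (\<Union>r\<in>{0<..<1}. orb b (g r)))"
proof -
  have large: "\<exists>X\<in>(\<Union>r\<in>{r0..<1}. orb b (g r)). \<bar>snd X\<bar> > N" if r0: "0 < r0" "r0 < 1" for r0 N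
  proof -
    have "ray K r0 > K" using r0 ray_gt by blast
    \<comment> \<open>A speed above both \<open>N\<close> and the one at \<open>r0\<close>;
      monotonicity of \<open>ray\<close> puts its parameter beyond \<open>r0\<close>.\<close>
    then have "max N (ray K r0) + 1 \<in> ray K ` {0<..<1}" unfolding ray_image by auto
    then obtain r where r: "0 < r" "r < 1" "ray K r = max N (ray K r0) + 1" by auto
    have "r0 \<le> r"
    proof (rule ccontr)
      assume "\<not> r0 \<le> r"
      then have "ray K r < ray K r0" using ray_mono[of r r0 K] r r0 by simp
      then show False using r by simp
    qed
    moreover have "\<bar>snd (cis b, g r)\<bar> > N" using g[OF r(1,2)] r(3) by simp
    moreover have "(cis b, g r) \<in> orb b (g r)" by (rule orb_mem)
    ultimately show ?thesis using r
      by (intro bexI[of _ "(cis b, g r)"]) (simp, metis UN_I atLeastLessThan_iff)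
  qed
  have "bounded (\<Union>r\<in>{0<..r0}. orb b (g r))" if r0: "0 < r0" "r0 < 1" for r0
  proof (rule bounded_orbs[of _ _ "ray K r0"])
    fix r assume "r \<in> {0<..r0}"
    then show "\<bar>g r\<bar> \<le> ray K r0"
      using ray_mono[of r r0 K] r0 g[of r] by (cases "r = r0") auto
  qed
  then show "semi_unbounded_curve (\<lambda>r. orb b (g r))"
    using not_bounded_speeds(2) large by (simp add: semi_unbounded_curve_def)
  have "\<not> bounded (snd ` (\<Union>r\<in>{1/2..<1}. orb b (g r)))"
    by (rule not_bounded_speeds(1)) (use large[of "1/2"] in auto)
  moreover have "snd ` (\<Union>r\<in>{1/2..<1}. orb b (g r)) \<subseteq> snd ` (\<Union>r\<in>{0<..<1}. orb b (g r))"
    by (intro image_mono UN_mono) auto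
  ultimately show "\<not> bounded (snd ` (\<Union>r\<in>{0<..<1}. orb b (g r)))"
    using bounded_subset by blast
qed

lemma rotations_up_curve:
  assumes K: "K > 0" and sup: "\<And>q z. K < q \<Longrightarrow> pot z < energy b q"
  shows "periodic_curve h \<Omega> \<mu> (rotations_up b K)" "periodic_curve h \<Omega> \<mu> (rotations_down b K)"
    "semi_unbounded_curve (rotations_up b K)" "semi_unbounded_curve (rotations_down b K)"
    "\<not> bounded (snd ` (\<Union>r\<in>{0<..<1}. rotations_up b K r))" "\<not> bounded (snd ` (\<Union>r\<in>{0<..<1}. rotations_down b K r))"
proof -
  have per: "is_period (curve b q) T \<Longrightarrow> is_period (curve b (- q)) T" for q T
    unfolding is_period_def curve_reverse
    by (metis (no_types, lifting) add_uminus_conv_diff diff_add_cancel minus_add_distrib)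
  have p: "orb b (ray K r) \<in> periodic_profiles h \<Omega> \<mu>" "orb b (- ray K r) \<in> periodic_profiles h \<Omega> \<mu>"
    if r: "0 < r" "r < 1" for r
  proof -
    have q: "ray K r > K" "ray K r > 0" using ray_gt[OF r, of K] K by auto
    obtain T where "is_period (curve b (ray K r)) T" using rotation(2)[OF q(2) sup[OF q(1)]] by blast
    then show "orb b (ray K r) \<in> periodic_profiles h \<Omega> \<mu>" "orb b (- ray K r) \<in> periodic_profiles h \<Omega> \<mu>"
      using q per by (auto intro!: periodic_orb)
  qed
  have pos: "0 < ray K r" if "0 < r" "r < 1" for r using ray_gt[OF that, of K] K by auto
  show "periodic_curve h \<Omega> \<mu> (rotations_up b K)" unfolding rotations_up_def[abs_def]
    by (rule periodic_curve_orb)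
      (use p pos in \<open>auto intro!: continuous_on_ray inj_on_ray mult_nonneg_nonneg intro: less_imp_le\<close>)
  show "periodic_curve h \<Omega> \<mu> (rotations_down b K)" unfolding rotations_down_def[abs_def]
    by (rule periodic_curve_orb)
      (use p pos inj_on_ray[of K] in \<open>auto intro!: continuous_on_minus continuous_on_ray mult_nonneg_nonneg
        intro: less_imp_le simp: inj_on_def\<close>)
  show "semi_unbounded_curve (rotations_up b K)" "\<not> bounded (snd ` (\<Union>r\<in>{0<..<1}. rotations_up b K r))"
    unfolding rotations_up_def[abs_def] by (rule semi_unbounded_orbs[of K]; use K pos in force)+
  show "semi_unbounded_curve (rotations_down b K)" "\<not> bounded (snd ` (\<Union>r\<in>{0<..<1}. rotations_down b K r))"
    unfolding rotations_down_def[abs_def] by (rule semi_unbounded_orbs[of K]; use K pos in force)+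
qed

text \<open>The velocity on a rotation never vanishes and hence keeps its sign.\<close>

lemma rotations_up_disjoint:
  assumes K: "K > 0" and sup: "\<And>q z. K < q \<Longrightarrow> pot z < energy b q"
  shows "rotations_up b K ` {0<..<1} \<inter> rotations_down b K ` {0<..<1} = {}"
proof -
  have "orb b q \<noteq> orb b (- q')" if "K < q" "K < q'" for q q'
  proof
    assume "orb b q = orb b (- q')"
    then have "(cis b, - q') \<in> orb b q" using orb_mem by simp
    then obtain t where "vel b q t = - q'" by (auto simp: orb_def curve_def)
    then show False using rotation(1)[of q b t] K sup that by auto
  qed
  then show ?thesis unfolding rotations_up_image rotations_down_image by auto
qed

lemma orb_images_disjoint:
  assumes "\<And>q q'. q \<in> A \<Longrightarrow> q' \<in> B \<Longrightarrow> energy b q \<noteq> energy b' q'"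
  shows "orb b ` A \<inter> orb b' ` B = {}" "orb b ` A \<inter> (\<lambda>q. orb b' (- q)) ` B = {}"
proof -
  have "orb b q \<noteq> orb b' q'" "orb b q \<noteq> orb b' (- q')" if "q \<in> A" "q' \<in> B" for q q'
    using assms[OF that] orb_eq_energy[of b q b' q'] orb_eq_energy[of b q b' "- q'"] by auto
  then show "orb b ` A \<inter> orb b' ` B = {}" "orb b ` A \<inter> (\<lambda>q. orb b' (- q)) ` B = {}" by blast+
qed

text \<open>Connections are not periodic. So once the listed orbits cover all nonequilibria, neither
  a further periodic profile nor a further connection can exist, and both sets follow from the
  cover.\<close>

lemma phase_portrait_intro:
  assumes E: "equilibria h \<Omega> \<mu> = E"
    and cover: "\<And>x v. v \<noteq> 0 \<or> force x \<noteq> 0 \<Longrightarrow> orb x v \<in> C \<union> (\<Union>F\<in>set (Bs @ Us). F ` {0<..<1})"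
    and C: "\<And>S. S \<in> C \<Longrightarrow> \<exists>P Q. S \<in> connections h \<Omega> \<mu> P Q"
    and per: "\<And>F. F \<in> set (Bs @ Us) \<Longrightarrow> periodic_curve h \<Omega> \<mu> F"
    and bd: "\<And>F. F \<in> set Bs \<Longrightarrow> bounded_curve F"
    and ub: "\<And>F. F \<in> set Us \<Longrightarrow> semi_unbounded_curve F"
    and disj: "sorted_wrt (\<lambda>F G. F ` {0<..<1} \<inter> G ` {0<..<1} = {}) (Bs @ Us)"
  shows "phase_portrait h \<Omega> \<mu> E C Bs Us"
    and "connections h \<Omega> \<mu> P Q = {S \<in> C. S \<in> connections h \<Omega> \<mu> P Q}"
proof -
  define L where "L = (\<Union>F\<in>set (Bs @ Us). F ` {0<..<1})"
  have L: "L \<subseteq> periodic_profiles h \<Omega> \<mu>" using per by (fastforce simp: L_def periodic_curve_def)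
  have noneq: "\<exists>x v. S = orb x v \<and> (v \<noteq> 0 \<or> force x \<noteq> 0)" if S: "S \<in> periodic_profiles h \<Omega> \<mu>" for S
  proof -
    obtain \<gamma> where \<gamma>: "trajectory h \<Omega> \<mu> \<gamma>" "S = range \<gamma>" "\<not> \<gamma> constant_on UNIV"
      using S by (auto simp: periodic_profiles_def)
    obtain x v where "\<And>t. \<gamma> (t + 0) = curve x v t" using trajectory_start[OF \<gamma>(1)] by blast
    then have "\<gamma> = curve x v" by auto
    then show ?thesis using \<gamma> curve_constant_iff by (auto simp: orb_def)
  qed
  have cov: "orb x v \<in> C \<union> L" if "v \<noteq> 0 \<or> force x \<noteq> 0" for x v
    unfolding L_def by (rule cover[OF that])
  have perL: "periodic_profiles h \<Omega> \<mu> = L"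
  proof (intro equalityI subsetI)
    fix S assume S: "S \<in> periodic_profiles h \<Omega> \<mu>"
    then have "S \<in> C \<union> L" using noneq[OF S] cov by metis
    moreover have "S \<notin> C" using C[of S] S connection_not_periodic by metis
    ultimately show "S \<in> L" by simp
  qed (use L in auto)
  have "profiles h \<Omega> \<mu> = (\<lambda>P. {P}) ` E \<union> C \<union> L"
  proof (intro equalityI subsetI)
    fix S assume "S \<in> profiles h \<Omega> \<mu>"
    then obtain x v where S: "S = orb x v" by (auto simp: profiles_eq)
    show "S \<in> (\<lambda>P. {P}) ` E \<union> C \<union> L"
    proof (cases "v \<noteq> 0 \<or> force x \<noteq> 0")
      case True
      then show ?thesis using cov[OF True] S by simp
    next
      case False
      then have "S = {(cis x, 0)}" "(cis x, 0) \<in> E"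
        using S orb_equilibrium[of x] E[symmetric] by (auto simp: equilibria_eq)
      then show ?thesis by blast
    qed
  next
    fix S assume "S \<in> (\<lambda>P. {P}) ` E \<union> C \<union> L"
    then consider "S \<in> (\<lambda>P. {P}) ` E" | "S \<in> C" | "S \<in> L" by blast
    then show "S \<in> profiles h \<Omega> \<mu>"
    proof cases
      case 1
      then obtain x where "S = {(cis x, 0)}" "force x = 0" by (auto simp: E[symmetric] equilibria_eq)
      then have "S = orb x 0" using orb_equilibrium by simp
      then show ?thesis by (auto simp: profiles_eq)
    next
      case 2
      then obtain P Q where "S \<in> connections h \<Omega> \<mu> P Q" using C by metis
      then show ?thesis by (auto simp: connections_def profiles_def)
    next
      case 3
      then have "S \<in> periodic_profiles h \<Omega> \<mu>" using L by auto
      then show ?thesis by (auto simp: periodic_profiles_def profiles_def)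
    qed
  qed
  then show "phase_portrait h \<Omega> \<mu> E C Bs Us"
    unfolding phase_portrait_def using E per bd ub disj perL by (simp add: L_def)
  show "connections h \<Omega> \<mu> P Q = {S \<in> C. S \<in> connections h \<Omega> \<mu> P Q}"
  proof (intro equalityI subsetI)
    fix S assume S: "S \<in> connections h \<Omega> \<mu> P Q"
    obtain x v where "S = orb x v" "v \<noteq> 0 \<or> force x \<noteq> 0" using connection_is_orb[OF S] by metis
    then have "S \<in> C \<union> L" using cov by simp
    then show "S \<in> {S \<in> C. S \<in> connections h \<Omega> \<mu> P Q}"
      using S connection_not_periodic[OF S] L by auto
  qed auto
qed

subsection \<open>Potential wells\<close>

text \<open>A potential well with bottom \<open>b\<close> between the barriers \<open>l\<close> and
  \<open>u\<close>. Signs of the force are prescribed, rather than heights, because they also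
  exclude equilibria other than the bottom strictly inside.\<close>

definition well :: "real \<Rightarrow> real \<Rightarrow> real \<Rightarrow> bool" where
  "well l b u \<longleftrightarrow> l < b \<and> b < u \<and> (\<forall>z. l < z \<and> z < b \<longrightarrow> force z > 0) \<and> (\<forall>z. b < z \<and> z < u \<longrightarrow> force z < 0)"

lemma well_less: "well l b u \<Longrightarrow> l < b \<and> b < u"
  by (simp add: well_def)

lemma well_pot_left: "well l b u \<Longrightarrow> l < z \<Longrightarrow> z \<le> b \<Longrightarrow> pot z < pot l"
  by (rule pot_less_of_force_pos) (auto simp: well_def)

lemma well_pot_right: "well l b u \<Longrightarrow> b \<le> z \<Longrightarrow> z < u \<Longrightarrow> pot z < pot u"
  by (rule pot_less_of_force_neg) (auto simp: well_def)

lemma well_pot_inside: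
  assumes "well l b u" "l < z" "z < u" "pot l \<le> E" "pot u \<le> E"
  shows "pot z < E"
  using well_pot_left[OF assms(1,2)] well_pot_right[OF assms(1) _ assms(3)] assms(4,5)
  by (cases "z \<le> b") auto

lemma well_orb:
  assumes "well l b u" "l \<le> x" "x \<le> u" "v \<noteq> 0 \<or> force x \<noteq> 0" "force l = 0" "force b = 0" "force u = 0"
  shows "\<exists>q. q \<noteq> 0 \<and> orb x v = orb b q"
proof (rule orb_well[of l b u])
  show "v \<noteq> 0 \<or> l < x \<and> x < u \<and> x \<noteq> b" using assms by (cases "x = l"; cases "x = u") auto
qed (use assms in \<open>auto simp: well_def\<close>)

lemma well_libration:
  assumes w: "well l b u" and v: "0 < v" and e: "energy b v < pot l" "energy b v < pot u"
  shows "orb b v \<in> periodic_profiles h \<Omega> \<mu>" "orb b (- v) = orb b v"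
proof -
  have ne: "force y \<noteq> 0" if y: "l < y" "y < u" "pot y = energy b v" for y
  proof -
    have "y \<noteq> b" using y v by (auto simp: energy_def)
    then show ?thesis using w y by (cases "y < b") (force simp: well_def)+
  qed
  show "orb b v \<in> periodic_profiles h \<Omega> \<mu>" "orb b (- v) = orb b v"
    by (rule libration[OF v _ _ e]; use w ne in \<open>auto simp: well_def\<close>)+
qed

lemma well_joins:
  assumes w: "well l b u" and v: "0 < v" and e: "energy b v = pot l" "energy b v = pot u"
    and f: "force l = 0" "force u = 0"
  shows "joins b v (cis l, 0) (cis u, 0)" "joins b (- v) (cis u, 0) (cis l, 0)"
proof -
  have r: "(curve b v \<longlongrightarrow> (cis u, 0)) at_top"
    by (rule limit_right) (use w v e f well_less well_pot_right[OF w] in auto)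
  have l: "(curve b v \<longlongrightarrow> (cis l, 0)) at_bot"
    by (rule limit_left) (use w v e f well_less well_pot_left[OF w] in auto)
  show "joins b v (cis l, 0) (cis u, 0)" "joins b (- v) (cis u, 0) (cis l, 0)"
    using r l limits_reverse limits_reverse' by (auto simp: joins_def)
qed

lemma well_confined:
  assumes w: "well l b u" and v: "v \<noteq> 0"
    and e: "energy b v < pot l \<or> (energy b v = pot l \<and> force l = 0)"
      "energy b v < pot u \<or> (energy b v = pot u \<and> force u = 0)"
  shows "l < pos b v t" "pos b v t < u"
  using flow_confined[of l b u v t] flow_avoids[of b v l] flow_avoids[of b v u] w v e
  by (auto simp: well_def)

text \<open>The orbit stays in the open interval, which \<open>b'\<close> avoids. The last two
  assumptions keep \<open>b'\<close> less than a full turn away from every point of the interval, so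
  it is not the same angle as any of them.\<close>

lemma well_orbs_differ:
  assumes w: "well l b u" and v: "v \<noteq> 0"
    and e: "energy b v < pot l \<or> (energy b v = pot l \<and> force l = 0)"
      "energy b v < pot u \<or> (energy b v = pot u \<and> force u = 0)"
    and b': "b' \<le> l \<or> u \<le> b'" "u - 2 * pi \<le> b'" "b' \<le> l + 2 * pi"
  shows "orb b v \<noteq> orb b' v'"
proof
  assume "orb b v = orb b' v'"
  then have "(cis b', v') \<in> orb b v" using orb_mem by simp
  then obtain t where t: "cis b' = cis (pos b v t)" by (auto simp: orb_def curve_def)
  have c: "l < pos b v t" "pos b v t < u" by (rule well_confined[OF w v e])+
  have "b' = pos b v t" by (rule cis_eq_close[OF t]) (use c b' in auto)
  then show False using c b' by auto
qed

lemma well_vel_pos: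
  assumes w: "well l b u" and v: "0 < v" and e: "energy b v = pot l" "energy b v = pot u"
    and f: "force l = 0" "force u = 0"
  shows "vel b v t > 0"
proof (rule vel_pos[OF v])
  fix t
  have c: "l < pos b v t" "pos b v t < u" by (rule well_confined[OF w]; use v e f in auto)+
  have "pot (pos b v t) < energy b v" by (rule well_pot_inside[OF w c]) (use e in auto)
  then show "vel b v t \<noteq> 0" using flow_energy[of b v t] by (auto simp: energy_def)
qed

lemma well_reflect:
  assumes "well l b u"
  shows "well (- u) (- b) (- l)"
proof -
  have "force z > 0" if "- u < z" "z < - b" for z
    using assms that force_minus[of z] unfolding well_def by (smt (verit))
  moreover have "force z < 0" if "- b < z" "z < - l" for z
    using assms that force_minus[of z] unfolding well_def by (smt (verit))
  ultimately show ?thesis using assms by (auto simp: well_def)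
qed

text \<open>The speed at the bottom \<open>b\<close> of a well which is just enough to reach the height of \<open>s\<close>.\<close>

definition escape :: "real \<Rightarrow> real \<Rightarrow> real" where
  "escape b s = sqrt (2 * (pot s - pot b))"

lemma escape:
  assumes "pot b < pot s"
  shows "escape b s > 0" "energy b (escape b s) = pot s"
    "\<And>q. energy b q < pot s \<longleftrightarrow> \<bar>q\<bar> < escape b s" "\<And>q. energy b q = pot s \<longleftrightarrow> \<bar>q\<bar> = escape b s"
    "\<And>q. pot s < energy b q \<longleftrightarrow> escape b s < \<bar>q\<bar>"
proof -
  show p: "escape b s > 0" using assms by (simp add: escape_def)
  have e2: "(escape b s)\<^sup>2 = 2 * (pot s - pot b)" using assms by (simp add: escape_def)
  show "energy b (escape b s) = pot s" unfolding energy_def e2 by (simp add: diff_divide_distrib)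
  have q: "energy b q - pot s = (\<bar>q\<bar>\<^sup>2 - (escape b s)\<^sup>2) / 2" for q
    unfolding energy_def e2 by (simp add: field_simps)
  show lt: "energy b q < pot s \<longleftrightarrow> \<bar>q\<bar> < escape b s" for q
  proof -
    have "energy b q < pot s \<longleftrightarrow> energy b q - pot s < 0" by simp
    also have "\<dots> \<longleftrightarrow> \<bar>q\<bar>\<^sup>2 < (escape b s)\<^sup>2" unfolding q by simp
    also have "\<dots> \<longleftrightarrow> \<bar>q\<bar> < escape b s" using p power2_less_imp_less[of "\<bar>q\<bar>" "escape b s"] power_strict_mono[of "\<bar>q\<bar>" "escape b s" 2] by auto
    finally show ?thesis .
  qed
  show gt: "pot s < energy b q \<longleftrightarrow> escape b s < \<bar>q\<bar>" for q
  proof -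
    have "pot s < energy b q \<longleftrightarrow> 0 < energy b q - pot s" by simp
    also have "\<dots> \<longleftrightarrow> (escape b s)\<^sup>2 < \<bar>q\<bar>\<^sup>2" unfolding q by simp
    also have "\<dots> \<longleftrightarrow> escape b s < \<bar>q\<bar>" using p power2_less_imp_less[of "escape b s" "\<bar>q\<bar>"] power_strict_mono[of "escape b s" "\<bar>q\<bar>" 2] by auto
    finally show ?thesis .
  qed
  show "energy b q = pot s \<longleftrightarrow> \<bar>q\<bar> = escape b s" for q
    using lt[of q] gt[of q] by linarith
qed

text \<open>Above all barriers every orbit passes every angle, so the rotations are already
  exhausted by those started at one well.\<close>

lemma orb_pass_above:
  assumes "q \<noteq> 0" "\<And>z. pot z < energy b q" "pot c < pot s" "\<And>z. pot z \<le> pot s" "pot s < energy b q"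
  shows "\<exists>q'. escape c s < \<bar>q'\<bar> \<and> orb b q = orb c q'"
proof -
  define q' where "q' = (if q > 0 then 1 else -1) * sqrt (2 * (energy b q - pot c))"
  have o: "orb b q = orb c q'"
    using orb_pass[of q b c] orb_pass_neg[of q b c] assms(1,2) by (auto simp: q'_def)
  then have "pot s < energy c q'" using orb_eq_energy[OF o] assms(5) by simp
  then show ?thesis using o escape(5)[OF assms(3)] by blast
qed

end

lemma filter_four: "{s \<in> {a, b, c, d}. p s} =
    (if p a then {a} else {}) \<union> (if p b then {b} else {}) \<union> (if p c then {c} else {}) \<union> (if p d then {d} else {})"
  by auto

context profile_ode
begin

subsection \<open>Two wells of equal height\<close>

lemma cis_2pi_shift: "cis (x + 2 * pi) = cis x"
  by (simp flip: cis_mult)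

text \<open>\<open>s\<close> marks a height that does not exceed either barrier. Below it the motion
  turns on both sides, so that reversed speeds give the same libration.\<close>

lemma well_librations:
  assumes w: "well l b u" and s: "pot s \<le> pot l" "pot s \<le> pot u" "pot b < pot s"
  shows "periodic_curve h \<Omega> \<mu> (librations b (escape b s))" "bounded_curve (librations b (escape b s))"
    "\<And>q. 0 < \<bar>q\<bar> \<Longrightarrow> \<bar>q\<bar> < escape b s \<Longrightarrow> orb b q \<in> librations b (escape b s) ` {0<..<1}"
proof -
  have per: "orb b q \<in> periodic_profiles h \<Omega> \<mu>" "orb b (- q) = orb b q" if "0 < q" "q < escape b s" for q
    using well_libration[OF w that(1)] escape(3)[OF s(3), of q] that s by auto
  show "periodic_curve h \<Omega> \<mu> (librations b (escape b s))" "bounded_curve (librations b (escape b s))"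
    using librations_curve[OF escape(1)[OF s(3)] per(1)] by auto
  fix q assume q: "0 < \<bar>q\<bar>" "\<bar>q\<bar> < escape b s"
  have "orb b q = orb b \<bar>q\<bar>" using per(2)[OF q] by (cases "q \<ge> 0") auto
  then show "orb b q \<in> librations b (escape b s) ` {0<..<1}"
    unfolding librations_image[OF escape(1)[OF s(3)]] using q by auto
qed

lemma rotations_up_cover:
  assumes "K < \<bar>q\<bar>" "0 < K"
  shows "orb b q \<in> rotations_up b K ` {0<..<1} \<union> rotations_down b K ` {0<..<1}"
proof (cases "q > 0")
  case True
  then show ?thesis using assms by (auto simp: rotations_up_image)
next
  case False
  then have "orb b q = orb b (- (- q))" "- q \<in> {K<..}" using assms by auto
  then show ?thesis unfolding rotations_down_image by blast
qed

text \<open>These librations have energy below \<open>pot s\<close> and the rotations have energy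
  above \<open>pot s'\<close>.\<close>

lemma librations_rotations_up_disjoint:
  assumes "pot b < pot s" "pot b' < pot s'" "pot s \<le> pot s'"
  shows "librations b (escape b s) ` {0<..<1} \<inter> rotations_up b' (escape b' s') ` {0<..<1} = {}"
    "librations b (escape b s) ` {0<..<1} \<inter> rotations_down b' (escape b' s') ` {0<..<1} = {}"
proof -
  have ne: "energy b q \<noteq> energy b' q'" if "q \<in> {0<..<escape b s}" "q' \<in> {escape b' s'<..}" for q q'
  proof -
    have "energy b q < pot s" using escape(3)[OF assms(1), of q] that by auto
    moreover have "pot s' < energy b' q'" using escape(5)[OF assms(2), of q'] that by auto
    ultimately show ?thesis using assms(3) by simp
  qed
  show "librations b (escape b s) ` {0<..<1} \<inter> rotations_up b' (escape b' s') ` {0<..<1} = {}"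
    "librations b (escape b s) ` {0<..<1} \<inter> rotations_down b' (escape b' s') ` {0<..<1} = {}"
    unfolding librations_image[OF escape(1)[OF assms(1)]] rotations_up_image rotations_down_image
    by (rule orb_images_disjoint(1)[OF ne], assumption+) (rule orb_images_disjoint(2)[OF ne], assumption+)
qed

text \<open>Two wells fill one full turn, separated by barriers of equal height. At the critical
  speed each well contributes one connection per direction; above it, rotations run over both wells
  and are parametrized at \<open>b1\<close> alone.\<close>

theorem double_well_portrait:
  assumes w1: "well s1 b1 s2" and w2: "well s2 b2 (s1 + 2 * pi)"
    and f: "force s1 = 0" "force b1 = 0" "force s2 = 0" "force b2 = 0" and eq: "pot s1 = pot s2"
  shows "heteroclinic_portrait h \<Omega> \<mu> (cis s1, 0) (cis s2, 0) (cis b1, 0) (cis b2, 0)"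
    and "heteroclinic_portrait h \<Omega> \<mu> (cis s2, 0) (cis s1, 0) (cis b1, 0) (cis b2, 0)"
proof -
  \<comment> \<open>The barrier \<open>s1\<close> met again one turn later, as the right end of the
    second well.\<close>
  define s3 where "s3 = s1 + 2 * pi"
  have w2': "well s2 b2 s3" using w2 by (simp add: s3_def)
  have c3: "cis s3 = cis s1" by (simp add: s3_def cis_2pi_shift)
  have f3: "force s3 = 0" and eq3: "pot s3 = pot s1" using force_cis[OF c3] pot_cis[OF c3] f by auto
  have order: "s1 < b1" "b1 < s2" "s2 < b2" "b2 < s3" using well_less[OF w1] well_less[OF w2'] by auto
  have lt1: "pot b1 < pot s1" using well_pot_left[OF w1, of b1] order by simp
  have lt2: "pot b2 < pot s1" using well_pot_left[OF w2', of b2] order eq by simp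
  have rep: "\<exists>y. cis y = cis x \<and> (y = s1 \<or> y = s2 \<or> (s1 < y \<and> y < s2) \<or> (s2 < y \<and> y < s3))" for x
  proof -
    obtain y where "s1 \<le> y" "y < s3" "cis y = cis x" using cis_representative[of s1 x] by (auto simp: s3_def)
    then show ?thesis by (intro exI[of _ y]) linarith
  qed
  have pmax: "pot z \<le> pot s1" for z
  proof -
    obtain y where y: "cis y = cis z" "y = s1 \<or> y = s2 \<or> (s1 < y \<and> y < s2) \<or> (s2 < y \<and> y < s3)"
      using rep by blast
    have "pot y \<le> pot s1"
      using y(2) well_pot_inside[OF w1, of y "pot s1"] well_pot_inside[OF w2', of y "pot s1"] eq eq3 by auto
    then show ?thesis using pot_cis[OF y(1)] by simp
  qed
  define P Q R S :: cyl where "P = (cis s1, 0)" and "Q = (cis s2, 0)" and "R = (cis b1, 0)" and "S = (cis b2, 0)"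
  have ne: "cis x \<noteq> cis y" if "s1 \<le> x" "x < y" "y < s3" for x y
    using cis_eq_close[of x y] that by (auto simp: s3_def)
  have dist: "distinct [P, Q, R, S]"
    using ne[of s1 s2] ne[of s1 b1] ne[of s1 b2] ne[of b1 s2] ne[of s2 b2] ne[of b1 b2] order
    by (auto simp: P_def Q_def R_def S_def)
  have E: "equilibria h \<Omega> \<mu> = {P, Q, R, S}"
  proof (intro equalityI subsetI)
    fix X assume "X \<in> equilibria h \<Omega> \<mu>"
    then obtain x where x: "X = (cis x, 0)" "force x = 0" by (auto simp: equilibria_eq)
    obtain y where y: "cis y = cis x" "y = s1 \<or> y = s2 \<or> (s1 < y \<and> y < s2) \<or> (s2 < y \<and> y < s3)"
      using rep by blast
    have "force y = 0" using force_cis[OF y(1)] x by simp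
    then have "y = b1" if "s1 < y \<and> y < s2"
      using w1 that unfolding well_def by (metis less_irrefl linorder_neqE_linordered_idom)
    moreover have "y = b2" if "s2 < y \<and> y < s3"
      using w2' that \<open>force y = 0\<close> unfolding well_def by (metis less_irrefl linorder_neqE_linordered_idom)
    ultimately have "y = s1 \<or> y = s2 \<or> y = b1 \<or> y = b2" using y(2) by blast
    then show "X \<in> {P, Q, R, S}" using x y(1)[symmetric] by (auto simp: P_def Q_def R_def S_def)
  next
    fix X assume "X \<in> {P, Q, R, S}"
    then show "X \<in> equilibria h \<Omega> \<mu>" using f by (auto simp: P_def Q_def R_def S_def equilibria_eq)
  qed
  define K1 K2 where "K1 = escape b1 s1" and "K2 = escape b2 s1"
  note e1 = escape[OF lt1, folded K1_def] and e2 = escape[OF lt2, folded K2_def]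
  note l1 = well_librations[OF w1 _ _ lt1, folded K1_def, OF order_refl eq_refl[OF eq]]
  note l2 = well_librations[OF w2' _ _ lt2, folded K2_def, OF eq_refl[OF eq] eq_refl[OF eq3[symmetric]]]
  have sup: "pot z < energy b1 q" if "K1 < q" for q z
    using pmax[of z] e1(5)[of q] that by auto
  note r1 = rotations_up_curve[OF e1(1) sup]
  define C where "C = {orb b1 K1, orb b1 (- K1), orb b2 K2, orb b2 (- K2)}"
  \<comment> \<open>The second well runs from \<open>s2\<close> to the copy of \<open>s1\<close>, so
    there positive speed leads from \<open>Q\<close> to \<open>P\<close>.\<close>
  have J: "joins b1 K1 P Q" "joins b1 (- K1) Q P" "joins b2 K2 Q P" "joins b2 (- K2) P Q"
    using well_joins[OF w1 e1(1)] well_joins[OF w2' e2(1)] e1(2) e2(2) eq eq3 f f3 c3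
    by (auto simp: P_def Q_def)
  define Bs Us where "Bs = [librations b1 K1, librations b2 K2]" and "Us = [rotations_up b1 K1, rotations_down b1 K1]"
  have K: "K1 \<noteq> 0" "K2 \<noteq> 0" using e1(1) e2(1) by auto
  have "orb b1 K1 \<in> connections h \<Omega> \<mu> P Q" "orb b1 (- K1) \<in> connections h \<Omega> \<mu> Q P"
    "orb b2 K2 \<in> connections h \<Omega> \<mu> Q P" "orb b2 (- K2) \<in> connections h \<Omega> \<mu> P Q"
    unfolding orb_connection_iff using J K by simp_all
  then have CC: "\<exists>P Q. S \<in> connections h \<Omega> \<mu> P Q" if "S \<in> C" for S
    using that unfolding C_def by fast
  have cov1: "orb b1 q \<in> C \<union> (\<Union>F\<in>set (Bs @ Us). F ` {0<..<1})" if "q \<noteq> 0" for q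
  proof -
    consider "\<bar>q\<bar> < K1" | "\<bar>q\<bar> = K1" | "K1 < \<bar>q\<bar>" by linarith
    then show ?thesis
    proof cases
      case 1
      then show ?thesis using l1(3)[of q] that by (auto simp: Bs_def)
    next
      case 2
      then have "q = K1 \<or> q = - K1" by auto
      then show ?thesis by (auto simp: C_def)
    next
      case 3
      then show ?thesis using rotations_up_cover[OF 3 e1(1), of b1] by (auto simp: Us_def)
    qed
  qed
  have cov2: "orb b2 q \<in> C \<union> (\<Union>F\<in>set (Bs @ Us). F ` {0<..<1})" if "q \<noteq> 0" for q
  proof -
    consider "\<bar>q\<bar> < K2" | "\<bar>q\<bar> = K2" | "K2 < \<bar>q\<bar>" by linarith
    then show ?thesis
    proof cases
      case 1
      then show ?thesis using l2(3)[of q] that by (auto simp: Bs_def)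
    next
      case 2
      then have "q = K2 \<or> q = - K2" by auto
      then show ?thesis by (auto simp: C_def)
    next
      case 3
      \<comment> \<open>An orbit that escapes from the second well passes the first bottom, where
        the cover is already known.\<close>
      then have gt: "pot s1 < energy b2 q" by (simp add: e2(5))
      have "\<exists>q'. K1 < \<bar>q'\<bar> \<and> orb b2 q = orb b1 q'"
        unfolding K1_def by (rule orb_pass_above[OF that _ lt1 pmax gt]) (use pmax gt in \<open>auto intro: le_less_trans\<close>)
      then obtain q' where q': "K1 < \<bar>q'\<bar>" "orb b2 q = orb b1 q'" by blast
      then have "q' \<noteq> 0" using e1(1) by auto
      then show ?thesis using cov1[of q'] q' by simp
    qed
  qed
  have cov: "orb x v \<in> C \<union> (\<Union>F\<in>set (Bs @ Us). F ` {0<..<1})" if nz: "v \<noteq> 0 \<or> force x \<noteq> 0" for x v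
  proof -
    obtain y where y: "cis y = cis x" "y = s1 \<or> y = s2 \<or> (s1 < y \<and> y < s2) \<or> (s2 < y \<and> y < s3)"
      using rep by blast
    have nz': "v \<noteq> 0 \<or> force y \<noteq> 0" using nz force_cis[OF y(1)] by simp
    have o: "orb x v = orb y v" using orb_cis[OF y(1)] by simp
    have "(s1 \<le> y \<and> y \<le> s2) \<or> (s2 \<le> y \<and> y \<le> s3)" using y(2) order by linarith
    then show ?thesis
    proof
      assume "s1 \<le> y \<and> y \<le> s2"
      then obtain q where "q \<noteq> 0" "orb y v = orb b1 q" using well_orb[OF w1 _ _ nz'] f by auto
      then show ?thesis using cov1 o by simp
    next
      assume "s2 \<le> y \<and> y \<le> s3"
      then obtain q where "q \<noteq> 0" "orb y v = orb b2 q" using well_orb[OF w2' _ _ nz'] f f3 by auto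
      then show ?thesis using cov2 o by simp
    qed
  qed
  \<comment> \<open>Orbits not above the barriers stay in the first well and so miss the angle
    \<open>b2\<close>.\<close>
  have diff: "orb b1 v \<noteq> orb b2 v'" if "v \<noteq> 0" "energy b1 v \<le> pot s1" for v v'
    by (rule well_orbs_differ[OF w1 that(1)]) (use that f eq order in \<open>auto simp: s3_def\<close>)
  have d12: "librations b1 K1 ` {0<..<1} \<inter> librations b2 K2 ` {0<..<1} = {}"
  proof -
    have "orb b1 q \<noteq> orb b2 q'" if "0 < q" "q < K1" for q q'
      by (rule diff) (use that e1(3)[of q] in auto)
    then show ?thesis unfolding librations_image[OF e1(1)] librations_image[OF e2(1)] by auto
  qed
  have disj: "sorted_wrt (\<lambda>F G. F ` {0<..<1} \<inter> G ` {0<..<1} = {}) (Bs @ Us)"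
    using d12 librations_rotations_up_disjoint[OF lt1 lt1 order_refl] librations_rotations_up_disjoint[OF lt2 lt1 order_refl]
      rotations_up_disjoint[OF e1(1) sup] by (simp add: Bs_def Us_def K1_def K2_def)
  note pp = phase_portrait_intro[OF E cov CC _ _ _ disj]
  have 1: "phase_portrait h \<Omega> \<mu> {P, Q, R, S} C Bs Us"
    by (rule pp(1)) (use l1 l2 r1 in \<open>auto simp: Bs_def Us_def\<close>)
  have 2: "connections h \<Omega> \<mu> X Y = {S \<in> C. S \<in> connections h \<Omega> \<mu> X Y}" for X Y
    by (rule pp(2)) (use l1 l2 r1 in \<open>auto simp: Bs_def Us_def\<close>)
  have PQ: "P \<noteq> Q" using dist by auto
  have mem: "orb b1 K1 \<in> connections h \<Omega> \<mu> X Y \<longleftrightarrow> X = P \<and> Y = Q"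
    "orb b1 (- K1) \<in> connections h \<Omega> \<mu> X Y \<longleftrightarrow> X = Q \<and> Y = P"
    "orb b2 K2 \<in> connections h \<Omega> \<mu> X Y \<longleftrightarrow> X = Q \<and> Y = P"
    "orb b2 (- K2) \<in> connections h \<Omega> \<mu> X Y \<longleftrightarrow> X = P \<and> Y = Q" for X Y
    unfolding orb_connection_iff using J K
      joins_unique[OF J(1), of X Y] joins_unique[OF J(2), of X Y]
      joins_unique[OF J(3), of X Y] joins_unique[OF J(4), of X Y] by auto
  have cPQ: "connections h \<Omega> \<mu> P Q = {orb b1 K1, orb b2 (- K2)}"
    by (rule trans[OF 2], unfold C_def filter_four) (simp add: mem PQ PQ[symmetric] insert_commute)
  have cQP: "connections h \<Omega> \<mu> Q P = {orb b1 (- K1), orb b2 K2}"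
    by (rule trans[OF 2], unfold C_def filter_four) (simp add: mem PQ PQ[symmetric] insert_commute)
  have "card (connections h \<Omega> \<mu> P Q) = 2" unfolding cPQ using diff[of K1 "- K2"] K e1(2) by simp
  moreover have "card (connections h \<Omega> \<mu> Q P) = 2" unfolding cQP using diff[of "- K1" K2] K e1(2) by simp
  moreover have "connections h \<Omega> \<mu> P Q \<inter> connections h \<Omega> \<mu> Q P = {}"
  proof -
    have "orb b1 K1 \<notin> connections h \<Omega> \<mu> Q P" "orb b2 (- K2) \<notin> connections h \<Omega> \<mu> Q P"
      using PQ by (simp_all add: mem)
    then show ?thesis unfolding cPQ by simp
  qed
  moreover have "connections h \<Omega> \<mu> P Q \<union> connections h \<Omega> \<mu> Q P = C"
    unfolding cPQ cQP C_def by fast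
  ultimately have h: "heteroclinic_portrait h \<Omega> \<mu> P Q R S"
    unfolding heteroclinic_portrait_def using dist 1 unfolding Bs_def Us_def by metis
  have "heteroclinic_portrait h \<Omega> \<mu> Q P R S"
  proof -
    have "connections h \<Omega> \<mu> Q P \<union> connections h \<Omega> \<mu> P Q = connections h \<Omega> \<mu> P Q \<union> connections h \<Omega> \<mu> Q P"
      "connections h \<Omega> \<mu> Q P \<inter> connections h \<Omega> \<mu> P Q = connections h \<Omega> \<mu> P Q \<inter> connections h \<Omega> \<mu> Q P"
      "{Q, P, R, S} = {P, Q, R, S}" by blast+
    moreover have "distinct [Q, P, R, S]" using dist by auto
    ultimately show ?thesis using h unfolding heteroclinic_portrait_def by metis
  qed
  then show "heteroclinic_portrait h \<Omega> \<mu> (cis s1, 0) (cis s2, 0) (cis b1, 0) (cis b2, 0)"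
    "heteroclinic_portrait h \<Omega> \<mu> (cis s2, 0) (cis s1, 0) (cis b1, 0) (cis b2, 0)"
    using h by (simp_all add: P_def Q_def R_def S_def)
qed

subsection \<open>Two wells separated by barriers of different height\<close>

lemma joins_reflect:
  assumes "joins x v (z, 0) (z', 0)"
  shows "joins (- x) (- v) (cnj z, 0) (cnj z', 0)"
proof -
  have e: "curve (- x) (- v) = (\<lambda>t. (cnj (fst (curve x v t)), - snd (curve x v t)))"
    by (rule ext) (simp add: curve_reflect case_prod_beta)
  have "((\<lambda>t. (cnj (fst (curve x v t)), - snd (curve x v t))) \<longlongrightarrow> (cnj (fst (w, 0::real)), - snd (w, 0::real))) F"
    if "(curve x v \<longlongrightarrow> (w, 0)) F" for w F
    by (intro tendsto_Pair tendsto_minus tendsto_cnj tendsto_fst tendsto_snd that)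
  then show ?thesis using assms unfolding joins_def e by auto
qed

text \<open>The barrier at \<open>pi\<close> is lower than the one at 0. Below both heights there
  are librations in two mirror-image wells, between the heights librations that cross
  \<open>pi\<close> and span both wells, above them rotations. The two critical heights carry the
  homoclinic orbits.\<close>

theorem barrier_portrait:
  assumes w: "well 0 c pi" and f: "force c = 0" and lt: "pot pi < pot 0"
  shows "card (connections h \<Omega> \<mu> north north) = 2 \<and> card (connections h \<Omega> \<mu> south south) = 2 \<and>
    (\<exists>B1 B2 B3 U1 U2. phase_portrait h \<Omega> \<mu> {north, south, (cis c, 0), (cis (- c), 0)}
      (connections h \<Omega> \<mu> north north \<union> connections h \<Omega> \<mu> south south) [B1, B2, B3] [U1, U2])"
proof -
  have f0: "force 0 = 0" "force pi = 0" "force (- pi) = 0" by (simp_all add: force_def)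
  have c: "0 < c" "c < pi" using well_less[OF w] by auto
  have w': "well (- pi) (- c) 0" using well_reflect[OF w] by simp
  have ltc: "pot c < pot pi" using well_pot_right[OF w, of c] c by simp
  \<comment> \<open>The potential is also symmetric about \<open>pi\<close>, which transfers
    estimates from half a turn to a full one.\<close>
  have per: "pot (2 * pi - z) = pot z" "force (2 * pi - z) = - force z" for z
    using pot_cis[of "2 * pi - z" "- z"] force_cis[of "2 * pi - z" "- z"] cis_2pi_shift[of "- z"] by auto
  have below: "pot z < pot 0" if z: "0 < z" "z < 2 * pi" for z
  proof -
    have *: "pot y < pot 0" if "0 < y" "y \<le> pi" for y
      using well_pot_inside[OF w, of y "pot 0"] that lt by (cases "y = pi") auto
    show ?thesis using *[of z] *[of "2 * pi - z"] per(1)[of z] z by (cases "z \<le> pi") auto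
  qed
  have pmax: "pot z \<le> pot 0" for z
  proof -
    obtain y where y: "0 \<le> y" "y < 2 * pi" "cis y = cis z" using cis_representative[of 0 z] by auto
    then show ?thesis using below[of y] pot_cis[OF y(3)] by (cases "y = 0") auto
  qed
  have E: "equilibria h \<Omega> \<mu> = {north, south, (cis c, 0), (cis (- c), 0)}"
  proof (intro equalityI subsetI)
    fix X assume "X \<in> equilibria h \<Omega> \<mu>"
    then obtain x where x: "X = (cis x, 0)" "force x = 0" by (auto simp: equilibria_eq)
    obtain y where y: "- pi \<le> y" "y < - pi + 2 * pi" "cis y = cis x" using cis_representative by blast
    have fy: "force y = 0" using force_cis[OF y(3)] x by simp
    have ypi: "y < pi" using y(2) by simp
    have "y = c" if "0 < y"
      using w that fy ypi unfolding well_def by (metis less_irrefl linorder_neqE_linordered_idom)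
    moreover have "y = - c" if "- pi < y" "y < 0"
      using w' that fy unfolding well_def by (metis less_irrefl linorder_neqE_linordered_idom)
    ultimately have "y = 0 \<or> y = c \<or> y = - c \<or> y = - pi" using y by linarith
    moreover have "cis (- pi) = - 1" by (simp add: complex_eq_iff)
    ultimately show "X \<in> {north, south, (cis c, 0), (cis (- c), 0)}"
      using x y(3)[symmetric] by (auto simp: north_def south_def)
  next
    fix X :: cyl assume "X \<in> {north, south, (cis c, 0), (cis (- c), 0)}"
    moreover have "(cis x, 0) \<in> equilibria h \<Omega> \<mu>" if "force x = 0" for x
      using that by (simp add: equilibria_eq)
    from this[OF f] this[of "- c"] this[OF f0(1)] this[OF f0(2)]
    have "(cis c, 0) \<in> equilibria h \<Omega> \<mu>" "(cis (- c), 0) \<in> equilibria h \<Omega> \<mu>"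
      "north \<in> equilibria h \<Omega> \<mu>" "south \<in> equilibria h \<Omega> \<mu>"
      using f by (simp_all add: north_def south_def)
    ultimately show "X \<in> equilibria h \<Omega> \<mu>" by auto
  qed
  \<comment> \<open>\<open>K\<close> is the speed at the bottom \<open>c\<close> that just reaches
    the low barrier, \<open>L\<close> the speed on top of the low barrier that just reaches the high
    one. Orbits higher than the low barrier are parametrized at \<open>pi\<close>, although it is no
    bottom.\<close>
  define K L where "K = escape c pi" and "L = escape pi 0"
  have K': "escape (- c) pi = K" by (simp add: K_def escape_def)
  note eK = escape[OF ltc, folded K_def] and eL = escape[OF lt, folded L_def]
  have ltc': "pot (- c) < pot pi" using ltc by simp
  note l1 = well_librations[OF w less_imp_le[OF lt] order_refl ltc, folded K_def]
  have l2: "periodic_curve h \<Omega> \<mu> (librations (- c) K)" "bounded_curve (librations (- c) K)"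
    "\<And>q. 0 < \<bar>q\<bar> \<Longrightarrow> \<bar>q\<bar> < K \<Longrightarrow> orb (- c) q \<in> librations (- c) K ` {0<..<1}"
    using well_librations[OF w' _ _ ltc', unfolded K'] lt by auto
  have ne: "force y \<noteq> 0" if y: "0 < y" "y < 2 * pi" "pot pi < pot y" for y
  proof -
    have *: "force z \<noteq> 0" if z: "0 < z" "z < pi" "pot pi < pot z" for z
    proof -
      have "z \<noteq> c" using z ltc by auto
      then show ?thesis using w z by (cases "z < c") (force simp: well_def)+
    qed
    consider "y < pi" | "y = pi" | "y > pi" by linarith
    then show ?thesis
    proof cases
      case 3
      then show ?thesis using *[of "2 * pi - y"] y per by auto
    qed (use * y in auto)
  qed
  have lib3: "orb pi q \<in> periodic_profiles h \<Omega> \<mu>" "orb pi (- q) = orb pi q" if q: "0 < q" "q < L" for q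
  proof -
    have e: "energy pi q < pot 0" using eL(3)[of q] q by simp
    have e': "pot pi < energy pi q" using q by (simp add: energy_def)
    show "orb pi q \<in> periodic_profiles h \<Omega> \<mu>" "orb pi (- q) = orb pi q"
      by (rule libration[of q 0 pi "2 * pi"]; use q e e' ne per(1)[of 0] in auto)+
  qed
  note l3 = librations_curve[OF eL(1) lib3(1)]
  have sup: "pot z < energy pi q" if "L < q" for q z
    using pmax[of z] eL(5)[of q] that by auto
  note r3 = rotations_up_curve[OF eL(1) sup]
  \<comment> \<open>At the height of the low barrier the motion tends to \<open>pi\<close> on one
    side and turns before 0 on the other. So each well has a single homoclinic orbit, which is its
    own reverse.\<close>
  have hs: "orb c (- K) = orb c K" "joins c K south south"
  proof -
    have t: "\<exists>t<0. vel c K t = 0 \<and> (\<forall>s. t < s \<and> s \<le> 0 \<longrightarrow> vel c K s > 0)"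
    proof (rule turn_left[of K 0])
      show "force y \<noteq> 0" if "0 < y" "y < c" for y using w that by (force simp: well_def)
    qed (use eK(1,2) c lt in auto)
    then obtain t where t: "vel c K t = 0" by blast
    show "orb c (- K) = orb c K" by (rule orb_turn[OF t])
    have r: "(curve c K \<longlongrightarrow> (cis pi, 0)) at_top"
      by (rule limit_right) (use eK(1,2) c f0 well_pot_right[OF w] in auto)
    then show "joins c K south south"
      using limit_turn[OF t r] by (simp add: joins_def south_def)
  qed
  have hs': "orb (- c) (- K) = orb (- c) K" "joins (- c) (- K) south south"
    using orb_eq_reflect[OF hs(1)] joins_reflect[of c K "-1" "-1"] hs(2) by (auto simp: south_def)
  \<comment> \<open>At the height of the high barrier the motion runs from 0 over \<open>pi\<close>
    to \<open>2 * pi\<close> without turning, and the two directions give two orbits.\<close>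
  have hn: "joins pi L north north" "joins pi (- L) north north"
  proof -
    have "(curve pi L \<longlongrightarrow> (cis (2 * pi), 0)) at_top"
      by (rule limit_right) (use eL(1,2) below per(1)[of 0] per(2)[of 0] f0 in auto)
    moreover have "(curve pi L \<longlongrightarrow> (cis 0, 0)) at_bot"
      by (rule limit_left) (use eL(1,2) below f0 in auto)
    ultimately show "joins pi L north north" "joins pi (- L) north north"
      using limits_reverse[of pi L 1] limits_reverse'[of pi L 1] by (auto simp: joins_def north_def)
  qed
  have velL: "vel pi L t > 0" for t
  proof (rule vel_pos[OF eL(1)])
    fix t
    have a: "pos pi L t \<noteq> 0" "pos pi L t \<noteq> 2 * pi" for t
      using flow_avoids[of pi L 0 t] flow_avoids[of pi L "2 * pi" t] eL(1,2) per(1)[of 0] per(2)[of 0] f0 by auto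
    have "0 < pos pi L t" "pos pi L t < 2 * pi" by (rule flow_confined[of 0 pi "2 * pi"]; use a in auto)+
    then have "pot (pos pi L t) < energy pi L" using below eL(2) by simp
    then show "vel pi L t \<noteq> 0" using flow_energy[of pi L t] by (auto simp: energy_def)
  qed
  have dn: "orb pi L \<noteq> orb pi (- L)"
  proof
    assume "orb pi L = orb pi (- L)"
    then have "(cis pi, - L) \<in> orb pi L" using orb_mem[of pi "- L"] by simp
    then obtain t where "vel pi L t = - L" by (auto simp: orb_def curve_def)
    then show False using velL[of t] eL(1) by simp
  qed
  have diff: "orb c v \<noteq> orb (- c) v'" if "v \<noteq> 0" "energy c v \<le> pot pi" for v v'
    by (rule well_orbs_differ[OF w that(1)]) (use that f0 c lt in auto)
  define C where "C = {orb c K, orb (- c) (- K), orb pi L, orb pi (- L)}"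
  define Bs Us where "Bs = [librations c K, librations (- c) K, librations pi L]" and "Us = [rotations_up pi L, rotations_down pi L]"
  define A where "A = C \<union> (\<Union>F\<in>set (Bs @ Us). F ` {0<..<1})"
  have KL: "K \<noteq> 0" "L \<noteq> 0" using eK(1) eL(1) by auto
  have CC: "\<exists>P Q. S \<in> connections h \<Omega> \<mu> P Q" if "S \<in> C" for S
  proof -
    have "orb c K \<in> connections h \<Omega> \<mu> south south" "orb (- c) (- K) \<in> connections h \<Omega> \<mu> south south"
      "orb pi L \<in> connections h \<Omega> \<mu> north north" "orb pi (- L) \<in> connections h \<Omega> \<mu> north north"
      unfolding orb_connection_iff using hs(2) hs'(2) hn KL by simp_all
    then show ?thesis using that unfolding C_def by fast
  qed
  have covpi: "orb pi q \<in> A" if "q \<noteq> 0" for q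
  proof -
    consider "\<bar>q\<bar> < L" | "\<bar>q\<bar> = L" | "L < \<bar>q\<bar>" by linarith
    then show ?thesis
    proof cases
      case 1
      then have "orb pi q = orb pi \<bar>q\<bar>" using lib3(2)[of "\<bar>q\<bar>"] that by (cases "q \<ge> 0") auto
      then have "orb pi q \<in> librations pi L ` {0<..<1}" unfolding librations_image[OF eL(1)] using 1 that by auto
      then show ?thesis by (auto simp: A_def Bs_def)
    next
      case 2
      then have "q = L \<or> q = - L" by auto
      then show ?thesis by (auto simp: A_def C_def)
    next
      case 3
      then show ?thesis using rotations_up_cover[OF 3 eL(1), of pi] by (auto simp: A_def Us_def)
    qed
  qed
  \<comment> \<open>Whatever exceeds the low barrier passes over it, which reduces these orbits to
    those started at \<open>pi\<close>.\<close>
  have pass: "\<exists>q'. q' \<noteq> 0 \<and> orb c q = orb pi q'" if q: "K < \<bar>q\<bar>" for q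
  proof -
    have e: "pot pi < energy c q" using eK(5) q by simp
    have seg: "pot z < energy c q" if "z \<in> closed_segment c pi" for z
      using well_pot_right[OF w, of z] that c e by (cases "z = pi") (auto simp: closed_segment_eq_real_ivl)
    define q' where "q' = (if q > 0 then 1 else -1) * sqrt (2 * (energy c q - pot pi))"
    have "orb c q = orb pi q'"
      using orb_pass[of q c pi] orb_pass_neg[of q c pi] seg q eK(1) by (auto simp: q'_def)
    moreover have "q' \<noteq> 0" using e by (auto simp: q'_def)
    ultimately show ?thesis by blast
  qed
  have covc: "orb c q \<in> A" if "q \<noteq> 0" for q
  proof -
    consider "\<bar>q\<bar> < K" | "\<bar>q\<bar> = K" | "K < \<bar>q\<bar>" by linarith
    then show ?thesis
    proof cases
      case 1
      then show ?thesis using l1(3)[of q] that by (auto simp: A_def Bs_def)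
    next
      case 2
      then have "q = K \<or> q = - K" by auto
      then show ?thesis using hs(1) by (auto simp: A_def C_def)
    next
      case 3
      then show ?thesis using pass covpi by metis
    qed
  qed
  have covc': "orb (- c) q \<in> A" if "q \<noteq> 0" for q
  proof -
    consider "\<bar>q\<bar> < K" | "\<bar>q\<bar> = K" | "K < \<bar>q\<bar>" by linarith
    then show ?thesis
    proof cases
      case 1
      then show ?thesis using l2(3)[of q] that by (auto simp: A_def Bs_def)
    next
      case 2
      then have "q = K \<or> q = - K" by auto
      then show ?thesis using hs'(1) by (auto simp: A_def C_def)
    next
      case 3
      then obtain q' where q': "q' \<noteq> 0" "orb c (- q) = orb pi q'" using pass[of "- q"] by auto
      \<comment> \<open>The mirror image arrives at \<open>- pi\<close>, which is the same angle as
        \<open>pi\<close>.\<close>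
      have "orb (- c) q = orb (- pi) (- q')" using orb_eq_reflect[OF q'(2)] by simp
      also have "\<dots> = orb pi (- q')" by (rule orb_cis) (simp add: complex_eq_iff)
      finally show ?thesis using covpi[of "- q'"] q'(1) by simp
    qed
  qed
  have cov: "orb x v \<in> C \<union> (\<Union>F\<in>set (Bs @ Us). F ` {0<..<1})" if nz: "v \<noteq> 0 \<or> force x \<noteq> 0" for x v
  proof -
    obtain y where y: "- pi \<le> y" "y < - pi + 2 * pi" "cis y = cis x" using cis_representative by blast
    have nz': "v \<noteq> 0 \<or> force y \<noteq> 0" using nz force_cis[OF y(3)] by simp
    have o: "orb x v = orb y v" using orb_cis[OF y(3)] by simp
    have "orb y v \<in> A"
    proof (cases "y \<ge> 0")
      case True
      then show ?thesis using well_orb[OF w True _ nz'] f f0 covc y(2) by auto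
    next
      case False
      then show ?thesis using well_orb[OF w' y(1) _ nz'] f f0 covc' by auto
    qed
    then show ?thesis using o by (simp add: A_def)
  qed
  have d12: "librations c K ` {0<..<1} \<inter> librations (- c) K ` {0<..<1} = {}"
  proof -
    have "orb c q \<noteq> orb (- c) q'" if "0 < q" "q < K" for q q'
      by (rule diff) (use that eK(3)[of q] in auto)
    then show ?thesis unfolding librations_image[OF eK(1)] by auto
  qed
  \<comment> \<open>The height of the low barrier separates the energies of the inner and the outer
    librations.\<close>
  have d3: "librations b K ` {0<..<1} \<inter> librations pi L ` {0<..<1} = {}" if "b = c \<or> b = - c" for b
    unfolding librations_image[OF eK(1)] librations_image[OF eL(1)]
  proof (rule orb_images_disjoint(1))
    fix q q' assume "q \<in> {0<..<K}" "q' \<in> {0<..<L}"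
    then have "energy b q < pot pi" "pot pi < energy pi q'"
      using that eK(3)[of q] by (auto simp: energy_def)
    then show "energy b q \<noteq> energy pi q'" by simp
  qed
  have disj: "sorted_wrt (\<lambda>F G. F ` {0<..<1} \<inter> G ` {0<..<1} = {}) (Bs @ Us)"
    using d12 d3[of c] d3[of "- c"] rotations_up_disjoint[OF eL(1) sup]
      librations_rotations_up_disjoint[OF ltc lt less_imp_le[OF lt], folded K_def L_def]
      librations_rotations_up_disjoint[OF ltc' lt less_imp_le[OF lt], unfolded K', folded L_def]
      librations_rotations_up_disjoint[OF lt lt order_refl, folded L_def]
    by (simp add: Bs_def Us_def)
  note pp = phase_portrait_intro[OF E cov CC _ _ _ disj]
  have 1: "phase_portrait h \<Omega> \<mu> {north, south, (cis c, 0), (cis (- c), 0)} C Bs Us"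
    by (rule pp(1)) (use l1 l2 l3 r3 in \<open>auto simp: Bs_def Us_def\<close>)
  have 2: "connections h \<Omega> \<mu> X Y = {S \<in> C. S \<in> connections h \<Omega> \<mu> X Y}" for X Y
    by (rule pp(2)) (use l1 l2 l3 r3 in \<open>auto simp: Bs_def Us_def\<close>)
  have NS: "north \<noteq> south" by (auto simp: north_def south_def complex_eq_iff)
  have mem: "orb c K \<in> connections h \<Omega> \<mu> X Y \<longleftrightarrow> X = south \<and> Y = south"
    "orb (- c) (- K) \<in> connections h \<Omega> \<mu> X Y \<longleftrightarrow> X = south \<and> Y = south"
    "orb pi L \<in> connections h \<Omega> \<mu> X Y \<longleftrightarrow> X = north \<and> Y = north"
    "orb pi (- L) \<in> connections h \<Omega> \<mu> X Y \<longleftrightarrow> X = north \<and> Y = north" for X Y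
    unfolding orb_connection_iff using hs(2) hs'(2) hn KL
      joins_unique[OF hs(2), of X Y] joins_unique[OF hs'(2), of X Y]
      joins_unique[OF hn(1), of X Y] joins_unique[OF hn(2), of X Y] by auto
  have cn: "connections h \<Omega> \<mu> north north = {orb pi L, orb pi (- L)}"
    by (rule trans[OF 2], unfold C_def filter_four) (simp add: mem NS NS[symmetric] insert_commute)
  have cs: "connections h \<Omega> \<mu> south south = {orb c K, orb (- c) (- K)}"
    by (rule trans[OF 2], unfold C_def filter_four) (simp add: mem NS NS[symmetric] insert_commute)
  have "card (connections h \<Omega> \<mu> north north) = 2" unfolding cn using dn by simp
  moreover have "card (connections h \<Omega> \<mu> south south) = 2"
    unfolding cs using diff[of K "- K"] KL eK(2) by simp
  moreover have "connections h \<Omega> \<mu> north north \<union> connections h \<Omega> \<mu> south south = C"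
    unfolding cn cs C_def by fast
  ultimately show ?thesis using 1 unfolding Bs_def Us_def by metis
qed

end

section \<open>Subcritical anisotropy\<close>

lemma set_limitI:
  assumes lim: "(\<rho> \<longlongrightarrow> 0) flt"
    and ev: "\<forall>\<^sub>F r in flt. (\<forall>X\<in>F r. \<exists>Y\<in>S. dist X Y \<le> \<rho> r) \<and> (\<forall>Y\<in>S. \<exists>X\<in>F r. dist X Y \<le> \<rho> r)"
  shows "set_limit F S flt"
  unfolding set_limit_def
proof (intro allI impI)
  fix \<epsilon> :: real assume "\<epsilon> > 0"
  then have "\<forall>\<^sub>F r in flt. \<rho> r < \<epsilon>" using order_tendstoD(2)[OF lim] by simp
  with ev show "\<forall>\<^sub>F r in flt. F r \<subseteq> (\<Union>x\<in>S. ball x \<epsilon>) \<and> S \<subseteq> (\<Union>x\<in>F r. ball x \<epsilon>)"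
  proof eventually_elim
    case (elim r)
    show ?case
    proof (intro conjI subsetI)
      fix X assume "X \<in> F r"
      then obtain Y where "Y \<in> S" "dist X Y \<le> \<rho> r" using elim by blast
      then show "X \<in> (\<Union>x\<in>S. ball x \<epsilon>)" using elim by (intro UN_I[of Y]) (auto simp: dist_commute)
    next
      fix Y assume "Y \<in> S"
      then obtain X where "X \<in> F r" "dist X Y \<le> \<rho> r" using elim by blast
      then show "Y \<in> (\<Union>x\<in>F r. ball x \<epsilon>)" using elim by (intro UN_I[of X]) auto
    qed
  qed
qed

lemma dist_Pair_le: "dist (a, b) (c, d) \<le> dist a c + dist b d"
  unfolding dist_Pair_Pair by (rule order_trans[OF sqrt_sum_squares_le_sum]) auto

lemma dist_cis_1: "dist (cis x) 1 = sqrt (2 * (1 - cos x))"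
proof -
  have "(cmod (cis x - 1))\<^sup>2 = 2 * (1 - cos x)"
    unfolding cmod_power2 using sin_cos_squared_add[of x] by (simp add: power2_eq_square algebra_simps)
  then show ?thesis by (metis dist_norm norm_ge_zero real_sqrt_unique)
qed

lemma dist_cis_minus_1: "dist (cis x) (- 1) = sqrt (2 * (1 + cos x))"
proof -
  have "(cmod (cis x - (- 1)))\<^sup>2 = 2 * (1 + cos x)"
    unfolding cmod_power2 using sin_cos_squared_add[of x] by (simp add: power2_eq_square algebra_simps)
  then show ?thesis by (metis dist_norm norm_ge_zero real_sqrt_unique)
qed

text \<open>Zeros are moved by multiples of \<open>P\<close> into the centred window, where only 0
  is left. The windows are half-open so that a zero at an end point is counted once.\<close>

lemma periodic_zeros:
  fixes P :: real
  assumes P: "P > 0" and shift: "\<And>t. Z (t + P) \<longleftrightarrow> Z t" and win: "\<And>t. - P / 2 \<le> t \<Longrightarrow> t < P / 2 \<Longrightarrow> Z t \<longleftrightarrow> t = 0"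
  shows "Z t \<longleftrightarrow> (\<exists>n::int. t = of_int n * P)" "\<exists>!t. t \<in> {a..<a + P} \<and> Z t"
proof -
  have shift_nat: "Z (t + real n * P) \<longleftrightarrow> Z t" for t n
    by (induction n) (use shift[of "t + real _ * P"] in \<open>auto simp: algebra_simps\<close>)
  have shift_int: "Z (t + of_int n * P) \<longleftrightarrow> Z t" for t and n :: int
  proof (cases "n \<ge> 0")
    case True
    then show ?thesis using shift_nat[of t "nat n"] by simp
  next
    case False
    then show ?thesis using shift_nat[of "t + of_int n * P" "nat (- n)"] by (simp add: algebra_simps)
  qed
  show Z: "Z t \<longleftrightarrow> (\<exists>n::int. t = of_int n * P)" for t
  proof
    assume "Z t"
    \<comment> \<open>Rounding to the nearest multiple of \<open>P\<close> leaves a remainder in the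
      centred window.\<close>
    define n where "n = \<lfloor>(t + P / 2) / P\<rfloor>"
    have n: "of_int n * P \<le> t + P / 2" "t + P / 2 < (of_int n + 1) * P"
      using floor_divide_lower[OF P, of "t + P / 2"] floor_divide_upper[OF P, of "t + P / 2"]
      unfolding n_def by auto
    have "Z (t + of_int (- n) * P)" using \<open>Z t\<close> shift_int by blast
    then have "t + of_int (- n) * P = 0" using win[of "t + of_int (- n) * P"] n by (simp add: algebra_simps)
    then show "\<exists>n::int. t = of_int n * P" by (intro exI[of _ n]) simp
  next
    assume "\<exists>n::int. t = of_int n * P"
    then obtain n :: int where "t = 0 + of_int n * P" by auto
    then show "Z t" using shift_int[of 0 n] win[of 0] P by simp
  qed
  define n where "n = \<lceil>a / P\<rceil>"
  have "of_int n \<ge> a / P" "of_int n < a / P + 1" unfolding n_def by linarith+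
  then have n: "a \<le> of_int n * P" "of_int n * P < a + P" using P by (auto simp: field_simps)
  show "\<exists>!t. t \<in> {a..<a + P} \<and> Z t"
  proof (rule ex1I[of _ "of_int n * P"])
    fix t assume t: "t \<in> {a..<a + P} \<and> Z t"
    then obtain m :: int where m: "t = of_int m * P" using Z by auto
    have "\<bar>of_int (m - n) * P\<bar> < 1 * P" using t n m by (auto simp: algebra_simps)
    then have "\<bar>real_of_int (m - n)\<bar> < 1" using P by (simp add: abs_mult)
    then have "m = n" by linarith
    then show "t = of_int n * P" using m by simp
  qed (use n Z in auto)
qed

lemma is_period_shift: "is_period (\<lambda>t. \<gamma> (t + s)) T \<longleftrightarrow> is_period \<gamma> T"
proof -
  have "(\<forall>t. \<gamma> (t + T + s) = \<gamma> (t + s)) \<longleftrightarrow> (\<forall>t. \<gamma> (t + T) = \<gamma> t)"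
    by (metis add.assoc add.commute diff_add_cancel)
  then show ?thesis by (simp add: is_period_def)
qed

lemma minimal_period_shift: "minimal_period (\<lambda>t. \<gamma> (t + s)) T \<longleftrightarrow> minimal_period \<gamma> T"
  by (simp add: minimal_period_def is_period_shift)

context profile_ode
begin

lemma translate_2pi: "pos (x + 2 * pi) v t = pos x v t + 2 * pi" "vel (x + 2 * pi) v t = vel x v t"
  using sol_eq_flow[OF sol_translate[OF sol_flow[of x v], of "2 * pi"], of 0 "x + 2 * pi" v t] by auto

text \<open>\<open>pi\<close> and \<open>- pi\<close> are the same angle, so the mirror symmetry at
  0, shifted by a full turn, becomes one at \<open>pi\<close>.\<close>

lemma mirror_pi: "pos pi v (- t) = 2 * pi - pos pi v t" "vel pi v (- t) = vel pi v t"
  using flow_mirror[of pi v "t"] translate_2pi[of "- pi" v t] by auto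

lemma pos_strict_mono:
  assumes "s < t" "\<And>r. s < r \<Longrightarrow> r < t \<Longrightarrow> vel x v r > 0"
  shows "pos x v s < pos x v t"
  by (rule DERIV_pos_imp_increasing_open[OF assms(1)])
    (use assms(2) DERIV_pos sol_cont[OF sol_flow] in blast)+

text \<open>The librations about \<open>pi\<close>: the mirror symmetry about \<open>pi\<close> turns the half period into a shift that
  preserves the crossings.\<close>

lemma libration_pi_crossings:
  assumes q: "q > 0" and e: "energy pi q < pot 0" and ne: "\<And>y. 0 < y \<Longrightarrow> y < 2 * pi \<Longrightarrow> y \<noteq> pi \<Longrightarrow> force y \<noteq> 0"
  shows "\<exists>T. minimal_period (curve pi q) T \<and>
    (\<forall>\<xi>0. \<exists>!\<xi>. \<xi> \<in> {\<xi>0..<\<xi>0 + T / 2} \<and> crosses (curve pi q) south \<xi>)"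
proof -
  have p2: "pot (2 * pi) = pot 0" by (rule pot_cis) simp
  have potpi: "pot pi < energy pi q" using q by (simp add: energy_def)
  \<comment> \<open>The time from \<open>pi\<close> to the turning point, a quarter of the
    period.\<close>
  obtain t1 where t1: "t1 > 0" "vel pi q t1 = 0" "\<And>s. 0 \<le> s \<and> s < t1 \<Longrightarrow> vel pi q s > 0"
    using turn_right[of q pi "2 * pi"] q e p2 ne potpi by force
  have conf: "0 < pos pi q t" "pos pi q t < 2 * pi" for t
    by (rule flow_confined[of 0 pi "2 * pi" q t]; use flow_avoids e p2 in simp)+
  have vp: "vel pi q s > 0" if "- t1 < s" "s < t1" for s
    using t1(3)[of s] t1(3)[of "- s"] mirror_pi(2)[of q s] that by (cases "s \<ge> 0") auto
  define Z where "Z t \<longleftrightarrow> pos pi q t = pi" for t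
  \<comment> \<open>The symmetry about the turning instant composed with the mirror at
    \<open>pi\<close>: half a period later the position is reflected about \<open>pi\<close> and the
    velocity is reversed.\<close>
  have half: "pos pi q (t + 2 * t1) = 2 * pi - pos pi q t" "vel pi q (t + 2 * t1) = - vel pi q t" for t
    using sol_turn_symmetric[OF sol_flow t1(2), of "- t"] mirror_pi[of q t] by (auto simp: add.commute)
  have P: "2 * t1 > 0" using t1 by simp
  have shift: "Z (t + 2 * t1) \<longleftrightarrow> Z t" for t unfolding Z_def half by auto
  have win: "Z t \<longleftrightarrow> t = 0" if "- (2 * t1) / 2 \<le> t" "t < 2 * t1 / 2" for t
  proof
    assume "Z t"
    show "t = 0"
    proof (rule ccontr)
      assume "t \<noteq> 0"
      then consider "t < 0" | "0 < t" by linarith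
      then have "pos pi q t \<noteq> pos pi q 0"
      proof cases
        case 1
        then show ?thesis using pos_strict_mono[of t 0 pi q] vp that t1(1) by force
      next
        case 2
        then show ?thesis using pos_strict_mono[of 0 t pi q] vp that t1(1) by force
      qed
      then show False using \<open>Z t\<close> by (simp add: Z_def)
    qed
  qed (simp add: Z_def)
  note pz = periodic_zeros[OF P shift win]
  have cis_pi_iff: "cis (pos pi q t) = - 1 \<longleftrightarrow> Z t" for t
    using cis_eq_close[of "pos pi q t" pi] conf[of t] by (auto simp: Z_def)
  have crosses: "crosses (curve pi q) south t \<longleftrightarrow> Z t" for t
  proof -
    have "vel pi q t \<noteq> 0" if "Z t"
      using flow_energy[of pi q t] that potpi by (auto simp: Z_def energy_def)
    then show ?thesis using cis_pi_iff by (auto simp: crosses_def curve_def south_def)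
  qed
  have per: "is_period (curve pi q) (4 * t1)"
    using two_turns_period[of pi q "- t1" t1] t1 mirror_pi(2)[of q t1] by simp
  have "minimal_period (curve pi q) (4 * t1)"
    unfolding minimal_period_def
  proof (intro conjI allI impI per)
    fix S assume S: "is_period (curve pi q) S"
    then have S0: "S > 0" and "curve pi q (0 + S) = curve pi q 0" unfolding is_period_def by blast+
    then have c: "cis (pos pi q S) = - 1" and v: "vel pi q S = q" by (auto simp: curve_def)
    then obtain n :: int where n: "S = of_int n * (2 * t1)" using cis_pi_iff pz(1) by auto
    \<comment> \<open>Periods are return times to \<open>pi\<close>, hence multiples of
      \<open>2 * t1\<close>. One such step reverses the velocity, so at least two are
      needed.\<close>
    have "n > 0" using S0 n t1(1) by (simp add: zero_less_mult_iff)
    moreover have "n \<noteq> 1" using n v half(2)[of 0] q by auto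
    ultimately have "real_of_int n \<ge> 2" by linarith
    then show "4 * t1 \<le> S" using n t1(1) mult_right_mono[of 2 "real_of_int n" "2 * t1"] by simp
  qed
  moreover have "\<exists>!\<xi>. \<xi> \<in> {\<xi>0..<\<xi>0 + 4 * t1 / 2} \<and> crosses (curve pi q) south \<xi>" for \<xi>0
    using pz(2)[of \<xi>0] by (simp add: crosses)
  ultimately show ?thesis by blast
qed

definition crosses_both :: "(real \<Rightarrow> cyl) \<Rightarrow> bool" where
  "crosses_both \<gamma> \<longleftrightarrow> (\<exists>T. minimal_period \<gamma> T \<and>
     (\<exists>\<xi>0. (\<exists>\<xi>\<in>{\<xi>0..\<xi>0 + T / 2}. crosses \<gamma> north \<xi>) \<and> (\<exists>\<xi>\<in>{\<xi>0..\<xi>0 + T / 2}. crosses \<gamma> south \<xi>)))"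

lemma crosses_both_shift:
  assumes "crosses_both \<gamma>"
  shows "crosses_both (\<lambda>t. \<gamma> (t + s))"
proof -
  obtain T a x y where T: "minimal_period \<gamma> T" and x: "x \<in> {a..a + T / 2}" "crosses \<gamma> north x"
    and y: "y \<in> {a..a + T / 2}" "crosses \<gamma> south y"
    using assms unfolding crosses_both_def by blast
  have "x - s \<in> {a - s..a - s + T / 2}" "crosses (\<lambda>t. \<gamma> (t + s)) north (x - s)"
    "y - s \<in> {a - s..a - s + T / 2}" "crosses (\<lambda>t. \<gamma> (t + s)) south (y - s)"
    using x y by (auto simp: crosses_def)
  then show ?thesis unfolding crosses_both_def minimal_period_shift using T by blast
qed

lemma crosses_both_reverse:
  assumes "crosses_both (curve x q)"
  shows "crosses_both (curve x (- q))"
proof -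
  have per: "is_period (curve x v) S \<Longrightarrow> is_period (curve x (- v)) S" for v S
    unfolding is_period_def curve_reverse
    by (metis (no_types, lifting) add_uminus_conv_diff diff_add_cancel minus_add_distrib)
  obtain T a t u where T: "minimal_period (curve x q) T" and t: "t \<in> {a..a + T / 2}" "crosses (curve x q) north t"
    and u: "u \<in> {a..a + T / 2}" "crosses (curve x q) south u"
    using assms unfolding crosses_both_def by blast
  have "minimal_period (curve x (- q)) T"
    using T per[of q] per[of "- q"] unfolding minimal_period_def by auto
  moreover have "- t \<in> {- a - T / 2..- a - T / 2 + T / 2}" "- u \<in> {- a - T / 2..- a - T / 2 + T / 2}"
    using t(1) u(1) by auto
  moreover have "crosses (curve x (- q)) north (- t)" "crosses (curve x (- q)) south (- u)"
    using t(2) u(2) by (auto simp: crosses_def curve_reverse case_prod_beta)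
  ultimately show ?thesis unfolding crosses_both_def by blast
qed

text \<open>The north pole is crossed at a time \<open>m\<close> between the successive crossings of
  the south pole at 0 and \<open>T\<close>, so \<open>m\<close> is within half a period of one of
  them; the interval is anchored accordingly.\<close>

lemma rotation_crosses_both:
  assumes q: "q > 0" "\<And>z. pot z < energy pi q"
  shows "crosses_both (curve pi q)"
proof -
  have v: "vel pi q t > 0" for t by (rule rotation(1)[OF q])
  obtain T where T: "T > 0" "pos pi q T = pi + 2 * pi" "is_period (curve pi q) T"
    using rotation(2)[OF q] by blast
  have "minimal_period (curve pi q) T"
    unfolding minimal_period_def
  proof (intro conjI allI impI T)
    fix S assume S: "is_period (curve pi q) S"
    then have S0: "S > 0" and "curve pi q (0 + S) = curve pi q 0" unfolding is_period_def by blast+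
    then have c: "cis (pos pi q S) = cis pi" by (auto simp: curve_def)
    have gt: "pos pi q 0 < pos pi q S" by (rule pos_strict_mono[OF S0 v])
    show "T \<le> S"
    proof (rule ccontr)
      assume "\<not> T \<le> S"
      then have "pos pi q S < pos pi q T" using pos_strict_mono[of S T pi q] v by simp
      then have "pos pi q S = pi" using cis_eq_close[OF c] gt T by simp
      then show False using gt by simp
    qed
  qed
  moreover have "\<exists>m\<ge>0. m \<le> T \<and> pos pi q m = 2 * pi"
    by (rule IVT') (use T sol_cont[OF sol_flow] in auto)
  then obtain m where m: "0 \<le> m" "m \<le> T" "pos pi q m = 2 * pi" by blast
  have "cis (pos pi q T) = - 1" unfolding T(2) cis_mult[symmetric] by simp
  then have south: "crosses (curve pi q) south 0" "crosses (curve pi q) south T"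
    using v[of T] q by (auto simp: crosses_def curve_def south_def)
  have north: "crosses (curve pi q) north m"
    using v[of m] m by (auto simp: crosses_def curve_def north_def)
  have "\<exists>a. (\<exists>\<xi>\<in>{a..a + T / 2}. crosses (curve pi q) north \<xi>) \<and> (\<exists>\<xi>\<in>{a..a + T / 2}. crosses (curve pi q) south \<xi>)"
  proof (cases "m \<le> T / 2")
    case True
    then show ?thesis using south(1) north m(1) T(1) by (intro exI[of _ 0] conjI bexI[of _ m] bexI[of _ 0]) auto
  next
    case False
    then show ?thesis using south(2) north m(2) T(1) by (intro exI[of _ m] conjI bexI[of _ m] bexI[of _ T]) auto
  qed
  ultimately show ?thesis unfolding crosses_both_def by blast
qed

text \<open>Both differences factor, for instance \<open>pot x - pot pi = (1 + cos x) * (h -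
  \<Omega> + \<mu> / 2 * (1 - cos x))\<close>, and the second factor is bounded below. This turns a
  small energy difference into a small distance from the pole.\<close>

lemma pot_gap:
  assumes "\<bar>\<mu>\<bar> < h - \<Omega>"
  shows "(h - \<Omega> - \<bar>\<mu>\<bar>) * (1 + cos x) \<le> pot x - pot pi" "(h - \<Omega> - \<bar>\<mu>\<bar>) * (1 - cos x) \<le> pot 0 - pot x"
proof -
  have c: "0 \<le> 1 + cos x" "0 \<le> 1 - cos x" using cos_ge_minus_one[of x] cos_le_one[of x] by linarith+
  have "\<bar>\<mu> / 2 * (1 - cos x)\<bar> \<le> \<bar>\<mu>\<bar>"
    using c mult_left_mono[of "1 - cos x" 2 "\<bar>\<mu>\<bar> / 2"] by (simp add: abs_mult)
  then have "h - \<Omega> - \<bar>\<mu>\<bar> \<le> h - \<Omega> + \<mu> / 2 * (1 - cos x)" by linarith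
  from mult_right_mono[OF this c(1)]
  show "(h - \<Omega> - \<bar>\<mu>\<bar>) * (1 + cos x) \<le> pot x - pot pi"
    by (simp add: pot_def power2_eq_square field_simps)
  have "\<bar>\<mu> / 2 * (1 + cos x)\<bar> \<le> \<bar>\<mu>\<bar>"
    using c mult_left_mono[of "1 + cos x" 2 "\<bar>\<mu>\<bar> / 2"] by (simp add: abs_mult)
  then have "h - \<Omega> - \<bar>\<mu>\<bar> \<le> h - \<Omega> - \<mu> / 2 * (1 + cos x)" by linarith
  from mult_right_mono[OF this c(2)]
  show "(h - \<Omega> - \<bar>\<mu>\<bar>) * (1 - cos x) \<le> pot 0 - pot x"
    by (simp add: pot_def power2_eq_square field_simps)
qed

lemma subcritical_well:
  assumes "\<bar>\<mu>\<bar> < h - \<Omega>"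
  shows "well 0 pi (2 * pi)"
proof -
  have p: "h - \<Omega> - \<mu> * cos x > 0" for x
  proof -
    have "\<mu> * cos x \<le> \<bar>\<mu>\<bar> * \<bar>cos x\<bar>" by (metis abs_ge_self abs_mult)
    also have "\<dots> \<le> \<bar>\<mu>\<bar>" using mult_left_mono[of "\<bar>cos x\<bar>" 1 "\<bar>\<mu>\<bar>"] by simp
    finally show ?thesis using assms by simp
  qed
  have "force z > 0" if "0 < z" "z < pi" for z
    using sin_gt_zero[OF that] p[of z] by (simp add: force_def)
  moreover have "force z < 0" if "pi < z" "z < 2 * pi" for z
    using sin_lt_zero[OF that] p[of z] by (simp add: force_def mult_neg_pos)
  ultimately show ?thesis by (simp add: well_def)
qed

end

lemma set_limit_reverse:
  assumes "set_limit F S flt"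
  shows "set_limit (\<lambda>r. (\<lambda>(z, p). (z, - p)) ` F r) ((\<lambda>(z, p). (z, - p)) ` S) flt"
proof -
  define R :: "cyl \<Rightarrow> cyl" where "R = (\<lambda>(z, p). (z, - p))"
  have d: "dist (R X) (R Y) = dist X Y" for X Y
    by (cases X; cases Y) (simp add: R_def dist_Pair_Pair dist_minus)
  have mono: "R ` A \<subseteq> (\<Union>x\<in>R ` B. ball x \<epsilon>)" if "A \<subseteq> (\<Union>x\<in>B. ball x \<epsilon>)" for A B \<epsilon>
  proof
    fix Y assume "Y \<in> R ` A"
    then obtain X where X: "X \<in> A" "Y = R X" by blast
    then obtain x where "x \<in> B" "dist x X < \<epsilon>" using \<open>A \<subseteq> _\<close> by auto
    then show "Y \<in> (\<Union>x\<in>R ` B. ball x \<epsilon>)" using X d by (intro UN_I[of "R x"]) auto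
  qed
  have "set_limit (\<lambda>r. R ` F r) (R ` S) flt"
    unfolding set_limit_def
  proof (intro allI impI)
    fix \<epsilon> :: real assume "\<epsilon> > 0"
    then have "\<forall>\<^sub>F r in flt. F r \<subseteq> (\<Union>x\<in>S. ball x \<epsilon>) \<and> S \<subseteq> (\<Union>x\<in>F r. ball x \<epsilon>)"
      using assms by (simp add: set_limit_def)
    then show "\<forall>\<^sub>F r in flt. R ` F r \<subseteq> (\<Union>x\<in>R ` S. ball x \<epsilon>) \<and> R ` S \<subseteq> (\<Union>x\<in>R ` F r. ball x \<epsilon>)"
      by (rule eventually_mono) (use mono in blast)
  qed
  then show ?thesis by (simp add: R_def)
qed

context profile_ode
begin

lemma orb_pi_iff:
  assumes w: "well 0 pi (2 * pi)" and e: "energy pi q \<le> pot 0" and q: "q \<noteq> 0"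
    and X: "X \<in> orb pi q"
  obtains x v where "X = (cis x, v)" "0 < x" "x < 2 * pi" "energy x v = energy pi q"
proof -
  obtain t where t: "X = curve pi q t" using X by (auto simp: orb_def)
  have p2: "pot (2 * pi) = pot 0" "force 0 = 0" "force (2 * pi) = 0" by (simp_all add: pot_def force_def)
  have "0 < pos pi q t" "pos pi q t < 2 * pi"
    by (rule well_confined[OF w q]; use e p2 in auto)+
  then show thesis using that[of "pos pi q t" "vel pi q t"] t flow_energy[of pi q t] by (auto simp: curve_def)
qed

text \<open>Each such point lies on an orbit through \<open>pi\<close>, and the energy fixes the
  speed there up to sign.\<close>

lemma orb_pi_mem:
  assumes w: "well 0 pi (2 * pi)" and x: "0 < x" "x < 2 * pi" and e: "energy x v = energy pi q" and q: "q \<noteq> 0"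
  shows "(cis x, v) \<in> orb pi q \<union> orb pi (- q)"
proof -
  have p2: "force 0 = 0" "force pi = 0" "force (2 * pi) = 0" by (simp_all add: force_def)
  have "v \<noteq> 0 \<or> force x \<noteq> 0"
  proof (rule ccontr)
    assume "\<not> ?thesis"
    then have "v = 0" "force x = 0" by auto
    then have "x = pi" using w x unfolding well_def by (metis less_irrefl linorder_neqE_linordered_idom)
    then show False using e q \<open>v = 0\<close> by (simp add: energy_def)
  qed
  then obtain q' where q': "orb x v = orb pi q'"
    using well_orb[OF w less_imp_le[OF x(1)] less_imp_le[OF x(2)] _ p2] by blast
  then have "q'\<^sup>2 = q\<^sup>2" using orb_eq_energy[OF q'] e by (simp add: energy_def)
  then have "q' = q \<or> q' = - q" by (simp add: power2_eq_iff)
  then show ?thesis using orb_mem[of x v] q' by auto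
qed

text \<open>At or above the barrier height the velocity cannot change sign on the way to
  \<open>pi\<close>, which selects one of the two orbits.\<close>

lemma orb_pi_mem_pos:
  assumes w: "well 0 pi (2 * pi)" and x: "0 < x" "x < 2 * pi" and e: "energy x v = energy pi q" and q: "q > 0" "v > 0"
    and E: "pot 0 \<le> energy pi q"
  shows "(cis x, v) \<in> orb pi q"
proof -
  have p2: "pot (2 * pi) = pot 0" by (simp add: pot_def)
  have "orb x v = orb pi (sqrt (2 * (energy x v - pot pi)))"
  proof (rule orb_pass[OF q(2)])
    fix z assume "z \<in> closed_segment x pi"
    then have "0 < z" "z < 2 * pi" using x by (auto simp: closed_segment_eq_real_ivl split: if_splits)
    then show "pot z < energy x v" using well_pot_inside[OF w, of z "energy x v"] E e p2 by simp
  qed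
  also have "2 * (energy x v - pot pi) = q\<^sup>2" using e by (simp add: energy_def)
  finally show ?thesis using orb_mem[of x v] q(1) by simp
qed

text \<open>Changing the speed at a fixed angle moves a point to another energy level. Subadditivity
  of the square root bounds the displacement by the energy difference alone, uniformly along an
  orbit.\<close>

lemma adjust_speed:
  assumes "0 \<le> v\<^sup>2 + 2 * c"
  obtains v' where "energy x v' = energy x v + c" "dist v v' \<le> sqrt (2 * \<bar>c\<bar>)"
    "0 < v \<Longrightarrow> 0 < v\<^sup>2 + 2 * c \<Longrightarrow> 0 < v'"
proof -
  define v' where "v' = (if v \<ge> 0 then 1 else -1) * sqrt (v\<^sup>2 + 2 * c)"
  have "v'\<^sup>2 = v\<^sup>2 + 2 * c" using assms by (simp add: v'_def power_mult_distrib)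
  then have "energy x v' = energy x v + c" by (simp add: energy_def add_divide_distrib)
  moreover have "dist v v' \<le> sqrt (2 * \<bar>c\<bar>)"
  proof -
    have "sqrt (v\<^sup>2 + 2 * c) \<le> sqrt (v\<^sup>2 + 2 * \<bar>c\<bar>)" "sqrt (v\<^sup>2) \<le> sqrt ((v\<^sup>2 + 2 * c) + 2 * \<bar>c\<bar>)"
      by (intro real_sqrt_le_mono; simp)+
    moreover have "sqrt (v\<^sup>2 + 2 * \<bar>c\<bar>) \<le> sqrt (v\<^sup>2) + sqrt (2 * \<bar>c\<bar>)"
      "sqrt ((v\<^sup>2 + 2 * c) + 2 * \<bar>c\<bar>) \<le> sqrt (v\<^sup>2 + 2 * c) + sqrt (2 * \<bar>c\<bar>)"
      using assms by (intro sqrt_add_le_add_sqrt; simp)+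
    ultimately have "\<bar>\<bar>v\<bar> - sqrt (v\<^sup>2 + 2 * c)\<bar> \<le> sqrt (2 * \<bar>c\<bar>)" unfolding real_sqrt_abs by linarith
    then show ?thesis by (cases "v \<ge> 0") (simp_all add: v'_def dist_real_def)
  qed
  moreover have "0 < v \<Longrightarrow> 0 < v\<^sup>2 + 2 * c \<Longrightarrow> 0 < v'" by (simp add: v'_def)
  ultimately show thesis using that by blast
qed

text \<open>There is a single well, whose barriers 0 and \<open>2 * pi\<close> are the same point of
  the cylinder. The limits of the families are obtained by moving points vertically between energy
  levels; this fails only close to the north pole, where the orbits are near each other
  anyway.\<close>

theorem subcritical_portrait:
  assumes a: "\<bar>\<mu>\<bar> < h - \<Omega>"
  shows "\<exists>H\<^sub>1 H\<^sub>2 B U\<^sub>1 U\<^sub>2.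
           H\<^sub>1 \<noteq> H\<^sub>2 \<and> connections h \<Omega> \<mu> north north = {H\<^sub>1, H\<^sub>2} \<and>
           phase_portrait h \<Omega> \<mu> {north, south} {H\<^sub>1, H\<^sub>2} [B] [U\<^sub>1, U\<^sub>2] \<and>
           (\<forall>\<gamma>. trajectory h \<Omega> \<mu> \<gamma> \<and> range \<gamma> = H\<^sub>1 \<longrightarrow>
              (\<exists>!\<xi>. crosses \<gamma> south \<xi>) \<and> (\<forall>\<xi>. crosses \<gamma> south \<xi> \<longrightarrow> snd (\<gamma> \<xi>) > 0)) \<and>
           (\<forall>\<gamma>. trajectory h \<Omega> \<mu> \<gamma> \<and> range \<gamma> = H\<^sub>2 \<longrightarrow>
              (\<exists>!\<xi>. crosses \<gamma> south \<xi>) \<and> (\<forall>\<xi>. crosses \<gamma> south \<xi> \<longrightarrow> snd (\<gamma> \<xi>) < 0)) \<and>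
           set_limit B {south} (at_right 0) \<and> set_limit B (H\<^sub>1 \<union> H\<^sub>2) (at_left 1) \<and>
           set_limit U\<^sub>1 H\<^sub>1 (at_right 0) \<and> set_limit U\<^sub>2 H\<^sub>2 (at_right 0) \<and>
           \<not> bounded (snd ` (\<Union>r\<in>{0<..<1}. U\<^sub>1 r)) \<and> \<not> bounded (snd ` (\<Union>r\<in>{0<..<1}. U\<^sub>2 r)) \<and>
           (\<forall>r\<in>{0<..<1}. \<forall>\<gamma>. trajectory h \<Omega> \<mu> \<gamma> \<and> range \<gamma> = B r \<longrightarrow>
              (\<exists>T. minimal_period \<gamma> T \<and>
                 (\<forall>\<xi>\<^sub>0. \<exists>!\<xi>. \<xi> \<in> {\<xi>\<^sub>0..<\<xi>\<^sub>0 + T / 2} \<and> crosses \<gamma> south \<xi>))) \<and>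
           (\<forall>r\<in>{0<..<1}. \<forall>\<gamma>. trajectory h \<Omega> \<mu> \<gamma> \<and> range \<gamma> \<in> {U\<^sub>1 r, U\<^sub>2 r} \<longrightarrow>
              (\<exists>T. minimal_period \<gamma> T \<and>
                 (\<exists>\<xi>\<^sub>0. (\<exists>\<xi>\<in>{\<xi>\<^sub>0..\<xi>\<^sub>0 + T / 2}. crosses \<gamma> north \<xi>) \<and>
                       (\<exists>\<xi>\<in>{\<xi>\<^sub>0..\<xi>\<^sub>0 + T / 2}. crosses \<gamma> south \<xi>))))"
proof -
  have w: "well 0 pi (2 * pi)" by (rule subcritical_well[OF a])
  have f0: "force 0 = 0" "force pi = 0" "force (2 * pi) = 0" by (simp_all add: force_def)
  have p2: "pot (2 * pi) = pot 0" by (simp add: pot_def)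
  have lt: "pot pi < pot 0" using well_pot_left[OF w, of pi] by simp
  have ne: "force y \<noteq> 0" if "0 < y" "y < 2 * pi" "y \<noteq> pi" for y
    using w that unfolding well_def by (metis less_irrefl linorder_neqE_linordered_idom)
  define K where "K = escape pi 0"
  note eK = escape[OF lt, folded K_def]
  have K0: "K \<noteq> 0" using eK(1) by simp
  have pmax: "pot z \<le> pot 0" for z
  proof -
    obtain y where y: "0 \<le> y" "y < 2 * pi" "cis y = cis z" using cis_representative[of 0 z] by auto
    then show ?thesis using well_pot_inside[OF w, of y "pot 0"] pot_cis[OF y(3)] p2 by (cases "y = 0") auto
  qed
  have sup: "pot z < energy pi q" if "K < q" for q z
    using pmax[of z] eK(5)[of q] that by auto
  note r3 = rotations_up_curve[OF eK(1) sup]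
  note l1 = well_librations[OF w order_refl _ lt, folded K_def, unfolded p2, OF order_refl]
  have lib: "orb pi (- q) = orb pi q" if "0 < q" "q < K" for q
    using well_libration(2)[OF w that(1)] eK(3)[of q] that p2 by simp
  have E: "equilibria h \<Omega> \<mu> = {north, south}"
  proof (intro equalityI subsetI)
    fix X assume "X \<in> equilibria h \<Omega> \<mu>"
    then obtain x where x: "X = (cis x, 0)" "force x = 0" by (auto simp: equilibria_eq)
    obtain y where y: "0 \<le> y" "y < 0 + 2 * pi" "cis y = cis x" using cis_representative by blast
    have "force y = 0" using force_cis[OF y(3)] x by simp
    then have "y = 0 \<or> y = pi" using ne[of y] y by force
    then show "X \<in> {north, south}" using x y(3)[symmetric] by (auto simp: north_def south_def)
  next
    fix X :: cyl assume X: "X \<in> {north, south}"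
    have "(cis x, 0) \<in> equilibria h \<Omega> \<mu>" if "force x = 0" for x
      using that by (simp add: equilibria_eq)
    from this[OF f0(1)] this[OF f0(2)] show "X \<in> equilibria h \<Omega> \<mu>"
      using X by (auto simp: north_def south_def)
  qed
  have J: "joins pi K north north" "joins pi (- K) north north"
    using well_joins[OF w eK(1)] eK(2) p2 f0 by (auto simp: north_def)
  define H1 H2 where "H1 = orb pi K" and "H2 = orb pi (- K)"
  define B U1 U2 where "B = librations pi K" and "U1 = rotations_up pi K" and "U2 = rotations_down pi K"
  have velK: "vel pi K t > 0" for t
    by (rule well_vel_pos[OF w eK(1)]) (use eK(2) p2 f0 in auto)
  have posK: "0 < pos pi K t" "pos pi K t < 2 * pi" for t
    by (rule well_confined[OF w K0]; use eK(2) p2 f0 in auto)+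
  have mono: "pos pi K s < pos pi K t" if "s < t" for s t
    by (rule pos_strict_mono[OF that velK])
  have H12: "H1 \<noteq> H2"
  proof
    assume "H1 = H2"
    then have "(cis pi, - K) \<in> orb pi K" using orb_mem[of pi "- K"] by (simp add: H1_def H2_def)
    then obtain t where "vel pi K t = - K" by (auto simp: orb_def curve_def)
    then show False using velK[of t] eK(1) by simp
  qed
  have conn: "H1 \<in> connections h \<Omega> \<mu> north north" "H2 \<in> connections h \<Omega> \<mu> north north"
    unfolding H1_def H2_def orb_connection_iff using J K0 by simp_all
  then have CC: "\<exists>P Q. S \<in> connections h \<Omega> \<mu> P Q" if "S \<in> {H1, H2}" for S
    using that by fast
  have covpi: "orb pi q \<in> {H1, H2} \<union> (\<Union>F\<in>set ([B] @ [U1, U2]). F ` {0<..<1})" if "q \<noteq> 0" for q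
  proof -
    consider "\<bar>q\<bar> < K" | "\<bar>q\<bar> = K" | "K < \<bar>q\<bar>" by linarith
    then show ?thesis
    proof cases
      case 1
      then show ?thesis using l1(3)[of q] that by (auto simp: B_def)
    next
      case 2
      then have "q = K \<or> q = - K" by auto
      then show ?thesis by (auto simp: H1_def H2_def)
    next
      case 3
      then show ?thesis using rotations_up_cover[OF 3 eK(1), of pi] by (auto simp: U1_def U2_def)
    qed
  qed
  have cov: "orb x v \<in> {H1, H2} \<union> (\<Union>F\<in>set ([B] @ [U1, U2]). F ` {0<..<1})" if nz: "v \<noteq> 0 \<or> force x \<noteq> 0" for x v
  proof -
    obtain y where y: "0 \<le> y" "y < 0 + 2 * pi" "cis y = cis x" using cis_representative by blast
    have nz': "v \<noteq> 0 \<or> force y \<noteq> 0" using nz force_cis[OF y(3)] by simp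
    have o: "orb x v = orb y v" using orb_cis[OF y(3)] by simp
    obtain q where "q \<noteq> 0" "orb y v = orb pi q" using well_orb[OF w y(1) _ nz'] f0 y(2) by auto
    then show ?thesis using covpi o by simp
  qed
  have disj: "sorted_wrt (\<lambda>F G. F ` {0<..<1} \<inter> G ` {0<..<1} = {}) ([B] @ [U1, U2])"
    using rotations_up_disjoint[OF eK(1) sup] librations_rotations_up_disjoint[OF lt lt order_refl, folded K_def]
    by (simp add: B_def U1_def U2_def)
  note pp = phase_portrait_intro[OF E cov CC _ _ _ disj]
  have 1: "phase_portrait h \<Omega> \<mu> {north, south} {H1, H2} [B] [U1, U2]"
    by (rule pp(1)) (use l1 r3 in \<open>auto simp: B_def U1_def U2_def\<close>)
  have "connections h \<Omega> \<mu> north north = {S \<in> {H1, H2}. S \<in> connections h \<Omega> \<mu> north north}"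
    by (rule pp(2)) (use l1 r3 in \<open>auto simp: B_def U1_def U2_def\<close>)
  also have "\<dots> = {H1, H2}" using conn by fast
  finally have 2: "connections h \<Omega> \<mu> north north = {H1, H2}" .

  \<comment> \<open>Crossings of the poles\<close>
  have southK: "cis (pos pi K t) = - 1 \<longleftrightarrow> t = 0" for t
  proof
    assume "cis (pos pi K t) = - 1"
    then have "pos pi K t = pos pi K 0" using cis_eq_close[of "pos pi K t" pi] posK[of t] by simp
    then show "t = 0" using mono[of t 0] mono[of 0 t] by (cases t "0::real" rule: linorder_cases) auto
  qed simp
  have 3: "(\<exists>!\<xi>. crosses \<gamma> south \<xi>) \<and> (\<forall>\<xi>. crosses \<gamma> south \<xi> \<longrightarrow> snd (\<gamma> \<xi>) > 0)"
    if \<gamma>: "trajectory h \<Omega> \<mu> \<gamma>" "range \<gamma> = H1" for \<gamma>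
  proof -
    obtain s where s: "\<gamma> = (\<lambda>t. curve pi K (t + s))" using trajectory_orb[OF \<gamma>(1)] \<gamma>(2) H1_def by blast
    have c: "crosses \<gamma> south t \<longleftrightarrow> t = - s" for t
      using southK[of "t + s"] velK[of "t + s"] by (auto simp: s crosses_def curve_def south_def)
    show ?thesis unfolding c using eK(1) by (auto simp: s curve_def)
  qed
  have 4: "(\<exists>!\<xi>. crosses \<gamma> south \<xi>) \<and> (\<forall>\<xi>. crosses \<gamma> south \<xi> \<longrightarrow> snd (\<gamma> \<xi>) < 0)"
    if \<gamma>: "trajectory h \<Omega> \<mu> \<gamma>" "range \<gamma> = H2" for \<gamma>
  proof -
    obtain s where s: "\<gamma> = (\<lambda>t. curve pi (- K) (t + s))" using trajectory_orb[OF \<gamma>(1)] \<gamma>(2) H2_def by blast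
    have c: "crosses \<gamma> south t \<longleftrightarrow> t = - s" for t
      using southK[of "- (t + s)"] velK[of "- (t + s)"]
      by (auto simp: s crosses_def curve_def south_def flow_reverse)
    show ?thesis unfolding c using eK(1) by (auto simp: s curve_def)
  qed
  have 5: "\<exists>T. minimal_period \<gamma> T \<and> (\<forall>\<xi>0. \<exists>!\<xi>. \<xi> \<in> {\<xi>0..<\<xi>0 + T / 2} \<and> crosses \<gamma> south \<xi>)"
    if r: "r \<in> {0<..<1}" and \<gamma>: "trajectory h \<Omega> \<mu> \<gamma>" "range \<gamma> = B r" for r \<gamma>
  proof -
    define q where "q = K * r"
    have q: "0 < q" "q < K" using r eK(1) by (auto simp: q_def)
    obtain s where s: "\<gamma> = (\<lambda>t. curve pi q (t + s))"
      using trajectory_orb[OF \<gamma>(1), of pi q] \<gamma>(2) by (auto simp: B_def librations_def q_def)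
    have e: "energy pi q < pot 0" using eK(3)[of q] q by simp
    obtain T where T: "minimal_period (curve pi q) T"
      "\<And>\<xi>0. \<exists>!\<xi>. \<xi> \<in> {\<xi>0..<\<xi>0 + T / 2} \<and> crosses (curve pi q) south \<xi>"
      using libration_pi_crossings[OF q(1) e ne] by blast
    have c: "crosses \<gamma> south t \<longleftrightarrow> crosses (curve pi q) south (t + s)" for t by (simp add: s crosses_def)
    have "\<exists>!\<xi>. \<xi> \<in> {\<xi>0..<\<xi>0 + T / 2} \<and> crosses \<gamma> south \<xi>" for \<xi>0
    proof -
      obtain t where t: "t \<in> {\<xi>0 + s..<\<xi>0 + s + T / 2}" "crosses (curve pi q) south t"
        and u: "\<And>t'. t' \<in> {\<xi>0 + s..<\<xi>0 + s + T / 2} \<Longrightarrow> crosses (curve pi q) south t' \<Longrightarrow> t' = t"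
        using T(2)[of "\<xi>0 + s"] by blast
      show ?thesis
      proof (rule ex1I[of _ "t - s"])
        show "t - s \<in> {\<xi>0..<\<xi>0 + T / 2} \<and> crosses \<gamma> south (t - s)" using t by (auto simp: c)
        fix \<xi> assume "\<xi> \<in> {\<xi>0..<\<xi>0 + T / 2} \<and> crosses \<gamma> south \<xi>"
        then have "\<xi> + s = t" by (intro u) (auto simp: c)
        then show "\<xi> = t - s" by simp
      qed
    qed
    then show ?thesis using T(1) by (auto simp: s minimal_period_shift)
  qed
  have cb: "crosses_both \<gamma>"
    if r: "r \<in> {0<..<1}" and \<gamma>: "trajectory h \<Omega> \<mu> \<gamma>" "range \<gamma> \<in> {U1 r, U2 r}" for r \<gamma>
  proof -
    define q where "q = ray K r"
    have q: "K < q" using ray_gt[of r K] r by (simp add: q_def)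
    then have q0: "q > 0" using eK(1) by simp
    note c = rotation_crosses_both[OF q0 sup[OF q]]
    from \<gamma>(2) show ?thesis
    proof
      assume "range \<gamma> = U1 r"
      then obtain s where "\<gamma> = (\<lambda>t. curve pi q (t + s))"
        using trajectory_orb[OF \<gamma>(1), of pi q] by (auto simp: U1_def rotations_up_def q_def)
      then show ?thesis using crosses_both_shift[OF c] by simp
    next
      assume "range \<gamma> \<in> {U2 r}"
      then obtain s where "\<gamma> = (\<lambda>t. curve pi (- q) (t + s))"
        using trajectory_orb[OF \<gamma>(1), of pi "- q"] by (auto simp: U2_def rotations_down_def q_def)
      then show ?thesis using crosses_both_shift[OF crosses_both_reverse[OF c]] by simp
    qed
  qed

  \<comment> \<open>Limits of the families in Hausdorff distance\<close>
  define \<delta> where "\<delta> = h - \<Omega> - \<bar>\<mu>\<bar>"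
  have \<delta>: "\<delta> > 0" using a by (simp add: \<delta>_def)
  note gap = pot_gap[OF a, folded \<delta>_def]
  have 6: "set_limit B {south} (at_right 0)"
  proof (rule set_limitI)
    show "((\<lambda>r. sqrt ((K * r)\<^sup>2 / \<delta>) + K * r) \<longlongrightarrow> 0) (at_right 0)"
    proof -
      have "((\<lambda>r. sqrt ((K * r)\<^sup>2 / \<delta>) + K * r) \<longlongrightarrow> sqrt ((K * 0)\<^sup>2 / \<delta>) + K * 0) (at_right 0)"
        using \<delta> by (intro tendsto_intros) auto
      then show ?thesis by simp
    qed
    have "\<forall>\<^sub>F r::real in at_right 0. r \<in> {0<..<1}" by (rule eventually_at_right_real) simp
    then show "\<forall>\<^sub>F r in at_right 0. (\<forall>X\<in>B r. \<exists>Y\<in>{south}. dist X Y \<le> sqrt ((K * r)\<^sup>2 / \<delta>) + K * r) \<and>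
        (\<forall>Y\<in>{south}. \<exists>X\<in>B r. dist X Y \<le> sqrt ((K * r)\<^sup>2 / \<delta>) + K * r)"
    proof eventually_elim
      case (elim r)
      define q where "q = K * r"
      have q: "0 < q" "q < K" using elim eK(1) by (auto simp: q_def)
      \<comment> \<open>Kinetic energy and potential energy above the bottom are each at most
        \<open>q\<^sup>2 / 2\<close>; \<open>pot_gap\<close> converts the latter into a bound for
        the angle.\<close>
      have d: "dist X south \<le> sqrt (q\<^sup>2 / \<delta>) + q" if X: "X \<in> B r" for X
      proof -
        obtain t where t: "X = (cis (pos pi q t), vel pi q t)"
          using X by (auto simp: B_def librations_def orb_def curve_def q_def)
        define x v where "x = pos pi q t" and "v = vel pi q t"
        have e: "v\<^sup>2 / 2 + (pot x - pot pi) = q\<^sup>2 / 2"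
          using flow_energy[of pi q t] by (simp add: x_def v_def energy_def)
        have n: "0 \<le> \<delta> * (1 + cos x)" using \<delta> cos_ge_minus_one[of x] by (intro mult_nonneg_nonneg) linarith+
        have "v\<^sup>2 \<le> q\<^sup>2" "2 * (\<delta> * (1 + cos x)) \<le> q\<^sup>2" using e gap(1)[of x] n zero_le_power2[of v] by linarith+
        then have "\<bar>v\<bar> \<le> q" "2 * (1 + cos x) \<le> q\<^sup>2 / \<delta>"
          using q \<delta> abs_le_square_iff[of v q] by (simp, simp add: pos_le_divide_eq mult.commute mult.left_commute)
        then have "dist (cis x) (- 1) \<le> sqrt (q\<^sup>2 / \<delta>)" "dist v 0 \<le> q"
          unfolding dist_cis_minus_1 by (auto simp: dist_real_def)
        then show ?thesis using dist_Pair_le[of "cis x" v "- 1" 0] t by (simp add: south_def x_def v_def)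
      qed
      moreover have "(cis pi, q) \<in> B r" using orb_mem[of pi q] by (simp add: B_def librations_def q_def)
      ultimately show ?case unfolding q_def by blast
    qed
  qed
  \<comment> \<open>One modulus for all limits at the homoclinic orbits, in terms of the energy
    difference \<open>d\<close>: \<open>sqrt (2 * d)\<close> for a change of speed,
    \<open>sqrt (2 * d / \<delta>)\<close> for each of two distances from the north pole,
    \<open>sqrt d\<close> for a point taken close to that pole.\<close>
  define \<rho> where "\<rho> d = 2 * sqrt (2 * d / \<delta>) + (sqrt (2 * d) + sqrt d)" for d
  have \<rho>0: "((\<lambda>r. \<rho> (f r)) \<longlongrightarrow> 0) flt" if "(f \<longlongrightarrow> 0) flt" for f flt
  proof -
    have "((\<lambda>r. 2 * sqrt (2 * f r / \<delta>) + (sqrt (2 * f r) + sqrt (f r))) \<longlongrightarrow>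
        2 * sqrt (2 * 0 / \<delta>) + (sqrt (2 * 0) + sqrt 0)) flt"
      using \<delta> that by (intro tendsto_intros) auto
    then show ?thesis by (simp add: \<rho>_def)
  qed
  have \<rho>ge: "sqrt (2 * d) \<le> \<rho> d" "sqrt (2 * d) + sqrt d \<le> \<rho> d" "2 * sqrt (2 * d / \<delta>) + sqrt (2 * d) \<le> \<rho> d" if "d \<ge> 0" for d
    using that \<delta> by (auto simp: \<rho>_def)
  have energy_pi: "energy pi q = pot 0 - (K\<^sup>2 - q\<^sup>2) / 2" for q
  proof -
    have "K\<^sup>2 / 2 + pot pi = pot 0" using eK(2) by (simp add: energy_def)
    then show ?thesis unfolding energy_def by (simp add: field_simps)
  qed
  have H: "(cis x, v) \<in> H1 \<union> H2" if "0 < x" "x < 2 * pi" "energy x v = pot 0" for x v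
    using orb_pi_mem[OF w that(1,2), of v K] that(3) eK(2) K0 by (simp add: H1_def H2_def)
  have H1: "(cis x, v) \<in> H1" if "0 < x" "x < 2 * pi" "energy x v = pot 0" "v > 0" for x v
    using orb_pi_mem_pos[OF w that(1,2), of v K] that(3,4) eK(1,2) by (simp add: H1_def)
  have 7: "set_limit B (H1 \<union> H2) (at_left 1)"
  proof (rule set_limitI)
    define f where "f r = (K\<^sup>2 - (K * r)\<^sup>2) / 2" for r
    have "((\<lambda>r. (K\<^sup>2 - (K * r)\<^sup>2) / 2) \<longlongrightarrow> (K\<^sup>2 - (K * 1)\<^sup>2) / 2) (at_left 1)"
      by (intro tendsto_intros) auto
    then have "(f \<longlongrightarrow> 0) (at_left 1)" by (simp add: f_def[abs_def])
    then show "((\<lambda>r. \<rho> (f r)) \<longlongrightarrow> 0) (at_left 1)" by (rule \<rho>0)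
    have "\<forall>\<^sub>F r::real in at_left 1. r \<in> {0<..<1}" by (rule eventually_at_left_real) simp
    then show "\<forall>\<^sub>F r in at_left 1. (\<forall>X\<in>B r. \<exists>Y\<in>H1 \<union> H2. dist X Y \<le> \<rho> (f r)) \<and>
        (\<forall>Y\<in>H1 \<union> H2. \<exists>X\<in>B r. dist X Y \<le> \<rho> (f r))"
    proof eventually_elim
      case (elim r)
      define q d where "q = K * r" and "d = f r"
      have q: "0 < q" "q < K" using elim eK(1) by (auto simp: q_def)
      have d: "energy pi q = pot 0 - d" by (simp add: energy_pi f_def d_def q_def)
      have d0: "d > 0" using eK(3)[of q] d q by simp
      have Br: "B r = orb pi q" by (simp add: B_def librations_def q_def)
      show ?case unfolding d_def[symmetric]
      proof (intro conjI ballI)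
        fix X assume "X \<in> B r"
        then obtain x v where x: "X = (cis x, v)" "0 < x" "x < 2 * pi" "energy x v = pot 0 - d"
          using orb_pi_iff[OF w, of q X] d d0 q unfolding Br by auto
        have "0 \<le> v\<^sup>2 + 2 * d" using d0 by simp
        then obtain v' where v': "energy x v' = energy x v + d" "dist v v' \<le> sqrt (2 * \<bar>d\<bar>)"
          by (rule adjust_speed[where x = x])
        have "(cis x, v') \<in> H1 \<union> H2" by (rule H[OF x(2,3)]) (use x(4) v'(1) in simp)
        moreover have "dist X (cis x, v') \<le> \<rho> d"
          using dist_Pair_le[of "cis x" v "cis x" v'] \<rho>ge(1)[of d] d0 x(1) v'(2) by simp
        ultimately show "\<exists>Y\<in>H1 \<union> H2. dist X Y \<le> \<rho> d" by blast
      next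
        fix Y assume "Y \<in> H1 \<union> H2"
        then obtain x v where x: "Y = (cis x, v)" "0 < x" "x < 2 * pi" "energy x v = pot 0"
          using orb_pi_iff[OF w, of K Y] orb_pi_iff[OF w, of "- K" Y] eK(2) K0 unfolding H1_def H2_def by auto
        show "\<exists>X\<in>B r. dist X Y \<le> \<rho> d"
        proof (cases "v\<^sup>2 \<ge> 2 * d")
          case True
          then have "0 \<le> v\<^sup>2 + 2 * (- d)" by simp
          then obtain v' where v': "energy x v' = energy x v + - d" "dist v v' \<le> sqrt (2 * \<bar>- d\<bar>)"
            by (rule adjust_speed[where x = x])
          have "energy x v' = energy pi q" using x(4) v'(1) d by simp
          then have "(cis x, v') \<in> B r" using orb_pi_mem[OF w x(2,3), of v' q] q lib[of q] by (auto simp: Br)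
          moreover have "dist (cis x, v') Y \<le> \<rho> d"
            using dist_Pair_le[of "cis x" v' "cis x" v] \<rho>ge(1)[of d] d0 x(1) v'(2) by (simp add: dist_commute)
          ultimately show ?thesis by blast
        next
          case False
          then have v: "v\<^sup>2 < 2 * d" by simp
          have "pot pi \<le> pot 0 - d" using d zero_le_power2[of q] unfolding energy_def by linarith
          then have "\<exists>y\<ge>0. y \<le> pi \<and> pot y = pot 0 - d"
            by (intro IVT2') (use d0 continuous_pot in auto)
          then obtain y where y: "0 \<le> y" "y \<le> pi" "pot y = pot 0 - d" by blast
          have "y \<noteq> 0" using y d0 by auto
          then have y': "0 < y" "y < 2 * pi" using y by auto
          have "(cis y, 0) \<in> B r"
            using orb_pi_mem[OF w y', of 0 q] q lib[of q] y(3) d by (auto simp: Br energy_def)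
          moreover have near: "dist (cis z) 1 \<le> sqrt (2 * d / \<delta>)" if "pot 0 - pot z \<le> d" for z
          proof -
            have "\<delta> * (1 - cos z) \<le> d" using gap(2)[of z] that by linarith
            then have "2 * (1 - cos z) \<le> 2 * d / \<delta>" using \<delta> by (simp add: field_simps)
            then show ?thesis unfolding dist_cis_1 by (rule real_sqrt_le_mono)
          qed
          have "dist (cis y) (cis x) \<le> dist (cis y) 1 + dist (cis x) 1"
            by (rule dist_triangle2)
          then have "dist (cis y) (cis x) \<le> 2 * sqrt (2 * d / \<delta>)"
            using near[of y] near[of x] y(3) x(4) v by (simp add: energy_def)
          moreover have "dist 0 v \<le> sqrt (2 * d)"
            using real_le_rsqrt[of "\<bar>v\<bar>" "2 * d"] v by (simp add: dist_real_def less_imp_le)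
          ultimately show ?thesis
            using dist_Pair_le[of "cis y" 0 "cis x" v] \<rho>ge(3)[of d] d0 x(1)
            by (intro bexI[of _ "(cis y, 0)"]) auto
        qed
      qed
    qed
  qed
  have 8: "set_limit U1 H1 (at_right 0)"
  proof (rule set_limitI)
    define f where "f r = ((ray K r)\<^sup>2 - K\<^sup>2) / 2" for r
    have "((\<lambda>r. ((K + r / (1 - r))\<^sup>2 - K\<^sup>2) / 2) \<longlongrightarrow> ((K + 0 / (1 - 0))\<^sup>2 - K\<^sup>2) / 2) (at_right 0)"
      by (intro tendsto_intros) auto
    then have "(f \<longlongrightarrow> 0) (at_right 0)" by (simp add: f_def[abs_def] ray_def)
    then show "((\<lambda>r. \<rho> (f r)) \<longlongrightarrow> 0) (at_right 0)" by (rule \<rho>0)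
    have "\<forall>\<^sub>F r::real in at_right 0. r \<in> {0<..<1}" by (rule eventually_at_right_real) simp
    then show "\<forall>\<^sub>F r in at_right 0. (\<forall>X\<in>U1 r. \<exists>Y\<in>H1. dist X Y \<le> \<rho> (f r)) \<and>
        (\<forall>Y\<in>H1. \<exists>X\<in>U1 r. dist X Y \<le> \<rho> (f r))"
    proof eventually_elim
      case (elim r)
      define q d where "q = ray K r" and "d = f r"
      have q: "K < q" using ray_gt[of r K] elim by (simp add: q_def)
      have d: "energy pi q = pot 0 + d" by (simp add: energy_pi f_def d_def q_def diff_divide_distrib)
      have d0: "d > 0" using sup[OF q, of 0] d by simp
      have Ur: "U1 r = orb pi q" by (simp add: U1_def rotations_up_def q_def)
      show ?case unfolding d_def[symmetric]
      proof (intro conjI ballI)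
        fix X assume "X \<in> U1 r"
        then obtain t where t: "X = (cis (pos pi q t), vel pi q t)" by (auto simp: Ur orb_def curve_def)
        define v where "v = vel pi q t"
        obtain x where x: "0 \<le> x" "x < 0 + 2 * pi" "cis x = cis (pos pi q t)" using cis_representative by blast
        have v: "v > 0" unfolding v_def by (rule rotation(1)) (use q eK(1) sup in auto)
        have e: "energy x v = pot 0 + d" using flow_energy[of pi q t] energy_cis[OF x(3)] d by (simp add: v_def)
        have X: "X = (cis x, v)" using t x(3) by (simp add: v_def)
        show "\<exists>Y\<in>H1. dist X Y \<le> \<rho> d"
        proof (cases "x = 0")
          \<comment> \<open>The rotation passes the north pole, which the homoclinic orbit only
            approaches; a late point of the latter, closer than \<open>sqrt d\<close>, is taken
            instead.\<close>
          case True
          have "\<forall>\<^sub>F t in at_top. dist (curve pi K t) north < sqrt d"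
            using J(1) d0 unfolding joins_def tendsto_iff by simp
          then obtain t where t: "dist (curve pi K t) north < sqrt d"
            using eventually_happens'[OF trivial_limit_at_top_linorder] by blast
          have "v = sqrt (2 * d)" using e v True by (intro real_sqrt_unique[symmetric]) (auto simp: energy_def)
          then have "dist X north \<le> sqrt (2 * d)"
            using X True d0 dist_Pair_le[of 1 v 1 0] by (simp add: north_def dist_real_def)
          then have "dist X (curve pi K t) \<le> \<rho> d"
            using t dist_triangle2[of X "curve pi K t" north] \<rho>ge(2)[of d] d0 by simp
          then show ?thesis using curve_mem[of pi K t] by (auto simp: H1_def)
        next
          case False
          then have x': "0 < x" "x < 2 * pi" using x by auto
          have pos: "v\<^sup>2 - 2 * d > 0"
            using e well_pot_inside[OF w x', of "pot 0"] p2 by (simp add: energy_def)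
          then have "0 \<le> v\<^sup>2 + 2 * (- d)" by simp
          then obtain v' where v': "energy x v' = energy x v + - d" "dist v v' \<le> sqrt (2 * \<bar>- d\<bar>)" "0 < v'"
            using adjust_speed[of v "- d" x] v pos by (metis diff_conv_add_uminus mult_minus_right)
          have "(cis x, v') \<in> H1" by (rule H1[OF x']) (use v'(1,3) e v pos in auto)
          moreover have "dist X (cis x, v') \<le> \<rho> d"
            using dist_Pair_le[of "cis x" v "cis x" v'] \<rho>ge(1)[of d] d0 X v'(2) by simp
          ultimately show ?thesis by blast
        qed
      next
        fix Y assume Y: "Y \<in> H1"
        then obtain t where t: "Y = (cis (pos pi K t), vel pi K t)" by (auto simp: H1_def orb_def curve_def)
        define x v where "x = pos pi K t" and "v = vel pi K t"
        have v: "v > 0" using velK by (simp add: v_def)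
        have x: "0 < x" "x < 2 * pi" using posK by (auto simp: x_def)
        have e: "energy x v = pot 0" using flow_energy[of pi K t] eK(2) by (simp add: x_def v_def)
        have "0 < v\<^sup>2 + 2 * d" using d0 by (simp add: add_nonneg_pos)
        then obtain v' where v': "energy x v' = energy x v + d" "dist v v' \<le> sqrt (2 * \<bar>d\<bar>)" "0 < v'"
          using adjust_speed[of v d x] v by (metis less_imp_le)
        have "(cis x, v') \<in> U1 r"
          unfolding Ur by (rule orb_pi_mem_pos[OF w x]) (use q eK(1) d d0 e v' in auto)
        moreover have "dist (cis x, v') Y \<le> \<rho> d"
          using dist_Pair_le[of "cis x" v' "cis x" v] \<rho>ge(1)[of d] d0 t v'(2)
          by (simp add: x_def v_def dist_commute)
        ultimately show "\<exists>X\<in>U1 r. dist X Y \<le> \<rho> d" by blast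
      qed
    qed
  qed
  \<comment> \<open>Time reversal maps the upward family and its limit to the downward ones.\<close>
  have 9: "set_limit U2 H2 (at_right 0)"
  proof -
    have "U2 = (\<lambda>r. (\<lambda>(z, p). (z, - p)) ` U1 r)" by (simp add: U1_def U2_def rotations_up_def rotations_down_def orb_reverse fun_eq_iff)
    then show ?thesis using set_limit_reverse[OF 8] by (simp add: H1_def H2_def orb_reverse)
  qed
  show ?thesis
    by (rule exI[of _ H1], rule exI[of _ H2], rule exI[of _ B], rule exI[of _ U1], rule exI[of _ U2], intro conjI)
      (use H12 1 2 3 4 5 cb[unfolded crosses_both_def] 6 7 8 9 r3(5,6) in \<open>simp_all add: U1_def U2_def\<close>)
qed

end

section \<open>Square integrable solutions of linear equations on the line\<close>

definition sqint :: "(real \<Rightarrow> complex) \<Rightarrow> bool" where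
  "sqint g \<longleftrightarrow> g \<in> borel_measurable borel \<and> integrable lborel (\<lambda>x. (cmod (g x))\<^sup>2)"

definition nsq :: "(real \<Rightarrow> complex) \<Rightarrow> real" where
  "nsq g = (LINT x|lborel. (cmod (g x))\<^sup>2)"

lemma nsq_nonneg: "0 \<le> nsq g"
  by (simp add: nsq_def)

lemma sqint_cmult: "sqint g \<Longrightarrow> sqint (\<lambda>x. c * g x)"
  by (auto simp: sqint_def norm_mult power_mult_distrib)

lemma nsq_cmult: "nsq (\<lambda>x. c * g x) = (cmod c)\<^sup>2 * nsq g"
  by (simp add: nsq_def norm_mult power_mult_distrib)

lemma norm_add_squared_le: "(norm (a + b))\<^sup>2 \<le> 2 * (norm a)\<^sup>2 + 2 * (norm b)\<^sup>2"
  for a b :: "'a::real_normed_vector"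
proof -
  have "(norm (a + b))\<^sup>2 \<le> (norm a + norm b)\<^sup>2" by (intro power_mono norm_triangle_ineq) simp
  also have "\<dots> \<le> 2 * (norm a)\<^sup>2 + 2 * (norm b)\<^sup>2"
    using zero_le_power2[of "norm a - norm b"] by (simp add: power2_eq_square algebra_simps)
  finally show ?thesis .
qed

lemma sqint_add:
  assumes "sqint f" "sqint g"
  shows "sqint (\<lambda>x. f x + g x)" "nsq (\<lambda>x. f x + g x) \<le> 2 * nsq f + 2 * nsq g"
proof -
  have [measurable]: "f \<in> borel_measurable borel" "g \<in> borel_measurable borel"
    and i: "integrable lborel (\<lambda>x. (cmod (f x))\<^sup>2)" "integrable lborel (\<lambda>x. (cmod (g x))\<^sup>2)"
    using assms by (auto simp: sqint_def)
  have i2: "integrable lborel (\<lambda>x. 2 * (cmod (f x))\<^sup>2 + 2 * (cmod (g x))\<^sup>2)"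
    using i by auto
  have i3: "integrable lborel (\<lambda>x. (cmod (f x + g x))\<^sup>2)"
    by (rule Bochner_Integration.integrable_bound[OF i2]) (auto simp: norm_add_squared_le)
  show "sqint (\<lambda>x. f x + g x)" using i3 by (simp add: sqint_def)
  have "nsq (\<lambda>x. f x + g x) \<le> (LINT x|lborel. 2 * (cmod (f x))\<^sup>2 + 2 * (cmod (g x))\<^sup>2)"
    unfolding nsq_def by (rule integral_mono[OF i3 i2]) (rule norm_add_squared_le)
  also have "\<dots> = 2 * nsq f + 2 * nsq g" using i by (simp add: nsq_def)
  finally show "nsq (\<lambda>x. f x + g x) \<le> 2 * nsq f + 2 * nsq g" .
qed

lemma sqint_diff: "sqint f \<Longrightarrow> sqint g \<Longrightarrow> sqint (\<lambda>x. f x - g x)"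
  using sqint_add(1)[of f "\<lambda>x. - 1 * g x"] sqint_cmult[of g "- 1"] by simp

lemma sqint_reflect:
  assumes "sqint g"
  shows "sqint (\<lambda>x. g (- x))" "nsq (\<lambda>x. g (- x)) = nsq g"
proof -
  have [measurable]: "g \<in> borel_measurable borel" using assms by (simp add: sqint_def)
  show "sqint (\<lambda>x. g (- x))"
    using assms lborel_integrable_real_affine_iff[of "-1" "\<lambda>x. (cmod (g x))\<^sup>2" 0] by (simp add: sqint_def)
  show "nsq (\<lambda>x. g (- x)) = nsq g"
    using lborel_integral_real_affine[of "-1" "\<lambda>x. (cmod (g x))\<^sup>2" 0] by (simp add: nsq_def)
qed

lemma integrable_indicator_Icc: "integrable lborel (indicator {a..b} :: real \<Rightarrow> real)" for a b :: real
  by (rule integrable_real_indicator) (auto simp: emeasure_lborel_Icc_eq)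

text \<open>On a bounded interval \<open>1 + |g|^2\<close> is an integrable bound for
  \<open>|g|\<close>.\<close>

lemma sqint_set_integrable:
  assumes "sqint g"
  shows "set_integrable lborel {a..b} g"
proof -
  have [measurable]: "g \<in> borel_measurable borel" using assms by (simp add: sqint_def)
  have i: "integrable lborel (\<lambda>x. indicator {a..b} x *\<^sub>R (1::real) + (cmod (g x))\<^sup>2)"
    using assms integrable_indicator_Icc
    by (intro Bochner_Integration.integrable_add integrable_scaleR_left) (auto simp: sqint_def)
  have "cmod (indicator {a..b} x *\<^sub>R g x) \<le> indicator {a..b} x *\<^sub>R 1 + (cmod (g x))\<^sup>2" for x
  proof -
    have "cmod (g x) \<le> 1 + (cmod (g x))\<^sup>2"
    proof -
      have "0 \<le> (cmod (g x))\<^sup>2 + 1 - 2 * cmod (g x)"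
        using zero_le_power2[of "cmod (g x) - 1"] by (simp add: power2_diff)
      then show ?thesis using norm_ge_zero[of "g x"] by linarith
    qed
    then show ?thesis by (auto simp: indicator_def)
  qed
  then show ?thesis unfolding set_integrable_def
    by (intro Bochner_Integration.integrable_bound[OF i]) (auto simp: abs_of_nonneg)
qed

section \<open>Convolution with one-sided exponentials\<close>

lemma nn_integral_exp_decay:
  assumes "c > 0"
  shows "(\<integral>\<^sup>+ s. ennreal (exp (- c * s)) * indicator {0..} s \<partial>lborel) = ennreal (1 / c)"
proof -
  have "(\<integral>\<^sup>+ s. ennreal (exp (- c * s)) * indicator {0..} s \<partial>lborel) = ennreal (0 - (- exp (- c * 0) / c))"
  proof (rule nn_integral_FTC_atLeast)
    show "((\<lambda>s. - exp (- c * s) / c) \<longlongrightarrow> 0) at_top"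
      using assms by real_asymp
  qed (use assms in \<open>auto intro!: derivative_eq_intros\<close>)
  then show ?thesis by simp
qed

definition decay :: "real \<Rightarrow> real \<Rightarrow> real \<Rightarrow> real" where
  "decay c x t = (if t \<le> x then exp (c * (t - x)) else 0)"

lemma decay_nonneg [simp]: "0 \<le> decay c x t"
  by (simp add: decay_def)

lemma decay_measurable [measurable]: "(\<lambda>(x, t). decay c x t) \<in> borel_measurable (borel \<Otimes>\<^sub>M borel)"
  unfolding decay_def by measurable

lemma nn_integral_decay:
  assumes "c > 0"
  shows "(\<integral>\<^sup>+ t. decay c x t \<partial>lborel) = ennreal (1 / c)" "(\<integral>\<^sup>+ x. decay c x t \<partial>lborel) = ennreal (1 / c)"
proof -
  have "(\<integral>\<^sup>+ t. ennreal (decay c x t) \<partial>lborel) = (\<integral>\<^sup>+ s. ennreal (decay c x (x + (- 1) * s)) \<partial>lborel)"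
    using nn_integral_real_affine[of "\<lambda>t. ennreal (decay c x t)" "-1" x] by simp
  also have "\<dots> = (\<integral>\<^sup>+ s. ennreal (exp (- c * s)) * indicator {0..} s \<partial>lborel)"
    by (intro nn_integral_cong) (auto simp: decay_def indicator_def)
  finally show "(\<integral>\<^sup>+ t. decay c x t \<partial>lborel) = ennreal (1 / c)"
    using nn_integral_exp_decay[OF assms] by simp
  have "(\<integral>\<^sup>+ x. ennreal (decay c x t) \<partial>lborel) = (\<integral>\<^sup>+ s. ennreal (decay c (t + 1 * s) t) \<partial>lborel)"
    using nn_integral_real_affine[of "\<lambda>x. ennreal (decay c x t)" 1 t] by simp
  also have "\<dots> = (\<integral>\<^sup>+ s. ennreal (exp (- c * s)) * indicator {0..} s \<partial>lborel)"
    by (intro nn_integral_cong) (auto simp: decay_def indicator_def)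
  finally show "(\<integral>\<^sup>+ x. decay c x t \<partial>lborel) = ennreal (1 / c)"
    using nn_integral_exp_decay[OF assms] by simp
qed

definition kern :: "complex \<Rightarrow> (real \<Rightarrow> complex) \<Rightarrow> real \<Rightarrow> real \<Rightarrow> complex" where
  "kern \<sigma> g x t = (if t \<le> x then exp (\<sigma> * of_real (t - x)) * g t else 0)"

text \<open>Convolution with \<open>exp (- \<sigma> s)\<close> on \<open>s >= 0\<close>: for
  \<open>Re \<sigma> > 0\<close> it inverts \<open>\<sigma> + d/dx\<close> on square integrable
  functions.\<close>

definition resolv :: "complex \<Rightarrow> (real \<Rightarrow> complex) \<Rightarrow> real \<Rightarrow> complex" where
  "resolv \<sigma> g x = (LINT t|lborel. kern \<sigma> g x t)"

lemma kern_measurable [measurable]: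
  assumes [measurable]: "g \<in> borel_measurable borel"
  shows "(\<lambda>(x, t). kern \<sigma> g x t) \<in> borel_measurable (borel \<Otimes>\<^sub>M borel)"
  unfolding kern_def by measurable

lemma norm_kern: "cmod (kern \<sigma> g x t) = decay (Re \<sigma>) x t * cmod (g t)"
  by (simp add: kern_def decay_def norm_mult)

text \<open>Young's inequality. The bound is crude but serves integrability only; the estimate of
  the norm is made in \<open>resolv_sqint\<close>.\<close>

lemma norm_kern_le: "cmod (kern \<sigma> g x t) \<le> decay (2 * Re \<sigma>) x t + (cmod (g t))\<^sup>2"
proof -
  have e: "decay (2 * Re \<sigma>) x t = (decay (Re \<sigma>) x t)\<^sup>2"
    by (auto simp: decay_def power2_eq_square simp flip: exp_add)
  have "2 * (decay (Re \<sigma>) x t * cmod (g t)) \<le> (decay (Re \<sigma>) x t)\<^sup>2 + (cmod (g t))\<^sup>2"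
    using zero_le_power2[of "decay (Re \<sigma>) x t - cmod (g t)"] unfolding power2_diff by linarith
  moreover have "0 \<le> decay (Re \<sigma>) x t * cmod (g t)" by simp
  ultimately show ?thesis unfolding norm_kern e by linarith
qed

lemma integrable_decay:
  assumes "c > 0"
  shows "integrable lborel (decay c x)" "(LINT t|lborel. decay c x t) = 1 / c"
proof -
  have [measurable]: "decay c x \<in> borel_measurable borel" unfolding decay_def[abs_def] by measurable
  show "integrable lborel (decay c x)"
    by (rule integrableI_nonneg) (use nn_integral_decay(1)[OF assms, of x] in auto)
  show "(LINT t|lborel. decay c x t) = 1 / c"
    by (rule integral_eq_nn_integral[THEN trans]) (use nn_integral_decay(1)[OF assms, of x] assms in auto)
qed

lemma integrable_kern:
  assumes "sqint g" "Re \<sigma> > 0"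
  shows "integrable lborel (kern \<sigma> g x)" "(LINT t|lborel. cmod (kern \<sigma> g x t)) \<le> 1 / (2 * Re \<sigma>) + nsq g"
proof -
  have [measurable]: "g \<in> borel_measurable borel" using assms by (simp add: sqint_def)
  have [measurable]: "kern \<sigma> g x \<in> borel_measurable borel" unfolding kern_def[abs_def] by measurable
  have i: "integrable lborel (\<lambda>t. decay (2 * Re \<sigma>) x t + (cmod (g t))\<^sup>2)"
    using assms by (intro Bochner_Integration.integrable_add integrable_decay) (auto simp: sqint_def)
  show k: "integrable lborel (kern \<sigma> g x)"
    by (rule Bochner_Integration.integrable_bound[OF i]) (auto intro!: AE_I2 order_trans[OF norm_kern_le])
  have "(LINT t|lborel. cmod (kern \<sigma> g x t)) \<le> (LINT t|lborel. decay (2 * Re \<sigma>) x t + (cmod (g t))\<^sup>2)"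
    by (rule integral_mono[OF integrable_norm[OF k] i norm_kern_le])
  also have "\<dots> = 1 / (2 * Re \<sigma>) + nsq g"
    using assms integrable_decay[of "2 * Re \<sigma>" x] by (simp add: sqint_def nsq_def)
  finally show "(LINT t|lborel. cmod (kern \<sigma> g x t)) \<le> 1 / (2 * Re \<sigma>) + nsq g" .
qed

lemma resolv_measurable [measurable]:
  assumes [measurable]: "g \<in> borel_measurable borel"
  shows "resolv \<sigma> g \<in> borel_measurable borel"
proof -
  have [measurable]: "case_prod (kern \<sigma> g) \<in> borel_measurable (borel \<Otimes>\<^sub>M lborel)"
    using kern_measurable[of g \<sigma>] by simp
  show ?thesis unfolding resolv_def[abs_def] by measurable
qed

text \<open>Schur's test: in the Cauchy-Schwarz inequality one half of the decay rate stands alone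
  and the other half stays with \<open>g\<close>; then the integrals are exchanged. Each integration
  of the kernel costs \<open>1 / Re \<sigma>\<close>.\<close>

lemma resolv_sqint:
  assumes g: "sqint g" and s: "Re \<sigma> > 0"
  shows "sqint (resolv \<sigma> g)" "nsq (resolv \<sigma> g) \<le> nsq g / (Re \<sigma>)\<^sup>2"
proof -
  have [measurable]: "g \<in> borel_measurable borel" using g by (simp add: sqint_def)
  define s where "s = Re \<sigma>"
  have s0: "s > 0" using assms by (simp add: s_def)
  have [measurable]: "decay c x \<in> borel_measurable borel" for c x unfolding decay_def[abs_def] by measurable
  have half: "decay (s / 2) x t * decay (s / 2) x t = decay s x t" for x t
    by (auto simp: decay_def simp flip: exp_add)
  have pt: "ennreal ((cmod (resolv \<sigma> g x))\<^sup>2) \<le> ennreal (1 / s) * (\<integral>\<^sup>+ t. ennreal (decay s x t * (cmod (g t))\<^sup>2) \<partial>lborel)" for x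
  proof -
    have "ennreal (cmod (resolv \<sigma> g x)) \<le> (\<integral>\<^sup>+ t. ennreal (cmod (kern \<sigma> g x t)) \<partial>lborel)"
      unfolding resolv_def by (rule integral_norm_bound_ennreal[OF integrable_kern(1)[OF assms]])
    also have "\<dots> = (\<integral>\<^sup>+ t. ennreal (decay (s / 2) x t) * ennreal (decay (s / 2) x t * cmod (g t)) \<partial>lborel)"
      by (intro nn_integral_cong) (simp add: norm_kern s_def[symmetric] half[symmetric] ennreal_mult[symmetric] mult.assoc)
    finally have "(ennreal (cmod (resolv \<sigma> g x)))\<^sup>2 \<le> (\<integral>\<^sup>+ t. ennreal (decay (s / 2) x t) * ennreal (decay (s / 2) x t * cmod (g t)) \<partial>lborel)\<^sup>2"
      by (rule power_mono) simp
    also have "\<dots> \<le> (\<integral>\<^sup>+ t. (ennreal (decay (s / 2) x t))\<^sup>2 \<partial>lborel) * (\<integral>\<^sup>+ t. (ennreal (decay (s / 2) x t * cmod (g t)))\<^sup>2 \<partial>lborel)"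
      by (rule Cauchy_Schwarz_nn_integral) auto
    also have "(\<lambda>t. (ennreal (decay (s / 2) x t))\<^sup>2) = (\<lambda>t. ennreal (decay s x t))"
      by (simp add: fun_eq_iff power2_eq_square half flip: ennreal_mult)
    also have "(\<lambda>t. (ennreal (decay (s / 2) x t * cmod (g t)))\<^sup>2) = (\<lambda>t. ennreal (decay s x t * (cmod (g t))\<^sup>2))"
      by (simp add: fun_eq_iff power2_eq_square half[symmetric] mult_ac flip: ennreal_mult)
    finally show ?thesis by (simp add: nn_integral_decay(1)[OF s0] ennreal_power)
  qed
  have [measurable]: "(\<lambda>(x, t). ennreal (decay s x t * (cmod (g t))\<^sup>2)) \<in> borel_measurable (lborel \<Otimes>\<^sub>M lborel)"
    unfolding decay_def by measurable
  have "(\<integral>\<^sup>+ x. ennreal ((cmod (resolv \<sigma> g x))\<^sup>2) \<partial>lborel) \<le>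
      (\<integral>\<^sup>+ x. ennreal (1 / s) * (\<integral>\<^sup>+ t. ennreal (decay s x t * (cmod (g t))\<^sup>2) \<partial>lborel) \<partial>lborel)"
    by (intro nn_integral_mono pt)
  also have "\<dots> = ennreal (1 / s) * (\<integral>\<^sup>+ x. (\<integral>\<^sup>+ t. ennreal (decay s x t * (cmod (g t))\<^sup>2) \<partial>lborel) \<partial>lborel)"
    by (rule nn_integral_cmult) measurable
  also have "(\<integral>\<^sup>+ x. (\<integral>\<^sup>+ t. ennreal (decay s x t * (cmod (g t))\<^sup>2) \<partial>lborel) \<partial>lborel) =
      (\<integral>\<^sup>+ t. (\<integral>\<^sup>+ x. ennreal (decay s x t * (cmod (g t))\<^sup>2) \<partial>lborel) \<partial>lborel)"
    by (rule lborel_pair.Fubini'[symmetric]) measurable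
  also have "\<dots> = (\<integral>\<^sup>+ t. ennreal (1 / s) * ennreal ((cmod (g t))\<^sup>2) \<partial>lborel)"
  proof (rule nn_integral_cong)
    fix t
    have [measurable]: "(\<lambda>x. decay s x t) \<in> borel_measurable borel" unfolding decay_def by measurable
    have "(\<integral>\<^sup>+ x. ennreal (decay s x t * (cmod (g t))\<^sup>2) \<partial>lborel) = (\<integral>\<^sup>+ x. ennreal (decay s x t) * ennreal ((cmod (g t))\<^sup>2) \<partial>lborel)"
      by (simp add: ennreal_mult)
    also have "\<dots> = ennreal (1 / s) * ennreal ((cmod (g t))\<^sup>2)"
      by (simp add: nn_integral_multc nn_integral_decay(2)[OF s0])
    finally show "(\<integral>\<^sup>+ x. ennreal (decay s x t * (cmod (g t))\<^sup>2) \<partial>lborel) = ennreal (1 / s) * ennreal ((cmod (g t))\<^sup>2)" .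
  qed
  also have "\<dots> = ennreal (1 / s) * (\<integral>\<^sup>+ t. ennreal ((cmod (g t))\<^sup>2) \<partial>lborel)"
    by (rule nn_integral_cmult) measurable
  also have "(\<integral>\<^sup>+ t. ennreal ((cmod (g t))\<^sup>2) \<partial>lborel) = ennreal (nsq g)"
    using g unfolding nsq_def sqint_def by (intro nn_integral_eq_integral) auto
  finally have le: "(\<integral>\<^sup>+ x. ennreal ((cmod (resolv \<sigma> g x))\<^sup>2) \<partial>lborel) \<le> ennreal (nsq g / s\<^sup>2)"
    using s0 nsq_nonneg[of g] by (simp add: power2_eq_square field_simps flip: ennreal_mult)
  have i: "integrable lborel (\<lambda>x. (cmod (resolv \<sigma> g x))\<^sup>2)"
    by (rule integrableI_nonneg) (use le in \<open>auto intro: le_less_trans\<close>)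
  then show "sqint (resolv \<sigma> g)" by (simp add: sqint_def)
  have "ennreal (nsq (resolv \<sigma> g)) \<le> ennreal (nsq g / s\<^sup>2)"
    unfolding nsq_def using le nn_integral_eq_integral[OF i] by (simp add: nsq_def)
  then show "nsq (resolv \<sigma> g) \<le> nsq g / (Re \<sigma>)\<^sup>2"
    using nsq_nonneg[of g] by (simp add: s_def)
qed

text \<open>Fubini on the triangle below the diagonal takes the place of the product rule for absolutely continuous functions.\<close>

lemma resolv_has_integral:
  assumes g: "sqint g" and s: "Re \<sigma> > 0" and ab: "a \<le> b"
  shows "((\<lambda>x. g x - \<sigma> * resolv \<sigma> g x) has_integral (resolv \<sigma> g b - resolv \<sigma> g a)) {a..b}"
proof -
  have [measurable]: "g \<in> borel_measurable borel" using g by (simp add: sqint_def)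
  have \<sigma>0: "\<sigma> \<noteq> 0" using s by auto
  \<comment> \<open>Restricted to the strip over \<open>{a..b}\<close>. Integrating over
    \<open>t\<close> first gives the integral of \<open>resolv\<close>, integrating over
    \<open>x\<close> first gives its increment and the integral of \<open>g\<close>.\<close>
  define f where "f x t = indicator {a..b} x *\<^sub>R (\<sigma> * kern \<sigma> g x t)" for x t
  have [measurable]: "case_prod f \<in> borel_measurable (lborel \<Otimes>\<^sub>M lborel)"
    unfolding f_def kern_def by measurable
  define M where "M = cmod \<sigma> * (1 / (2 * Re \<sigma>) + nsq g)"
  have int1: "integrable lborel (f x)" for x
    unfolding f_def using integrable_kern(1)[OF g s] by (auto intro!: integrable_scaleR_right)
  have bnd: "(LINT t|lborel. norm (f x t)) \<le> indicator {a..b} x *\<^sub>R M" for x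
  proof (cases "x \<in> {a..b}")
    case True
    then have "(LINT t|lborel. norm (f x t)) = cmod \<sigma> * (LINT t|lborel. cmod (kern \<sigma> g x t))"
      by (simp add: f_def norm_mult)
    also have "\<dots> \<le> M" unfolding M_def by (intro mult_left_mono integrable_kern(2)[OF g s]) auto
    finally show ?thesis using True by simp
  qed (simp add: f_def)
  have iM: "integrable lborel (\<lambda>x. indicator {a..b} x *\<^sub>R M)"
    by (intro integrable_scaleR_left integrable_indicator_Icc)
  have "integrable (lborel \<Otimes>\<^sub>M lborel) (case_prod f)"
  proof (rule lborel_pair.Fubini_integrable)
    show "integrable lborel (\<lambda>x. LINT t|lborel. norm (case_prod f (x, t)))"
    proof (rule Bochner_Integration.integrable_bound[OF iM])
      show "AE x in lborel. norm (LINT t|lborel. norm (case_prod f (x, t))) \<le> norm (indicator {a..b} x *\<^sub>R M)"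
      proof (rule AE_I2)
        fix x
        have "0 \<le> (LINT t|lborel. norm (f x t))" by simp
        then show "norm (LINT t|lborel. norm (case_prod f (x, t))) \<le> norm (indicator {a..b} x *\<^sub>R M)"
          using bnd[of x] by simp
      qed
    qed measurable
  qed (use int1 in auto)
  from lborel_pair.Fubini_integral[OF this]
  have fub: "(LINT t|lborel. LINT x|lborel. f x t) = (LINT x|lborel. LINT t|lborel. f x t)" .
  have right: "(LINT t|lborel. f x t) = indicator {a..b} x *\<^sub>R (\<sigma> * resolv \<sigma> g x)" for x
    unfolding f_def resolv_def by simp
  have left: "(LINT x|lborel. f x t) = kern \<sigma> g a t + indicator {a<..b} t *\<^sub>R g t - kern \<sigma> g b t" for t
  proof -
    define F where "F x = - exp (\<sigma> * of_real (t - x)) * g t" for x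
    have dF: "(F has_vector_derivative \<sigma> * (exp (\<sigma> * of_real (t - x)) * g t)) (at x within A)" for x A
      unfolding F_def
      by (auto intro!: derivative_eq_intros has_vector_derivative_real_field simp: has_real_derivative_iff_has_vector_derivative)
    have FTC: "(LINT x|lborel. indicator {c..b} x *\<^sub>R (\<sigma> * (exp (\<sigma> * of_real (t - x)) * g t))) = F b - F c" if "c \<le> b" for c
      by (rule integral_FTC_Icc[OF that dF]) (intro continuous_intros)
    show ?thesis
    proof (cases "t \<le> b")
      case True
      \<comment> \<open>The source at \<open>t\<close> acts from \<open>t\<close> onwards, or from
        \<open>a\<close> if it lies to the left of the strip.\<close>
      define c where "c = max a t"
      have "f x t = indicator {c..b} x *\<^sub>R (\<sigma> * (exp (\<sigma> * of_real (t - x)) * g t))" for x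
        by (auto simp: f_def kern_def c_def indicator_def)
      then have "(LINT x|lborel. f x t) = F b - F c" using FTC[of c] True ab by (simp add: c_def)
      then show ?thesis using True ab by (cases "t \<le> a") (auto simp: F_def c_def kern_def max_def)
    next
      case False
      then have "f x t = 0" for x by (auto simp: f_def kern_def indicator_def)
      then show ?thesis using False ab by (auto simp: kern_def)
    qed
  qed
  have ig: "set_integrable lborel {a..b} g" by (rule sqint_set_integrable[OF g])
  have ae: "AE t in lborel. indicator {a<..b} t *\<^sub>R g t = indicator {a..b} t *\<^sub>R g t"
    using AE_lborel_singleton[of a] by eventually_elim (auto simp: indicator_def)
  have ig': "integrable lborel (\<lambda>t. indicator {a<..b} t *\<^sub>R g t)"
    using ig unfolding set_integrable_def by (rule integrable_cong_AE_imp) (use ae in auto)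
  have "(LINT t|lborel. LINT x|lborel. f x t) =
      resolv \<sigma> g a + (LINT t|lborel. indicator {a<..b} t *\<^sub>R g t) - resolv \<sigma> g b"
    unfolding left resolv_def using integrable_kern(1)[OF g s] ig' by simp
  also have "(LINT t|lborel. indicator {a<..b} t *\<^sub>R g t) = (LINT t:{a..b}|lborel. g t)"
    unfolding set_lebesgue_integral_def by (rule integral_cong_AE) (use ae in auto)
  finally have eq: "(LINT x:{a..b}|lborel. \<sigma> * resolv \<sigma> g x) = resolv \<sigma> g a + (LINT t:{a..b}|lborel. g t) - resolv \<sigma> g b"
    unfolding fub right set_lebesgue_integral_def .
  have ir: "set_integrable lborel {a..b} (\<lambda>x. \<sigma> * resolv \<sigma> g x)"
    by (rule sqint_set_integrable[OF sqint_cmult[OF resolv_sqint(1)[OF g s]]])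
  have "set_integrable lborel {a..b} (\<lambda>x. g x - \<sigma> * resolv \<sigma> g x)"
    by (rule set_integral_diff(1)[OF ig ir])
  from set_borel_integral_eq_integral[OF this]
  have "((\<lambda>x. g x - \<sigma> * resolv \<sigma> g x) has_integral (LINT x:{a..b}|lborel. g x - \<sigma> * resolv \<sigma> g x)) {a..b}"
    by (simp add: has_integral_integral)
  also have "(LINT x:{a..b}|lborel. g x - \<sigma> * resolv \<sigma> g x) = resolv \<sigma> g b - resolv \<sigma> g a"
    using eq by (simp add: set_integral_diff(2)[OF ig ir])
  finally show ?thesis .
qed

text \<open>Factorization of \<open>\<sigma>\<^sup>2 - d^2/dx^2\<close> into
  \<open>\<sigma> - d/dx\<close> and \<open>\<sigma> + d/dx\<close>. The first factor is inverted by
  the reflected convolution, giving \<open>p\<close>, the second by \<open>resolv\<close>, giving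
  \<open>u\<close> with derivative \<open>p - \<sigma> u\<close>. Two squared factors
  \<open>1 / Re \<sigma>\<close> make the fourth power.\<close>

lemma resolvent_line:
  assumes g: "sqint g" and s: "Re \<sigma> > 0"
  shows "\<exists>u v. sqint u \<and> sqint v \<and> (\<forall>a b. a \<le> b \<longrightarrow> (v has_integral (u b - u a)) {a..b}) \<and>
    (\<forall>a b. a \<le> b \<longrightarrow> ((\<lambda>x. \<sigma>\<^sup>2 * u x - g x) has_integral (v b - v a)) {a..b}) \<and> nsq u \<le> nsq g / (Re \<sigma>) ^ 4"
proof -
  define g' where "g' x = g (- x)" for x
  have g': "sqint g'" "nsq g' = nsq g" using sqint_reflect[OF g] by (simp_all add: g'_def[abs_def])
  define p where "p x = resolv \<sigma> g' (- x)" for x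
  have p: "sqint p" "nsq p \<le> nsq g / (Re \<sigma>)\<^sup>2"
    using sqint_reflect[OF resolv_sqint(1)[OF g'(1) s]] resolv_sqint(2)[OF g'(1) s] g'(2)
    by (simp_all add: p_def[abs_def])
  have p_int: "((\<lambda>x. \<sigma> * p x - g x) has_integral (p b - p a)) {a..b}" if "a \<le> b" for a b
  proof -
    have "((\<lambda>x. g' x - \<sigma> * resolv \<sigma> g' x) has_integral (p a - p b)) {- b..- a}"
      using resolv_has_integral[OF g'(1) s, of "- b" "- a"] that by (simp add: p_def)
    then have "((\<lambda>x. (\<lambda>x. g x - \<sigma> * p x) (- x)) has_integral (p a - p b)) {- b..- a}"
      by (simp add: g'_def p_def)
    then have "((\<lambda>x. g x - \<sigma> * p x) has_integral (p a - p b)) {a..b}"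
      by (rule has_integral_reflect_real[where f = "\<lambda>x. g x - \<sigma> * p x", THEN iffD1])
    from has_integral_neg[OF this] show ?thesis by simp
  qed
  define u where "u = resolv \<sigma> p"
  have u: "sqint u" "nsq u \<le> nsq p / (Re \<sigma>)\<^sup>2" using resolv_sqint[OF p(1) s] by (simp_all add: u_def)
  define v where "v x = p x - \<sigma> * u x" for x
  have v_int: "(v has_integral (u b - u a)) {a..b}" if "a \<le> b" for a b
    using resolv_has_integral[OF p(1) s that] by (simp add: v_def[abs_def] u_def)
  have "((\<lambda>x. \<sigma>\<^sup>2 * u x - g x) has_integral (v b - v a)) {a..b}" if "a \<le> b" for a b
  proof -
    have "((\<lambda>x. (\<sigma> * p x - g x) - \<sigma> * v x) has_integral ((p b - p a) - \<sigma> * (u b - u a))) {a..b}"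
      by (intro has_integral_diff p_int v_int has_integral_mult_right that)
    moreover have "(\<lambda>x. (\<sigma> * p x - g x) - \<sigma> * v x) = (\<lambda>x. \<sigma>\<^sup>2 * u x - g x)"
      by (simp add: v_def power2_eq_square fun_eq_iff algebra_simps)
    moreover have "(p b - p a) - \<sigma> * (u b - u a) = v b - v a" by (simp add: v_def algebra_simps)
    ultimately show ?thesis by simp
  qed
  moreover have "sqint v" unfolding v_def[abs_def] by (intro sqint_diff p(1) sqint_cmult u(1))
  moreover have "nsq u \<le> nsq g / (Re \<sigma>) ^ 4"
  proof -
    have "nsq p / (Re \<sigma>)\<^sup>2 \<le> nsq g / (Re \<sigma>)\<^sup>2 / (Re \<sigma>)\<^sup>2" by (intro divide_right_mono p) auto
    then show ?thesis using u(2) by (simp add: power2_eq_square power4_eq_xxxx mult.assoc)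
  qed
  ultimately show ?thesis using u(1) v_int by blast
qed

section \<open>Uniqueness of square integrable solutions\<close>

lemma increments_primitive:
  fixes u v :: "real \<Rightarrow> complex"
  assumes "\<And>a b. a \<le> b \<Longrightarrow> (v has_integral (u b - u a)) {a..b}"
  shows "u = (\<lambda>t. u 0 + primitive v t)"
proof
  fix t
  show "u t = u 0 + primitive v t"
    using assms[of 0 t] assms[of t 0]
    by (cases "0 \<le> t") (auto simp: primitive_nonneg primitive_nonpos dest!: integral_unique)
qed

lemma increments_continuous:
  fixes u v :: "real \<Rightarrow> complex"
  assumes "\<And>a b. a \<le> b \<Longrightarrow> (v has_integral (u b - u a)) {a..b}"
  shows "continuous_on UNIV u"
proof (rule continuous_at_imp_continuous_on, rule ballI)
  fix x :: real
  have "v integrable_on {x - 1..x + 1}" using assms[of "x - 1" "x + 1"] by auto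
  then have "continuous_on {x - 1..x + 1} (\<lambda>y. u (x - 1) + integral {x - 1..y} v)"
    by (intro continuous_on_add continuous_on_const indefinite_integral_continuous_1)
  moreover have "u (x - 1) + integral {x - 1..y} v = u y" if "y \<in> {x - 1..x + 1}" for y
    using integral_unique[OF assms[of "x - 1" y]] that by simp
  ultimately have "continuous_on {x - 1..x + 1} u" by (metis (no_types, lifting) continuous_on_cong)
  moreover have "x \<in> interior {x - 1..x + 1}" by simp
  ultimately show "isCont u x" using continuous_on_interior by blast
qed

lemma increments_derivative:
  fixes u v :: "real \<Rightarrow> complex"
  assumes "\<And>a b. a \<le> b \<Longrightarrow> (v has_integral (u b - u a)) {a..b}" "continuous_on UNIV v"
  shows "(u has_vector_derivative v x) (at x)"
proof -
  have "((\<lambda>t. u 0 + primitive v t) has_vector_derivative 0 + v x) (at x)"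
    by (intro has_vector_derivative_add has_vector_derivative_const has_vector_derivative_primitive assms)
  then show ?thesis using increments_primitive[of v u] assms(1) by simp
qed

text \<open>The solution is \<open>P 0 * exp (\<sigma> x)\<close>, whose modulus on the right
  half-line is at least that of \<open>P 0\<close>. Integration over \<open>{0..n}\<close> for all
  \<open>n\<close> leaves only \<open>P 0 = 0\<close>.\<close>

lemma sqint_exp_solution_zero:
  assumes sq: "sqint P" and s: "Re \<sigma> > 0" and der: "\<And>x. (P has_vector_derivative \<sigma> * P x) (at x)"
  shows "P x = 0"
proof -
  have "((\<lambda>x. P 0 * exp (\<sigma> * of_real x)) has_vector_derivative \<sigma> * (P 0 * exp (\<sigma> * of_real x))) (at x)" for x
    by (auto intro!: derivative_eq_intros has_vector_derivative_real_field)
  then have P: "P x = P 0 * exp (\<sigma> * of_real x)" for x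
    using lipschitz_ode_unique[of "\<lambda>z. \<sigma> * z" "cmod \<sigma>" P "\<lambda>x. P 0 * exp (\<sigma> * of_real x)" 0 x] der
    by (simp add: norm_mult flip: right_diff_distrib)
  have "real n * (cmod (P 0))\<^sup>2 \<le> nsq P" for n
  proof -
    have "(LINT x|lborel. indicator {0..real n} x *\<^sub>R (cmod (P 0))\<^sup>2) \<le> nsq P"
      unfolding nsq_def
    proof (rule integral_mono)
      show "integrable lborel (\<lambda>x. indicator {0..real n} x *\<^sub>R (cmod (P 0))\<^sup>2)"
        by (intro integrable_scaleR_left integrable_indicator_Icc)
      show "integrable lborel (\<lambda>x. (cmod (P x))\<^sup>2)" using sq by (simp add: sqint_def)
      fix x
      have "cmod (P 0) \<le> cmod (P x)" if "0 \<le> x"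
        unfolding P[of x] norm_mult using s that by (simp add: mult_le_cancel_left1)
      then show "indicator {0..real n} x *\<^sub>R (cmod (P 0))\<^sup>2 \<le> (cmod (P x))\<^sup>2"
        by (auto simp: indicator_def intro: power_mono)
    qed
    then show ?thesis by simp
  qed
  then have "P 0 = 0"
    using reals_Archimedean3[of "(cmod (P 0))\<^sup>2"] by (metis not_le zero_less_power2 norm_eq_zero)
  then show ?thesis using P[of x] by simp
qed

text \<open>Continuity of \<open>u\<close> makes the weak derivatives classical. Then
  \<open>v + \<sigma> u\<close> solves \<open>P' = \<sigma> P\<close> and vanishes, and the
  remaining equation \<open>u' = - \<sigma> u\<close> is of the same kind after reflection.\<close>

lemma resolvent_line_unique:
  assumes u: "sqint u" and v: "sqint v" and s: "Re \<sigma> > 0"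
    and uv: "\<And>a b. a \<le> b \<Longrightarrow> (v has_integral (u b - u a)) {a..b}"
    and vw: "\<And>a b. a \<le> b \<Longrightarrow> (w has_integral (v b - v a)) {a..b}"
    and ae: "AE x in lborel. w x = \<sigma>\<^sup>2 * u x"
  shows "u x = 0"
proof -
  have vu: "((\<lambda>x. \<sigma>\<^sup>2 * u x) has_integral (v b - v a)) {a..b}" if "a \<le> b" for a b
  proof -
    have "AE x in lborel. x \<in> {a..b} \<longrightarrow> w x = \<sigma>\<^sup>2 * u x" using ae by eventually_elim simp
    from has_integral_AE[OF this] show ?thesis using vw[OF that] by blast
  qed
  have cu: "continuous_on UNIV u" by (rule increments_continuous[OF uv])
  have du: "(u has_vector_derivative v x) (at x)" for x
    by (rule increments_derivative[OF uv increments_continuous[OF vw]])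
  have dv: "(v has_vector_derivative \<sigma>\<^sup>2 * u x) (at x)" for x
    by (rule increments_derivative[OF vu]) (auto intro!: continuous_intros cu)
  define P where "P x = v x + \<sigma> * u x" for x
  have "(P has_vector_derivative \<sigma> * P x) (at x)" for x
  proof -
    have "(P has_vector_derivative \<sigma>\<^sup>2 * u x + \<sigma> * v x) (at x)"
      unfolding P_def by (intro has_vector_derivative_add has_vector_derivative_mult_right du dv)
    then show ?thesis by (simp add: P_def power2_eq_square algebra_simps)
  qed
  then have P0: "P x = 0" for x
    by (rule sqint_exp_solution_zero[rotated 2]) (use s in \<open>auto simp: P_def[abs_def] intro!: sqint_add sqint_cmult u v\<close>)
  define U where "U x = u (- x)" for x
  have "(U has_vector_derivative \<sigma> * U x) (at x)" for x
  proof -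
    have "((u \<circ> (\<lambda>x. - x)) has_vector_derivative (- 1) *\<^sub>R v (- x)) (at x)"
      by (rule vector_diff_chain_at) (auto intro!: derivative_eq_intros du)
    moreover have "v (- x) = - \<sigma> * u (- x)" using P0[of "- x"] by (simp add: P_def eq_neg_iff_add_eq_0)
    ultimately show ?thesis by (simp add: U_def[abs_def] comp_def)
  qed
  then have "U (- x) = 0"
    by (rule sqint_exp_solution_zero[rotated 2]) (use s in \<open>auto simp: U_def[abs_def] intro!: sqint_reflect u\<close>)
  then show ?thesis by (simp add: U_def)
qed

text \<open>The witness is \<open>1 / (1 + e\<^sup>2 x\<^sup>2)\<close>. Its derivatives are
  controlled by the function itself, the second one with the factor \<open>6 e\<^sup>2\<close>,
  which explains \<open>e\<^sup>2 = \<eta> / 6\<close>.\<close>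

lemma slowly_varying_function:
  assumes \<eta>: "\<eta> > (0::real)"
  shows "\<exists>\<phi> \<phi>' \<phi>'' :: real \<Rightarrow> real. (\<forall>x. (\<phi> has_real_derivative \<phi>' x) (at x)) \<and>
    (\<forall>x. (\<phi>' has_real_derivative \<phi>'' x) (at x)) \<and> continuous_on UNIV \<phi>'' \<and> (\<forall>x. 0 < \<phi> x) \<and>
    (\<exists>K. \<forall>x. \<bar>\<phi>' x\<bar> \<le> K * \<phi> x) \<and> (\<forall>x. \<bar>\<phi>'' x\<bar> \<le> \<eta> * \<phi> x) \<and> integrable lborel (\<lambda>x. (\<phi> x)\<^sup>2)"
proof -
  define e where "e = sqrt (\<eta> / 6)"
  have e: "e > 0" "e\<^sup>2 = \<eta> / 6" using \<eta> by (auto simp: e_def)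
  define y where "y x = 1 + e\<^sup>2 * x\<^sup>2" for x
  have y1: "y x \<ge> 1" for x by (simp add: y_def)
  have y0: "y x \<noteq> 0" for x using y1[of x] by linarith
  have dy: "(y has_real_derivative 2 * e\<^sup>2 * x) (at x)" for x
    unfolding y_def by (auto intro!: derivative_eq_intros)
  define \<phi> where "\<phi> x = 1 / y x" for x
  define \<phi>' where "\<phi>' x = - (2 * e\<^sup>2 * x) / (y x)\<^sup>2" for x
  define \<phi>'' where "\<phi>'' x = e\<^sup>2 * (6 * (e\<^sup>2 * x\<^sup>2) - 2) / (y x) ^ 3" for x
  have d1: "(\<phi> has_real_derivative \<phi>' x) (at x)" for x
    unfolding \<phi>_def \<phi>'_def using y0[of x]
    by (auto intro!: derivative_eq_intros dy simp: power2_eq_square)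
  have d2: "(\<phi>' has_real_derivative \<phi>'' x) (at x)" for x
  proof -
    have "(\<phi>' has_real_derivative (- (2 * e\<^sup>2) * (y x)\<^sup>2 - (- (2 * e\<^sup>2 * x)) * (2 * y x * (2 * e\<^sup>2 * x))) / ((y x)\<^sup>2 * (y x)\<^sup>2)) (at x)"
      unfolding \<phi>'_def[abs_def]
      by (rule DERIV_divide) (use y0[of x] in \<open>auto intro!: derivative_eq_intros dy\<close>)
    also have "(- (2 * e\<^sup>2) * (y x)\<^sup>2 - (- (2 * e\<^sup>2 * x)) * (2 * y x * (2 * e\<^sup>2 * x))) =
        e\<^sup>2 * (8 * (e\<^sup>2 * x\<^sup>2) - 2 * y x) * y x"
      by (simp add: power2_eq_square algebra_simps)
    also have "8 * (e\<^sup>2 * x\<^sup>2) - 2 * y x = 6 * (e\<^sup>2 * x\<^sup>2) - 2" by (simp add: y_def)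
    also have "e\<^sup>2 * (6 * (e\<^sup>2 * x\<^sup>2) - 2) * y x / ((y x)\<^sup>2 * (y x)\<^sup>2) = \<phi>'' x"
      using y0[of x] by (simp add: \<phi>''_def power2_eq_square power3_eq_cube)
    finally show ?thesis .
  qed
  have c: "continuous_on UNIV \<phi>''"
    unfolding \<phi>''_def using y0
    by (intro continuous_intros continuous_at_imp_continuous_on ballI DERIV_isCont[OF dy]) auto
  have pos: "\<phi> x > 0" for x using y1[of x] by (simp add: \<phi>_def)
  have b1: "\<bar>\<phi>' x\<bar> \<le> (2 * e) * \<phi> x" for x
  proof -
    have "\<bar>e * x\<bar> \<le> y x"
    proof -
      have "0 \<le> (\<bar>e * x\<bar> - 1)\<^sup>2" by simp
      then have "2 * \<bar>e * x\<bar> \<le> 1 + (e * x)\<^sup>2" unfolding power2_diff by simp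
      then show ?thesis by (simp add: y_def power_mult_distrib)
    qed
    then have "2 * e * \<bar>e * x\<bar> \<le> 2 * e * y x" using e by simp
    moreover have "\<bar>\<phi>' x\<bar> = 2 * e * \<bar>e * x\<bar> / (y x)\<^sup>2"
      using e by (simp add: \<phi>'_def abs_mult power2_eq_square)
    ultimately have "\<bar>\<phi>' x\<bar> \<le> 2 * e * y x / (y x)\<^sup>2" by (simp add: divide_right_mono)
    then show ?thesis using y0[of x] by (simp add: \<phi>_def power2_eq_square)
  qed
  have b2: "\<bar>\<phi>'' x\<bar> \<le> \<eta> * \<phi> x" for x
  proof -
    have t: "0 \<le> e\<^sup>2 * x\<^sup>2" by simp
    have "\<bar>6 * w - 2\<bar> \<le> 6 * (1 + w)" if "0 \<le> w" for w :: real
      using that by (simp add: abs_le_iff)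
    from this[OF t] have "\<bar>6 * (e\<^sup>2 * x\<^sup>2) - 2\<bar> \<le> 6 * y x" by (simp add: y_def)
    then have "e\<^sup>2 * \<bar>6 * (e\<^sup>2 * x\<^sup>2) - 2\<bar> / (y x) ^ 3 \<le> e\<^sup>2 * (6 * y x) / (y x) ^ 3"
      using y1[of x] by (intro divide_right_mono mult_left_mono) auto
    also have "\<dots> = \<eta> / (y x)\<^sup>2" using y0[of x] e(2) by (simp add: power2_eq_square power3_eq_cube)
    also have "\<dots> \<le> \<eta> / y x" using y1[of x] \<eta> by (simp add: power2_eq_square frac_le)
    finally show ?thesis using y1[of x] by (simp add: \<phi>''_def \<phi>_def abs_mult)
  qed
  have [measurable]: "\<phi> \<in> borel_measurable borel"
    by (intro borel_measurable_continuous_onI continuous_at_imp_continuous_on ballI DERIV_isCont[OF d1])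
  \<comment> \<open>The antiderivative is \<open>arctan (e * x) / e\<close>. It gives integrability
    of \<open>\<phi>\<close>, which dominates its own square because
    \<open>\<phi> <= 1\<close>.\<close>
  have "(\<integral>\<^sup>+ x. ennreal (\<phi> x) * indicator {0..} x \<partial>lborel) = ennreal (pi / 2 / e - arctan (e * 0) / e)"
  proof (rule nn_integral_FTC_atLeast)
    show "((\<lambda>x. arctan (e * x) / e) \<longlongrightarrow> pi / 2 / e) at_top"
      using e(1) by (intro tendsto_divide filterlim_compose[OF tendsto_arctan_at_top]
          filterlim_tendsto_pos_mult_at_top[OF tendsto_const] filterlim_ident tendsto_const) auto
    show "((\<lambda>x. arctan (e * x) / e) has_real_derivative \<phi> x) (at x)" for x
    proof -
      have "((\<lambda>x. arctan (e * x) / e) has_real_derivative (inverse (1 + (e * x)\<^sup>2) * (e * 1)) / e) (at x)"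
        by (intro DERIV_cdivide DERIV_chain2[OF DERIV_arctan] DERIV_cmult DERIV_ident)
      then show ?thesis using e(1) by (simp add: \<phi>_def y_def power_mult_distrib inverse_eq_divide)
    qed
  qed (use pos in \<open>auto intro: less_imp_le\<close>)
  then have "(\<integral>\<^sup>+ x. ennreal (\<phi> x * indicator {0..} x) \<partial>lborel) < \<infinity>"
    by (subst (asm) nn_integral_cong[of _ _ "\<lambda>x. ennreal (\<phi> x * indicator {0..} x)"]) (auto simp: indicator_def)
  then have i: "integrable lborel (\<lambda>x. \<phi> x * indicator {0..} x)"
    by (intro integrableI_nonneg) (use pos in \<open>auto intro!: AE_I2 mult_nonneg_nonneg intro: less_imp_le\<close>)
  have i': "integrable lborel (\<lambda>x. \<phi> (- x) * indicator {0..} (- x))"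
    using i lborel_integrable_real_affine_iff[of "-1" "\<lambda>x. \<phi> x * indicator {0..} x" 0] by simp
  have "integrable lborel (\<lambda>x. (\<phi> x)\<^sup>2)"
  proof (rule Bochner_Integration.integrable_bound[OF Bochner_Integration.integrable_add[OF i i']])
    have "(\<phi> x)\<^sup>2 \<le> \<phi> x * indicator {0..} x + \<phi> (- x) * indicator {0..} (- x)" for x
    proof -
      have "\<phi> x \<le> 1" using y1[of x] by (simp add: \<phi>_def)
      then have "(\<phi> x)\<^sup>2 \<le> \<phi> x" using pos[of x] by (simp add: power2_eq_square mult_le_cancel_left1)
      moreover have "\<phi> (- x) = \<phi> x" by (simp add: \<phi>_def y_def)
      ultimately show ?thesis using pos[of x] by (auto simp: indicator_def)
    qed
    then show "AE x in lborel. norm ((\<phi> x)\<^sup>2) \<le> norm (\<phi> x * indicator {0..} x + \<phi> (- x) * indicator {0..} (- x))"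
      by (intro AE_I2) (smt (verit) norm_power real_norm_def abs_of_nonneg zero_le_power2)
  qed measurable
  then show ?thesis using d1 d2 c pos b1 b2 by (intro exI[of _ \<phi>] exI[of _ \<phi>'] exI[of _ \<phi>''] conjI) auto
qed

text \<open>The imaginary part is \<open>Im z\<close> times a positive number, so a root would be
  real; but for positive \<open>z\<close> the terms cannot cancel.\<close>

lemma quadratic_no_root_right_half_plane:
  fixes z :: complex
  assumes "A > 0" "B > 0" "D \<ge> 0" "Re z > 0"
  shows "of_real A * z\<^sup>2 + of_real B * z + of_real D \<noteq> 0"
proof
  assume *: "of_real A * z\<^sup>2 + of_real B * z + of_real D = 0"
  have "Im z * (2 * A * Re z + B) = 0"
    using arg_cong[OF *, of Im] by (simp add: power2_eq_square algebra_simps)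
  moreover have "2 * A * Re z + B > 0" using assms by (intro add_pos_pos mult_pos_pos) auto
  ultimately have "Im z = 0" by simp
  then have "A * (Re z)\<^sup>2 + B * Re z + D = 0"
    using arg_cong[OF *, of Re] by (simp add: power2_eq_square)
  moreover have "A * (Re z)\<^sup>2 + B * Re z > 0" using assms by (intro add_pos_pos mult_pos_pos) auto
  ultimately show False using assms(3) by linarith
qed

text \<open>\<open>q\<close> is the square of a wave number and the expression the determinant of
  the Fourier transformed system. Sorted by powers of \<open>z\<close>, its first two coefficients
  are positive and the last is nonnegative.\<close>

lemma symbol_nonzero:
  fixes z :: complex
  assumes "\<alpha> > 0" "\<kappa> > 0" "Re z > 0" "q \<ge> 0"
  shows "(of_real \<alpha> * z + of_real \<kappa> + of_real q) * (of_real \<alpha> * z + of_real q) + z\<^sup>2 \<noteq> 0"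
proof -
  have "of_real (\<alpha>\<^sup>2 + 1) * z\<^sup>2 + of_real (\<alpha> * (\<kappa> + 2 * q)) * z + of_real ((\<kappa> + q) * q) \<noteq> (0::complex)"
    using assms by (intro quadratic_no_root_right_half_plane) (auto intro!: add_nonneg_pos mult_pos_pos add_pos_nonneg)
  then show ?thesis by (simp add: power2_eq_square algebra_simps)
qed

text \<open>The principal root has nonnegative real part, and an imaginary root squares to a
  nonpositive real number.\<close>

lemma Re_csqrt_pos:
  assumes "\<And>q::real. q \<ge> 0 \<Longrightarrow> \<nu> \<noteq> - of_real q"
  shows "Re (csqrt \<nu>) > 0"
proof (rule ccontr)
  assume "\<not> Re (csqrt \<nu>) > 0"
  then have "Re (csqrt \<nu>) = 0" using csqrt_principal[of \<nu>] by auto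
  then have c: "csqrt \<nu> = \<i> * of_real (Im (csqrt \<nu>))" by (simp add: complex_eq_iff)
  have "\<nu> = (csqrt \<nu>)\<^sup>2" by simp
  also have "\<dots> = - of_real ((Im (csqrt \<nu>))\<^sup>2)" by (subst c) (simp add: power_mult_distrib)
  finally show False using assms[of "(Im (csqrt \<nu>))\<^sup>2"] by simp
qed

text \<open>\<open>b\<close> and \<open>c\<close> are trace and determinant of the coefficient
  matrix, \<open>\<nu>\<close> and \<open>\<nu>'\<close> its eigenvalues. An eigenvalue
  \<open>- q\<close> with \<open>q >= 0\<close> would be a zero of the symbol; so both have roots
  with positive real part, as the scalar resolvents require.\<close>

lemma symbol_factors:
  fixes z :: complex
  assumes "\<alpha> > 0" "\<kappa> > 0" "Re z > 0"
  obtains \<sigma> \<tau> where "Re \<sigma> > 0" "Re \<tau> > 0" "\<sigma>\<^sup>2 + \<tau>\<^sup>2 = 2 * (of_real \<alpha> * z) + of_real \<kappa>"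
    "\<sigma>\<^sup>2 * \<tau>\<^sup>2 = (of_real \<alpha> * z + of_real \<kappa>) * (of_real \<alpha> * z) + z\<^sup>2"
proof -
  define b c where "b = 2 * (of_real \<alpha> * z) + of_real \<kappa>"
    and "c = (of_real \<alpha> * z + of_real \<kappa>) * (of_real \<alpha> * z) + z\<^sup>2"
  define d where "d = csqrt (b\<^sup>2 - 4 * c)"
  have d: "d\<^sup>2 = b\<^sup>2 - 4 * c" by (simp add: d_def)
  define \<nu> \<nu>' where "\<nu> = (b + d) / 2" and "\<nu>' = (b - d) / 2"
  have sum: "\<nu> + \<nu>' = b" by (simp add: \<nu>_def \<nu>'_def field_simps)
  have "4 * (\<nu> * \<nu>') = b\<^sup>2 - d\<^sup>2" by (simp add: \<nu>_def \<nu>'_def power2_eq_square field_simps)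
  then have prod: "\<nu> * \<nu>' = c" using d by simp
  have nonneg: "x \<noteq> - of_real q" if x: "x * x - b * x + c = 0" and q: "q \<ge> 0" for x q
  proof
    assume "x = - of_real q"
    then have "(of_real \<alpha> * z + of_real \<kappa> + of_real q) * (of_real \<alpha> * z + of_real q) + z\<^sup>2 = 0"
      using x by (simp add: b_def c_def algebra_simps power2_eq_square)
    then show False using symbol_nonzero[OF assms q] by simp
  qed
  have "\<nu> * \<nu> - b * \<nu> + c = 0" "\<nu>' * \<nu>' - b * \<nu>' + c = 0"
    unfolding sum[symmetric] prod[symmetric] by (simp_all add: algebra_simps)
  then have "Re (csqrt \<nu>) > 0" "Re (csqrt \<nu>') > 0" using nonneg by (blast intro: Re_csqrt_pos)+
  then show thesis using that[of "csqrt \<nu>" "csqrt \<nu>'"] sum prod by (simp add: b_def c_def)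
qed

text \<open>The equations \<open>u'' = (\<alpha> z + \<kappa>) u - z v - g1\<close> and
  \<open>v'' = z u + \<alpha> z v - g2\<close>, integrated once to match the increments in
  \<open>H2\<close>.\<close>

definition system_solution ::
    "complex \<Rightarrow> complex \<Rightarrow> complex \<Rightarrow> (real \<Rightarrow> complex) \<Rightarrow> (real \<Rightarrow> complex) \<Rightarrow>
     (real \<Rightarrow> complex) \<Rightarrow> (real \<Rightarrow> complex) \<Rightarrow> (real \<Rightarrow> complex) \<Rightarrow> (real \<Rightarrow> complex) \<Rightarrow> bool" where
  "system_solution \<alpha> \<kappa> z g1 g2 u u' v v' \<longleftrightarrow> sqint u \<and> sqint u' \<and> sqint v \<and> sqint v' \<and>
    (\<forall>a b. a \<le> b \<longrightarrow> (u' has_integral (u b - u a)) {a..b}) \<and>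
    (\<forall>a b. a \<le> b \<longrightarrow> (v' has_integral (v b - v a)) {a..b}) \<and>
    (\<forall>a b. a \<le> b \<longrightarrow> ((\<lambda>x. (\<alpha> * z + \<kappa>) * u x - z * v x - g1 x) has_integral (u' b - u' a)) {a..b}) \<and>
    (\<forall>a b. a \<le> b \<longrightarrow> ((\<lambda>x. z * u x + \<alpha> * z * v x - g2 x) has_integral (v' b - v' a)) {a..b})"

text \<open>With \<open>\<nu> = \<sigma>\<^sup>2\<close> and \<open>\<nu>' = \<tau>\<^sup>2\<close> the eigenvalues of the coefficient matrix, \<open>y = (\<alpha> z - \<nu>) u + z v\<close> comes from a left
  eigenvector; this makes the system triangular.\<close>

lemma system_resolvent:
  fixes z :: complex
  assumes "\<alpha> > 0" "\<kappa> > 0" "Re z > 0"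
  shows "\<exists>K\<ge>0. \<forall>g1 g2. sqint g1 \<and> sqint g2 \<longrightarrow> (\<exists>u u' v v'.
    system_solution (of_real \<alpha>) (of_real \<kappa>) z g1 g2 u u' v v' \<and> nsq u + nsq v \<le> K * (nsq g1 + nsq g2))"
proof -
  obtain \<sigma> \<tau> where re: "Re \<sigma> > 0" "Re \<tau> > 0" and sum: "\<sigma>\<^sup>2 + \<tau>\<^sup>2 = 2 * (of_real \<alpha> * z) + of_real \<kappa>"
    and prod: "\<sigma>\<^sup>2 * \<tau>\<^sup>2 = (of_real \<alpha> * z + of_real \<kappa>) * (of_real \<alpha> * z) + z\<^sup>2"
    using symbol_factors[OF assms] by blast
  have z: "z \<noteq> 0" using assms(3) by auto
  define r where "r = of_real \<alpha> * z - \<sigma>\<^sup>2"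
  have r': "of_real \<alpha> * z + of_real \<kappa> = \<tau>\<^sup>2 - r" using sum by (simp add: r_def algebra_simps)
  \<comment> \<open>The characteristic equation, rewritten by the sum and the product of the
    eigenvalues; it says that \<open>(r, z)\<close> is a left eigenvector for
    \<open>\<sigma>\<^sup>2\<close>.\<close>
  have rr: "r * (of_real \<alpha> * z - \<tau>\<^sup>2) = z\<^sup>2"
  proof -
    have "r * (of_real \<alpha> * z - \<tau>\<^sup>2) = (of_real \<alpha> * z)\<^sup>2 - of_real \<alpha> * z * (\<sigma>\<^sup>2 + \<tau>\<^sup>2) + \<sigma>\<^sup>2 * \<tau>\<^sup>2"
      by (simp add: r_def power2_eq_square algebra_simps)
    then show ?thesis unfolding sum prod by (simp add: power2_eq_square algebra_simps)
  qed
  define k1 k2 where "k1 = 1 / (Re \<sigma>) ^ 4" and "k2 = 1 / (Re \<tau>) ^ 4"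
  define R Z where "R = (cmod r)\<^sup>2" and "Z = (cmod z)\<^sup>2"
  have nn: "k1 \<ge> 0" "k2 \<ge> 0" "R \<ge> 0" "Z > 0" using z by (auto simp: k1_def k2_def R_def Z_def)
  define Ky where "Ky = k1 * (2 * R + 2 * Z)"
  define Ku where "Ku = k2 * (2 + 2 * Ky)"
  define Kv where "Kv = (2 * Ky + 2 * R * Ku) / Z"
  have nnK: "Ky \<ge> 0" "Ku \<ge> 0" "Kv \<ge> 0" using nn by (auto simp: Ky_def Ku_def Kv_def)
  show ?thesis
  proof (intro exI[of _ "Ku + Kv"] conjI allI impI)
    show "0 \<le> Ku + Kv" using nnK by simp
    fix g1 g2 assume "sqint g1 \<and> sqint g2"
    then have g: "sqint g1" "sqint g2" by auto
    define N where "N = nsq g1 + nsq g2"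
    have N: "0 \<le> N" "nsq g1 \<le> N" "nsq g2 \<le> N" using nsq_nonneg[of g1] nsq_nonneg[of g2] by (auto simp: N_def)
    \<comment> \<open>The source of the decoupled scalar equation for
      \<open>y = r u + z v\<close>.\<close>
    define G where "G x = r * g1 x + z * g2 x" for x
    have G: "sqint G" unfolding G_def[abs_def] by (intro sqint_add(1) sqint_cmult g)
    have nG: "nsq G \<le> (2 * R + 2 * Z) * N"
    proof -
      have "nsq G \<le> 2 * (R * nsq g1) + 2 * (Z * nsq g2)"
        unfolding G_def[abs_def] R_def Z_def nsq_cmult[symmetric] by (intro sqint_add(2) sqint_cmult g)
      also have "\<dots> \<le> 2 * (R * N) + 2 * (Z * N)" using nn N by (intro add_mono mult_left_mono) auto
      finally show ?thesis by (simp add: algebra_simps)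
    qed
    obtain y y' where y: "sqint y" "sqint y'"
      and yy': "\<And>a b. a \<le> b \<Longrightarrow> (y' has_integral (y b - y a)) {a..b}"
      and y'': "\<And>a b. a \<le> b \<Longrightarrow> ((\<lambda>x. \<sigma>\<^sup>2 * y x - G x) has_integral (y' b - y' a)) {a..b}"
      and ny: "nsq y \<le> nsq G / (Re \<sigma>) ^ 4"
      using resolvent_line[OF G re(1)] by blast
    have ny': "nsq y \<le> Ky * N"
    proof -
      have "nsq y \<le> k1 * nsq G" using ny by (simp add: k1_def)
      also have "\<dots> \<le> k1 * ((2 * R + 2 * Z) * N)" using nG nn by (intro mult_left_mono) auto
      finally show ?thesis by (simp add: Ky_def mult.assoc)
    qed
    \<comment> \<open>With \<open>y\<close> known, the equation for \<open>u\<close> is scalar with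
      coefficient \<open>\<tau>\<^sup>2\<close>, and \<open>y\<close> joins the source;
      \<open>v\<close> is then recovered by division by \<open>z\<close>.\<close>
    define H where "H x = g1 x + y x" for x
    have H: "sqint H" unfolding H_def[abs_def] by (intro sqint_add(1) g y)
    obtain u u' where u: "sqint u" "sqint u'"
      and uu': "\<And>a b. a \<le> b \<Longrightarrow> (u' has_integral (u b - u a)) {a..b}"
      and u'': "\<And>a b. a \<le> b \<Longrightarrow> ((\<lambda>x. \<tau>\<^sup>2 * u x - H x) has_integral (u' b - u' a)) {a..b}"
      and nu: "nsq u \<le> nsq H / (Re \<tau>) ^ 4"
      using resolvent_line[OF H re(2)] by blast
    have nu': "nsq u \<le> Ku * N"
    proof -
      have "nsq H \<le> 2 * nsq g1 + 2 * nsq y" unfolding H_def[abs_def] by (intro sqint_add(2) g y)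
      also have "\<dots> \<le> 2 * N + 2 * (Ky * N)" using N ny' by linarith
      finally have "k2 * nsq H \<le> k2 * (2 * N + 2 * (Ky * N))" using nn by (intro mult_left_mono)
      moreover have "nsq u \<le> k2 * nsq H" using nu by (simp add: k2_def)
      ultimately show ?thesis by (simp add: Ku_def algebra_simps)
    qed
    define v v' where "v x = (1 / z) * (y x - r * u x)" and "v' x = (1 / z) * (y' x - r * u' x)" for x
    have v: "sqint v" "sqint v'"
      unfolding v_def[abs_def] v'_def[abs_def] by (intro sqint_cmult sqint_diff u y)+
    have nv: "nsq v \<le> Kv * N"
    proof -
      have "nsq (\<lambda>x. y x + (- r) * u x) \<le> 2 * nsq y + 2 * nsq (\<lambda>x. (- r) * u x)"
        by (intro sqint_add(2) sqint_cmult u y)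
      also have "\<dots> = 2 * nsq y + 2 * (R * nsq u)" by (subst nsq_cmult) (simp add: R_def)
      also have "\<dots> \<le> 2 * (Ky * N) + 2 * (R * (Ku * N))"
        using ny' nu' nn by (intro add_mono mult_left_mono) auto
      finally have "nsq (\<lambda>x. y x - r * u x) \<le> 2 * (Ky * N) + 2 * (R * (Ku * N))" by simp
      then have "nsq v \<le> (1 / Z) * (2 * (Ky * N) + 2 * (R * (Ku * N)))"
        unfolding v_def[abs_def] nsq_cmult using nn
        by (simp add: Z_def norm_divide power_divide divide_right_mono)
      then show ?thesis by (simp add: Kv_def algebra_simps add_divide_distrib)
    qed
    have vv': "(v' has_integral (v b - v a)) {a..b}" if "a \<le> b" for a b
    proof -
      have "((\<lambda>x. (1 / z) * (y' x - r * u' x)) has_integral (1 / z) * ((y b - y a) - r * (u b - u a))) {a..b}"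
        by (intro has_integral_mult_right has_integral_diff yy' uu' that)
      then show ?thesis by (simp add: v_def v'_def[abs_def] algebra_simps)
    qed
    have u2: "\<tau>\<^sup>2 * u x - H x = (of_real \<alpha> * z + of_real \<kappa>) * u x - z * v x - g1 x" for x
      unfolding r' using z by (simp add: v_def H_def algebra_simps)
    have v2: "(1 / z) * ((\<sigma>\<^sup>2 * y x - G x) - r * (\<tau>\<^sup>2 * u x - H x)) = z * u x + of_real \<alpha> * z * v x - g2 x" for x
    proof -
      have "(\<sigma>\<^sup>2 * y x - G x) - r * (\<tau>\<^sup>2 * u x - H x) = (\<sigma>\<^sup>2 + r) * y x - r * \<tau>\<^sup>2 * u x - z * g2 x"
        by (simp add: G_def H_def algebra_simps)
      also have "\<sigma>\<^sup>2 + r = of_real \<alpha> * z" by (simp add: r_def)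
      also have "r * \<tau>\<^sup>2 = r * (of_real \<alpha> * z) - z\<^sup>2" unfolding rr[symmetric] by (simp add: algebra_simps)
      finally have e: "(\<sigma>\<^sup>2 * y x - G x) - r * (\<tau>\<^sup>2 * u x - H x) =
          of_real \<alpha> * z * y x - (r * (of_real \<alpha> * z) - z\<^sup>2) * u x - z * g2 x" .
      show ?thesis unfolding e using z by (simp add: v_def power2_eq_square field_simps)
    qed
    have v'': "((\<lambda>x. z * u x + of_real \<alpha> * z * v x - g2 x) has_integral (v' b - v' a)) {a..b}" if "a \<le> b" for a b
    proof -
      have "((\<lambda>x. (1 / z) * ((\<sigma>\<^sup>2 * y x - G x) - r * (\<tau>\<^sup>2 * u x - H x))) has_integral
          (1 / z) * ((y' b - y' a) - r * (u' b - u' a))) {a..b}"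
        by (intro has_integral_mult_right has_integral_diff y'' u'' that)
      moreover have "(1 / z) * ((y' b - y' a) - r * (u' b - u' a)) = v' b - v' a"
        by (simp add: v'_def algebra_simps)
      ultimately show ?thesis unfolding v2 by simp
    qed
    have "nsq u + nsq v \<le> (Ku + Kv) * (nsq g1 + nsq g2)"
      using nu' nv unfolding N_def by (simp add: algebra_simps)
    moreover have "system_solution (of_real \<alpha>) (of_real \<kappa>) z g1 g2 u u' v v'"
      unfolding system_solution_def using u v uu' vv' u''[unfolded u2] v'' by blast
    ultimately show "\<exists>u u' v v'. system_solution (of_real \<alpha>) (of_real \<kappa>) z g1 g2 u u' v v' \<and>
      nsq u + nsq v \<le> (Ku + Kv) * (nsq g1 + nsq g2)" by blast
  qed
qed

text \<open>The combination \<open>r u + z v\<close> solves a scalar homogeneous equation and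
  vanishes; then so does \<open>u\<close>, and \<open>v\<close> because \<open>z\<close> is nonzero.
  The equations are only assumed almost everywhere, as in \<open>resolvent_equation\<close>.\<close>

lemma system_unique:
  fixes z :: complex
  assumes "\<alpha> > 0" "\<kappa> > 0" "Re z > 0"
    and sq: "sqint u" "sqint u'" "sqint v" "sqint v'"
    and uu': "\<And>a b. a \<le> b \<Longrightarrow> (u' has_integral (u b - u a)) {a..b}"
    and vv': "\<And>a b. a \<le> b \<Longrightarrow> (v' has_integral (v b - v a)) {a..b}"
    and u'': "\<And>a b. a \<le> b \<Longrightarrow> (u2 has_integral (u' b - u' a)) {a..b}"
    and v'': "\<And>a b. a \<le> b \<Longrightarrow> (v2 has_integral (v' b - v' a)) {a..b}"
    and ae: "AE x in lborel. u2 x = (of_real \<alpha> * z + of_real \<kappa>) * u x - z * v x"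
      "AE x in lborel. v2 x = z * u x + of_real \<alpha> * z * v x"
  shows "u x = 0 \<and> v x = 0"
proof -
  obtain \<sigma> \<tau> where re: "Re \<sigma> > 0" "Re \<tau> > 0" and sum: "\<sigma>\<^sup>2 + \<tau>\<^sup>2 = 2 * (of_real \<alpha> * z) + of_real \<kappa>"
    and prod: "\<sigma>\<^sup>2 * \<tau>\<^sup>2 = (of_real \<alpha> * z + of_real \<kappa>) * (of_real \<alpha> * z) + z\<^sup>2"
    using symbol_factors[OF assms(1-3)] by blast
  have z: "z \<noteq> 0" using assms(3) by auto
  define r where "r = of_real \<alpha> * z - \<sigma>\<^sup>2"
  have r': "of_real \<alpha> * z + of_real \<kappa> = \<tau>\<^sup>2 - r" using sum by (simp add: r_def algebra_simps)
  have rr: "r * (\<tau>\<^sup>2 - of_real \<alpha> * z) = - z\<^sup>2"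
  proof -
    have "r * (\<tau>\<^sup>2 - of_real \<alpha> * z) = of_real \<alpha> * z * (\<sigma>\<^sup>2 + \<tau>\<^sup>2) - (of_real \<alpha> * z)\<^sup>2 - \<sigma>\<^sup>2 * \<tau>\<^sup>2"
      by (simp add: r_def power2_eq_square algebra_simps)
    then show ?thesis unfolding sum prod by (simp add: power2_eq_square algebra_simps)
  qed
  have y: "r * u x + z * v x = 0" for x
  proof (rule resolvent_line_unique[OF _ _ re(1)])
    show "sqint (\<lambda>x. r * u x + z * v x)" "sqint (\<lambda>x. r * u' x + z * v' x)"
      by (intro sqint_add(1) sqint_cmult sq)+
    show "((\<lambda>x. r * u' x + z * v' x) has_integral (r * u b + z * v b - (r * u a + z * v a))) {a..b}" if "a \<le> b" for a b
    proof -
      have "((\<lambda>x. r * u' x + z * v' x) has_integral (r * (u b - u a) + z * (v b - v a))) {a..b}"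
        by (intro has_integral_add has_integral_mult_right uu' vv' that)
      then show ?thesis by (simp add: algebra_simps)
    qed
    show "((\<lambda>x. r * u2 x + z * v2 x) has_integral (r * u' b + z * v' b - (r * u' a + z * v' a))) {a..b}" if "a \<le> b" for a b
    proof -
      have "((\<lambda>x. r * u2 x + z * v2 x) has_integral (r * (u' b - u' a) + z * (v' b - v' a))) {a..b}"
        by (intro has_integral_add has_integral_mult_right u'' v'' that)
      then show ?thesis by (simp add: algebra_simps)
    qed
    show "AE x in lborel. r * u2 x + z * v2 x = \<sigma>\<^sup>2 * (r * u x + z * v x)"
      using ae
    proof eventually_elim
      case (elim x)
      have "r * u2 x + z * v2 x = (r * (\<tau>\<^sup>2 - r) + z\<^sup>2) * u x + (of_real \<alpha> * z - r) * (z * v x)"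
        unfolding elim r' by (simp add: power2_eq_square algebra_simps)
      also have "r * (\<tau>\<^sup>2 - r) + z\<^sup>2 = r * \<sigma>\<^sup>2"
      proof -
        have "r * (\<tau>\<^sup>2 - r) = r * (\<tau>\<^sup>2 - of_real \<alpha> * z) + r * \<sigma>\<^sup>2" by (simp add: r_def algebra_simps)
        then show ?thesis unfolding rr by simp
      qed
      also have "of_real \<alpha> * z - r = \<sigma>\<^sup>2" by (simp add: r_def)
      finally show ?case by (simp add: algebra_simps)
    qed
  qed
  have u0: "u x = 0" for x
  proof (rule resolvent_line_unique[OF sq(1,2) re(2) uu' u''])
    show "AE x in lborel. u2 x = \<tau>\<^sup>2 * u x"
      using ae(1)
    proof eventually_elim
      case (elim x)
      have "z * v x = - (r * u x)" using y[of x] by (simp add: eq_neg_iff_add_eq_0 add.commute)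
      then show ?case unfolding elim r' by (simp add: algebra_simps)
    qed
  qed
  then show ?thesis using y[of x] z by simp
qed

section \<open>Linearization about the wavetrain\<close>

lemma has_derivative_cross3 [derivative_intros]:
  assumes "(f has_derivative f') (at x within A)" "(g has_derivative g') (at x within A)"
  shows "((\<lambda>x. cross3 (f x) (g x)) has_derivative (\<lambda>h. cross3 (f x) (g' h) + cross3 (f' h) (g x))) (at x within A)"
  by (rule bounded_bilinear.FDERIV[OF bilinear_conv_bounded_bilinear[THEN iffD1, OF bilinear_cross] assms])

lemma has_derivative_LLGS_residual:
  "(LLGS_residual \<alpha> \<beta> h \<mu> has_derivative (\<lambda>(w, wt, wxx).
     wt - (cross3 m (\<alpha> *\<^sub>R wt - wxx + (\<mu> * w$3) *\<^sub>R e3 + \<beta> *\<^sub>R cross3 w e3)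
       + cross3 w (\<alpha> *\<^sub>R mt - mxx + (\<mu> * m$3 - h) *\<^sub>R e3 + \<beta> *\<^sub>R cross3 m e3)))) (at (m, mt, mxx))"
proof -
  have nth: "((\<lambda>X. (fst X) $ 3) has_derivative (\<lambda>X. (fst X) $ 3)) (at P)" for P :: "(real^3) \<times> (real^3) \<times> (real^3)"
    by (intro bounded_linear_imp_has_derivative bounded_linear_compose[OF bounded_linear_vec_nth bounded_linear_fst])
  have "((\<lambda>X. fst (snd X) - cross3 (fst X) (\<alpha> *\<^sub>R fst (snd X) - snd (snd X) + (\<mu> * (fst X)$3 - h) *\<^sub>R e3 + \<beta> *\<^sub>R cross3 (fst X) e3))
    has_derivative (\<lambda>X. fst (snd X) - (cross3 m (\<alpha> *\<^sub>R fst (snd X) - snd (snd X) + (\<mu> * (fst X)$3) *\<^sub>R e3 + \<beta> *\<^sub>R cross3 (fst X) e3)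
       + cross3 (fst X) (\<alpha> *\<^sub>R mt - mxx + (\<mu> * m$3 - h) *\<^sub>R e3 + \<beta> *\<^sub>R cross3 m e3)))) (at (m, mt, mxx))"
    by (auto intro!: derivative_eq_intros nth)
  then show ?thesis
    by (simp add: LLGS_residual_def[abs_def] case_prod_beta')
qed

text \<open>All terms with \<open>\<Omega>\<close> cancel in the rotating frame:
  \<open>\<beta> = \<alpha> \<Omega>\<close> balances damping and torque, and
  \<open>\<mu> cos \<theta> - h = - \<Omega>\<close> along the wavetrain balances the precession. As
  \<open>k = 0\<close>, nothing depends on \<open>x\<close>. The frequency argument is
  \<open>- \<Omega>\<close> because wavetrains have phase \<open>k x - \<omega> t\<close>.\<close>

lemma wavetrain_linearization_eq:
  assumes "\<beta> = \<alpha> * \<Omega>" "h - \<Omega> = \<mu> * cos \<theta>\<^sub>0"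
  shows "wavetrain_linearization \<alpha> \<beta> h \<mu> 0 (- \<Omega>) \<theta>\<^sub>0 x w wt wxx =
    wt - cross3 (sph 0 \<theta>\<^sub>0) (\<alpha> *\<^sub>R wt - wxx + (\<mu> * w$3) *\<^sub>R e3)"
proof -
  define n where "n = sph 0 \<theta>\<^sub>0"
  have n3: "\<mu> * n$3 - h = - \<Omega>" using assms(2) by (simp add: n_def sph_def)
  have "frechet_derivative (LLGS_residual \<alpha> \<beta> h \<mu>) (at (n, - (- \<Omega>) *\<^sub>R cross3 e3 n, 0)) =
    (\<lambda>(w, wt, wxx). wt - (cross3 n (\<alpha> *\<^sub>R wt - wxx + (\<mu> * w$3) *\<^sub>R e3 + \<beta> *\<^sub>R cross3 w e3)
       + cross3 w (\<alpha> *\<^sub>R (- (- \<Omega>) *\<^sub>R cross3 e3 n) - 0 + (\<mu> * n$3 - h) *\<^sub>R e3 + \<beta> *\<^sub>R cross3 n e3)))"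
    by (rule frechet_derivative_at[symmetric, OF has_derivative_LLGS_residual])
  then have "wavetrain_linearization \<alpha> \<beta> h \<mu> 0 (- \<Omega>) \<theta>\<^sub>0 x w wt wxx =
    (wt - (- \<Omega>) *\<^sub>R cross3 e3 w) - (cross3 n (\<alpha> *\<^sub>R (wt - (- \<Omega>) *\<^sub>R cross3 e3 w) - wxx + (\<mu> * w$3) *\<^sub>R e3 + \<beta> *\<^sub>R cross3 w e3)
       + cross3 w (\<alpha> *\<^sub>R (- (- \<Omega>) *\<^sub>R cross3 e3 n) - 0 + (\<mu> * n$3 - h) *\<^sub>R e3 + \<beta> *\<^sub>R cross3 n e3))"
    by (simp add: wavetrain_linearization_def n_def)
  also have "\<dots> = wt - cross3 n (\<alpha> *\<^sub>R wt - wxx + (\<mu> * w$3) *\<^sub>R e3)"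
    unfolding n3 assms(1)
    by (simp add: vec_eq_iff forall_3 cross3_def e3_def axis_def algebra_simps)
  finally show ?thesis by (simp add: n_def)
qed

text \<open>Orthonormal coordinates on the complexified tangent plane at
  \<open>sph 0 \<theta>\<close>: \<open>u\<close> along the polar direction, \<open>v\<close> along
  the azimuthal one, which is the second axis there.\<close>

definition tang :: "real \<Rightarrow> complex \<Rightarrow> complex \<Rightarrow> complex^3" where
  "tang \<theta> u v = vector [of_real (cos \<theta>) * u, v, - of_real (sin \<theta>) * u]"

definition polar :: "real \<Rightarrow> complex^3 \<Rightarrow> complex" where
  "polar \<theta> w = of_real (cos \<theta>) * w$1 - of_real (sin \<theta>) * w$3"

lemma sin_cos_complex: "(of_real (sin \<theta>))\<^sup>2 + (of_real (cos \<theta>))\<^sup>2 = (1 :: complex)"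
  unfolding of_real_power[symmetric] of_real_add[symmetric] by simp

lemma polar_tang [simp]: "polar \<theta> (tang \<theta> u v) = u" "tang \<theta> u v $ 2 = v"
proof -
  have "polar \<theta> (tang \<theta> u v) = ((of_real (sin \<theta>))\<^sup>2 + (of_real (cos \<theta>))\<^sup>2) * u"
    by (simp add: polar_def tang_def power2_eq_square algebra_simps)
  then show "polar \<theta> (tang \<theta> u v) = u" by (simp add: sin_cos_complex)
qed (simp add: tang_def)

lemma tangent_field_tang: "tangent_field 0 \<theta> (\<lambda>x. tang \<theta> (u x) (v x))"
  by (simp add: tangent_field_def tang_def sph_def ReV_def ImV_def inner_vec_def sum_3)

lemma tangent_field_components:
  assumes "tangent_field 0 \<theta> w"
  shows "w x = tang \<theta> (polar \<theta> (w x)) (w x $ 2)"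
proof -
  define S C :: complex where "S = of_real (sin \<theta>)" and "C = of_real (cos \<theta>)"
  have SC: "S\<^sup>2 + C\<^sup>2 = 1" by (simp add: S_def C_def sin_cos_complex)
  have o: "S * w x $ 1 + C * w x $ 3 = 0"
    using assms by (simp add: tangent_field_def sph_def ReV_def ImV_def inner_vec_def sum_3 complex_eq_iff S_def C_def mult.commute)
  have "C * (C * w x $ 1 - S * w x $ 3) = (S\<^sup>2 + C\<^sup>2) * w x $ 1 - S * (S * w x $ 1 + C * w x $ 3)"
    "- S * (C * w x $ 1 - S * w x $ 3) = (S\<^sup>2 + C\<^sup>2) * w x $ 3 - C * (S * w x $ 1 + C * w x $ 3)"
    by (simp_all add: power2_eq_square algebra_simps)
  then show ?thesis
    unfolding o SC by (simp add: vec_eq_iff forall_3 tang_def polar_def S_def C_def)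
qed

lemma norm_tang: "(norm (tang \<theta> u v))\<^sup>2 = (cmod u)\<^sup>2 + (cmod v)\<^sup>2"
proof -
  have "(norm (tang \<theta> u v))\<^sup>2 = (\<bar>cos \<theta>\<bar> * cmod u)\<^sup>2 + (cmod v)\<^sup>2 + (\<bar>sin \<theta>\<bar> * cmod u)\<^sup>2"
    by (simp add: norm_vec_def L2_set_def sum_3 tang_def norm_mult)
  also have "\<dots> = ((sin \<theta>)\<^sup>2 + (cos \<theta>)\<^sup>2) * (cmod u)\<^sup>2 + (cmod v)\<^sup>2"
    by (simp only: power_mult_distrib power2_abs distrib_right add_ac)
  finally show ?thesis by simp
qed

lemma norm_tangent:
  assumes "tangent_field 0 \<theta> w"
  shows "(norm (w x))\<^sup>2 = (cmod (polar \<theta> (w x)))\<^sup>2 + (cmod (w x $ 2))\<^sup>2"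
  using norm_tang[of \<theta> "polar \<theta> (w x)" "w x $ 2"] tangent_field_components[OF assms, of x] by simp

text \<open>The cross product with the base point annihilates radial parts, so \<open>W\<close> need
  not be tangent. The first and third scalar equations are multiples of one polar equation by
  \<open>cos \<theta>\<close> and \<open>- sin \<theta>\<close>; their combination recovers it even
  if one factor vanishes.\<close>

lemma resolvent_pointwise:
  assumes "\<beta> = \<alpha> * \<Omega>" "h - \<Omega> = \<mu> * cos \<theta>" and w: "tangent_field 0 \<theta> w" and f: "tangent_field 0 \<theta> f"
    and eqs: "wavetrain_linearization \<alpha> \<beta> h \<mu> 0 (- \<Omega>) \<theta> x (ReV (w x)) (ReV (z *s w x - f x)) (ReV W) = 0"
      "wavetrain_linearization \<alpha> \<beta> h \<mu> 0 (- \<Omega>) \<theta> x (ImV (w x)) (ImV (z *s w x - f x)) (ImV W) = 0"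
  shows "polar \<theta> W = (of_real \<alpha> * z + of_real (\<mu> * (sin \<theta>)\<^sup>2)) * polar \<theta> (w x) - z * w x $ 2
      - (of_real \<alpha> * polar \<theta> (f x) - f x $ 2)"
    "W $ 2 = z * polar \<theta> (w x) + of_real \<alpha> * z * w x $ 2 - (polar \<theta> (f x) + of_real \<alpha> * f x $ 2)"
proof -
  define S C :: complex where "S = of_real (sin \<theta>)" and "C = of_real (cos \<theta>)"
  define u v fu fv where "u = polar \<theta> (w x)" and "v = w x $ 2" and "fu = polar \<theta> (f x)" and "fv = f x $ 2"
  have SC: "S * S + C * C = 1" using sin_cos_complex[of \<theta>] by (simp add: S_def C_def power2_eq_square)
  have wx: "w x $ 1 = C * u" "w x $ 3 = - S * u" "f x $ 1 = C * fu" "f x $ 3 = - S * fu"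
    using tangent_field_components[OF w, of x] tangent_field_components[OF f, of x]
    by (simp_all add: tang_def u_def v_def fu_def fv_def S_def C_def vec_eq_iff forall_3)
  define a where "a = z * u - fu"
  define b where "b = z * v - fv"
  have 1: "C * a + C * (of_real \<alpha> * b - W $ 2) = 0"
    and 2: "b - (C * (of_real \<alpha> * (C * a) - W $ 1) - S * (of_real \<alpha> * (- S * a) - W $ 3 + of_real \<mu> * (- S * u))) = 0"
    and 3: "- S * a - S * (of_real \<alpha> * b - W $ 2) = 0"
    using eqs unfolding wavetrain_linearization_eq[OF assms(1,2)]
    by (simp_all add: vec_eq_iff forall_3 cross3_def sph_def e3_def axis_def ReV_def ImV_def complex_eq_iff
        a_def b_def v_def[symmetric] fv_def[symmetric] wx S_def C_def algebra_simps)
  have "C * (C * a + C * (of_real \<alpha> * b - W $ 2)) - S * (- S * a - S * (of_real \<alpha> * b - W $ 2)) =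
      (S * S + C * C) * (a + of_real \<alpha> * b - W $ 2)"
    by (simp add: algebra_simps)
  then have "a + of_real \<alpha> * b - W $ 2 = 0" unfolding 1 3 SC by simp
  then show "W $ 2 = z * polar \<theta> (w x) + of_real \<alpha> * z * w x $ 2 - (polar \<theta> (f x) + of_real \<alpha> * f x $ 2)"
    by (simp add: a_def b_def u_def v_def fu_def fv_def algebra_simps)
  have "b - (C * (of_real \<alpha> * (C * a) - W $ 1) - S * (of_real \<alpha> * (- S * a) - W $ 3 + of_real \<mu> * (- S * u))) =
      b - (S * S + C * C) * (of_real \<alpha> * a) + (C * W $ 1 - S * W $ 3) - of_real \<mu> * (S * S) * u"
    by (simp add: algebra_simps)
  then have "b - of_real \<alpha> * a + polar \<theta> W - of_real \<mu> * (S * S) * u = 0"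
    unfolding 2 SC by (simp add: polar_def S_def C_def)
  then show "polar \<theta> W = (of_real \<alpha> * z + of_real (\<mu> * (sin \<theta>)\<^sup>2)) * polar \<theta> (w x) - z * w x $ 2
      - (of_real \<alpha> * polar \<theta> (f x) - f x $ 2)"
    by (simp add: a_def b_def u_def v_def fu_def fv_def S_def power2_eq_square algebra_simps)
qed

text \<open>The converse computation, which verifies a solution that has been constructed from its
  components.\<close>

lemma resolvent_pointwise_tang:
  assumes "\<beta> = \<alpha> * \<Omega>" "h - \<Omega> = \<mu> * cos \<theta>" and f: "tangent_field 0 \<theta> f"
    and a: "a = (of_real \<alpha> * z + of_real (\<mu> * (sin \<theta>)\<^sup>2)) * u - z * v - (of_real \<alpha> * polar \<theta> (f x) - f x $ 2)"
    and b: "b = z * u + of_real \<alpha> * z * v - (polar \<theta> (f x) + of_real \<alpha> * f x $ 2)"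
  shows "wavetrain_linearization \<alpha> \<beta> h \<mu> 0 (- \<Omega>) \<theta> x (ReV (tang \<theta> u v)) (ReV (z *s tang \<theta> u v - f x)) (ReV (tang \<theta> a b)) = 0"
    "wavetrain_linearization \<alpha> \<beta> h \<mu> 0 (- \<Omega>) \<theta> x (ImV (tang \<theta> u v)) (ImV (z *s tang \<theta> u v - f x)) (ImV (tang \<theta> a b)) = 0"
proof -
  define S C :: complex where "S = of_real (sin \<theta>)" and "C = of_real (cos \<theta>)"
  define fu fv where "fu = polar \<theta> (f x)" and "fv = f x $ 2"
  have SC: "S * S + C * C = 1" using sin_cos_complex[of \<theta>] by (simp add: S_def C_def power2_eq_square)
  have fx: "f x $ 1 = C * fu" "f x $ 3 = - S * fu"
    using tangent_field_components[OF f, of x]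
    by (simp_all add: tang_def fu_def S_def C_def vec_eq_iff forall_3)
  define p q where "p = z * u - fu" and "q = z * v - fv"
  have b': "p + of_real \<alpha> * q - b = 0" by (simp add: b p_def q_def fu_def fv_def algebra_simps)
  have a': "q - of_real \<alpha> * p + a - of_real \<mu> * (S * S) * u = 0"
    by (simp add: a p_def q_def fu_def fv_def S_def power2_eq_square algebra_simps)
  have 1: "C * p + C * (of_real \<alpha> * q - b) = 0"
    using arg_cong[OF b', of "\<lambda>t. C * t"] by (simp add: algebra_simps)
  have 3: "- S * p - S * (of_real \<alpha> * q - b) = 0"
    using arg_cong[OF b', of "\<lambda>t. - S * t"] by (simp add: algebra_simps)
  have "q - (C * (of_real \<alpha> * (C * p) - C * a) - S * (of_real \<alpha> * (- S * p) - (- S * a) + of_real \<mu> * (- S * u))) =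
      q - (S * S + C * C) * (of_real \<alpha> * p) + (S * S + C * C) * a - of_real \<mu> * (S * S) * u"
    by (simp add: algebra_simps)
  then have 2: "q - (C * (of_real \<alpha> * (C * p) - C * a) - S * (of_real \<alpha> * (- S * p) - (- S * a) + of_real \<mu> * (- S * u))) = 0"
    unfolding SC using a' by simp
  show "wavetrain_linearization \<alpha> \<beta> h \<mu> 0 (- \<Omega>) \<theta> x (ReV (tang \<theta> u v)) (ReV (z *s tang \<theta> u v - f x)) (ReV (tang \<theta> a b)) = 0"
    "wavetrain_linearization \<alpha> \<beta> h \<mu> 0 (- \<Omega>) \<theta> x (ImV (tang \<theta> u v)) (ImV (z *s tang \<theta> u v - f x)) (ImV (tang \<theta> a b)) = 0"
    using 1 2 3 unfolding wavetrain_linearization_eq[OF assms(1,2)]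
    by (simp_all add: vec_eq_iff forall_3 cross3_def sph_def e3_def axis_def ReV_def ImV_def complex_eq_iff
        tang_def p_def q_def fv_def[symmetric] fx S_def C_def algebra_simps)
qed

section \<open>Square integrable tangent fields in components\<close>

lemma bounded_linear_polar: "bounded_linear (polar \<theta>)"
  unfolding polar_def[abs_def]
  by (intro bounded_linear_sub bounded_linear_compose[OF bounded_linear_mult_right] bounded_linear_vec_nth)

lemma bounded_linear_nth2: "bounded_linear (\<lambda>w :: complex^3. w $ 2)"
  by (rule bounded_linear_vec_nth)

lemma bounded_linear_tang: "bounded_linear (\<lambda>u. tang \<theta> u 0)" "bounded_linear (\<lambda>v. tang \<theta> 0 v)"
  by (auto intro!: linear_conv_bounded_linear[THEN iffD1] linearI
      simp: tang_def vec_eq_iff forall_3 scaleR_conv_of_real[where 'a = complex] algebra_simps)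

lemma tang_split: "tang \<theta> u v = tang \<theta> u 0 + tang \<theta> 0 v"
  by (simp add: tang_def vec_eq_iff forall_3)

lemma L2_linear:
  assumes "L2 w" "bounded_linear l"
  shows "sqint (\<lambda>x. l (w x))"
proof -
  have [measurable]: "w \<in> borel_measurable borel" using assms by (simp add: L2_def)
  have [measurable]: "(\<lambda>x. l (w x)) \<in> borel_measurable borel"
    by (rule borel_measurable_continuous_on[OF linear_continuous_on[OF assms(2)]]) measurable
  obtain K where K: "\<And>x. norm (l x) \<le> norm x * K" "K \<ge> 0"
    using bounded_linear.nonneg_bounded[OF assms(2)] by blast
  have "integrable lborel (\<lambda>x. K\<^sup>2 * (norm (w x))\<^sup>2)" using assms(1) by (simp add: L2_def)
  then have "integrable lborel (\<lambda>x. (cmod (l (w x)))\<^sup>2)"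
  proof (rule Bochner_Integration.integrable_bound)
    have "(cmod (l (w x)))\<^sup>2 \<le> (norm (w x) * K)\<^sup>2" for x by (intro power_mono K) auto
    then show "AE x in lborel. norm ((cmod (l (w x)))\<^sup>2) \<le> norm (K\<^sup>2 * (norm (w x))\<^sup>2)"
      by (intro AE_I2) (simp add: power_mult_distrib mult.commute)
  qed measurable
  then show ?thesis by (simp add: sqint_def)
qed

lemma L2_tang:
  assumes "sqint u" "sqint v"
  shows "L2 (\<lambda>x. tang \<theta> (u x) (v x))"
proof -
  have [measurable]: "u \<in> borel_measurable borel" "v \<in> borel_measurable borel"
    using assms by (auto simp: sqint_def)
  have [measurable]: "(\<lambda>x. tang \<theta> (u x) 0) \<in> borel_measurable borel" "(\<lambda>x. tang \<theta> 0 (v x)) \<in> borel_measurable borel"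
    by (rule borel_measurable_continuous_on[OF linear_continuous_on[OF bounded_linear_tang(1)]], measurable)
      (rule borel_measurable_continuous_on[OF linear_continuous_on[OF bounded_linear_tang(2)]], measurable)
  have "(\<lambda>x. tang \<theta> (u x) (v x)) \<in> borel_measurable borel" by (subst tang_split) measurable
  then show ?thesis using assms by (simp add: L2_def norm_tang sqint_def)
qed

lemma tang_has_integral:
  assumes "(u has_integral U) S" "(v has_integral V) S"
  shows "((\<lambda>x. tang \<theta> (u x) (v x)) has_integral tang \<theta> U V) S"
proof -
  have "((\<lambda>x. tang \<theta> (u x) 0 + tang \<theta> 0 (v x)) has_integral tang \<theta> U 0 + tang \<theta> 0 V) S"
    using has_integral_linear[OF assms(1) bounded_linear_tang(1)] has_integral_linear[OF assms(2) bounded_linear_tang(2)]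
    by (intro has_integral_add) (simp_all add: comp_def)
  then show ?thesis by (simp add: tang_split[symmetric])
qed

lemma tang_diff: "tang \<theta> u v - tang \<theta> u' v' = tang \<theta> (u - u') (v - v')"
  by (simp add: tang_def vec_eq_iff forall_3 algebra_simps)

lemma H2_tang:
  assumes "sqint u" "sqint u'" "sqint u2" "sqint v" "sqint v'" "sqint v2"
    and "\<And>a b. a \<le> b \<Longrightarrow> (u' has_integral (u b - u a)) {a..b}" "\<And>a b. a \<le> b \<Longrightarrow> (v' has_integral (v b - v a)) {a..b}"
    and "\<And>a b. a \<le> b \<Longrightarrow> (u2 has_integral (u' b - u' a)) {a..b}" "\<And>a b. a \<le> b \<Longrightarrow> (v2 has_integral (v' b - v' a)) {a..b}"
  shows "H2 (\<lambda>x. tang \<theta> (u x) (v x)) (\<lambda>x. tang \<theta> (u2 x) (v2 x))"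
  unfolding H2_def using assms
  by (intro conjI exI[of _ "\<lambda>x. tang \<theta> (u' x) (v' x)"] allI impI L2_tang)
    (auto simp: tang_diff intro: tang_has_integral)

lemma H2_linear:
  assumes "H2 w wxx" "bounded_linear l"
  obtains w' where "sqint (\<lambda>x. l (w x))" "sqint (\<lambda>x. l (w' x))"
    "\<And>a b. a \<le> b \<Longrightarrow> ((\<lambda>x. l (w' x)) has_integral (l (w b) - l (w a))) {a..b}"
    "\<And>a b. a \<le> b \<Longrightarrow> ((\<lambda>x. l (wxx x)) has_integral (l (w' b) - l (w' a))) {a..b}"
proof -
  obtain w' where w': "L2 w'" and i: "\<And>a b. a \<le> b \<Longrightarrow> (w' has_integral (w b - w a)) {a..b}"
    "\<And>a b. a \<le> b \<Longrightarrow> (wxx has_integral (w' b - w' a)) {a..b}"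
    using assms(1) unfolding H2_def by blast
  interpret l: bounded_linear l by fact
  show thesis
  proof (rule that)
    show "sqint (\<lambda>x. l (w x))" "sqint (\<lambda>x. l (w' x))"
      using L2_linear[OF _ assms(2)] w' assms(1) by (auto simp: H2_def)
    show "((\<lambda>x. l (w' x)) has_integral (l (w b) - l (w a))) {a..b}"
      "((\<lambda>x. l (wxx x)) has_integral (l (w' b) - l (w' a))) {a..b}" if "a \<le> b" for a b
      using has_integral_linear[OF i(1)[OF that] assms(2)] has_integral_linear[OF i(2)[OF that] assms(2)]
      by (simp_all add: comp_def l.diff)
  qed
qed

definition wsq :: "(real \<Rightarrow> complex^3) \<Rightarrow> real" where
  "wsq w = (LINT x|lborel. (norm (w x))\<^sup>2)"

lemma L2_norm_fun_eq: "L2_norm_fun w = sqrt (wsq w)"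
  by (simp add: L2_norm_fun_def wsq_def)

lemma wsq_tangent:
  assumes "tangent_field 0 \<theta> w" "L2 w"
  shows "wsq w = nsq (\<lambda>x. polar \<theta> (w x)) + nsq (\<lambda>x. w x $ 2)"
  using L2_linear[OF assms(2) bounded_linear_polar[of \<theta>]] L2_linear[OF assms(2) bounded_linear_nth2]
  unfolding wsq_def norm_tangent[OF assms(1)] by (simp add: nsq_def sqint_def)

text \<open>The component data of one resolvent solution in a single statement, so that the data of
  two solutions can be extracted and subtracted.\<close>

definition polar_solution ::
    "real \<Rightarrow> real \<Rightarrow> real \<Rightarrow> complex \<Rightarrow> (real \<Rightarrow> complex^3) \<Rightarrow> (real \<Rightarrow> complex^3) \<Rightarrow>
     (real \<Rightarrow> complex) \<Rightarrow> (real \<Rightarrow> complex) \<Rightarrow> (real \<Rightarrow> complex) \<Rightarrow> (real \<Rightarrow> complex) \<Rightarrow> bool" where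
  "polar_solution \<theta> \<alpha> \<kappa> z f w u' u2 v' v2 \<longleftrightarrow> sqint (\<lambda>x. polar \<theta> (w x)) \<and> sqint u' \<and> sqint (\<lambda>x. w x $ 2) \<and> sqint v' \<and>
      (\<forall>a b. a \<le> b \<longrightarrow> (u' has_integral (polar \<theta> (w b) - polar \<theta> (w a))) {a..b}) \<and>
      (\<forall>a b. a \<le> b \<longrightarrow> (u2 has_integral (u' b - u' a)) {a..b}) \<and>
      (\<forall>a b. a \<le> b \<longrightarrow> (v' has_integral (w b $ 2 - w a $ 2)) {a..b}) \<and>
      (\<forall>a b. a \<le> b \<longrightarrow> (v2 has_integral (v' b - v' a)) {a..b}) \<and>
      (AE x in lborel. u2 x = (of_real \<alpha> * z + of_real \<kappa>) * polar \<theta> (w x) - z * w x $ 2 - (of_real \<alpha> * polar \<theta> (f x) - f x $ 2)) \<and>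
      (AE x in lborel. v2 x = z * polar \<theta> (w x) + of_real \<alpha> * z * w x $ 2 - (polar \<theta> (f x) + of_real \<alpha> * f x $ 2))"

context
  fixes \<alpha> \<beta> h \<mu> \<Omega> \<theta> :: real
  assumes \<alpha>: "\<alpha> > 0" and \<beta>: "\<beta> = \<alpha> * \<Omega>" and eq: "h - \<Omega> = \<mu> * cos \<theta>" and sin: "sin \<theta> \<noteq> 0"
begin

text \<open>Solving the linearized equation for second derivatives turns the components of
  \<open>f\<close> into the sources \<open>g1\<close> and \<open>g2\<close> by a rotation and
  dilation. The sign of \<open>\<mu>\<close> makes \<open>\<kappa>\<close> positive.\<close>

lemma resolvent_exists:
  assumes \<mu>: "\<mu> > 0" and z: "Re z > 0"
  shows "\<exists>C. \<forall>f. L2 f \<and> tangent_field 0 \<theta> f \<longrightarrow>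
    (\<exists>w. resolvent_equation \<alpha> \<beta> h \<mu> 0 (- \<Omega>) \<theta> z f w \<and> L2_norm_fun w \<le> C * L2_norm_fun f)"
proof -
  define \<kappa> where "\<kappa> = \<mu> * (sin \<theta>)\<^sup>2"
  have \<kappa>: "\<kappa> > 0" using \<mu> sin by (simp add: \<kappa>_def)
  obtain K where K: "K \<ge> 0" and sys: "\<And>g1 g2. sqint g1 \<Longrightarrow> sqint g2 \<Longrightarrow> \<exists>u u' v v'.
    system_solution (of_real \<alpha>) (of_real \<kappa>) z g1 g2 u u' v v' \<and> nsq u + nsq v \<le> K * (nsq g1 + nsq g2)"
    using system_resolvent[OF \<alpha> \<kappa> z] by blast
  \<comment> \<open>The constant of the system times the factor lost in passing from
    \<open>f\<close> to \<open>g1\<close> and \<open>g2\<close>; the root is due to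
    \<open>nsq\<close> being a squared norm.\<close>
  define C where "C = sqrt (K * (2 * \<alpha>\<^sup>2 + 2))"
  show ?thesis
  proof (intro exI[of _ C] allI impI)
    fix f assume "L2 f \<and> tangent_field 0 \<theta> f"
    then have f: "L2 f" "tangent_field 0 \<theta> f" by auto
    define fu fv where "fu x = polar \<theta> (f x)" and "fv x = f x $ 2" for x
    have fs: "sqint fu" "sqint fv"
      using L2_linear[OF f(1) bounded_linear_polar[of \<theta>]] L2_linear[OF f(1) bounded_linear_nth2]
      by (simp_all add: fu_def[abs_def] fv_def[abs_def])
    define g1 g2 where "g1 x = of_real \<alpha> * fu x + (- 1) * fv x" and "g2 x = fu x + of_real \<alpha> * fv x" for x
    have g: "sqint g1" "sqint g2"
      unfolding g1_def[abs_def] g2_def[abs_def] by (intro sqint_add(1) sqint_cmult fs)+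
    have ng: "nsq g1 + nsq g2 \<le> (2 * \<alpha>\<^sup>2 + 2) * (nsq fu + nsq fv)"
    proof -
      have "nsq g1 \<le> 2 * nsq (\<lambda>x. of_real \<alpha> * fu x) + 2 * nsq (\<lambda>x. (- 1) * fv x)"
        "nsq g2 \<le> 2 * nsq fu + 2 * nsq (\<lambda>x. of_real \<alpha> * fv x)"
        unfolding g1_def[abs_def] g2_def[abs_def] by (intro sqint_add(2) sqint_cmult fs)+
      then show ?thesis unfolding nsq_cmult by (simp add: algebra_simps)
    qed
    obtain u u' v v' where sol: "system_solution (of_real \<alpha>) (of_real \<kappa>) z g1 g2 u u' v v'"
      and n: "nsq u + nsq v \<le> K * (nsq g1 + nsq g2)"
      using sys[OF g] by blast
    have uv: "sqint u" "sqint u'" "sqint v" "sqint v'"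
      and i1: "\<And>a b. a \<le> b \<Longrightarrow> (u' has_integral (u b - u a)) {a..b}"
      and i2: "\<And>a b. a \<le> b \<Longrightarrow> (v' has_integral (v b - v a)) {a..b}"
      and i3: "\<And>a b. a \<le> b \<Longrightarrow> ((\<lambda>x. (of_real \<alpha> * z + of_real \<kappa>) * u x - z * v x - g1 x) has_integral (u' b - u' a)) {a..b}"
      and i4: "\<And>a b. a \<le> b \<Longrightarrow> ((\<lambda>x. z * u x + of_real \<alpha> * z * v x - g2 x) has_integral (v' b - v' a)) {a..b}"
      using sol unfolding system_solution_def by auto
    define w where "w x = tang \<theta> (u x) (v x)" for x
    define u2 v2 where "u2 x = (of_real \<alpha> * z + of_real \<kappa>) * u x - z * v x - g1 x"
      and "v2 x = z * u x + of_real \<alpha> * z * v x - g2 x" for x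
    have s2: "sqint u2" "sqint v2"
      unfolding u2_def[abs_def] v2_def[abs_def] by (intro sqint_diff sqint_add(1) sqint_cmult uv g)+
    have H: "H2 w (\<lambda>x. tang \<theta> (u2 x) (v2 x))"
      unfolding w_def[abs_def]
      by (rule H2_tang[OF uv(1,2) s2(1) uv(3,4) s2(2) i1 i2 i3[folded u2_def] i4[folded v2_def]])
    have t: "tangent_field 0 \<theta> w" unfolding w_def[abs_def] by (rule tangent_field_tang)
    have "resolvent_equation \<alpha> \<beta> h \<mu> 0 (- \<Omega>) \<theta> z f w"
      unfolding resolvent_equation_def
    proof (intro conjI t exI[of _ "\<lambda>x. tang \<theta> (u2 x) (v2 x)"] H AE_I2)
      fix x
      have e: "u2 x = (of_real \<alpha> * z + of_real (\<mu> * (sin \<theta>)\<^sup>2)) * u x - z * v x - (of_real \<alpha> * polar \<theta> (f x) - f x $ 2)"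
        "v2 x = z * u x + of_real \<alpha> * z * v x - (polar \<theta> (f x) + of_real \<alpha> * f x $ 2)"
        by (simp_all add: u2_def v2_def g1_def g2_def fu_def fv_def \<kappa>_def)
      show "wavetrain_linearization \<alpha> \<beta> h \<mu> 0 (- \<Omega>) \<theta> x (ReV (w x)) (ReV (z *s w x - f x)) (ReV (tang \<theta> (u2 x) (v2 x))) = 0"
        "wavetrain_linearization \<alpha> \<beta> h \<mu> 0 (- \<Omega>) \<theta> x (ImV (w x)) (ImV (z *s w x - f x)) (ImV (tang \<theta> (u2 x) (v2 x))) = 0"
        unfolding w_def by (rule resolvent_pointwise_tang[OF \<beta> eq f(2) e])+
    qed
    moreover have "L2_norm_fun w \<le> C * L2_norm_fun f"
    proof -
      have "wsq w = nsq u + nsq v"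
        using wsq_tangent[OF t] L2_tang[OF uv(1,3)] by (simp add: w_def[abs_def])
      also have "\<dots> \<le> K * ((2 * \<alpha>\<^sup>2 + 2) * (nsq fu + nsq fv))"
        using n mult_left_mono[OF ng K] by linarith
      also have "nsq fu + nsq fv = wsq f"
        using wsq_tangent[OF f(2,1)] by (simp add: fu_def[abs_def] fv_def[abs_def])
      finally have "sqrt (wsq w) \<le> sqrt (K * (2 * \<alpha>\<^sup>2 + 2) * wsq f)" by (simp add: mult.assoc)
      then show ?thesis by (simp add: L2_norm_fun_eq C_def real_sqrt_mult)
    qed
    ultimately show "\<exists>w. resolvent_equation \<alpha> \<beta> h \<mu> 0 (- \<Omega>) \<theta> z f w \<and> L2_norm_fun w \<le> C * L2_norm_fun f" by blast
  qed
qed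

text \<open>The sources cancel in the difference of two solutions, which therefore solves the
  homogeneous system.\<close>

lemma resolvent_unique:
  assumes \<mu>: "\<mu> > 0" and z: "Re z > 0" and f: "tangent_field 0 \<theta> f"
    and w1: "resolvent_equation \<alpha> \<beta> h \<mu> 0 (- \<Omega>) \<theta> z f w1"
    and w2: "resolvent_equation \<alpha> \<beta> h \<mu> 0 (- \<Omega>) \<theta> z f w2"
  shows "w1 = w2"
proof -
  define \<kappa> where "\<kappa> = \<mu> * (sin \<theta>)\<^sup>2"
  have \<kappa>: "\<kappa> > 0" using \<mu> sin by (simp add: \<kappa>_def)
  have data: "\<exists>u' u2 v' v2. polar_solution \<theta> \<alpha> \<kappa> z f w u' u2 v' v2"
    if w: "resolvent_equation \<alpha> \<beta> h \<mu> 0 (- \<Omega>) \<theta> z f w" for w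
  proof -
    obtain W where t: "tangent_field 0 \<theta> w" and H: "H2 w W"
      and ae: "AE x in lborel. wavetrain_linearization \<alpha> \<beta> h \<mu> 0 (- \<Omega>) \<theta> x (ReV (w x)) (ReV (z *s w x - f x)) (ReV (W x)) = 0 \<and>
        wavetrain_linearization \<alpha> \<beta> h \<mu> 0 (- \<Omega>) \<theta> x (ImV (w x)) (ImV (z *s w x - f x)) (ImV (W x)) = 0"
      using w unfolding resolvent_equation_def by blast
    obtain p where p: "sqint (\<lambda>x. polar \<theta> (w x))" "sqint (\<lambda>x. polar \<theta> (p x))"
      "\<And>a b. a \<le> b \<Longrightarrow> ((\<lambda>x. polar \<theta> (p x)) has_integral (polar \<theta> (w b) - polar \<theta> (w a))) {a..b}"
      "\<And>a b. a \<le> b \<Longrightarrow> ((\<lambda>x. polar \<theta> (W x)) has_integral (polar \<theta> (p b) - polar \<theta> (p a))) {a..b}"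
      by (rule H2_linear[OF H bounded_linear_polar[of \<theta>]]) blast
    obtain q :: "real \<Rightarrow> complex^3" where q: "sqint (\<lambda>x. w x $ 2)" "sqint (\<lambda>x. q x $ 2)"
      "\<And>a b. a \<le> b \<Longrightarrow> ((\<lambda>x. q x $ 2) has_integral (w b $ 2 - w a $ 2)) {a..b}"
      "\<And>a b. a \<le> b \<Longrightarrow> ((\<lambda>x. W x $ 2) has_integral (q b $ 2 - q a $ 2)) {a..b}"
      by (rule H2_linear[OF H bounded_linear_nth2]) blast
    have "AE x in lborel. polar \<theta> (W x) = (of_real \<alpha> * z + of_real \<kappa>) * polar \<theta> (w x) - z * w x $ 2 - (of_real \<alpha> * polar \<theta> (f x) - f x $ 2)"
      using ae unfolding \<kappa>_def by eventually_elim (rule resolvent_pointwise(1)[OF \<beta> eq t f]; simp)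
    moreover have "AE x in lborel. W x $ 2 = z * polar \<theta> (w x) + of_real \<alpha> * z * w x $ 2 - (polar \<theta> (f x) + of_real \<alpha> * f x $ 2)"
      using ae by eventually_elim (rule resolvent_pointwise(2)[OF \<beta> eq t f]; simp)
    ultimately have "polar_solution \<theta> \<alpha> \<kappa> z f w (\<lambda>x. polar \<theta> (p x)) (\<lambda>x. polar \<theta> (W x)) (\<lambda>x. q x $ 2) (\<lambda>x. W x $ 2)"
      unfolding polar_solution_def using p q by blast
    then show ?thesis by blast
  qed
  obtain p1 P1 q1 Q1 where sol1: "polar_solution \<theta> \<alpha> \<kappa> z f w1 p1 P1 q1 Q1"
    using data[OF w1] by blast
  have 1: "sqint (\<lambda>x. polar \<theta> (w1 x))" "sqint p1" "sqint (\<lambda>x. w1 x $ 2)" "sqint q1"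
      "\<And>a b. a \<le> b \<Longrightarrow> (p1 has_integral (polar \<theta> (w1 b) - polar \<theta> (w1 a))) {a..b}"
      "\<And>a b. a \<le> b \<Longrightarrow> (P1 has_integral (p1 b - p1 a)) {a..b}"
      "\<And>a b. a \<le> b \<Longrightarrow> (q1 has_integral (w1 b $ 2 - w1 a $ 2)) {a..b}"
      "\<And>a b. a \<le> b \<Longrightarrow> (Q1 has_integral (q1 b - q1 a)) {a..b}"
    and ae1: "AE x in lborel. P1 x = (of_real \<alpha> * z + of_real \<kappa>) * polar \<theta> (w1 x) - z * w1 x $ 2 - (of_real \<alpha> * polar \<theta> (f x) - f x $ 2)"
      "AE x in lborel. Q1 x = z * polar \<theta> (w1 x) + of_real \<alpha> * z * w1 x $ 2 - (polar \<theta> (f x) + of_real \<alpha> * f x $ 2)"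
    using sol1 unfolding polar_solution_def by auto
  obtain p2 P2 q2 Q2 where sol2: "polar_solution \<theta> \<alpha> \<kappa> z f w2 p2 P2 q2 Q2"
    using data[OF w2] by blast
  have 2: "sqint (\<lambda>x. polar \<theta> (w2 x))" "sqint p2" "sqint (\<lambda>x. w2 x $ 2)" "sqint q2"
      "\<And>a b. a \<le> b \<Longrightarrow> (p2 has_integral (polar \<theta> (w2 b) - polar \<theta> (w2 a))) {a..b}"
      "\<And>a b. a \<le> b \<Longrightarrow> (P2 has_integral (p2 b - p2 a)) {a..b}"
      "\<And>a b. a \<le> b \<Longrightarrow> (q2 has_integral (w2 b $ 2 - w2 a $ 2)) {a..b}"
      "\<And>a b. a \<le> b \<Longrightarrow> (Q2 has_integral (q2 b - q2 a)) {a..b}"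
    and ae2: "AE x in lborel. P2 x = (of_real \<alpha> * z + of_real \<kappa>) * polar \<theta> (w2 x) - z * w2 x $ 2 - (of_real \<alpha> * polar \<theta> (f x) - f x $ 2)"
      "AE x in lborel. Q2 x = z * polar \<theta> (w2 x) + of_real \<alpha> * z * w2 x $ 2 - (polar \<theta> (f x) + of_real \<alpha> * f x $ 2)"
    using sol2 unfolding polar_solution_def by auto
  have d: "((\<lambda>x. F x - G x) has_integral ((b1 - b2) - (a1 - a2))) {a..b}"
    if "(F has_integral (b1 - a1)) {a..b}" "(G has_integral (b2 - a2)) {a..b}" for F G :: "real \<Rightarrow> complex" and a b a1 a2 b1 b2
    using has_integral_diff[OF that] by (simp add: algebra_simps)
  have z: "polar \<theta> (w1 x) - polar \<theta> (w2 x) = 0 \<and> w1 x $ 2 - w2 x $ 2 = 0" for x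
  proof (rule system_unique[OF \<alpha> \<kappa> z, where u' = "\<lambda>x. p1 x - p2 x" and v' = "\<lambda>x. q1 x - q2 x"
        and ?u2.0 = "\<lambda>x. P1 x - P2 x" and ?v2.0 = "\<lambda>x. Q1 x - Q2 x"])
    show "AE x in lborel. P1 x - P2 x = (of_real \<alpha> * z + of_real \<kappa>) * (polar \<theta> (w1 x) - polar \<theta> (w2 x)) - z * (w1 x $ 2 - w2 x $ 2)"
      using ae1(1) ae2(1)
    proof eventually_elim
      case (elim x)
      show ?case unfolding elim by (simp add: algebra_simps)
    qed
    show "AE x in lborel. Q1 x - Q2 x = z * (polar \<theta> (w1 x) - polar \<theta> (w2 x)) + of_real \<alpha> * z * (w1 x $ 2 - w2 x $ 2)"
      using ae1(2) ae2(2)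
    proof eventually_elim
      case (elim x)
      show ?case unfolding elim by (simp add: algebra_simps)
    qed
  qed (intro sqint_diff 1(1-4) 2(1-4) d 1(5-8) 2(5-8); assumption)+
  have t: "tangent_field 0 \<theta> w1" "tangent_field 0 \<theta> w2"
    using w1 w2 by (auto simp: resolvent_equation_def)
  show ?thesis
  proof
    fix x
    have "polar \<theta> (w1 x) = polar \<theta> (w2 x)" "w1 x $ 2 = w2 x $ 2" using z[of x] by auto
    then show "w1 x = w2 x"
      using tangent_field_components[OF t(1), of x] tangent_field_components[OF t(2), of x] by metis
  qed
qed

text \<open>Uniqueness carries the bound from the constructed solution to every solution, as
  membership in the resolvent set demands.\<close>

theorem wavetrain_stable:
  assumes "\<mu> > 0"
  shows "spectrally_stable \<alpha> \<beta> h \<mu> 0 (- \<Omega>) \<theta>"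
  unfolding spectrally_stable_def wavetrain_spectrum_def
proof (intro ballI, rule ccontr)
  fix z assume z: "z \<in> - wavetrain_resolvent_set \<alpha> \<beta> h \<mu> 0 (- \<Omega>) \<theta>" "\<not> Re z \<le> 0"
  then have re: "Re z > 0" by simp
  obtain C where C: "\<And>f. L2 f \<and> tangent_field 0 \<theta> f \<Longrightarrow>
    \<exists>w. resolvent_equation \<alpha> \<beta> h \<mu> 0 (- \<Omega>) \<theta> z f w \<and> L2_norm_fun w \<le> C * L2_norm_fun f"
    using resolvent_exists[OF assms re] by blast
  have "(\<exists>!w. resolvent_equation \<alpha> \<beta> h \<mu> 0 (- \<Omega>) \<theta> z f w) \<and>
     (\<forall>w. resolvent_equation \<alpha> \<beta> h \<mu> 0 (- \<Omega>) \<theta> z f w \<longrightarrow> L2_norm_fun w \<le> C * L2_norm_fun f)"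
    if f: "L2 f \<and> tangent_field 0 \<theta> f" for f
  proof -
    obtain w where w: "resolvent_equation \<alpha> \<beta> h \<mu> 0 (- \<Omega>) \<theta> z f w" "L2_norm_fun w \<le> C * L2_norm_fun f"
      using C[OF f] by blast
    have "w' = w" if "resolvent_equation \<alpha> \<beta> h \<mu> 0 (- \<Omega>) \<theta> z f w'" for w'
      using resolvent_unique[OF assms re _ that w(1)] f by blast
    then show ?thesis using w by metis
  qed
  then have "z \<in> wavetrain_resolvent_set \<alpha> \<beta> h \<mu> 0 (- \<Omega>) \<theta>"
    unfolding wavetrain_resolvent_set_def by blast
  then show False using z(1) by simp
qed

text \<open>The unstable eigenvalue at wave number zero is approximated by slowly varying modulations of the eigenvector.\<close>

theorem wavetrain_unstable:
  assumes "\<mu> < 0"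
  shows "\<not> spectrally_stable \<alpha> \<beta> h \<mu> 0 (- \<Omega>) \<theta>"
proof
  define \<kappa> where "\<kappa> = \<mu> * (sin \<theta>)\<^sup>2"
  have \<kappa>: "\<kappa> < 0" using assms sin by (simp add: \<kappa>_def mult_neg_pos)
  have den: "1 + \<alpha>\<^sup>2 > 0" by (simp add: add_pos_nonneg)
  \<comment> \<open>The nonzero root of the symbol
    \<open>z * ((\<alpha>\<^sup>2 + 1) * z + \<alpha> * \<kappa>)\<close> at wave number zero; it is
    positive because \<open>\<kappa>\<close> is negative.\<close>
  define l where "l = - \<alpha> * \<kappa> / (1 + \<alpha>\<^sup>2)"
  have l: "l > 0" using \<alpha> \<kappa> den by (simp add: l_def mult_pos_neg divide_neg_pos)
  have l_eq: "(\<alpha>\<^sup>2 + 1) * l + \<alpha> * \<kappa> = 0" using den by (simp add: l_def add.commute)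
  define z :: complex where "z = of_real l"
  assume "spectrally_stable \<alpha> \<beta> h \<mu> 0 (- \<Omega>) \<theta>"
  then have "z \<in> wavetrain_resolvent_set \<alpha> \<beta> h \<mu> 0 (- \<Omega>) \<theta>"
    using l unfolding spectrally_stable_def wavetrain_spectrum_def by (force simp: z_def)
  then obtain C where C: "\<And>f w. L2 f \<Longrightarrow> tangent_field 0 \<theta> f \<Longrightarrow>
      resolvent_equation \<alpha> \<beta> h \<mu> 0 (- \<Omega>) \<theta> z f w \<Longrightarrow> L2_norm_fun w \<le> C * L2_norm_fun f"
    unfolding wavetrain_resolvent_set_def by blast
  \<comment> \<open>Small enough for \<open>|C| * \<eta> < 1\<close>, which finally contradicts the
    resolvent bound.\<close>
  define \<eta> where "\<eta> = 1 / (2 * (\<bar>C\<bar> + 1))"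
  have \<eta>: "\<eta> > 0" by (simp add: \<eta>_def add_nonneg_pos)
  obtain \<phi> \<phi>' \<phi>'' :: "real \<Rightarrow> real" and K where d1: "\<And>x. (\<phi> has_real_derivative \<phi>' x) (at x)"
    and d2: "\<And>x. (\<phi>' has_real_derivative \<phi>'' x) (at x)" and c2: "continuous_on UNIV \<phi>''" and pos: "\<And>x. 0 < \<phi> x"
    and b1: "\<And>x. \<bar>\<phi>' x\<bar> \<le> K * \<phi> x" and b2: "\<And>x. \<bar>\<phi>'' x\<bar> \<le> \<eta> * \<phi> x"
    and i0: "integrable lborel (\<lambda>x. (\<phi> x)\<^sup>2)"
    using slowly_varying_function[OF \<eta>] by blast
  have c: "continuous_on UNIV \<phi>" "continuous_on UNIV \<phi>'"
    using d1 d2 by (meson DERIV_isCont continuous_at_imp_continuous_on)+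
  have [measurable]: "\<phi> \<in> borel_measurable borel" "\<phi>' \<in> borel_measurable borel" "\<phi>'' \<in> borel_measurable borel"
    using c c2 by (auto intro: borel_measurable_continuous_onI)
  have dom: "integrable lborel (\<lambda>x. (g x)\<^sup>2)" if [measurable]: "g \<in> borel_measurable borel" and b: "\<And>x. \<bar>g x\<bar> \<le> L * \<phi> x" for g L
  proof (rule Bochner_Integration.integrable_bound)
    show "integrable lborel (\<lambda>x. L\<^sup>2 * (\<phi> x)\<^sup>2)" using i0 by simp
    have "(g x)\<^sup>2 \<le> (L * \<phi> x)\<^sup>2" for x
      using b[of x] by (metis abs_ge_self abs_le_square_iff order_trans)
    then show "AE x in lborel. norm ((g x)\<^sup>2) \<le> norm (L\<^sup>2 * (\<phi> x)\<^sup>2)"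
      by (intro AE_I2) (simp add: power_mult_distrib)
  qed measurable
  have i1: "integrable lborel (\<lambda>x. (\<phi>' x)\<^sup>2)" by (rule dom[OF _ b1]) measurable
  have i2: "integrable lborel (\<lambda>x. (\<phi>'' x)\<^sup>2)" by (rule dom[OF _ b2]) measurable
  have sq: "sqint (\<lambda>x. k * of_real (\<phi> x))" "sqint (\<lambda>x. k * of_real (\<phi>' x))" "sqint (\<lambda>x. k * of_real (\<phi>'' x))" for k
  proof -
    have "sqint (\<lambda>x. of_real (\<phi> x))" "sqint (\<lambda>x. of_real (\<phi>' x))" "sqint (\<lambda>x. of_real (\<phi>'' x))"
      using i0 i1 i2 by (simp_all add: sqint_def)
    then show "sqint (\<lambda>x. k * of_real (\<phi> x))" "sqint (\<lambda>x. k * of_real (\<phi>' x))" "sqint (\<lambda>x. k * of_real (\<phi>'' x))"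
      by (auto dest: sqint_cmult[of _ k])
  qed
  have int: "((\<lambda>x. k * of_real (g' x)) has_integral (k * of_real (g b) - k * of_real (g a))) {a..b}"
    if "a \<le> b" "\<And>x. (g has_real_derivative g' x) (at x)" for k :: complex and g g' a b
  proof (rule fundamental_theorem_of_calculus[OF that(1)])
    fix x
    have "((\<lambda>x. of_real (g x)) has_vector_derivative complex_of_real (g' x)) (at x within {a..b})"
      using that(2)[of x] by (intro has_vector_derivative_of_real) (simp add: has_real_derivative_iff_has_vector_derivative has_vector_derivative_at_within)
    then show "((\<lambda>x. k * of_real (g x)) has_vector_derivative k * of_real (g' x)) (at x within {a..b})"
      by (rule has_vector_derivative_mult_right)
  qed
  \<comment> \<open>For \<open>z = l\<close> the vector with components \<open>- \<alpha>\<close>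
    and 1 spans the kernel at wave number zero, so only terms with the second derivative of
    \<open>\<phi>\<close> are left over.\<close>
  define w where "w x = tang \<theta> (- of_real \<alpha> * of_real (\<phi> x)) (1 * of_real (\<phi> x))" for x
  define W where "W x = tang \<theta> (- of_real \<alpha> * of_real (\<phi>'' x)) (1 * of_real (\<phi>'' x))" for x
  \<comment> \<open>The solution of \<open>\<alpha> A - B = \<alpha>\<close>,
    \<open>A + \<alpha> B = - 1\<close>, which makes \<open>f\<close> absorb exactly those terms.
    This linear map is a rotation and dilation, and comparing lengths gives
    \<open>A\<^sup>2 + B\<^sup>2 = 1\<close>.\<close>
  define A B where "A = (\<alpha>\<^sup>2 - 1) / (1 + \<alpha>\<^sup>2)" and "B = - 2 * \<alpha> / (1 + \<alpha>\<^sup>2)"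
  define f where "f x = tang \<theta> (of_real A * of_real (\<phi>'' x)) (of_real B * of_real (\<phi>'' x))" for x
  have AB1: "\<alpha> * A - B = \<alpha>" "A + \<alpha> * B = - 1" "A\<^sup>2 + B\<^sup>2 = 1"
  proof -
    define d where "d = 1 + \<alpha>\<^sup>2"
    have d: "d \<noteq> 0" "\<alpha>\<^sup>2 = d - 1" using den by (auto simp: d_def)
    have Ad: "A * d = \<alpha>\<^sup>2 - 1" "B * d = - 2 * \<alpha>" using d(1) by (simp_all add: A_def B_def d_def)
    have "(\<alpha> * A - B) * d = \<alpha> * (A * d) - B * d" by (simp add: algebra_simps)
    also have "\<dots> = \<alpha> * d" unfolding Ad d(2) by (simp add: algebra_simps)
    finally show "\<alpha> * A - B = \<alpha>" using d(1) by simp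
    have "(A + \<alpha> * B) * d = A * d + \<alpha> * (B * d)" by (simp add: algebra_simps)
    also have "\<dots> = - 1 * d" unfolding Ad using d(2) by (simp add: power2_eq_square algebra_simps)
    finally show "A + \<alpha> * B = - 1" using d(1) mult_right_cancel by blast
    have "(A\<^sup>2 + B\<^sup>2) * d\<^sup>2 = (A * d)\<^sup>2 + (B * d)\<^sup>2" by (simp add: power_mult_distrib algebra_simps)
    also have "\<dots> = (\<alpha>\<^sup>2 - 1)\<^sup>2 + 4 * \<alpha>\<^sup>2" unfolding Ad by (simp add: power_mult_distrib)
    also have "\<dots> = 1 * d\<^sup>2" unfolding d(2) by (simp add: power2_eq_square algebra_simps)
    finally show "A\<^sup>2 + B\<^sup>2 = 1" using d(1) mult_right_cancel[of "d\<^sup>2"] by force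
  qed
  have t: "tangent_field 0 \<theta> w" "tangent_field 0 \<theta> f"
    unfolding w_def[abs_def] f_def[abs_def] by (rule tangent_field_tang)+
  have f: "L2 f" unfolding f_def[abs_def] by (intro L2_tang sq)
  have H: "H2 w W"
    unfolding w_def[abs_def] W_def[abs_def] by (rule H2_tang[OF sq(1-3)[of "- of_real \<alpha>"] sq(1-3)[of 1]]) (erule int, (rule d1 | rule d2))+
  have "resolvent_equation \<alpha> \<beta> h \<mu> 0 (- \<Omega>) \<theta> z f w"
    unfolding resolvent_equation_def
  proof (intro conjI t exI[of _ W] H AE_I2)
    fix x
    have e1: "- of_real \<alpha> * of_real (\<phi>'' x) = (of_real \<alpha> * z + of_real (\<mu> * (sin \<theta>)\<^sup>2)) * (- of_real \<alpha> * of_real (\<phi> x)) - z * (1 * of_real (\<phi> x))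
        - (of_real \<alpha> * polar \<theta> (f x) - f x $ 2)"
    proof -
      have "- \<alpha> * \<phi>'' x = (\<alpha> * l + \<kappa>) * (- \<alpha> * \<phi> x) - l * \<phi> x - (\<alpha> * A - B) * \<phi>'' x"
      proof -
        have "(\<alpha> * l + \<kappa>) * (- \<alpha> * \<phi> x) - l * \<phi> x = - ((\<alpha>\<^sup>2 + 1) * l + \<alpha> * \<kappa>) * \<phi> x"
          by (simp add: power2_eq_square algebra_simps)
        then show ?thesis unfolding l_eq AB1 by simp
      qed
      then have "complex_of_real (- \<alpha> * \<phi>'' x) = of_real ((\<alpha> * l + \<kappa>) * (- \<alpha> * \<phi> x) - l * \<phi> x - (\<alpha> * A - B) * \<phi>'' x)"
        by (rule arg_cong)
      then show ?thesis by (simp add: f_def z_def \<kappa>_def algebra_simps)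
    qed
    have e2: "1 * of_real (\<phi>'' x) = z * (- of_real \<alpha> * of_real (\<phi> x)) + of_real \<alpha> * z * (1 * of_real (\<phi> x)) - (polar \<theta> (f x) + of_real \<alpha> * f x $ 2)"
    proof -
      have "complex_of_real (\<phi>'' x) = - of_real ((A + \<alpha> * B) * \<phi>'' x)" unfolding AB1 by simp
      then show ?thesis by (simp add: f_def algebra_simps)
    qed
    show "wavetrain_linearization \<alpha> \<beta> h \<mu> 0 (- \<Omega>) \<theta> x (ReV (w x)) (ReV (z *s w x - f x)) (ReV (W x)) = 0"
      "wavetrain_linearization \<alpha> \<beta> h \<mu> 0 (- \<Omega>) \<theta> x (ImV (w x)) (ImV (z *s w x - f x)) (ImV (W x)) = 0"
      unfolding w_def W_def by (rule resolvent_pointwise_tang[OF \<beta> eq t(2) e1 e2])+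
  qed
  then have le: "L2_norm_fun w \<le> C * L2_norm_fun f" by (rule C[OF f t(2)])
  define N where "N = (LINT x|lborel. (\<phi> x)\<^sup>2)"
  have N: "N > 0"
  proof -
    have "N \<noteq> 0"
    proof
      assume "N = 0"
      then have "AE x in lborel. (\<phi> x)\<^sup>2 = 0"
        using integral_nonneg_eq_0_iff_AE[OF i0] by (simp add: N_def)
      then have "AE x in (lborel :: real measure). False" by (rule eventually_mono) (metis pos less_irrefl zero_eq_power2)
      then have "emeasure lborel (UNIV :: real set) = 0"
        using AE_iff_measurable[of "UNIV :: real set" lborel "\<lambda>_. False"] by simp
      then show False by simp
    qed
    moreover have "N \<ge> 0" by (simp add: N_def)
    ultimately show ?thesis by simp
  qed
  have "wsq w = (\<alpha>\<^sup>2 + 1) * N"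
  proof -
    have "(norm (w x))\<^sup>2 = (\<alpha>\<^sup>2 + 1) * (\<phi> x)\<^sup>2" for x
      unfolding w_def norm_tang by (simp add: norm_mult power_mult_distrib distrib_right)
    then show ?thesis by (simp add: wsq_def N_def)
  qed
  then have "N \<le> wsq w" using N by (simp add: algebra_simps)
  moreover have "wsq f \<le> \<eta>\<^sup>2 * N"
  proof -
    have "(norm (f x))\<^sup>2 = (\<phi>'' x)\<^sup>2" for x
    proof -
      have "(norm (f x))\<^sup>2 = (A\<^sup>2 + B\<^sup>2) * (\<phi>'' x)\<^sup>2"
        by (simp add: f_def norm_tang norm_mult power_mult_distrib distrib_right)
      then show ?thesis unfolding AB1 by simp
    qed
    then have "wsq f = (LINT x|lborel. (\<phi>'' x)\<^sup>2)" by (simp add: wsq_def)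
    also have "\<dots> \<le> (LINT x|lborel. \<eta>\<^sup>2 * (\<phi> x)\<^sup>2)"
    proof (rule integral_mono[OF i2])
      show "integrable lborel (\<lambda>x. \<eta>\<^sup>2 * (\<phi> x)\<^sup>2)" using i0 by simp
      fix x
      have "\<bar>\<phi>'' x\<bar>\<^sup>2 \<le> (\<eta> * \<phi> x)\<^sup>2" using b2[of x] by (intro power_mono) auto
      then show "(\<phi>'' x)\<^sup>2 \<le> \<eta>\<^sup>2 * (\<phi> x)\<^sup>2" by (simp add: power_mult_distrib)
    qed
    finally show ?thesis by (simp add: N_def)
  qed
  ultimately have "sqrt N \<le> L2_norm_fun w" "L2_norm_fun f \<le> sqrt (\<eta>\<^sup>2 * N)"
    by (auto simp: L2_norm_fun_eq)
  moreover have "sqrt (\<eta>\<^sup>2 * N) = \<eta> * sqrt N" using \<eta> by (simp add: real_sqrt_mult)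
  moreover have "0 \<le> L2_norm_fun f" by (simp add: L2_norm_fun_def)
  then have "C * L2_norm_fun f \<le> \<bar>C\<bar> * L2_norm_fun f" by (simp add: mult_right_mono)
  ultimately have "sqrt N \<le> \<bar>C\<bar> * (\<eta> * sqrt N)"
    using le mult_left_mono[of "L2_norm_fun f" "\<eta> * sqrt N" "\<bar>C\<bar>"] by simp
  also have "\<dots> = (\<bar>C\<bar> * \<eta>) * sqrt N" by simp
  also have "\<dots> < 1 * sqrt N"
    using N by (intro mult_strict_right_mono) (auto simp: \<eta>_def divide_less_eq)
  finally show False by simp
qed

end

section \<open>Coherent structures in spherical coordinates\<close>

text \<open>The derivative of \<open>sph\<close> with respect to the polar angle. Its companion
  \<open>frame_ph\<close> is the azimuthal derivative freed from the factor
  \<open>sin \<theta>\<close>, so that both remain unit vectors at the poles.\<close>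

definition frame_th :: "real \<Rightarrow> real \<Rightarrow> real^3" where
  "frame_th \<phi> \<theta> = vector [cos \<phi> * cos \<theta>, sin \<phi> * cos \<theta>, - sin \<theta>]"

definition frame_ph :: "real \<Rightarrow> real^3" where
  "frame_ph \<phi> = vector [- sin \<phi>, cos \<phi>, 0]"

lemma norm_sph: "norm (sph \<phi> \<theta>) = 1"
proof -
  have "sph \<phi> \<theta> \<bullet> sph \<phi> \<theta> = (cos \<phi> * sin \<theta>)\<^sup>2 + (sin \<phi> * sin \<theta>)\<^sup>2 + (cos \<theta>)\<^sup>2"
    by (simp add: sph_def inner_vec_def sum_3 power2_eq_square)
  also have "\<dots> = ((cos \<phi>)\<^sup>2 + (sin \<phi>)\<^sup>2) * (sin \<theta>)\<^sup>2 + (cos \<theta>)\<^sup>2"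
    unfolding power_mult_distrib distrib_right ..
  finally have "sph \<phi> \<theta> \<bullet> sph \<phi> \<theta> = ((cos \<phi>)\<^sup>2 + (sin \<phi>)\<^sup>2) * (sin \<theta>)\<^sup>2 + (cos \<theta>)\<^sup>2" .
  then show ?thesis by (simp add: norm_eq_1)
qed

lemma frame_cross:
  "cross3 (sph \<phi> \<theta>) (frame_th \<phi> \<theta>) = frame_ph \<phi>"
  "cross3 (sph \<phi> \<theta>) (frame_ph \<phi>) = - frame_th \<phi> \<theta>"
proof -
  have s: "sin \<theta> * sin \<theta> = 1 - cos \<theta> * cos \<theta>" "sin \<phi> * sin \<phi> = 1 - cos \<phi> * cos \<phi>"
    using sin_squared_eq[of \<theta>] sin_squared_eq[of \<phi>] by (simp_all add: power2_eq_square)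
  have "cos \<phi> * (sin \<theta> * (sin \<phi> * cos \<theta>)) = sin \<phi> * (sin \<theta> * (cos \<phi> * cos \<theta>))" by simp
  moreover have "- (sin \<phi> * (sin \<theta> * sin \<theta>)) - cos \<theta> * (sin \<phi> * cos \<theta>) = - sin \<phi>"
    "cos \<theta> * (cos \<phi> * cos \<theta>) + cos \<phi> * (sin \<theta> * sin \<theta>) = cos \<phi>"
    unfolding s by (simp_all add: algebra_simps)
  ultimately show "cross3 (sph \<phi> \<theta>) (frame_th \<phi> \<theta>) = frame_ph \<phi>"
    by (simp add: vec_eq_iff forall_3 cross3_def sph_def frame_th_def frame_ph_def algebra_simps)
  have "cos \<phi> * (cos \<phi> * sin \<theta>) + sin \<phi> * sin \<phi> * sin \<theta> = sin \<theta>"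
    unfolding s by (simp add: algebra_simps)
  then show "cross3 (sph \<phi> \<theta>) (frame_ph \<phi>) = - frame_th \<phi> \<theta>"
    by (simp add: vec_eq_iff forall_3 cross3_def sph_def frame_th_def frame_ph_def algebra_simps)
qed

lemma e3_frame: "e3 = cos \<theta> *\<^sub>R sph \<phi> \<theta> - sin \<theta> *\<^sub>R frame_th \<phi> \<theta>"
proof -
  have "cos \<theta> * cos \<theta> + sin \<theta> * sin \<theta> = 1" using sin_cos_squared_add2[of \<theta>] by (simp add: power2_eq_square)
  then show ?thesis
    by (simp add: e3_def axis_def vec_eq_iff forall_3 sph_def frame_th_def)
qed

text \<open>\<open>\<theta>\<close> is arbitrary: the frame does not degenerate at the poles, so the
  equation splits into components there too.\<close>

lemma frame_independent: "a *\<^sub>R frame_ph \<phi> + b *\<^sub>R frame_th \<phi> \<theta> = 0 \<longleftrightarrow> a = 0 \<and> b = 0"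
proof
  assume *: "a *\<^sub>R frame_ph \<phi> + b *\<^sub>R frame_th \<phi> \<theta> = 0"
  have 1: "- (a * sin \<phi>) + b * (cos \<phi> * cos \<theta>) = 0" and 2: "a * cos \<phi> + b * (sin \<phi> * cos \<theta>) = 0" and 3: "b * sin \<theta> = 0"
    using * by (simp_all add: vec_eq_iff forall_3 frame_ph_def frame_th_def)
  have "a * ((sin \<phi>)\<^sup>2 + (cos \<phi>)\<^sup>2) = 0" "b * cos \<theta> * ((sin \<phi>)\<^sup>2 + (cos \<phi>)\<^sup>2) = 0"
    using 1 2 by algebra+
  then have "a = 0" "b * cos \<theta> = 0" unfolding sin_cos_squared_add by simp_all
  moreover have "b = 0"
    using 3 \<open>b * cos \<theta> = 0\<close> sin_zero_abs_cos_one[of \<theta>] by auto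
  ultimately show "a = 0 \<and> b = 0" by simp
qed simp

text \<open>The radial part \<open>r\<close> is annihilated by the cross product, which also
  exchanges the tangential directions up to sign: \<open>T\<close> appears in the azimuthal and
  \<open>F\<close> in the polar component.\<close>

lemma residual_frame:
  "LLGS_residual \<alpha> \<beta> h \<mu> (sph \<phi> \<theta>, (\<Omega> * sin \<theta>) *\<^sub>R frame_ph \<phi>, r *\<^sub>R sph \<phi> \<theta> + T *\<^sub>R frame_th \<phi> \<theta> + F *\<^sub>R frame_ph \<phi>) =
    (\<Omega> * sin \<theta> + T + (\<mu> * cos \<theta> - h) * sin \<theta>) *\<^sub>R frame_ph \<phi> + (\<alpha> * \<Omega> * sin \<theta> - F - \<beta> * sin \<theta>) *\<^sub>R frame_th \<phi> \<theta>"
proof -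
  define m p t where "m = sph \<phi> \<theta>" and "p = frame_ph \<phi>" and "t = frame_th \<phi> \<theta>"
  have m3: "m $ 3 = cos \<theta>" by (simp add: m_def sph_def)
  have c: "cross3 m t = p" "cross3 m p = - t" by (simp_all add: m_def p_def t_def frame_cross)
  have e: "e3 = cos \<theta> *\<^sub>R m - sin \<theta> *\<^sub>R t" unfolding m_def t_def by (rule e3_frame)
  have ce: "cross3 m e3 = - sin \<theta> *\<^sub>R p"
    unfolding e by (simp add: Cross3.right_diff_distrib cross_mult_right c)
  have "LLGS_residual \<alpha> \<beta> h \<mu> (m, (\<Omega> * sin \<theta>) *\<^sub>R p, r *\<^sub>R m + T *\<^sub>R t + F *\<^sub>R p) =
      (\<Omega> * sin \<theta>) *\<^sub>R p - cross3 m (\<alpha> *\<^sub>R ((\<Omega> * sin \<theta>) *\<^sub>R p) - (r *\<^sub>R m + T *\<^sub>R t + F *\<^sub>R p) + (\<mu> * cos \<theta> - h) *\<^sub>R e3 + \<beta> *\<^sub>R (- sin \<theta> *\<^sub>R p))"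
    by (simp add: LLGS_residual_def m3 ce)
  also have "\<dots> = (\<Omega> * sin \<theta>) *\<^sub>R p - (\<alpha> *\<^sub>R ((\<Omega> * sin \<theta>) *\<^sub>R (- t)) - (T *\<^sub>R p + F *\<^sub>R (- t)) + (\<mu> * cos \<theta> - h) *\<^sub>R (- sin \<theta> *\<^sub>R p) + \<beta> *\<^sub>R (- sin \<theta> *\<^sub>R (- t)))"
    by (simp only: cross_add_right Cross3.right_diff_distrib cross_mult_right c ce cross_refl scaleR_zero_right add_0_left)
  also have "\<dots> = (\<Omega> * sin \<theta> + T + (\<mu> * cos \<theta> - h) * sin \<theta>) *\<^sub>R p + (\<alpha> * \<Omega> * sin \<theta> - F - \<beta> * sin \<theta>) *\<^sub>R t"
    by (simp add: algebra_simps)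
  finally show ?thesis by (simp add: m_def p_def t_def)
qed

lemma has_vector_derivative_vector3:
  assumes "(a has_real_derivative a') (at x)" "(b has_real_derivative b') (at x)" "(c has_real_derivative c') (at x)"
  shows "((\<lambda>x. vector [a x, b x, c x] :: real^3) has_vector_derivative vector [a', b', c']) (at x)"
proof -
  have v: "vector [p, q, r] = p *\<^sub>R axis 1 1 + q *\<^sub>R axis 2 1 + r *\<^sub>R (axis 3 1 :: real^3)" for p q r :: real
    by (simp add: vec_eq_iff forall_3 axis_def)
  have s: "((\<lambda>x. f x *\<^sub>R (e :: real^3)) has_vector_derivative f' *\<^sub>R e) (at x)" if "(f has_real_derivative f') (at x)" for f f' e
    using bounded_linear.has_vector_derivative[OF bounded_linear_scaleR_left] that
    by (simp add: has_real_derivative_iff_has_vector_derivative)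
  show ?thesis unfolding v by (intro has_vector_derivative_add s assms)
qed

text \<open>The frame components of the residual vanish separately, at the poles as well.
  \<open>T\<close> and \<open>F\<close> are the tangential components of the second derivative and
  \<open>r\<close> is the radial one.\<close>

lemma solves_LLGS_spherical:
  assumes \<phi>: "\<And>x. (\<phi> has_real_derivative \<phi>' x) (at x)" "\<And>x. (\<phi>' has_real_derivative \<phi>'' x) (at x)"
    and \<theta>: "\<And>x. (\<theta> has_real_derivative \<theta>' x) (at x)" "\<And>x. (\<theta>' has_real_derivative \<theta>'' x) (at x)"
  shows "solves_LLGS \<alpha> \<beta> h \<mu> (\<lambda>x t. sph (\<phi> x + \<Omega> * t) (\<theta> x)) \<longleftrightarrow>
    (\<forall>x. \<theta>'' x = sin (\<theta> x) * (h - \<Omega> - \<mu> * cos (\<theta> x) + cos (\<theta> x) * (\<phi>' x)\<^sup>2) \<and>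
      2 * cos (\<theta> x) * \<theta>' x * \<phi>' x + sin (\<theta> x) * \<phi>'' x = (\<alpha> * \<Omega> - \<beta>) * sin (\<theta> x))"
proof -
  define p where "p x t = \<phi> x + \<Omega> * t" for x t
  define m where "m x t = sph (p x t) (\<theta> x)" for x t
  define mt where "mt x t = (\<Omega> * sin (\<theta> x)) *\<^sub>R frame_ph (p x t)" for x t
  define mx where "mx x t = \<theta>' x *\<^sub>R frame_th (p x t) (\<theta> x) + (\<phi>' x * sin (\<theta> x)) *\<^sub>R frame_ph (p x t)" for x t
  define T where "T x = \<theta>'' x - sin (\<theta> x) * cos (\<theta> x) * (\<phi>' x)\<^sup>2" for x
  define F where "F x = 2 * cos (\<theta> x) * \<theta>' x * \<phi>' x + sin (\<theta> x) * \<phi>'' x" for x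
  define r where "r x = - (\<theta>' x)\<^sup>2 - (\<phi>' x)\<^sup>2 * (sin (\<theta> x))\<^sup>2" for x
  define mxx where "mxx x t = r x *\<^sub>R m x t + T x *\<^sub>R frame_th (p x t) (\<theta> x) + F x *\<^sub>R frame_ph (p x t)" for x t
  have dpt: "((\<lambda>t. p x t) has_real_derivative \<Omega>) (at t)" for x t
    unfolding p_def by (auto intro!: derivative_eq_intros)
  have dpx: "((\<lambda>x. p x t) has_real_derivative \<phi>' x) (at x)" for x t
    unfolding p_def by (auto intro!: derivative_eq_intros \<phi>)
  have dmt: "((\<lambda>t. m x t) has_vector_derivative mt x t) (at t)" for x t
  proof -
    have "((\<lambda>t. m x t) has_vector_derivative vector [- sin (p x t) * \<Omega> * sin (\<theta> x), cos (p x t) * \<Omega> * sin (\<theta> x), 0]) (at t)"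
      unfolding m_def sph_def
      by (rule has_vector_derivative_vector3) (auto intro!: derivative_eq_intros dpt)
    moreover have "vector [- sin (p x t) * \<Omega> * sin (\<theta> x), cos (p x t) * \<Omega> * sin (\<theta> x), 0] = mt x t"
      by (simp add: mt_def frame_ph_def vec_eq_iff forall_3)
    ultimately show ?thesis by simp
  qed
  have dmx: "((\<lambda>x. m x t) has_vector_derivative mx x t) (at x)" for x t
  proof -
    have "((\<lambda>x. m x t) has_vector_derivative vector [
        - sin (p x t) * \<phi>' x * sin (\<theta> x) + cos (\<theta> x) * \<theta>' x * cos (p x t),
        cos (p x t) * \<phi>' x * sin (\<theta> x) + cos (\<theta> x) * \<theta>' x * sin (p x t), - sin (\<theta> x) * \<theta>' x]) (at x)"
      unfolding m_def sph_def
      by (rule has_vector_derivative_vector3) (auto intro!: derivative_eq_intros dpx \<theta>)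
    moreover have "vector [
        - sin (p x t) * \<phi>' x * sin (\<theta> x) + cos (\<theta> x) * \<theta>' x * cos (p x t),
        cos (p x t) * \<phi>' x * sin (\<theta> x) + cos (\<theta> x) * \<theta>' x * sin (p x t), - sin (\<theta> x) * \<theta>' x] = mx x t"
      by (simp add: mx_def frame_ph_def frame_th_def vec_eq_iff forall_3 algebra_simps)
    ultimately show ?thesis by simp
  qed
  have dmxx: "((\<lambda>x. mx x t) has_vector_derivative mxx x t) (at x)" for x t
  proof -
    have mxv: "mx x t = vector [
        cos (p x t) * (cos (\<theta> x) * \<theta>' x) - sin (p x t) * (\<phi>' x * sin (\<theta> x)),
        sin (p x t) * (cos (\<theta> x) * \<theta>' x) + cos (p x t) * (\<phi>' x * sin (\<theta> x)), - (sin (\<theta> x) * \<theta>' x)]" for x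
      by (simp add: mx_def frame_ph_def frame_th_def vec_eq_iff forall_3 algebra_simps)
    define A where "A x = cos (\<theta> x) * \<theta>' x" for x
    define A' where "A' x = - sin (\<theta> x) * \<theta>' x * \<theta>' x + \<theta>'' x * cos (\<theta> x)" for x
    define B where "B x = \<phi>' x * sin (\<theta> x)" for x
    define B' where "B' x = \<phi>'' x * sin (\<theta> x) + cos (\<theta> x) * \<theta>' x * \<phi>' x" for x
    define D where "D x = - (sin (\<theta> x) * \<theta>' x)" for x
    define D' where "D' x = - (cos (\<theta> x) * \<theta>' x * \<theta>' x + \<theta>'' x * sin (\<theta> x))" for x
    have dA: "(A has_real_derivative A' x) (at x)" for x
      unfolding A_def A'_def by (auto intro!: derivative_eq_intros \<theta>)
    have dB: "(B has_real_derivative B' x) (at x)" for x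
      unfolding B_def B'_def by (auto intro!: derivative_eq_intros \<theta> \<phi>)
    have dD: "(D has_real_derivative D' x) (at x)" for x
      unfolding D_def D'_def by (auto intro!: derivative_eq_intros \<theta>)
    have "((\<lambda>x. mx x t) has_vector_derivative vector [
        (- sin (p x t) * \<phi>' x) * A x + A' x * cos (p x t) - ((cos (p x t) * \<phi>' x) * B x + B' x * sin (p x t)),
        (cos (p x t) * \<phi>' x) * A x + A' x * sin (p x t) + ((- sin (p x t) * \<phi>' x) * B x + B' x * cos (p x t)), D' x]) (at x)"
      unfolding mxv A_def[symmetric] B_def[symmetric] D_def[symmetric]
      by (rule has_vector_derivative_vector3) (auto intro!: derivative_eq_intros dpx dA dB dD)
    moreover have "vector [
        (- sin (p x t) * \<phi>' x) * A x + A' x * cos (p x t) - ((cos (p x t) * \<phi>' x) * B x + B' x * sin (p x t)),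
        (cos (p x t) * \<phi>' x) * A x + A' x * sin (p x t) + ((- sin (p x t) * \<phi>' x) * B x + B' x * cos (p x t)), D' x] = mxx x t"
    proof -
      define s c where "s = sin (\<theta> x)" and "c = cos (\<theta> x)"
      have sc: "c * c = 1 - s * s" using cos_squared_eq[of "\<theta> x"] by (simp add: s_def c_def power2_eq_square)
      have r1: "r x * s + T x * c = A' x - \<phi>' x * B x"
      proof -
        have "r x * s + T x * c = - (\<theta>' x * \<theta>' x) * s + \<theta>'' x * c - \<phi>' x * \<phi>' x * s * (s * s + c * c)"
          by (simp add: r_def T_def s_def[symmetric] c_def[symmetric] power2_eq_square algebra_simps)
        then show ?thesis unfolding sc by (simp add: A'_def B_def s_def[symmetric] c_def[symmetric] algebra_simps)
      qed
      have r2: "r x * c - T x * s = D' x"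
      proof -
        have "r x * c - T x * s = - (\<theta>' x * \<theta>' x) * c - \<theta>'' x * s"
          by (simp add: r_def T_def s_def[symmetric] c_def[symmetric] power2_eq_square algebra_simps)
        then show ?thesis by (simp add: D'_def s_def[symmetric] c_def[symmetric] algebra_simps)
      qed
      have r3: "F x = \<phi>' x * A x + B' x" by (simp add: F_def A_def B'_def algebra_simps)
      have x1: "(- sin (p x t) * \<phi>' x) * A x + A' x * cos (p x t) - ((cos (p x t) * \<phi>' x) * B x + B' x * sin (p x t)) =
          cos (p x t) * (r x * s + T x * c) - sin (p x t) * F x"
        unfolding r1 r3 by (simp add: algebra_simps)
      have x2: "(cos (p x t) * \<phi>' x) * A x + A' x * sin (p x t) + ((- sin (p x t) * \<phi>' x) * B x + B' x * cos (p x t)) =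
          sin (p x t) * (r x * s + T x * c) + cos (p x t) * F x"
        unfolding r1 r3 by (simp add: algebra_simps)
      show ?thesis unfolding x1 x2 r2[symmetric]
        by (simp add: mxx_def m_def sph_def frame_ph_def frame_th_def vec_eq_iff forall_3 s_def[symmetric] c_def[symmetric] algebra_simps)
    qed
    ultimately show ?thesis by simp
  qed
  have res: "LLGS_residual \<alpha> \<beta> h \<mu> (m x t, mt x t, mxx x t) = 0 \<longleftrightarrow>
      \<theta>'' x = sin (\<theta> x) * (h - \<Omega> - \<mu> * cos (\<theta> x) + cos (\<theta> x) * (\<phi>' x)\<^sup>2) \<and> F x = (\<alpha> * \<Omega> - \<beta>) * sin (\<theta> x)" for x t
    unfolding m_def mt_def mxx_def residual_frame frame_independent
    by (auto simp: T_def algebra_simps)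
  \<comment> \<open>\<open>solves_LLGS\<close> quantifies the derivatives existentially; their
    uniqueness lets the explicit ones be inserted.\<close>
  have uniq: "mt' x t = mt x t \<and> mx' x t = mx x t \<and> mxx' x t = mxx x t"
    if *: "\<And>x t. ((\<lambda>\<tau>. m x \<tau>) has_vector_derivative mt' x t) (at t) \<and> ((\<lambda>y. m y t) has_vector_derivative mx' x t) (at x) \<and>
        ((\<lambda>y. mx' y t) has_vector_derivative mxx' x t) (at x)" for mt' mx' mxx' x t
  proof -
    have "mx' = mx" using * dmx vector_derivative_unique_at by (intro ext) blast
    then show ?thesis using *[of x t] dmt[of x t] dmxx[where x = x and t = t] vector_derivative_unique_at by blast
  qed
  have "solves_LLGS \<alpha> \<beta> h \<mu> m \<longleftrightarrow> (\<forall>x t. LLGS_residual \<alpha> \<beta> h \<mu> (m x t, mt x t, mxx x t) = 0)"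
  proof
    assume "solves_LLGS \<alpha> \<beta> h \<mu> m"
    then obtain mt' mx' mxx' where *: "\<And>x t. ((\<lambda>\<tau>. m x \<tau>) has_vector_derivative mt' x t) (at t) \<and>
        ((\<lambda>y. m y t) has_vector_derivative mx' x t) (at x) \<and> ((\<lambda>y. mx' y t) has_vector_derivative mxx' x t) (at x)"
      and r: "\<And>x t. LLGS_residual \<alpha> \<beta> h \<mu> (m x t, mt' x t, mxx' x t) = 0"
      unfolding solves_LLGS_def by blast
    show "\<forall>x t. LLGS_residual \<alpha> \<beta> h \<mu> (m x t, mt x t, mxx x t) = 0"
      using uniq[OF *] r by auto
  next
    assume *: "\<forall>x t. LLGS_residual \<alpha> \<beta> h \<mu> (m x t, mt x t, mxx x t) = 0"
    show "solves_LLGS \<alpha> \<beta> h \<mu> m"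
      unfolding solves_LLGS_def
    proof (rule conjI)
      show "\<forall>x t. norm (m x t) = 1" by (simp add: m_def norm_sph)
      have "\<forall>x t. ((\<lambda>\<tau>. m x \<tau>) has_vector_derivative mt x t) (at t) \<and>
        ((\<lambda>y. m y t) has_vector_derivative mx x t) (at x) \<and>
        ((\<lambda>y. mx y t) has_vector_derivative mxx x t) (at x) \<and>
        LLGS_residual \<alpha> \<beta> h \<mu> (m x t, mt x t, mxx x t) = 0"
        by (intro allI conjI dmt dmx dmxx) (use * in blast)
      then show "\<exists>mt mx mxx. \<forall>x t. ((\<lambda>\<tau>. m x \<tau>) has_vector_derivative mt x t) (at t) \<and>
        ((\<lambda>y. m y t) has_vector_derivative mx x t) (at x) \<and>
        ((\<lambda>y. mx y t) has_vector_derivative mxx x t) (at x) \<and>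
        LLGS_residual \<alpha> \<beta> h \<mu> (m x t, mt x t, mxx x t) = 0"
        by (rule exI[where x = mxx, THEN exI[where x = mx], THEN exI[where x = mt]])
    qed
  qed
  moreover have "m = (\<lambda>x t. sph (\<phi> x + \<Omega> * t) (\<theta> x))" by (simp add: m_def p_def fun_eq_iff)
  ultimately show ?thesis unfolding res by (auto simp: F_def)
qed

text \<open>For constant phase the second spherical equation reduces to
  \<open>(\<alpha> \<Omega> - \<beta>) sin \<theta> = 0\<close>, which the choice of frequency
  settles.\<close>

lemma coherent_structure_iff_profile:
  assumes "\<beta> = \<alpha> * \<Omega>"
  shows "coherent_structure \<alpha> \<beta> h \<mu> 0 \<Omega> (\<lambda>_. \<phi>\<^sub>0) \<theta> \<longleftrightarrow> (\<exists>\<theta>'. profile_solution h \<Omega> \<mu> \<theta> \<theta>')"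
proof -
  have eq: "solves_LLGS \<alpha> \<beta> h \<mu> (coherent_field 0 \<Omega> (\<lambda>_. \<phi>\<^sub>0) \<theta>) \<longleftrightarrow> (\<forall>x. \<theta>'' x = sin (\<theta> x) * (h - \<Omega> - \<mu> * cos (\<theta> x)))"
    if "\<And>x. (\<theta> has_real_derivative \<theta>' x) (at x)" "\<And>x. (\<theta>' has_real_derivative \<theta>'' x) (at x)" for \<theta>' \<theta>''
    using solves_LLGS_spherical[of "\<lambda>_. \<phi>\<^sub>0" "\<lambda>_. 0" "\<lambda>_. 0" \<theta> \<theta>' \<theta>'' \<alpha> \<beta> h \<mu> \<Omega>] that assms
    by (simp add: coherent_field_def[abs_def])
  have "twice_differentiable (\<lambda>_. \<phi>\<^sub>0)"
    unfolding twice_differentiable_def by (intro exI[of _ "\<lambda>_. 0"]) auto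
  then have cs: "coherent_structure \<alpha> \<beta> h \<mu> 0 \<Omega> (\<lambda>_. \<phi>\<^sub>0) \<theta> \<longleftrightarrow>
      twice_differentiable \<theta> \<and> solves_LLGS \<alpha> \<beta> h \<mu> (coherent_field 0 \<Omega> (\<lambda>_. \<phi>\<^sub>0) \<theta>)"
    by (simp add: coherent_structure_def)
  show ?thesis unfolding cs
  proof
    assume *: "twice_differentiable \<theta> \<and> solves_LLGS \<alpha> \<beta> h \<mu> (coherent_field 0 \<Omega> (\<lambda>_. \<phi>\<^sub>0) \<theta>)"
    then obtain \<theta>' \<theta>'' where d: "\<And>x. (\<theta> has_real_derivative \<theta>' x) (at x)" "\<And>x. (\<theta>' has_real_derivative \<theta>'' x) (at x)"
      unfolding twice_differentiable_def by blast
    have "\<theta>'' = (\<lambda>x. sin (\<theta> x) * (h - \<Omega> - \<mu> * cos (\<theta> x)))"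
      using iffD1[OF eq[OF d] conjunct2[OF *]] by (intro ext) (rule spec)
    then show "\<exists>\<theta>'. profile_solution h \<Omega> \<mu> \<theta> \<theta>'"
      unfolding profile_solution_def using d by (intro exI[of _ \<theta>']) simp
  next
    assume "\<exists>\<theta>'. profile_solution h \<Omega> \<mu> \<theta> \<theta>'"
    then obtain \<theta>' where "profile_solution h \<Omega> \<mu> \<theta> \<theta>'" ..
    then have d: "\<And>x. (\<theta> has_real_derivative \<theta>' x) (at x)"
      "\<And>x. (\<theta>' has_real_derivative sin (\<theta> x) * (h - \<Omega> - \<mu> * cos (\<theta> x))) (at x)"
      by (simp_all add: profile_solution_def)
    have "\<forall>x. (\<theta> has_real_derivative \<theta>' x) (at x) \<and>
        (\<theta>' has_real_derivative sin (\<theta> x) * (h - \<Omega> - \<mu> * cos (\<theta> x))) (at x)"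
      using d by simp
    then have "twice_differentiable \<theta>"
      unfolding twice_differentiable_def by (intro exI)
    then show "twice_differentiable \<theta> \<and> solves_LLGS \<alpha> \<beta> h \<mu> (coherent_field 0 \<Omega> (\<lambda>_. \<phi>\<^sub>0) \<theta>)"
      using eq[OF d] by simp
  qed
qed

text \<open>With \<open>k = 0\<close> the wavetrain is a spherical solution with constant angles and
  frequency \<open>- \<omega>\<close>; the factor \<open>sin\<close> of the polar angle cancels from
  both equations.\<close>

lemma wavetrain_iff:
  "wavetrain \<alpha> \<beta> h \<mu> 0 \<omega> \<theta>\<^sub>0 \<longleftrightarrow> sin \<theta>\<^sub>0 \<noteq> 0 \<and> h + \<omega> = \<mu> * cos \<theta>\<^sub>0 \<and> \<alpha> * \<omega> = - \<beta>"
proof -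
  have "solves_LLGS \<alpha> \<beta> h \<mu> (\<lambda>x t. sph (0 * x - \<omega> * t) \<theta>\<^sub>0) \<longleftrightarrow>
    (0 = sin \<theta>\<^sub>0 * (h + \<omega> - \<mu> * cos \<theta>\<^sub>0) \<and> 0 = (- (\<alpha> * \<omega>) - \<beta>) * sin \<theta>\<^sub>0)"
    using solves_LLGS_spherical[of "\<lambda>_. 0" "\<lambda>_. 0" "\<lambda>_. 0" "\<lambda>_. \<theta>\<^sub>0" "\<lambda>_. 0" "\<lambda>_. 0" \<alpha> \<beta> h \<mu> "- \<omega>"] by simp
  then show ?thesis unfolding wavetrain_def by auto
qed

section \<open>Connections between the poles\<close>

text \<open>\<open>Q\<close> is the flux \<open>sin\<^sup>2 \<theta> q\<close>. Once positive, the quotient of its square and the energy increases, which keeps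
  \<open>S = sin\<^sup>2 \<theta>\<close> away from zero.\<close>

lemma flux_nonpos:
  fixes Q E S :: "real \<Rightarrow> real"
  assumes Q: "\<And>x. (Q has_real_derivative c * S x) (at x)" and E: "\<And>x. (E has_real_derivative c * Q x) (at x)"
    and c: "c \<ge> 0" and S: "\<And>x. S x \<ge> 0" and E1: "\<And>x. E x > 0" and le: "\<And>x. (Q x)\<^sup>2 \<le> 2 * E x * S x"
    and lim: "(S \<longlongrightarrow> 0) at_top"
  shows "Q x \<le> 0"
proof (rule ccontr)
  assume "\<not> Q x \<le> 0"
  then have Qx: "Q x > 0" by simp
  have Qpos: "Q y > 0" if "x \<le> y" for y
  proof -
    have "Q x \<le> Q y"
      by (rule DERIV_nonneg_imp_nondecreasing[OF that]) (use Q c S in \<open>auto intro!: exI mult_nonneg_nonneg\<close>)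
    then show ?thesis using Qx by simp
  qed
  \<comment> \<open>For positive \<open>Q\<close> its derivative has the sign of
    \<open>2 E S - Q\<^sup>2\<close>, which \<open>le\<close> controls. Moreover \<open>le\<close>
    gives \<open>R <= 2 S\<close>, so a positive value of \<open>R\<close> keeps \<open>S\<close>
    away from zero.\<close>
  define R where "R y = (Q y)\<^sup>2 / E y" for y
  have R: "R x \<le> R y" if "x \<le> y" for y
  proof (rule DERIV_nonneg_imp_nondecreasing[OF that])
    fix s assume s: "x \<le> s" "s \<le> y"
    have "(R has_real_derivative (2 * Q s * (c * S s) * E s - (Q s)\<^sup>2 * (c * Q s)) / (E s * E s)) (at s)"
      unfolding R_def by (rule DERIV_divide) (use E1[of s] in \<open>auto intro!: derivative_eq_intros Q E\<close>)
    moreover have "2 * Q s * (c * S s) * E s - (Q s)\<^sup>2 * (c * Q s) = c * Q s * (2 * E s * S s - (Q s)\<^sup>2)"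
      by (simp add: algebra_simps)
    moreover have "\<dots> \<ge> 0" using c Qpos[OF s(1)] le[of s] by (intro mult_nonneg_nonneg) auto
    ultimately show "\<exists>d. (R has_real_derivative d) (at s) \<and> 0 \<le> d"
      using E1[of s] by (intro exI[of _ "(2 * Q s * (c * S s) * E s - (Q s)\<^sup>2 * (c * Q s)) / (E s * E s)"]) auto
  qed
  have Rx: "R x > 0" using Qx E1[of x] by (simp add: R_def)
  have up: "R y \<le> 2 * S y" for y using le[of y] E1[of y] by (simp add: R_def divide_le_eq mult_ac)
  then have low: "R x / 2 \<le> S y" if "x \<le> y" for y using R[OF that] up[of y] by linarith
  have "eventually (\<lambda>y. S y < R x / 2) at_top" by (rule order_tendstoD(2)[OF lim]) (use Rx in simp)
  then have "eventually (\<lambda>y. S y < R x / 2 \<and> x \<le> y) at_top" by (rule eventually_conj[OF _ eventually_ge_at_top])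
  then obtain y where "S y < R x / 2" "x \<le> y" using eventually_happens'[OF trivial_limit_at_top_linorder] by blast
  then show False using low[of y] by simp
qed

text \<open>Reflecting the line changes the sign of \<open>Q\<close> and yields the opposite
  inequality; negative \<open>c\<close> is treated by passing to \<open>- Q\<close>.\<close>

lemma flux_zero:
  fixes Q E S :: "real \<Rightarrow> real"
  assumes Q: "\<And>x. (Q has_real_derivative c * S x) (at x)" and E: "\<And>x. (E has_real_derivative c * Q x) (at x)"
    and S: "\<And>x. S x \<ge> 0" and E1: "\<And>x. E x > 0" and le: "\<And>x. (Q x)\<^sup>2 \<le> 2 * E x * S x"
    and lim: "(S \<longlongrightarrow> 0) at_top" "(S \<longlongrightarrow> 0) at_bot"
  shows "Q x = 0"
proof -
  have main: "Q x = 0" if c: "c \<ge> 0" and Q: "\<And>x. (Q has_real_derivative c * S x) (at x)" and E: "\<And>x. (E has_real_derivative c * Q x) (at x)"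
    and le: "\<And>x. (Q x)\<^sup>2 \<le> 2 * E x * S x" for c x and Q :: "real \<Rightarrow> real"
  proof -
    have "Q x \<le> 0" by (rule flux_nonpos[OF Q E c S E1 le lim(1)])
    moreover have "- Q (- (- x)) \<le> 0"
    proof (rule flux_nonpos[where E = "\<lambda>x. E (- x)" and S = "\<lambda>x. S (- x)" and Q = "\<lambda>x. - Q (- x)" and c = c])
      have m: "((\<lambda>x. - x) has_real_derivative - 1) (at x)" for x :: real by (auto intro!: derivative_eq_intros)
      show "((\<lambda>x. - Q (- x)) has_real_derivative c * S (- x)) (at x)" for x
        using DERIV_minus[OF DERIV_chain2[OF Q m, of x]] by simp
      show "((\<lambda>x. E (- x)) has_real_derivative c * - Q (- x)) (at x)" for x
        using DERIV_chain2[OF E m, of x] by simp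
      show "((\<lambda>x. S (- x)) \<longlongrightarrow> 0) at_top" using lim(2) by (simp add: filterlim_at_bot_mirror)
    qed (use c S E1 le in auto)
    ultimately show ?thesis by simp
  qed
  show ?thesis
  proof (cases "c \<ge> 0")
    case True
    then show ?thesis using main[OF True Q E le] by blast
  next
    case False
    have "- Q x = 0"
    proof (rule main[of "- c" "\<lambda>x. - Q x"])
      show "((\<lambda>x. - Q x) has_real_derivative - c * S x) (at x)" for x using DERIV_minus[OF Q[of x]] by simp
      show "(E has_real_derivative - c * - Q x) (at x)" for x using E[of x] by simp
    qed (use False le in auto)
    then show ?thesis by simp
  qed
qed

text \<open>Only \<open>cos \<theta>\<close> is known to converge, so
  \<open>sin \<theta> * p\<close> takes the place of the position: it tends to 0 and its derivative
  tends to \<open>s * L\<close>, where \<open>L\<close> is the limit of \<open>p\<^sup>2\<close>.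
  Hence \<open>L = 0\<close>, and the energy is the potential at the pole.\<close>

lemma (in profile_ode) pole_limit_energy:
  assumes "sol \<theta> p" and lim: "((\<lambda>t. cos (\<theta> t)) \<longlongrightarrow> s) at_top" and s: "s * s = 1"
  shows "energy (\<theta> 0) (p 0) = (h - \<Omega>) * s - \<mu> / 2"
proof -
  have d: "(\<theta> has_real_derivative p t) (at t)" "(p has_real_derivative force (\<theta> t)) (at t)" for t
    using assms(1) by (auto simp: sol_iff)
  define E where "E = energy (\<theta> 0) (p 0)"
  define L where "L = 2 * (E - ((h - \<Omega>) * s - \<mu> / 2 * s\<^sup>2))"
  have p2: "(p t)\<^sup>2 = 2 * (E - ((h - \<Omega>) * cos (\<theta> t) - \<mu> / 2 * (cos (\<theta> t))\<^sup>2))" for t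
    using sol_energy[OF assms(1), of t 0] by (simp add: E_def energy_def pot_def)
  have lp: "((\<lambda>t. (p t)\<^sup>2) \<longlongrightarrow> L) at_top"
    unfolding p2 L_def by (intro tendsto_intros lim)
  have "((\<lambda>t. 1 - (cos (\<theta> t))\<^sup>2) \<longlongrightarrow> 1 - s\<^sup>2) at_top" by (intro tendsto_intros lim)
  then have ls2: "((\<lambda>t. (sin (\<theta> t))\<^sup>2) \<longlongrightarrow> 0) at_top" using s by (simp add: sin_squared_eq power2_eq_square[of s])
  then have "((\<lambda>t. sqrt ((sin (\<theta> t))\<^sup>2)) \<longlongrightarrow> sqrt 0) at_top" by (intro tendsto_intros)
  then have ls: "((\<lambda>t. sin (\<theta> t)) \<longlongrightarrow> 0) at_top" by (simp add: tendsto_rabs_zero_iff)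
  have "((\<lambda>t. sqrt ((sin (\<theta> t))\<^sup>2 * (p t)\<^sup>2)) \<longlongrightarrow> sqrt (0 * L)) at_top" by (intro tendsto_intros ls2 lp)
  then have g: "((\<lambda>t. sin (\<theta> t) * p t) \<longlongrightarrow> 0) at_top"
    by (simp add: power_mult_distrib[symmetric] tendsto_rabs_zero_iff del: power_mult_distrib)
  have der: "((\<lambda>t. sin (\<theta> t) * p t) has_real_derivative cos (\<theta> t) * (p t)\<^sup>2 + sin (\<theta> t) * force (\<theta> t)) (at t)" for t
    by (auto intro!: derivative_eq_intros d simp: power2_eq_square)
  have "((\<lambda>t. cos (\<theta> t) * (p t)\<^sup>2 + sin (\<theta> t) * (sin (\<theta> t) * (h - \<Omega> - \<mu> * cos (\<theta> t)))) \<longlongrightarrow>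
      s * L + 0 * (0 * (h - \<Omega> - \<mu> * s))) at_top"
    by (intro tendsto_intros lim lp ls)
  then have "s * L + 0 * (0 * (h - \<Omega> - \<mu> * s)) = 0"
    by (intro derivative_tendsto_0[OF der g]) (simp add: force_def)
  then have "L = 0" using s by auto
  then show ?thesis using s by (simp add: L_def E_def power2_eq_square)
qed

text \<open>The phase is arbitrary where \<open>\<theta>\<close> is at a pole, but the flux stays
  meaningful there. The frequency and the sign of \<open>\<mu>\<close> are read off where the
  profile crosses the equator.\<close>

lemma pole_connection_parameters:
  assumes \<alpha>: "\<alpha> > 0" and \<Omega>: "\<Omega> = \<beta> / \<alpha>" and cs: "coherent_structure \<alpha> \<beta> h \<mu> 0 \<Omega>' \<phi> \<theta>" and conn: "connects_poles \<theta>"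
  shows "\<Omega>' = \<Omega> \<and> h = \<Omega> \<and> \<mu> < 0"
proof -
  obtain q q' where \<phi>: "\<And>x. (\<phi> has_real_derivative q x) (at x)" "\<And>x. (q has_real_derivative q' x) (at x)"
    using cs unfolding coherent_structure_def twice_differentiable_def by blast
  obtain p p' where \<theta>: "\<And>x. (\<theta> has_real_derivative p x) (at x)" "\<And>x. (p has_real_derivative p' x) (at x)"
    using cs unfolding coherent_structure_def twice_differentiable_def by blast
  have "solves_LLGS \<alpha> \<beta> h \<mu> (\<lambda>x t. sph (\<phi> x + \<Omega>' * t) (\<theta> x))"
    using cs by (simp add: coherent_structure_def coherent_field_def[abs_def])
  from iffD1[OF solves_LLGS_spherical[OF \<phi> \<theta>] this]
  have eq1: "p' x = sin (\<theta> x) * (h - \<Omega>' - \<mu> * cos (\<theta> x) + cos (\<theta> x) * (q x)\<^sup>2)"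
    and eq2: "2 * cos (\<theta> x) * p x * q x + sin (\<theta> x) * q' x = (\<alpha> * \<Omega>' - \<beta>) * sin (\<theta> x)" for x
    by auto
  \<comment> \<open>The value of \<open>cos \<theta>\<close> at the pole where the connection
    starts; it treats both directions at once.\<close>
  define s :: real where "s = (if ((\<lambda>\<xi>. cis (\<theta> \<xi>)) \<longlongrightarrow> 1) at_bot then 1 else - 1)"
  have s: "s * s = 1" by (simp add: s_def)
  have "((\<lambda>\<xi>. cis (\<theta> \<xi>)) \<longlongrightarrow> of_real s) at_bot \<and> ((\<lambda>\<xi>. cis (\<theta> \<xi>)) \<longlongrightarrow> of_real (- s)) at_top"
  proof (cases "((\<lambda>\<xi>. cis (\<theta> \<xi>)) \<longlongrightarrow> 1) at_bot")
    case True
    have "\<not> ((\<lambda>\<xi>. cis (\<theta> \<xi>)) \<longlongrightarrow> - 1) at_bot"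
      using tendsto_unique[OF trivial_limit_at_bot_linorder True] by fastforce
    then show ?thesis using conn True by (auto simp: connects_poles_def s_def)
  qed (use conn in \<open>auto simp: connects_poles_def s_def\<close>)
  then have bot: "((\<lambda>\<xi>. cos (\<theta> \<xi>)) \<longlongrightarrow> s) at_bot" and top: "((\<lambda>\<xi>. cos (\<theta> \<xi>)) \<longlongrightarrow> - s) at_top"
    using tendsto_Re[of "\<lambda>\<xi>. cis (\<theta> \<xi>)"] by fastforce+
  define c where "c = \<alpha> * \<Omega>' - \<beta>"
  define S where "S x = (sin (\<theta> x))\<^sup>2" for x
  define Q where "Q x = S x * q x" for x
  \<comment> \<open>\<open>E\<close> is kinetic, potential and centrifugal energy, the last one
    being \<open>S q\<^sup>2 / 2\<close>. \<open>K\<close> bounds the potential part with a margin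
    of 1 and thus makes \<open>E\<close> positive.\<close>
  define K where "K = \<bar>h - \<Omega>'\<bar> + \<bar>\<mu>\<bar> + 1"
  define E where "E x = (p x)\<^sup>2 / 2 + ((h - \<Omega>') * cos (\<theta> x) - \<mu> / 2 * (cos (\<theta> x))\<^sup>2) + Q x * q x / 2 + K" for x
  have dS: "(S has_real_derivative 2 * sin (\<theta> x) * (cos (\<theta> x) * p x)) (at x)" for x
    unfolding S_def by (auto intro!: derivative_eq_intros \<theta>)
  have dQ: "(Q has_real_derivative c * S x) (at x)" for x
  proof -
    have "(Q has_real_derivative 2 * sin (\<theta> x) * (cos (\<theta> x) * p x) * q x + q' x * S x) (at x)"
      unfolding Q_def by (rule derivative_eq_intros dS \<phi> refl)+
    also have "2 * sin (\<theta> x) * (cos (\<theta> x) * p x) * q x + q' x * S x =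
        sin (\<theta> x) * (2 * cos (\<theta> x) * p x * q x + sin (\<theta> x) * q' x)"
      by (simp add: S_def power2_eq_square algebra_simps)
    also have "\<dots> = c * S x" unfolding eq2 by (simp add: S_def c_def power2_eq_square)
    finally show ?thesis .
  qed
  have dE: "(E has_real_derivative c * Q x) (at x)" for x
  proof -
    have "(E has_real_derivative p x * p' x + (- (h - \<Omega>') * (sin (\<theta> x) * p x) + \<mu> * cos (\<theta> x) * (sin (\<theta> x) * p x))
        + (c * S x * q x + q' x * Q x) / 2) (at x)"
      unfolding E_def by (rule derivative_eq_intros dQ \<phi> \<theta> refl | simp add: power2_eq_square algebra_simps)+
    moreover have "q' x * Q x = c * S x * q x - 2 * sin (\<theta> x) * (cos (\<theta> x) * p x) * (q x * q x)"
    proof -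
      have "q' x * Q x = (sin (\<theta> x) * q x) * (sin (\<theta> x) * q' x)" by (simp add: Q_def S_def power2_eq_square)
      also have "sin (\<theta> x) * q' x = c * sin (\<theta> x) - 2 * cos (\<theta> x) * p x * q x" using eq2[of x] by (simp add: c_def)
      finally show ?thesis by (simp add: S_def power2_eq_square algebra_simps)
    qed
    moreover have "p x * p' x + (- (h - \<Omega>') * (sin (\<theta> x) * p x) + \<mu> * cos (\<theta> x) * (sin (\<theta> x) * p x))
        + (c * S x * q x + (c * S x * q x - 2 * sin (\<theta> x) * (cos (\<theta> x) * p x) * (q x * q x))) / 2 = c * Q x"
      by (simp add: eq1 Q_def power2_eq_square field_simps)
    ultimately show ?thesis by simp
  qed
  have K: "- ((h - \<Omega>') * cos x - \<mu> / 2 * (cos x)\<^sup>2) \<le> K - 1" for x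
    using abs_le_D2[OF profile_ode.pot_bound[of h \<Omega>' \<mu> x]] by (simp add: K_def profile_ode.pot_def)
  have E: "E x \<ge> 1 + (p x)\<^sup>2 / 2 + Q x * q x / 2" for x
    using K[of "\<theta> x"] by (simp add: E_def)
  have Qq: "Q x * q x = S x * (q x)\<^sup>2" for x by (simp add: Q_def power2_eq_square)
  have S0: "S x \<ge> 0" for x by (simp add: S_def)
  have E0: "E x > 0" for x
  proof -
    have "0 \<le> (p x)\<^sup>2 / 2 + Q x * q x / 2" unfolding Qq using S0[of x] by simp
    then show ?thesis using E[of x] by linarith
  qed
  have le: "(Q x)\<^sup>2 \<le> 2 * E x * S x" for x
  proof -
    have "(Q x)\<^sup>2 = (Q x * q x) * S x" by (simp add: Q_def power2_eq_square)
    also have "\<dots> \<le> (2 * E x) * S x"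
    proof (rule mult_right_mono[OF _ S0])
      have "0 \<le> (p x)\<^sup>2 / 2" by simp
      then show "Q x * q x \<le> 2 * E x" using E[of x] by linarith
    qed
    finally show ?thesis .
  qed
  have lims: "(S \<longlongrightarrow> 0) at_top" "(S \<longlongrightarrow> 0) at_bot"
  proof -
    have "((\<lambda>x. 1 - (cos (\<theta> x))\<^sup>2) \<longlongrightarrow> 1 - (- s)\<^sup>2) at_top" "((\<lambda>x. 1 - (cos (\<theta> x))\<^sup>2) \<longlongrightarrow> 1 - s\<^sup>2) at_bot"
      by (intro tendsto_intros top bot)+
    then show "(S \<longlongrightarrow> 0) at_top" "(S \<longlongrightarrow> 0) at_bot"
      using s by (simp_all add: S_def[abs_def] sin_squared_eq power2_eq_square[of s])
  qed
  have Q0: "Q x = 0" for x by (rule flux_zero[OF dQ dE S0 E0 le lims])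
  \<comment> \<open>By continuity the profile crosses the equator between the two poles.\<close>
  obtain x0 where x0: "cos (\<theta> x0) = 0"
  proof -
    have contc: "connected (range (\<lambda>x. cos (\<theta> x)))"
      by (intro connected_continuous_image continuous_on_cos continuous_at_imp_continuous_on ballI DERIV_isCont[OF \<theta>(1)]) auto
    have b: "((\<lambda>x. s * cos (\<theta> x)) \<longlongrightarrow> 1) at_bot" "((\<lambda>x. s * cos (\<theta> x)) \<longlongrightarrow> - 1) at_top"
      using tendsto_mult_left[OF bot, of s] tendsto_mult_left[OF top, of s] s by auto
    obtain x where x: "s * cos (\<theta> x) > 0"
      using eventually_happens'[OF trivial_limit_at_bot_linorder order_tendstoD(1)[OF b(1), of 0]] by auto
    obtain y where y: "s * cos (\<theta> y) < 0"
      using eventually_happens'[OF trivial_limit_at_top_linorder order_tendstoD(2)[OF b(2), of 0]] by auto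
    have "0 \<in> range (\<lambda>x. cos (\<theta> x))"
    proof (cases "s > 0")
      case True
      then have "cos (\<theta> y) \<le> 0" "0 \<le> cos (\<theta> x)" using x y by (auto simp: zero_less_mult_iff mult_less_0_iff)
      then show ?thesis using connectedD_interval[OF contc, of "cos (\<theta> y)" "cos (\<theta> x)" 0] by blast
    next
      case False
      then have "cos (\<theta> x) \<le> 0" "0 \<le> cos (\<theta> y)" using x y by (auto simp: zero_less_mult_iff mult_less_0_iff)
      then show ?thesis using connectedD_interval[OF contc, of "cos (\<theta> x)" "cos (\<theta> y)" 0] by blast
    qed
    then show thesis using that by auto
  qed
  \<comment> \<open>The derivative of the vanishing flux is \<open>c * S\<close>, and
    \<open>S = 1\<close> on the equator.\<close>
  have "c * S x0 = 0"
  proof -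
    have "Q = (\<lambda>_. 0)" using Q0 by auto
    then show ?thesis using DERIV_unique[OF dQ[of x0], of 0] by simp
  qed
  moreover have "S x0 = 1" by (simp add: S_def sin_squared_eq x0)
  ultimately have "c = 0" by simp
  then have "\<alpha> * \<Omega>' = \<alpha> * \<Omega>" using \<alpha> \<Omega> by (simp add: c_def)
  then have \<Omega>': "\<Omega>' = \<Omega>" using \<alpha> by simp
  interpret P: profile_ode h \<Omega> \<mu> .
  have sol: "P.sol \<theta> p"
    unfolding P.sol_iff
  proof (intro allI conjI)
    fix x
    \<comment> \<open>Vanishing flux removes the centrifugal term at every point, through
      \<open>sin \<theta>\<close> or through \<open>q\<close>; so \<open>\<theta>\<close> solves the
      profile equation although \<open>q\<close> need not vanish at the poles.\<close>
    have "sin (\<theta> x) = 0 \<or> q x = 0" using Q0[of x] by (simp add: Q_def S_def)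
    then have "p' x = P.force (\<theta> x)" using eq1[of x] \<Omega>' by (auto simp: P.force_def)
    then show "(\<theta> has_real_derivative p x) (at x)" "(p has_real_derivative P.force (\<theta> x)) (at x)" using \<theta>[of x] by auto
  qed
  \<comment> \<open>The same energy is computed from both ends; the two values differ only in the
    sign of \<open>(h - \<Omega>) * s\<close>.\<close>
  have e1: "P.energy (\<theta> 0) (p 0) = (h - \<Omega>) * (- s) - \<mu> / 2"
    by (rule P.pole_limit_energy[OF sol top]) (use s in simp)
  have e2: "P.energy (\<theta> 0) (p 0) = (h - \<Omega>) * s - \<mu> / 2"
  proof -
    have "P.energy (\<theta> (0 - 0)) (- p (0 - 0)) = (h - \<Omega>) * s - \<mu> / 2"
      by (rule P.pole_limit_energy[OF P.sol_reverse[OF sol, of 0] _ s]) (use bot in \<open>simp add: filterlim_at_bot_mirror\<close>)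
    then show ?thesis by simp
  qed
  have "(h - \<Omega>) * s = 0" using e1 e2 by auto
  then have h: "h = \<Omega>" using s by auto
  have en: "(p x)\<^sup>2 / 2 - \<mu> / 2 * (cos (\<theta> x))\<^sup>2 = - \<mu> / 2" for x
  proof -
    have "P.energy (\<theta> x) (p x) = (h - \<Omega>) * (- s) - \<mu> / 2" using P.sol_energy[OF sol, of x 0] e1 by simp
    then show ?thesis unfolding P.energy_def P.pot_def using h by simp
  qed
  \<comment> \<open>On the equator the potential is zero, so \<open>- \<mu> / 2\<close> is a kinetic
    energy.\<close>
  have "\<mu> \<le> 0" using en[of x0] zero_le_power2[of "p x0"] x0 by simp
  moreover have "\<mu> \<noteq> 0"
  proof
    assume "\<mu> = 0"
    then have "p x = 0" for x using en[of x] by simp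
    then have "(\<theta> has_real_derivative 0) (at x)" for x using \<theta>(1)[of x] by simp
    then have cst: "\<theta> x = \<theta> x0" for x using DERIV_isconst_all[of \<theta> x x0] by blast
    have "(\<lambda>x. cos (\<theta> x)) = (\<lambda>_. 0)" by (rule ext) (subst cst, rule x0)
    then have "((\<lambda>_ :: real. 0) \<longlongrightarrow> s) at_bot" using bot by simp
    then have "s = 0" using tendsto_unique[OF trivial_limit_at_bot_linorder _ tendsto_const] by blast
    then show False using s by simp
  qed
  ultimately show ?thesis using \<Omega>' h by simp
qed

section \<open>Phase portraits in the presence of a wavetrain\<close>

context profile_ode
begin

lemma cos_less_iff_abs:
  assumes "\<bar>z\<bar> < pi" "0 < c" "c < pi"
  shows "cos c < cos z \<longleftrightarrow> \<bar>z\<bar> < c"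
  using cos_mono_less_eq[of c "\<bar>z\<bar>"] assms by simp

lemma force_wavetrain: "h - \<Omega> = \<mu> * cos c \<Longrightarrow> force z = \<mu> * (sin z * (cos c - cos z))"
  unfolding force_def by (simp add: algebra_simps)

text \<open>The wavetrain angles \<open>c\<close> and \<open>- c\<close> are the barriers, of equal
  height because the potential is even, and the poles are the bottoms.\<close>

theorem supercritical_portrait:
  assumes c: "0 < c" "c < pi" and \<mu>: "\<mu> > 0" and eq: "h - \<Omega> = \<mu> * cos c"
  shows "heteroclinic_portrait h \<Omega> \<mu> (cis c, 0) (cis (- c), 0) north south"
proof -
  note f = force_wavetrain[OF eq]
  have w1: "well (- c) 0 c"
    unfolding well_def
  proof (intro conjI allI impI)
    fix z assume z: "- c < z \<and> z < 0"
    then have "sin z < 0" "cos c - cos z < 0" using cos_less_iff_abs[of z c] c sin_gt_zero[of "- z"] by auto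
    then show "force z > 0" unfolding f using \<mu> by (simp add: mult_neg_neg)
  next
    fix z assume z: "0 < z \<and> z < c"
    then have "sin z > 0" "cos c - cos z < 0" using cos_less_iff_abs[of z c] c sin_gt_zero[of z] by auto
    then show "force z < 0" unfolding f using \<mu> by (simp add: mult_pos_neg)
  qed (use c in auto)
  have w2: "well c pi (- c + 2 * pi)"
    unfolding well_def
  proof (intro conjI allI impI)
    fix z assume z: "c < z \<and> z < pi"
    then have "sin z > 0" "cos c - cos z > 0" using cos_monotone_0_pi[of c z] c sin_gt_zero[of z] by auto
    then show "force z > 0" unfolding f using \<mu> by simp
  next
    fix z assume z: "pi < z \<and> z < - c + 2 * pi"
    then have "sin z < 0" "cos c - cos z > 0"
      using cos_monotone_0_pi[of c "2 * pi - z"] c sin_gt_zero[of "2 * pi - z"] by (auto simp: cos_diff sin_diff)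
    then show "force z < 0" unfolding f using \<mu> by (simp add: mult_neg_pos mult_pos_neg)
  qed (use c in auto)
  have "heteroclinic_portrait h \<Omega> \<mu> (cis c, 0) (cis (- c), 0) (cis 0, 0) (cis pi, 0)"
    by (rule double_well_portrait(2)[OF w1 w2]) (simp_all add: f)
  then show ?thesis by (simp add: north_def south_def)
qed

text \<open>Negative \<open>\<mu>\<close> exchanges the roles: the poles are the barriers and the
  wavetrain angles the bottoms. The heights at the poles differ by
  \<open>2 * (h - \<Omega>)\<close>.\<close>

theorem subsubcritical_portrait:
  assumes c: "0 < c" "c < pi" and \<mu>: "\<mu> < 0" and eq: "h - \<Omega> = \<mu> * cos c" and h: "h > \<Omega>"
  shows "card (connections h \<Omega> \<mu> north north) = 2 \<and> card (connections h \<Omega> \<mu> south south) = 2 \<and>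
    (\<exists>B1 B2 B3 U1 U2. phase_portrait h \<Omega> \<mu> {north, south, (cis c, 0), (cis (- c), 0)}
      (connections h \<Omega> \<mu> north north \<union> connections h \<Omega> \<mu> south south) [B1, B2, B3] [U1, U2])"
proof (rule barrier_portrait)
  note f = force_wavetrain[OF eq]
  show "well 0 c pi"
    unfolding well_def
  proof (intro conjI allI impI)
    fix z assume z: "0 < z \<and> z < c"
    then have "sin z > 0" "cos c - cos z < 0" using cos_monotone_0_pi[of z c] c sin_gt_zero[of z] by auto
    then show "force z > 0" unfolding f using \<mu> by (simp add: mult_neg_neg mult_pos_neg)
  next
    fix z assume z: "c < z \<and> z < pi"
    then have "sin z > 0" "cos c - cos z > 0" using cos_monotone_0_pi[of c z] c sin_gt_zero[of z] by auto
    then show "force z < 0" unfolding f using \<mu> by (simp add: mult_neg_pos)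
  qed (use c in auto)
  show "force c = 0" by (simp add: f)
  show "pot pi < pot 0" using h by (simp add: pot_def)
qed

text \<open>For \<open>h = \<Omega>\<close> the force has period \<open>pi\<close>, so the second
  well is a translate of the first and the poles are barriers of equal height.\<close>

theorem degenerate_portrait:
  assumes "h = \<Omega>" and \<mu>: "\<mu> < 0"
  shows "heteroclinic_portrait h \<Omega> \<mu> north south (cis (pi / 2), 0) (cis (- (pi / 2)), 0)"
proof -
  have f: "force z = - \<mu> * (sin z * cos z)" for z unfolding force_def using assms(1) by simp
  have p: "pot z = - \<mu> / 2 * (cos z)\<^sup>2" for z unfolding pot_def using assms(1) by simp
  have c3: "cos (3 * pi / 2) = 0" "sin (3 * pi / 2) = - 1" using cos_3over2_pi sin_3over2_pi by simp_all
  have shift: "force (z - pi) = force z" for z unfolding f by (simp add: sin_diff cos_diff)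
  have w1: "well 0 (pi / 2) pi"
    unfolding well_def
  proof (intro conjI allI impI)
    fix z assume z: "0 < z \<and> z < pi / 2"
    then have "sin z > 0" "cos z > 0" using sin_gt_zero[of z] cos_gt_zero[of z] by auto
    then show "force z > 0" unfolding f using \<mu> by (simp add: mult_neg_pos)
  next
    fix z assume z: "pi / 2 < z \<and> z < pi"
    then have "sin z > 0" "cos z < 0" using sin_gt_zero[of z] cos_monotone_0_pi[of "pi / 2" z] by auto
    then show "force z < 0" unfolding f using \<mu> by (simp add: mult_neg_neg mult_pos_neg)
  qed auto
  have w2: "well pi (3 / 2 * pi) (0 + 2 * pi)"
    unfolding well_def
  proof (intro conjI allI impI)
    fix z assume "pi < z \<and> z < 3 / 2 * pi"
    then have "force (z - pi) > 0" using w1 by (simp add: well_def)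
    then show "force z > 0" by (simp add: shift)
  next
    fix z assume "3 / 2 * pi < z \<and> z < 0 + 2 * pi"
    then have "force (z - pi) < 0" using w1 by (simp add: well_def)
    then show "force z < 0" by (simp add: shift)
  qed auto
  have "heteroclinic_portrait h \<Omega> \<mu> (cis 0, 0) (cis pi, 0) (cis (pi / 2), 0) (cis (3 / 2 * pi), 0)"
    by (rule double_well_portrait(1)[OF w1 w2]) (simp_all add: f p c3)
  moreover have "cis (3 / 2 * pi) = cis (- (pi / 2))"
    unfolding cis_eq_sin_cos by (simp add: c3)
  ultimately show ?thesis by (simp add: north_def south_def)
qed

end

lemma coherent_field_rotates:
  "coherent_field 0 \<Omega> (\<lambda>_. \<phi>\<^sub>0) \<theta> x t = rot3 (\<Omega> * t) (coherent_field 0 \<Omega> (\<lambda>_. \<phi>\<^sub>0) \<theta> x 0)"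
  by (simp add: coherent_field_def sph_def rot3_def vec_eq_iff forall_3 cos_add sin_add algebra_simps)

lemma profile_solution_reflect:
  assumes "h' - \<Omega> = \<Omega> - h"
  shows "profile_solution h \<Omega> \<mu> \<theta> \<theta>' \<longleftrightarrow> profile_solution h' \<Omega> \<mu> (\<lambda>\<xi>. \<theta> \<xi> + pi) \<theta>'"
proof -
  have d: "((\<lambda>\<xi>. f \<xi> + a) has_real_derivative D) (at x)" if "(f has_real_derivative D) (at x)"
    for f :: "real \<Rightarrow> real" and a D x
    using DERIV_add[OF that DERIV_const[of a]] by simp
  have iff: "((\<lambda>\<xi>. \<theta> \<xi> + pi) has_real_derivative D) (at x) \<longleftrightarrow> (\<theta> has_real_derivative D) (at x)" for D x
    using d[of \<theta> D x pi] d[of "\<lambda>\<xi>. \<theta> \<xi> + pi" D x "- pi"] by auto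
  have "sin (\<theta> \<xi> + pi) * (h' - \<Omega> - \<mu> * cos (\<theta> \<xi> + pi)) = sin (\<theta> \<xi>) * (h - \<Omega> - \<mu> * cos (\<theta> \<xi>))" for \<xi>
    unfolding assms by (simp add: algebra_simps)
  then show ?thesis unfolding profile_solution_def iff by simp
qed

lemma sph_minus: "sph \<phi> (- \<theta>) = sph (\<phi> + pi) \<theta>"
  by (simp add: sph_def)

text \<open>The third coordinate fixes the cosine of the polar angle and thereby its sine up to
  sign.\<close>

lemma wavetrain_orbit_meridian:
  "wavetrain_orbit \<theta>\<^sub>0 \<inter> meridian \<phi>\<^sub>0 = {sph \<phi>\<^sub>0 \<theta>\<^sub>0, sph \<phi>\<^sub>0 (- \<theta>\<^sub>0)}"
proof (intro equalityI subsetI)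
  fix v assume "v \<in> wavetrain_orbit \<theta>\<^sub>0 \<inter> meridian \<phi>\<^sub>0"
  then obtain \<phi> \<theta> where v: "v = sph \<phi> \<theta>\<^sub>0" "v = sph \<phi>\<^sub>0 \<theta>"
    unfolding wavetrain_orbit_def meridian_def by blast
  have "v $ 3 = cos \<theta>\<^sub>0" unfolding v(1) by (simp add: sph_def)
  moreover have "v $ 3 = cos \<theta>" unfolding v(2) by (simp add: sph_def)
  ultimately have c: "cos \<theta> = cos \<theta>\<^sub>0" by simp
  then have "(sin \<theta>)\<^sup>2 = (sin \<theta>\<^sub>0)\<^sup>2" by (simp add: sin_squared_eq)
  then have "sin \<theta> = sin \<theta>\<^sub>0 \<or> sin \<theta> = - sin \<theta>\<^sub>0" by (simp add: power2_eq_iff)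
  then show "v \<in> {sph \<phi>\<^sub>0 \<theta>\<^sub>0, sph \<phi>\<^sub>0 (- \<theta>\<^sub>0)}" unfolding v(2) by (auto simp: sph_def c)
next
  fix v assume "v \<in> {sph \<phi>\<^sub>0 \<theta>\<^sub>0, sph \<phi>\<^sub>0 (- \<theta>\<^sub>0)}"
  then show "v \<in> wavetrain_orbit \<theta>\<^sub>0 \<inter> meridian \<phi>\<^sub>0"
    unfolding wavetrain_orbit_def meridian_def using sph_minus[of \<phi>\<^sub>0 \<theta>\<^sub>0] by blast
qed

theorem theorem8:
  fixes \<alpha> \<beta> h \<mu> \<Omega> :: real
  assumes "\<alpha> > 0" and "\<Omega> = \<beta> / \<alpha>"
  shows
    "(\<forall>\<phi>\<^sub>0 \<theta>. coherent_structure \<alpha> \<beta> h \<mu> 0 \<Omega> (\<lambda>_. \<phi>\<^sub>0) \<theta> \<longleftrightarrow> (\<exists>\<theta>'. profile_solution h \<Omega> \<mu> \<theta> \<theta>')) \<and>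
     (\<forall>\<phi>\<^sub>0 \<theta>. coherent_structure \<alpha> \<beta> h \<mu> 0 \<Omega> (\<lambda>_. \<phi>\<^sub>0) \<theta> \<longrightarrow>
        (\<forall>x t. coherent_field 0 \<Omega> (\<lambda>_. \<phi>\<^sub>0) \<theta> x t =
               rot3 (\<Omega> * t) (coherent_field 0 \<Omega> (\<lambda>_. \<phi>\<^sub>0) \<theta> x 0))) \<and>
     (\<forall>h' \<theta> \<theta>'. h' - \<Omega> = \<Omega> - h \<longrightarrow>
        (profile_solution h \<Omega> \<mu> \<theta> \<theta>' \<longleftrightarrow> profile_solution h' \<Omega> \<mu> (\<lambda>\<xi>. \<theta> \<xi> + pi) \<theta>')) \<and>
     (h - \<Omega> > \<bar>\<mu>\<bar> \<and> \<bar>\<mu>\<bar> > 0 \<longrightarrow>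
        (\<nexists>\<omega> \<theta>\<^sub>0. wavetrain \<alpha> \<beta> h \<mu> 0 \<omega> \<theta>\<^sub>0) \<and>
        (\<exists>H\<^sub>1 H\<^sub>2 B U\<^sub>1 U\<^sub>2.
           H\<^sub>1 \<noteq> H\<^sub>2 \<and> connections h \<Omega> \<mu> north north = {H\<^sub>1, H\<^sub>2} \<and>
           phase_portrait h \<Omega> \<mu> {north, south} {H\<^sub>1, H\<^sub>2} [B] [U\<^sub>1, U\<^sub>2] \<and>
           (\<forall>\<gamma>. trajectory h \<Omega> \<mu> \<gamma> \<and> range \<gamma> = H\<^sub>1 \<longrightarrow>
              (\<exists>!\<xi>. crosses \<gamma> south \<xi>) \<and> (\<forall>\<xi>. crosses \<gamma> south \<xi> \<longrightarrow> snd (\<gamma> \<xi>) > 0)) \<and>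
           (\<forall>\<gamma>. trajectory h \<Omega> \<mu> \<gamma> \<and> range \<gamma> = H\<^sub>2 \<longrightarrow>
              (\<exists>!\<xi>. crosses \<gamma> south \<xi>) \<and> (\<forall>\<xi>. crosses \<gamma> south \<xi> \<longrightarrow> snd (\<gamma> \<xi>) < 0)) \<and>
           set_limit B {south} (at_right 0) \<and> set_limit B (H\<^sub>1 \<union> H\<^sub>2) (at_left 1) \<and>
           set_limit U\<^sub>1 H\<^sub>1 (at_right 0) \<and> set_limit U\<^sub>2 H\<^sub>2 (at_right 0) \<and>
           \<not> bounded (snd ` (\<Union>r\<in>{0<..<1}. U\<^sub>1 r)) \<and> \<not> bounded (snd ` (\<Union>r\<in>{0<..<1}. U\<^sub>2 r)) \<and>
           (\<forall>r\<in>{0<..<1}. \<forall>\<gamma>. trajectory h \<Omega> \<mu> \<gamma> \<and> range \<gamma> = B r \<longrightarrow>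
              (\<exists>T. minimal_period \<gamma> T \<and>
                 (\<forall>\<xi>\<^sub>0. \<exists>!\<xi>. \<xi> \<in> {\<xi>\<^sub>0..<\<xi>\<^sub>0 + T / 2} \<and> crosses \<gamma> south \<xi>))) \<and>
           (\<forall>r\<in>{0<..<1}. \<forall>\<gamma>. trajectory h \<Omega> \<mu> \<gamma> \<and> range \<gamma> \<in> {U\<^sub>1 r, U\<^sub>2 r} \<longrightarrow>
              (\<exists>T. minimal_period \<gamma> T \<and>
                 (\<exists>\<xi>\<^sub>0. (\<exists>\<xi>\<in>{\<xi>\<^sub>0..\<xi>\<^sub>0 + T / 2}. crosses \<gamma> north \<xi>) \<and>
                       (\<exists>\<xi>\<in>{\<xi>\<^sub>0..\<xi>\<^sub>0 + T / 2}. crosses \<gamma> south \<xi>)))))) \<and>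
     (h > \<Omega> \<and> \<bar>\<mu>\<bar> > h - \<Omega> \<longrightarrow>
        (\<exists>\<theta>\<^sub>0\<in>{0<..<pi}.
           cos \<theta>\<^sub>0 = (h - \<Omega>) / \<mu> \<and>
           wavetrain \<alpha> \<beta> h \<mu> 0 (- \<Omega>) \<theta>\<^sub>0 \<and>
           (\<mu> > 0 \<longrightarrow> spectrally_stable \<alpha> \<beta> h \<mu> 0 (- \<Omega>) \<theta>\<^sub>0) \<and>
           (\<mu> < 0 \<longrightarrow> \<not> spectrally_stable \<alpha> \<beta> h \<mu> 0 (- \<Omega>) \<theta>\<^sub>0) \<and>
           equilibria h \<Omega> \<mu> - {north, south} = {(cis \<theta>\<^sub>0, 0), (cis (- \<theta>\<^sub>0), 0)} \<and>
           cis \<theta>\<^sub>0 \<noteq> cis (- \<theta>\<^sub>0) \<and>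
           (\<forall>\<phi>\<^sub>0. wavetrain_orbit \<theta>\<^sub>0 \<inter> meridian \<phi>\<^sub>0 = {sph \<phi>\<^sub>0 \<theta>\<^sub>0, sph \<phi>\<^sub>0 (- \<theta>\<^sub>0)} \<and>
                 sph \<phi>\<^sub>0 (- \<theta>\<^sub>0) = sph (\<phi>\<^sub>0 + pi) \<theta>\<^sub>0) \<and>
           (\<mu> > h - \<Omega> \<longrightarrow>
              heteroclinic_portrait h \<Omega> \<mu> (cis \<theta>\<^sub>0, 0) (cis (- \<theta>\<^sub>0), 0) north south) \<and>
           (\<mu> < - (h - \<Omega>) \<longrightarrow>
              card (connections h \<Omega> \<mu> north north) = 2 \<and>
              card (connections h \<Omega> \<mu> south south) = 2 \<and>
              (\<exists>B\<^sub>1 B\<^sub>2 B\<^sub>3 U\<^sub>1 U\<^sub>2.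
                 phase_portrait h \<Omega> \<mu> {north, south, (cis \<theta>\<^sub>0, 0), (cis (- \<theta>\<^sub>0), 0)}
                   (connections h \<Omega> \<mu> north north \<union> connections h \<Omega> \<mu> south south)
                   [B\<^sub>1, B\<^sub>2, B\<^sub>3] [U\<^sub>1, U\<^sub>2])))) \<and>
     (\<forall>\<Omega>' \<phi> \<theta>. coherent_structure \<alpha> \<beta> h \<mu> 0 \<Omega>' \<phi> \<theta> \<and> connects_poles \<theta> \<longrightarrow>
        \<Omega>' = \<Omega> \<and> h = \<Omega> \<and> \<mu> < 0) \<and>
     (h = \<Omega> \<and> \<mu> < 0 \<longrightarrow>
        wavetrain \<alpha> \<beta> h \<mu> 0 (- \<Omega>) (pi / 2) \<and>
        (\<forall>\<theta> \<theta>'. profile_solution h \<Omega> \<mu> \<theta> \<theta>' \<longleftrightarrow>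
           (\<forall>\<xi>. (\<theta> has_real_derivative \<theta>' \<xi>) (at \<xi>) \<and>
                (\<theta>' has_real_derivative - \<mu> * sin (\<theta> \<xi>) * cos (\<theta> \<xi>)) (at \<xi>))) \<and>
        heteroclinic_portrait h \<Omega> \<mu> north south (cis (pi / 2), 0) (cis (- (pi / 2)), 0))"
proof (intro conjI allI impI, goal_cases)
  interpret profile_ode h \<Omega> \<mu> .
  have \<beta>: "\<beta> = \<alpha> * \<Omega>" using assms by simp
  note poles = pole_connection_parameters[OF assms]
  {
    case (1 \<phi>\<^sub>0 \<theta>)
    show ?case by (rule coherent_structure_iff_profile[OF \<beta>])
  next
    case (2 \<phi>\<^sub>0 \<theta> x t)
    show ?case by (rule coherent_field_rotates)
  next
    case (3 h' \<theta> \<theta>')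
    then show ?case by (rule profile_solution_reflect)
  next
    case 4
    show ?case
    proof
      assume "\<exists>\<omega> \<theta>\<^sub>0. wavetrain \<alpha> \<beta> h \<mu> 0 \<omega> \<theta>\<^sub>0"
      then obtain \<omega> \<theta>\<^sub>0 where w: "h + \<omega> = \<mu> * cos \<theta>\<^sub>0" "\<alpha> * \<omega> = - \<beta>" unfolding wavetrain_iff by blast
      have "\<alpha> * (\<omega> + \<Omega>) = 0" using w(2) \<beta> by (simp add: distrib_left)
      then have "\<omega> = - \<Omega>" using assms(1) by simp
      then have "h - \<Omega> = \<mu> * cos \<theta>\<^sub>0" using w(1) by simp
      moreover have "\<mu> * cos \<theta>\<^sub>0 \<le> \<bar>\<mu> * cos \<theta>\<^sub>0\<bar>" by (rule abs_ge_self)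
      moreover have "\<bar>\<mu> * cos \<theta>\<^sub>0\<bar> \<le> \<bar>\<mu>\<bar>" unfolding abs_mult by (rule mult_left_le) simp_all
      ultimately show False using 4 by linarith
    qed
  next
    case 5
    show ?case by (rule subcritical_portrait) (use 5 in simp)
  next
    case 6
    \<comment> \<open>The strict inequality puts this angle into the open interval up to
      \<open>pi\<close>, so its sine is positive and the wavetrain is genuine.\<close>
    define c where "c = arccos ((h - \<Omega>) / \<mu>)"
    have "\<bar>h - \<Omega>\<bar> < \<bar>\<mu>\<bar>" and \<mu>0: "\<mu> \<noteq> 0" using 6 by auto
    then have "\<bar>(h - \<Omega>) / \<mu>\<bar> < 1" unfolding abs_divide by (subst divide_less_eq) auto
    then have b: "- 1 < (h - \<Omega>) / \<mu>" "(h - \<Omega>) / \<mu> < 1" unfolding abs_less_iff by linarith+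
    have c: "0 < c" "c < pi" using arccos_lt_bounded[OF b] by (simp_all add: c_def)
    have cosc: "cos c = (h - \<Omega>) / \<mu>" using b by (simp add: c_def)
    then have eq: "h - \<Omega> = \<mu> * cos c" using \<mu>0 by simp
    have sinc: "sin c > 0" using c by (intro sin_gt_zero)
    have super: "heteroclinic_portrait h \<Omega> \<mu> (cis c, 0) (cis (- c), 0) north south" if "\<mu> > 0"
      by (rule supercritical_portrait[OF c that eq])
    have sub: "card (connections h \<Omega> \<mu> north north) = 2 \<and> card (connections h \<Omega> \<mu> south south) = 2 \<and>
      (\<exists>B1 B2 B3 U1 U2. phase_portrait h \<Omega> \<mu> {north, south, (cis c, 0), (cis (- c), 0)}
        (connections h \<Omega> \<mu> north north \<union> connections h \<Omega> \<mu> south south) [B1, B2, B3] [U1, U2])" if "\<mu> < 0"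
      by (rule subsubcritical_portrait[OF c that eq]) (use 6 in simp)
    have ne: "cis c \<noteq> cis (- c)" "north \<noteq> (cis c, 0)" "south \<noteq> (cis c, 0)"
        "north \<noteq> (cis (- c), 0)" "south \<noteq> (cis (- c), 0)"
      using sinc by (auto simp: north_def south_def complex_eq_iff)
    \<comment> \<open>Read off from the phase portrait that belongs to the sign of
      \<open>\<mu>\<close>.\<close>
    have eqs: "equilibria h \<Omega> \<mu> = {north, south, (cis c, 0), (cis (- c), 0)}"
    proof (cases "\<mu> > 0")
      case True
      have "equilibria h \<Omega> \<mu> = {(cis c, 0), (cis (- c), 0), north, south}"
        using super[OF True] unfolding heteroclinic_portrait_def phase_portrait_def by (elim conjE exE)
      then show ?thesis by auto
    next
      case False
      then have "\<mu> < 0" using \<mu>0 by simp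
      from sub[OF this] show ?thesis unfolding phase_portrait_def by (elim conjE exE)
    qed
    show ?case
    proof (intro bexI[of _ c] conjI impI allI, goal_cases)
      case 1 show ?case by (rule cosc)
    next
      case 2 show ?case unfolding wavetrain_iff using sinc eq \<beta> by simp
    next
      case 3 then show ?case by (intro wavetrain_stable) (use assms(1) \<beta> eq sinc in simp_all)
    next
      case 4 then show ?case by (intro wavetrain_unstable) (use assms(1) \<beta> eq sinc in simp_all)
    next
      case 5 show ?case unfolding eqs using ne by auto
    next
      case 6 show ?case by (rule ne(1))
    next
      case 7 show ?case by (rule wavetrain_orbit_meridian)
    next
      case 8 show ?case by (rule sph_minus)
    next
      case 9 then show ?case using 6 by (intro super) simp
    next
      case 10 then show ?case using sub 6 by simp
    next
      case 11 then show ?case using sub 6 by simp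
    next
      case 12 then show ?case using sub 6 by simp
    next
      case 13 show ?case using c by simp
    qed
  next
    case 7 then show ?case using poles by blast
  next
    case 8 then show ?case using poles by blast
  next
    case 9 then show ?case using poles by blast
  next
    case 10 then show ?case unfolding wavetrain_iff using \<beta> by simp
  next
    case (11 \<theta> \<theta>')
    then have "sin x * (h - \<Omega> - \<mu> * cos x) = - \<mu> * sin x * cos x" for x by simp
    then show ?case unfolding profile_solution_def by simp
  next
    case 12 then show ?case by (intro degenerate_portrait) auto
  }
qed

end
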